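(* Let $u\in\mathbb C^\times$ and let $\mathcal F_u$ be the vector space with basis $|\lambda\rangle_u$, $\lambda\in\mathcal P^+$ (all partitions). For $\lambda\in\mathcal P^+$ put $u_i=q^{\lambda_i}t^{-i+1}u$ ($i\ge1$). The following action gives a level $(0,1)$ representation of $\mathcal U_{q,t,p}$ on $\mathcal F_u$ (denoted $\mathcal F_u^{(0,1)}$): $$\gamma^{1/2}|\lambda\rangle_u=|\lambda\rangle_u,$$ $$x^+(z)|\lambda\rangle_u=a^+(p)\sum_{i=1}^{\ell(\lambda)+1}A^+_{\lambda,i}(p)\,\delta(u_i/z)\,|\lambda+\mathbf 1_i\rangle_u,$$ $$x^-(z)|\lambda\rangle_u=(q/t)^{1/2}a^-(p)\sum_{i=1}^{\ell(\lambda)}A^-_{\lambda,i}(p)\,\delta(q^{-1}u_i/z)\,|\lambda-\mathbf 1_i\rangle_u,$$ $$\psi^+(z)|\lambda\rangle_u=(q/t)^{1/2}B^+_\lambda(u/z;p)|\lambda\rangle_u,\qquad\psi^-(z)|\lambda\rangle_u=(q/t)^{-1/2}B^-_\lambda(z/u;p)|\lambda\rangle_u,$$ where $$A^+_{\lambda,i}(p)=\prod_{j=1}^{i-1}\frac{\theta_p(tu_i/u_j)\theta_p(qt^{-1}u_i/u_j)}{\theta_p(qu_i/u_j)\theta_p(u_i/u_j)},\qquad A^-_{\lambda,i}(p)=\prod_{j=i+1}^{\ell(\lambda)}\frac{\theta_p(qt^{-1}u_j/u_i)}{\theta_p(u_j/u_i)}\prod_{j=i+1}^{\ell(\lambda)+1}\frac{\theta_p(tu_j/u_i)}{\theta_p(qu_j/u_i)},$$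 $$B^+_\lambda(u/z;p)=\prod_{i=1}^{\ell(\lambda)}\frac{\theta_p(u_i/tz)}{\theta_p(u_i/qz)}\prod_{i=1}^{\ell(\lambda)+1}\frac{\theta_p(tu_i/qz)}{\theta_p(u_i/z)},\qquad B^-_\lambda(z/u;p)=\prod_{i=1}^{\ell(\lambda)}\frac{\theta_p(tz/u_i)}{\theta_p(qz/u_i)}\prod_{i=1}^{\ell(\lambda)+1}\frac{\theta_p(qz/tu_i)}{\theta_p(z/u_i)}.$$
   Context: Let $q,t\in\mathbb C^\times$ with $q,t,q/t$ not roots of unity (and generic). Set $\kappa_m=(1-q^m)(1-t^{-m})(1-(t/q)^m)$, $G^{\pm}(z)=(1-q^{\pm1}z)(1-t^{\mp1}z)(1-(q/t)^{\mp1}z)$, $\delta(z)=\sum_{n\in\mathbb Z}z^n$, $g(z;s)=\exp\big(\sum_{m>0}\frac{\kappa_m}{m}\frac{s^m}{1-s^m}z^m\big)$, $(z;p)_\infty=\prod_{n\ge0}(1-zp^n)$, $\theta_p(z)=(z;p)_\infty(p/z;p)_\infty$, and $$a^+(p)=(1-t)\frac{(pt/q;p)_\infty(p/t;p)_\infty}{(p;p)_\infty(p/q;p)_\infty},\qquad a^-(p)=(1-t^{-1})\frac{(pq/t;p)_\infty(pt;p)_\infty}{(p;p)_\infty(pq;p)_\infty}.$$ The elliptic quantum toroidal algebra $\mathcal U_{q,t,p}=U_{q,t,p}(\mathfrak{gl}_{1,tor})$ is generated by $\alpha_m$ ($m\in\mathbb Z\setminus\{0\}$), $x^\pm_n$ ($n\in\mathbb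 Z$) and invertible elements $\psi_0^\pm,\gamma^{1/2}$. Put $p^*=p\gamma^{-2}$, $x^\pm(z)=\sum_n x^\pm_nz^{-n}$, $$\psi^+(z)=\psi_0^+\exp\Big(-\sum_{m>0}\tfrac{p^m}{1-p^m}\alpha_{-m}(\gamma^{-1/2}z)^m\Big)\exp\Big(\sum_{m>0}\tfrac{1}{1-p^m}\alpha_m(\gamma^{-1/2}z)^{-m}\Big),$$ $$\psi^-(z)=\psi_0^-\exp\Big(-\sum_{m>0}\tfrac{1}{1-p^m}\alpha_{-m}(\gamma^{1/2}z)^m\Big)\exp\Big(\sum_{m>0}\tfrac{p^m}{1-p^m}\alpha_m(\gamma^{1/2}z)^{-m}\Big).$$ Defining relations: $\psi_0^\pm,\gamma^{1/2}$ central; $[\alpha_m,\alpha_n]=-\frac{\kappa_m}{m}(\gamma^m-\gamma^{-m})\gamma^{-m}\frac{1-p^m}{1-p^{*m}}\delta_{m+n,0}$; $[\alpha_m,x^+(z)]=-\frac{\kappa_m}{m}\frac{1-p^m}{1-p^{*m}}\gamma^{-3m/2}z^mx^+(z)$; $[\alpha_m,x^-(z)]=\frac{\kappa_m}{m}\gamma^{-m/2}z^mx^-(z)$; $[x^+(z),x^-(w)]=\frac{(1-q)(1-1/t)}{1-q/t}\big(\delta(\gamma^{-1}z/w)\psi^+(w)-\delta(\gamma z/w)\psi^-(\gamma^{-1}w)\big)$; $z^3G^+(w/z)g(w/z;p^* )x^+(z)x^+(w)=-w^3G^+(z/w)g(z/w;p^* )x^+(w)x^+(z)$; $z^3G^-(w/z)g(w/z;p)^{-1}x^-(z)x^-(w)=-w^3G^-(z/w)g(z/w;p)^{-1}x^-(w)x^-(z)$;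 $g(w/z;p^* )g(u/w;p^* )g(u/z;p^* )\big(\frac wu+\frac wz-\frac zw-\frac uw\big)x^+(z)x^+(w)x^+(u)+$ permutations in $z,w,u$ $=0$; $g(w/z;p)^{-1}g(u/w;p)^{-1}g(u/z;p)^{-1}\big(\frac wu+\frac wz-\frac zw-\frac uw\big)x^-(z)x^-(w)x^-(u)+$ permutations in $z,w,u$ $=0$. On modules, $p$ is regarded as a generic complex number with $|p|<1$ (or formal); here $\gamma=1$ so $p^*=p$. A module has level $(k,l)$ if $\gamma^{1/2}$ acts as $(t/q)^{k/4}$ and $\psi_0^+$ as $(t/q)^{-l/2}$. $\mathcal P^+$ is the set of partitions $\lambda=(\lambda_1\ge\lambda_2\ge\cdots)$ of nonnegative integers with finitely many nonzero parts, $\ell(\lambda)$ the number of nonzero parts, $\lambda\pm\mathbf 1_i$ means $\lambda_i$ replaced by $\lambda_i\pm1$ (coefficients $A^\pm_{\lambda,i}$ vanish when $\lambda\pm\mathbf 1_i$ is not a partition). The eigenvalue of $\psi^+(z)$ (resp. $\psi^-(z)$) is expanded for $|u/z|$ small (resp. $|z/u|$ small) order by order in $p$, matching the form of $\psi^\pm(z)$ above. *)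

theory Defs
  imports "HOL-Computational_Algebra.Computational_Algebra" "HOL-Library.Poly_Mapping"
begin

section \<open>Operators depending formally on p\<close>

text \<open>The parameter \<open>p\<close> is a formal variable.  A module is a complex vector space \<open>W\<close> on which the
  generators act by elements of \<open>End(W)[[p]]\<close>, i.e. by \<open>\<complex>[[p]]\<close>-linear operators on \<open>W[[p]]\<close>.
  Every complex vector space has a basis, so \<open>W\<close> is taken to be the space of finitely supported
  functions on an arbitrary basis type.\<close>

definition cscale :: "complex \<Rightarrow> ('b \<Rightarrow>\<^sub>0 complex) \<Rightarrow> ('b \<Rightarrow>\<^sub>0 complex)"
  where "cscale c v = Poly_Mapping.map (\<lambda>x. c * x) v"

lemma lookup_cscale [simp]: "Poly_Mapping.lookup (cscale c v) b = c * Poly_Mapping.lookup v b"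
  by (simp add: cscale_def Poly_Mapping.map.rep_eq when_def)

lemma vector_space_cscale: "vector_space cscale"
  by unfold_locales (auto intro!: poly_mapping_eqI simp: lookup_add algebra_simps)

lemma linear_cscale_iff:
  "Vector_Spaces.linear cscale cscale f \<longleftrightarrow>
     (\<forall>v w. f (v + w) = f v + f w) \<and> (\<forall>c v. f (cscale c v) = cscale c (f v))"
  by (simp add: Vector_Spaces.linear_iff vector_space_cscale)

typedef 'b endo = "{f :: ('b \<Rightarrow>\<^sub>0 complex) \<Rightarrow> ('b \<Rightarrow>\<^sub>0 complex). Vector_Spaces.linear cscale cscale f}"
  morphisms endo_app Abs_endo
  by (rule exI[of _ id]) (simp add: linear_cscale_iff)

setup_lifting type_definition_endo

lemma cscale_add_right: "cscale c (v + w) = cscale c v + cscale c w"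
  by (auto intro!: poly_mapping_eqI simp: lookup_add algebra_simps)

lemma cscale_diff_right: "cscale c (v - w) = cscale c v - cscale c w"
  by (auto intro!: poly_mapping_eqI simp: lookup_minus right_diff_distrib)

lemma cscale_minus_right: "cscale c (- v) = - cscale c v"
  by (auto intro!: poly_mapping_eqI)

lemma cscale_zero_right: "cscale c 0 = 0"
  by (auto intro!: poly_mapping_eqI)

lemma cscale_cscale: "cscale c (cscale d v) = cscale (c * d) v"
  by (auto intro!: poly_mapping_eqI simp: algebra_simps)

text \<open>Multiplication in \<open>'b endo\<close> is composition.\<close>

instantiation endo :: (type) ring_1
begin

lift_definition zero_endo :: "'a endo" is "\<lambda>_. 0"
  by (simp add: linear_cscale_iff cscale_zero_right)
lift_definition one_endo :: "'a endo" is "\<lambda>v. v"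
  by (simp add: linear_cscale_iff)
lift_definition plus_endo :: "'a endo \<Rightarrow> 'a endo \<Rightarrow> 'a endo" is "\<lambda>f g v. f v + g v"
  by (simp add: linear_cscale_iff cscale_add_right)
lift_definition minus_endo :: "'a endo \<Rightarrow> 'a endo \<Rightarrow> 'a endo" is "\<lambda>f g v. f v - g v"
  by (simp add: linear_cscale_iff cscale_diff_right)
lift_definition uminus_endo :: "'a endo \<Rightarrow> 'a endo" is "\<lambda>f v. - f v"
  by (simp add: linear_cscale_iff cscale_minus_right)
lift_definition times_endo :: "'a endo \<Rightarrow> 'a endo \<Rightarrow> 'a endo" is "\<lambda>f g v. f (g v)"
  by (simp add: linear_cscale_iff)

instance
proof
  show "(0 :: 'a endo) \<noteq> 1"
  proof
    assume "(0 :: 'a endo) = 1"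
    then have "endo_app (0 :: 'a endo) v = endo_app 1 v" for v by simp
    from this[of "Poly_Mapping.single undefined 1"] show False
      by (simp add: zero_endo.rep_eq one_endo.rep_eq)
         (metis lookup_single_eq lookup_zero zero_neq_one)
  qed
qed (transfer; auto simp: fun_eq_iff linear_cscale_iff algebra_simps)+

end

lift_definition endo_scalar :: "complex \<Rightarrow> 'b endo" is "\<lambda>c v. cscale c v"
  by (simp add: linear_cscale_iff cscale_add_right cscale_cscale mult.commute)

type_synonym 'b opser = "'b endo fps"

text \<open>In \<open>'b opser\<close> the series variable \<open>fps_X\<close> is \<open>p\<close>.\<close>

definition sc :: "complex \<Rightarrow> 'b opser"
  where "sc c = fps_const (endo_scalar c)"

definition act :: "'b opser \<Rightarrow> ('b \<Rightarrow>\<^sub>0 complex) \<Rightarrow> ('b \<Rightarrow>\<^sub>0 complex) fps"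
  where "act T v = Abs_fps (\<lambda>k. endo_app (T $ k) v)"

definition cmul :: "complex fps \<Rightarrow> ('b \<Rightarrow>\<^sub>0 complex) \<Rightarrow> ('b \<Rightarrow>\<^sub>0 complex) fps"
  where "cmul c v = Abs_fps (\<lambda>k. cscale (c $ k) v)"

text \<open>\<open>p\<close>-adically convergent sums: for every family to which \<open>psum\<close> is applied below,
  only finitely many members contribute to each power of \<open>p\<close>.\<close>

definition psum :: "('i \<Rightarrow> 'b opser) \<Rightarrow> 'b opser"
  where "psum f = Abs_fps (\<lambda>n. Sum_any (\<lambda>i. f i $ n))"

definition unit_inv :: "'a::ring_1 \<Rightarrow> 'a"
  where "unit_inv a = (THE b. a * b = 1 \<and> b * a = 1)"

definition is_invertible :: "'a::ring_1 \<Rightarrow> bool"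
  where "is_invertible a \<longleftrightarrow> (\<exists>b. a * b = 1 \<and> b * a = 1)"

definition upow :: "'a::ring_1 \<Rightarrow> int \<Rightarrow> 'a"
  where "upow a n = (if n \<ge> 0 then a ^ nat n else unit_inv a ^ nat (- n))"

text \<open>The inverse of a series with constant term 1 (a two-sided inverse, although multiplication
  need not be commutative).\<close>

definition recip :: "'a::ring_1 fps \<Rightarrow> 'a fps"
  where "recip f = fps_left_inverse f 1"

text \<open>Exponential of a series without constant term in an auxiliary variable
  (\<open>z\<close>, \<open>1/z\<close> or a ratio such as \<open>w/z\<close>), with coefficients in \<open>'b opser\<close>.\<close>

definition fexp :: "'b opser fps \<Rightarrow> 'b opser fps"
  where "fexp A = Abs_fps (\<lambda>n. \<Sum>k\<le>n. sc (1 / fact k) * (A ^ k) $ n)"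


section \<open>Representations of the elliptic quantum toroidal algebra\<close>

definition kappa :: "complex \<Rightarrow> complex \<Rightarrow> int \<Rightarrow> complex"
  where "kappa q t m = (1 - q powi m) * (1 - t powi (- m)) * (1 - (t / q) powi m)"

text \<open>\<open>g_ser q t s\<close> is \<open>g(y;s)\<close> as a power series in \<open>y\<close>; here \<open>s\<close> is an operator series
  without constant term, e.g. \<open>p\<close> or \<open>p\<^sup>*\<close>.\<close>

definition g_ser :: "complex \<Rightarrow> complex \<Rightarrow> 'b opser \<Rightarrow> 'b opser fps"
  where "g_ser q t s = fexp (Abs_fps (\<lambda>m. if m = 0 then 0
           else sc (kappa q t (int m) / of_nat m) * (s ^ m * recip (1 - s ^ m))))"

text \<open>\<open>G_ser q t 1\<close> and \<open>G_ser q t (-1)\<close> are \<open>G\<^sup>+\<close> and \<open>G\<^sup>-\<close>.\<close>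

definition G_ser :: "complex \<Rightarrow> complex \<Rightarrow> int \<Rightarrow> 'b opser fps"
  where "G_ser q t e =
     (1 - fps_const (sc (q powi e)) * fps_X) *
     (1 - fps_const (sc (t powi (- e))) * fps_X) *
     (1 - fps_const (sc ((q / t) powi (- e))) * fps_X)"

record 'b etor_ops =
  gam_half :: "'b opser"
  psi0_p :: "'b opser"
  psi0_m :: "'b opser"
  alpha :: "int \<Rightarrow> 'b opser"
  x_p :: "int \<Rightarrow> 'b opser"
  x_m :: "int \<Rightarrow> 'b opser"

text \<open>\<open>gpow A n\<close> is \<open>\<gamma>\<close> to the power \<open>n/2\<close>.\<close>

definition gpow :: "'b etor_ops \<Rightarrow> int \<Rightarrow> 'b opser"
  where "gpow A n = upow (gam_half A) n"

definition pstar :: "'b etor_ops \<Rightarrow> 'b opser"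
  where "pstar A = fps_X * gpow A (- 4)"

text \<open>\<open>p_ratio A m\<close> is \<open>(1 - p\<^sup>m) / (1 - p\<^sup>*\<^sup>m)\<close>.  For \<open>m < 0\<close> it is rewritten through positive
  powers: \<open>(1 - p\<^sup>-\<^sup>k) / (1 - p\<^sup>*\<^sup>-\<^sup>k) = (p\<^sup>*/p)\<^sup>k (1 - p\<^sup>k) / (1 - p\<^sup>*\<^sup>k)\<close>
  and \<open>p\<^sup>*/p = \<gamma>\<^sup>-\<^sup>2\<close>.\<close>

definition p_ratio :: "'b etor_ops \<Rightarrow> int \<Rightarrow> 'b opser"
  where "p_ratio A m =
    (let k = nat \<bar>m\<bar>; r = (1 - fps_X ^ k) * recip (1 - pstar A ^ k)
     in if m \<ge> 0 then r else gpow A (4 * m) * r)"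

text \<open>Coefficient of \<open>z\<^sup>n\<close> in \<open>E(z) F(1/z)\<close>.\<close>

definition two_sided :: "'b opser fps \<Rightarrow> 'b opser fps \<Rightarrow> int \<Rightarrow> 'b opser"
  where "two_sided E F n = psum (\<lambda>(i, j). if int i - int j = n then E $ i * F $ j else 0)"

text \<open>\<open>psi_plus A n\<close> and \<open>psi_minus A n\<close> are the coefficients of \<open>z\<^sup>n\<close> in \<open>\<psi>\<^sup>+(z)\<close> and \<open>\<psi>\<^sup>-(z)\<close>.\<close>

definition psi_plus :: "'b etor_ops \<Rightarrow> int \<Rightarrow> 'b opser"
  where "psi_plus A n = psi0_p A * two_sided
    (fexp (Abs_fps (\<lambda>m. if m = 0 then 0 else
       - (fps_X ^ m * recip (1 - fps_X ^ m) * alpha A (- int m) * gpow A (- int m)))))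
    (fexp (Abs_fps (\<lambda>m. if m = 0 then 0 else
       recip (1 - fps_X ^ m) * alpha A (int m) * gpow A (int m)))) n"

definition psi_minus :: "'b etor_ops \<Rightarrow> int \<Rightarrow> 'b opser"
  where "psi_minus A n = psi0_m A * two_sided
    (fexp (Abs_fps (\<lambda>m. if m = 0 then 0 else
       - (recip (1 - fps_X ^ m) * alpha A (- int m) * gpow A (int m)))))
    (fexp (Abs_fps (\<lambda>m. if m = 0 then 0 else
       fps_X ^ m * recip (1 - fps_X ^ m) * alpha A (int m) * gpow A (- int m)))) n"

text \<open>The modes of a current are \<open>x(z) = \<Sum>\<^sub>n x\<^sub>n z\<^sup>-\<^sup>n\<close>, so \<open>cur x n\<close> is the coefficient of \<open>z\<^sup>n\<close>.\<close>

definition cur :: "(int \<Rightarrow> 'b opser) \<Rightarrow> int \<Rightarrow> 'b opser"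
  where "cur x n = x (- n)"

text \<open>Coefficient of \<open>z\<^sup>a w\<^sup>b\<close> in \<open>z\<^sup>3 h(w/z) x(z) x(w)\<close>.\<close>

definition quad_coeff :: "'b opser fps \<Rightarrow> (int \<Rightarrow> 'b opser) \<Rightarrow> int \<Rightarrow> int \<Rightarrow> 'b opser"
  where "quad_coeff h x a b = psum (\<lambda>k. h $ k * cur x (a - 3 + int k) * cur x (b - int k))"

text \<open>Coefficient of \<open>z\<^sup>a w\<^sup>b v\<^sup>c\<close> in \<open>h(w/z) h(v/w) h(v/z) x(z) x(w) x(v)\<close>.\<close>

definition cubic_coeff :: "'b opser fps \<Rightarrow> (int \<Rightarrow> 'b opser) \<Rightarrow> int \<Rightarrow> int \<Rightarrow> int \<Rightarrow> 'b opser"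
  where "cubic_coeff h x a b c = psum (\<lambda>(i, j, k). h $ i * h $ j * h $ k *
     cur x (a + int i + int k) * cur x (b - int i + int j) * cur x (c - int j - int k))"

text \<open>Coefficient of \<open>z\<^sup>a w\<^sup>b v\<^sup>c\<close> in
  \<open>h(w/z) h(v/w) h(v/z) (w/v + w/z - z/w - v/w) x(z) x(w) x(v)\<close>.\<close>

definition serre_coeff :: "'b opser fps \<Rightarrow> (int \<Rightarrow> 'b opser) \<Rightarrow> int \<Rightarrow> int \<Rightarrow> int \<Rightarrow> 'b opser"
  where "serre_coeff h x a b c =
     cubic_coeff h x a (b - 1) (c + 1) + cubic_coeff h x (a + 1) (b - 1) c
     - cubic_coeff h x (a - 1) (b + 1) c - cubic_coeff h x a (b + 1) (c - 1)"

definition commutator :: "'a::ring \<Rightarrow> 'a \<Rightarrow> 'a"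
  where "commutator a b = a * b - b * a"

definition central_op :: "'b etor_ops \<Rightarrow> 'b opser \<Rightarrow> bool"
  where "central_op A y \<longleftrightarrow>
     commutator y (gam_half A) = 0 \<and> commutator y (psi0_p A) = 0 \<and> commutator y (psi0_m A) = 0 \<and>
     (\<forall>m. m \<noteq> 0 \<longrightarrow> commutator y (alpha A m) = 0) \<and>
     (\<forall>n. commutator y (x_p A n) = 0 \<and> commutator y (x_m A n) = 0)"

text \<open>The operators satisfy the defining relations of \<open>U\<^sub>q\<^sub>,\<^sub>t\<^sub>,\<^sub>p(gl\<^sub>1\<^sub>,\<^sub>t\<^sub>o\<^sub>r)\<close>.  Relations between currents are
  stated coefficientwise; the exponents \<open>a\<close>, \<open>b\<close>, \<open>c\<close> belong to \<open>z\<close>, \<open>w\<close> and the third variable.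
  With \<open>\<delta>(z) = \<Sum>\<^sub>n z\<^sup>n\<close>, the coefficients of \<open>z\<^sup>a w\<^sup>b\<close> in \<open>\<delta>(\<gamma>\<^sup>-\<^sup>1z/w) \<psi>\<^sup>+(w)\<close> and
  \<open>\<delta>(\<gamma>z/w) \<psi>\<^sup>-(\<gamma>\<^sup>-\<^sup>1w)\<close> are \<open>\<gamma>\<^sup>-\<^sup>a \<psi>\<^sup>+\<^bsub>a+b\<^esub>\<close> and \<open>\<gamma>\<^sup>-\<^sup>b \<psi>\<^sup>-\<^bsub>a+b\<^esub>\<close>.
  The value \<open>alpha A 0\<close> is not a generator and plays no role.\<close>

definition etor_rep :: "complex \<Rightarrow> complex \<Rightarrow> 'b etor_ops \<Rightarrow> bool"
  where "etor_rep q t A \<longleftrightarrow>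
     is_invertible (gam_half A) \<and> is_invertible (psi0_p A) \<and> is_invertible (psi0_m A) \<and>
     central_op A (gam_half A) \<and> central_op A (psi0_p A) \<and> central_op A (psi0_m A) \<and>
     (\<forall>m n. m \<noteq> 0 \<longrightarrow> n \<noteq> 0 \<longrightarrow> commutator (alpha A m) (alpha A n) =
        (if m + n = 0 then
           sc (- (kappa q t m / of_int m)) * (gpow A (2 * m) - gpow A (- 2 * m)) * gpow A (- 2 * m)
             * p_ratio A m
         else 0)) \<and>
     (\<forall>m a. m \<noteq> 0 \<longrightarrow> commutator (alpha A m) (cur (x_p A) a) =
        sc (- (kappa q t m / of_int m)) * p_ratio A m * gpow A (- 3 * m) * cur (x_p A) (a - m)) \<and>
     (\<forall>m a. m \<noteq> 0 \<longrightarrow> commutator (alpha A m) (cur (x_m A) a) =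
        sc (kappa q t m / of_int m) * gpow A (- m) * cur (x_m A) (a - m)) \<and>
     (\<forall>a b. commutator (cur (x_p A) a) (cur (x_m A) b) =
        sc ((1 - q) * (1 - 1 / t) / (1 - q / t)) *
          (gpow A (- 2 * a) * psi_plus A (a + b) - gpow A (- 2 * b) * psi_minus A (a + b))) \<and>
     (let h = G_ser q t 1 * g_ser q t (pstar A) in
        \<forall>a b. quad_coeff h (x_p A) a b = - quad_coeff h (x_p A) b a) \<and>
     (let h = G_ser q t (- 1) * recip (g_ser q t fps_X) in
        \<forall>a b. quad_coeff h (x_m A) a b = - quad_coeff h (x_m A) b a) \<and>
     (let s = serre_coeff (g_ser q t (pstar A)) (x_p A) in
        \<forall>a b c. s a b c + s a c b + s b a c + s b c a + s c a b + s c b a = 0) \<and>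
     (let s = serre_coeff (recip (g_ser q t fps_X)) (x_m A) in
        \<forall>a b c. s a b c + s a c b + s b a c + s b c a + s c a b + s c b a = 0)"

text \<open>Level \<open>(k,l)\<close>, where \<open>r\<close> is the chosen fourth root of \<open>t/q\<close>: \<open>(t/q)\<^bsup>k/4\<^esup> = r\<^sup>k\<close> and
  \<open>(t/q)\<^bsup>-l/2\<^esup> = r\<^bsup>-2l\<^esup>\<close>.\<close>

definition has_level :: "complex \<Rightarrow> int \<Rightarrow> int \<Rightarrow> 'b etor_ops \<Rightarrow> bool"
  where "has_level r k l A \<longleftrightarrow>
     gam_half A = sc (r powi k) \<and> psi0_p A = sc (r powi (- 2 * l))"


section \<open>Theta functions\<close>

text \<open>\<open>qpoch a\<close> is \<open>(a;p)\<^sub>\<infinity>\<close> as a series in \<open>p\<close>; factors with index above \<open>k\<close> do not affect the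
  coefficient of \<open>p\<^sup>k\<close>.  The argument may itself involve \<open>p\<close>.\<close>

definition qpoch :: "'a::comm_ring_1 fps \<Rightarrow> 'a fps"
  where "qpoch a = Abs_fps (\<lambda>k. (\<Prod>n\<le>k. 1 - a * fps_X ^ n) $ k)"

text \<open>The argument ranges over a field: either complex numbers, or Laurent series in \<open>1/z\<close> or \<open>z\<close>.\<close>

definition theta :: "'a::field \<Rightarrow> 'a fps"
  where "theta a = qpoch (fps_const a) * qpoch (fps_const (inverse a) * fps_X)"

definition a_plus :: "complex \<Rightarrow> complex \<Rightarrow> complex fps"
  where "a_plus q t = fps_const (1 - t) *
     (qpoch (fps_const (t / q) * fps_X) * qpoch (fps_const (1 / t) * fps_X)) /
     (qpoch fps_X * qpoch (fps_const (1 / q) * fps_X))"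

definition a_minus :: "complex \<Rightarrow> complex \<Rightarrow> complex fps"
  where "a_minus q t = fps_const (1 - 1 / t) *
     (qpoch (fps_const (q / t) * fps_X) * qpoch (fps_const t * fps_X)) /
     (qpoch fps_X * qpoch (fps_const q * fps_X))"


section \<open>The Fock space\<close>

definition is_ptn :: "(nat \<Rightarrow> nat) \<Rightarrow> bool"
  where "is_ptn f \<longleftrightarrow> antimono f \<and> finite {i. f i \<noteq> 0}"

text \<open>Parts are stored from index 0; \<open>part l i\<close> below is \<open>\<lambda>\<^sub>i\<close> with \<open>i \<ge> 1\<close>.\<close>

typedef ptn = "{f. is_ptn f}"
  morphisms ptn_fun Abs_ptn
  by (rule exI[of _ "\<lambda>_. 0"]) (simp add: is_ptn_def antimono_def)

definition part :: "ptn \<Rightarrow> nat \<Rightarrow> nat"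
  where "part l i = ptn_fun l (i - 1)"

definition plen :: "ptn \<Rightarrow> nat"
  where "plen l = card {i. ptn_fun l i \<noteq> 0}"

definition ket :: "ptn \<Rightarrow> ptn \<Rightarrow>\<^sub>0 complex"
  where "ket l = Poly_Mapping.single l 1"

text \<open>\<open>|\<lambda> \<plusminus> 1\<^sub>i\<rangle>\<close>, read as 0 if \<open>\<lambda> \<plusminus> 1\<^sub>i\<close> is not a partition.\<close>

definition ket_fun :: "(nat \<Rightarrow> nat) \<Rightarrow> ptn \<Rightarrow>\<^sub>0 complex"
  where "ket_fun f = (if is_ptn f then ket (Abs_ptn f) else 0)"

definition ket_add :: "ptn \<Rightarrow> nat \<Rightarrow> ptn \<Rightarrow>\<^sub>0 complex"
  where "ket_add l i = ket_fun ((ptn_fun l)(i - 1 := part l i + 1))"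

definition ket_remove :: "ptn \<Rightarrow> nat \<Rightarrow> ptn \<Rightarrow>\<^sub>0 complex"
  where "ket_remove l i = ket_fun ((ptn_fun l)(i - 1 := part l i - 1))"

definition uu :: "complex \<Rightarrow> complex \<Rightarrow> complex \<Rightarrow> ptn \<Rightarrow> nat \<Rightarrow> complex"
  where "uu q t u l i = q ^ part l i * t powi (- int i + 1) * u"

definition A_plus :: "complex \<Rightarrow> complex \<Rightarrow> complex \<Rightarrow> ptn \<Rightarrow> nat \<Rightarrow> complex fps"
  where "A_plus q t u l i = (let U = uu q t u l in
     \<Prod>j = 1..<i. theta (t * U i / U j) * theta (q / t * U i / U j) /
        (theta (q * U i / U j) * theta (U i / U j)))"

definition A_minus :: "complex \<Rightarrow> complex \<Rightarrow> complex \<Rightarrow> ptn \<Rightarrow> nat \<Rightarrow> complex fps"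
  where "A_minus q t u l i = (let U = uu q t u l in
     (\<Prod>j = i+1..plen l. theta (q / t * U j / U i) / theta (U j / U i)) *
     (\<Prod>j = i+1..plen l + 1. theta (t * U j / U i) / theta (q * U j / U i)))"

text \<open>The Laurent variable \<open>fls_X\<close> is \<open>1/z\<close> in \<open>B_plus\<close> and \<open>z\<close> in \<open>B_minus\<close>.  Division takes place
  in Laurent series in that variable, order by order in \<open>p\<close>, which is the expansion for small
  \<open>u/z\<close>, respectively small \<open>z/u\<close>.\<close>

definition B_plus :: "complex \<Rightarrow> complex \<Rightarrow> complex \<Rightarrow> ptn \<Rightarrow> complex fls fps"
  where "B_plus q t u l = (let U = uu q t u l; mon = (\<lambda>c. fls_const c * fls_X) in
     (\<Prod>i = 1..plen l. theta (mon (U i / t)) / theta (mon (U i / q))) *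
     (\<Prod>i = 1..plen l + 1. theta (mon (t * U i / q)) / theta (mon (U i))))"

definition B_minus :: "complex \<Rightarrow> complex \<Rightarrow> complex \<Rightarrow> ptn \<Rightarrow> complex fls fps"
  where "B_minus q t u l = (let U = uu q t u l; mon = (\<lambda>c. fls_const c * fls_X) in
     (\<Prod>i = 1..plen l. theta (mon (t / U i)) / theta (mon (q / U i))) *
     (\<Prod>i = 1..plen l + 1. theta (mon (q / (t * U i))) / theta (mon (1 / U i))))"

definition mode :: "complex fls fps \<Rightarrow> int \<Rightarrow> complex fps"
  where "mode B n = Abs_fps (\<lambda>k. fls_nth (B $ k) n)"

text \<open>The action on \<open>\<F>\<^sub>u\<close>, with \<open>s\<close> the chosen value of \<open>(q/t)\<^bsup>1/2\<^esup>\<close>, coefficient by coefficient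
  in \<open>z\<close>: \<open>x\<^sup>\<plusminus>\<^sub>n\<close> is the coefficient of \<open>z\<^sup>-\<^sup>n\<close> in \<open>x\<^sup>\<plusminus>(z)\<close>, and
  \<open>\<delta>(c/z)\<close> contributes \<open>c\<^sup>n\<close>.  The operators \<open>\<alpha>\<^sub>m\<close> and \<open>\<psi>\<^sub>0\<^sup>\<plusminus>\<close> enter through \<open>\<psi>\<^sup>\<plusminus>(z)\<close>.\<close>

definition fock_action :: "complex \<Rightarrow> complex \<Rightarrow> complex \<Rightarrow> complex \<Rightarrow> ptn etor_ops \<Rightarrow> bool"
  where "fock_action q t s u A \<longleftrightarrow> (\<forall>l.
     act (gam_half A) (ket l) = cmul 1 (ket l) \<and>
     (\<forall>n. act (x_p A n) (ket l) =
        (\<Sum>i = 1..plen l + 1.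
           cmul (a_plus q t * A_plus q t u l i * fps_const (uu q t u l i powi n)) (ket_add l i))) \<and>
     (\<forall>n. act (x_m A n) (ket l) =
        (\<Sum>i = 1..plen l.
           cmul (fps_const s * a_minus q t * A_minus q t u l i
                 * fps_const ((uu q t u l i / q) powi n)) (ket_remove l i))) \<and>
     (\<forall>n. act (psi_plus A n) (ket l) =
        cmul (fps_const s * mode (B_plus q t u l) (- n)) (ket l)) \<and>
     (\<forall>n. act (psi_minus A n) (ket l) =
        cmul (fps_const (inverse s) * mode (B_minus q t u l) n) (ket l)))"

text \<open>Genericity of \<open>q\<close> and \<open>t\<close>; in particular \<open>q\<close>, \<open>t\<close> and \<open>q/t\<close> are not roots of unity.\<close>

definition generic :: "complex \<Rightarrow> complex \<Rightarrow> bool"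
  where "generic q t \<longleftrightarrow> (\<forall>a b :: int. q powi a * t powi b = 1 \<longrightarrow> a = 0 \<and> b = 0)"

end

theory Submission
  imports Defs
begin

text \<open>The operators \<open>\<alpha>\<^sub>m\<close> are diagonal with the power sums of the zeros and poles of the \<open>\<psi>\<close>-eigenvalue
  as eigenvalues; exponentiating them gives the theta quotients because
  \<open>exp (- \<Sum>\<^sub>m c\<^sup>m y\<^sup>m / (m (1 - p\<^sup>m))) = (c y; p)\<^sub>\<infinity>\<close>.  The matrix elements of \<open>x\<^sup>+\<close> are
  \<open>a\<^sup>+ \<Prod>\<^sub>j\<^sub><\<^sub>i f (u\<^sub>i / u\<^sub>j)\<close> with \<open>f\<close> a theta quotient satisfying \<open>f (1 / x) = f (x / q)\<close>, and those of
  the transpose of \<open>x\<^sup>-\<close> are the same products over \<open>j > i\<close>, so both currents are treated alike.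

  Off the diagonal, \<open>x\<^sup>+ x\<^sup>-\<close> and \<open>x\<^sup>- x\<^sup>+\<close> agree entry by entry.  On the diagonal, each coefficient in \<open>p\<close> of
  the \<open>\<psi>\<close>-eigenvalue is a rational function of \<open>z\<close> whose poles are simple and do not depend on \<open>p\<close>; by partial fractions
  its two expansions differ by a sum of delta functions, whose residues are the diagonal
  entries of the commutator.  In the quadratic and cubic relations, each pair of added boxes contributes
  a product of \<open>f\<close> and the structure function in which everything depending on \<open>p\<close> is, up to sign, symmetric in
  the two boxes; it factors out and leaves identities of rational functions.\<close>

section \<open>p-adic sums\<close>

text \<open>The formulas of the action contain the length of the partition, which changes when boxes
  are added or removed. Operators are therefore compared with a common number N of rows: beyond the
  last nonempty row consecutive contents have ratio 1/t, and the factors of an additional row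
  cancel. The second obstacle is that intermediate shapes must be partitions, whereas the relations
  mix all orders of adding boxes. To have boxes added in all cases, entries of the lowering currents
  are read from the target upwards. Genericity enters through the ratios of contents of different
  rows, q^a t^b with b nonzero: they are never powers of q, so the theta functions in the
  denominators are units. The infinite sums over modes in the relations converge p-adically because
  coefficient m of g is divisible by p^m; summing them substitutes a ratio of contents for the
  variable of g.\<close>

definition csum :: "('i \<Rightarrow> 'a::comm_monoid_add fps) \<Rightarrow> 'a fps"
  where "csum f = Abs_fps (\<lambda>n. Sum_any (\<lambda>i. f i $ n))"

definition pfin :: "('i \<Rightarrow> 'a::zero fps) \<Rightarrow> bool"
  where "pfin f \<longleftrightarrow> (\<forall>n. finite {i. f i $ n \<noteq> 0})"

text \<open>Coefficient \<open>n\<close> of a product involves all lower orders of both factors, so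
  the indices contributing at order \<open>n\<close> alone are too few.\<close>

definition psupp :: "('i \<Rightarrow> 'a::zero fps) \<Rightarrow> nat \<Rightarrow> 'i set"
  where "psupp f n = {i. \<exists>m\<le>n. f i $ m \<noteq> 0}"

lemma finite_psupp: "pfin f \<Longrightarrow> finite (psupp f n)"
proof -
  assume "pfin f"
  then have "finite (\<Union>m\<le>n. {i. f i $ m \<noteq> 0})" by (auto simp: pfin_def)
  moreover have "psupp f n = (\<Union>m\<le>n. {i. f i $ m \<noteq> 0})" by (auto simp: psupp_def)
  ultimately show ?thesis by simp
qed

lemma csum_nth_superset:
  "finite S \<Longrightarrow> (\<And>i. i \<notin> S \<Longrightarrow> f i $ n = 0) \<Longrightarrow> csum f $ n = (\<Sum>i\<in>S. f i $ n)"
  by (simp add: csum_def) (rule Sum_any.expand_superset; auto)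

lemma csum_nth: "pfin f \<Longrightarrow> n \<le> k \<Longrightarrow> csum f $ n = (\<Sum>i\<in>psupp f k. f i $ n)"
  by (rule csum_nth_superset) (auto simp: finite_psupp, auto simp: psupp_def)

lemma pfin_finite: "finite {i. f i \<noteq> 0} \<Longrightarrow> pfin f"
  unfolding pfin_def by (auto intro: finite_subset[rotated])

lemma csum_finite: "finite S \<Longrightarrow> (\<And>i. i \<notin> S \<Longrightarrow> f i = 0) \<Longrightarrow> csum f = (\<Sum>i\<in>S. f i)"
  by (rule fps_ext) (simp add: csum_nth_superset[of S] fps_sum_nth)

lemma pfin_mult:
  fixes f :: "'i \<Rightarrow> 'a::semiring_0 fps"
  assumes "pfin f" and "pfin g"
  shows "pfin (\<lambda>(i, j). f i * g j)"
  unfolding pfin_def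
proof
  fix n
  have "{(i, j). (f i * g j) $ n \<noteq> 0} \<subseteq> psupp f n \<times> psupp g n"
  proof (clarify)
    fix i j assume "(f i * g j) $ n \<noteq> 0"
    then obtain k where "k \<in> {0..n}" "f i $ k * g j $ (n - k) \<noteq> 0"
      unfolding fps_mult_nth by (meson sum.neutral)
    then have "f i $ k \<noteq> 0" "g j $ (n - k) \<noteq> 0" "k \<le> n" by auto
    then show "i \<in> psupp f n \<and> j \<in> psupp g n" by (auto simp: psupp_def intro: exI[of _ "n - k"])
  qed
  then have "finite {(i, j). (f i * g j) $ n \<noteq> 0}"
    by (rule finite_subset) (simp add: finite_psupp assms)
  then show "finite {ij. (case ij of (i, j) \<Rightarrow> f i * g j) $ n \<noteq> 0}"
    by (rule back_subst[of finite]) auto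
qed

lemma csum_prod:
  fixes f :: "'i \<Rightarrow> 'a::semiring_0 fps"
  assumes "pfin f" and "pfin g"
  shows "csum f * csum g = csum (\<lambda>(i, j). f i * g j)"
proof (rule fps_ext)
  fix n
  have z: "(f i * g j) $ n = 0" if "(i, j) \<notin> psupp f n \<times> psupp g n" for i j
    unfolding fps_mult_nth by (rule sum.neutral) (use that in \<open>auto simp: psupp_def\<close>)
  have "csum (\<lambda>(i, j). f i * g j) $ n
      = (\<Sum>(i, j)\<in>psupp f n \<times> psupp g n. (f i * g j) $ n)"
    by (subst csum_nth_superset[of "psupp f n \<times> psupp g n"])
       (auto simp: finite_psupp assms intro!: sum.cong z)
  also have "\<dots> = (\<Sum>i\<in>psupp f n. \<Sum>j\<in>psupp g n. \<Sum>k=0..n. f i $ k * g j $ (n - k))"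
    by (simp only: sum.cartesian_product[symmetric] fps_mult_nth)
  also have "\<dots> = (\<Sum>k=0..n. \<Sum>i\<in>psupp f n. \<Sum>j\<in>psupp g n. f i $ k * g j $ (n - k))"
    by (subst sum.swap, subst sum.swap[of _ "{0..n}"]) simp
  also have "\<dots> = (\<Sum>k=0..n. csum f $ k * csum g $ (n - k))"
    by (rule sum.cong) (auto simp: csum_nth[OF assms(1), of _ n] csum_nth[OF assms(2), of _ n] sum_product)
  finally show "(csum f * csum g) $ n = csum (\<lambda>(i, j). f i * g j) $ n"
    by (simp add: fps_mult_nth)
qed

lemma pfin_cmult:
  fixes f :: "'i \<Rightarrow> 'a::semiring_0 fps"
  assumes "pfin f" shows "pfin (\<lambda>i. c * f i)"
  unfolding pfin_def
proof
  fix n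
  have "{i. (c * f i) $ n \<noteq> 0} \<subseteq> psupp f n"
    by (rule subsetI, rule ccontr) (auto simp: psupp_def fps_mult_nth)
  then show "finite {i. (c * f i) $ n \<noteq> 0}"
    by (rule finite_subset) (simp add: finite_psupp assms)
qed

lemma csum_cmult:
  fixes f :: "'i \<Rightarrow> 'a::semiring_0 fps"
  assumes "pfin f" shows "csum (\<lambda>i. c * f i) = c * csum f"
proof (rule fps_ext)
  fix n
  have "csum (\<lambda>i. c * f i) $ n = (\<Sum>i\<in>psupp f n. (c * f i) $ n)"
    by (rule csum_nth_superset) (auto simp: finite_psupp assms, auto simp: psupp_def fps_mult_nth)
  also have "\<dots> = (\<Sum>k=0..n. c $ k * csum f $ (n - k))"
    by (simp add: fps_mult_nth csum_nth[OF assms, of _ n] sum_distrib_left)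
       (rule sum.swap)
  finally show "csum (\<lambda>i. c * f i) $ n = (c * csum f) $ n" by (simp add: fps_mult_nth)
qed

lemma csum_sum:
  assumes "\<And>x. x \<in> I \<Longrightarrow> pfin (F x)" and "finite I"
  shows "csum (\<lambda>i. \<Sum>x\<in>I. F x i) = (\<Sum>x\<in>I. csum (F x))"
proof (rule fps_ext)
  fix n
  let ?S = "\<Union>x\<in>I. {i. F x i $ n \<noteq> 0}"
  have S: "finite ?S" using assms by (auto simp: pfin_def)
  have "csum (\<lambda>i. \<Sum>x\<in>I. F x i) $ n = (\<Sum>i\<in>?S. (\<Sum>x\<in>I. F x i) $ n)"
    by (rule csum_nth_superset[OF S]) (auto simp: fps_sum_nth intro!: sum.neutral)
  also have "\<dots> = (\<Sum>x\<in>I. \<Sum>i\<in>?S. F x i $ n)"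
    by (simp add: fps_sum_nth) (rule sum.swap)
  also have "\<dots> = (\<Sum>x\<in>I. csum (F x) $ n)"
    by (intro sum.cong refl csum_nth_superset[symmetric] S) auto
  finally show "csum (\<lambda>i. \<Sum>x\<in>I. F x i) $ n = (\<Sum>x\<in>I. csum (F x)) $ n"
    by (simp add: fps_sum_nth)
qed

section \<open>Matrix coefficients\<close>

abbreviation sgl :: "'b \<Rightarrow> 'b \<Rightarrow>\<^sub>0 complex"
  where "sgl l \<equiv> Poly_Mapping.single l 1"

lemma endo_app_add: "endo_app f (v + w) = endo_app f v + endo_app f w"
  using endo_app[of f] by (simp add: linear_cscale_iff)

lemma endo_app_cscale: "endo_app f (cscale c v) = cscale c (endo_app f v)"
  using endo_app[of f] by (simp add: linear_cscale_iff)

lemma endo_app_zero: "endo_app f 0 = 0"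
  using endo_app_add[of f 0 0] by simp

lemma endo_app_sum: "endo_app f (\<Sum>i\<in>I. v i) = (\<Sum>i\<in>I. endo_app f (v i))"
  by (induction I rule: infinite_finite_induct) (auto simp: endo_app_zero endo_app_add)

lemma expand_superset:
  fixes v :: "'b \<Rightarrow>\<^sub>0 complex"
  assumes "finite F" "\<And>b. b \<notin> F \<Longrightarrow> Poly_Mapping.lookup v b = 0"
  shows "v = (\<Sum>b\<in>F. cscale (Poly_Mapping.lookup v b) (sgl b))"
  by (rule poly_mapping_eqI)
     (use assms in \<open>auto simp: lookup_sum lookup_single when_def if_distrib sum.delta cong: if_cong\<close>)

lemma endo_app_expand:
  assumes "finite F" "\<And>b. b \<notin> F \<Longrightarrow> Poly_Mapping.lookup v b = 0"
  shows "endo_app f v = (\<Sum>b\<in>F. cscale (Poly_Mapping.lookup v b) (endo_app f (sgl b)))"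
  by (subst expand_superset[OF assms]) (auto simp: endo_app_sum endo_app_cscale)

lemma endo_eqI:
  assumes "\<And>l. endo_app f (sgl l) = endo_app g (sgl l)"
  shows "f = g"
proof -
  have "endo_app f v = endo_app g v" for v
    using endo_app_expand[of "Poly_Mapping.keys v" v f] endo_app_expand[of "Poly_Mapping.keys v" v g] assms
    by (simp add: in_keys_iff)
  then show ?thesis by (auto simp: endo_app_inject[symmetric])
qed

definition mc :: "'b opser \<Rightarrow> 'b \<Rightarrow> 'b \<Rightarrow> complex fps"
  where "mc T l m = Abs_fps (\<lambda>k. Poly_Mapping.lookup (endo_app (T $ k) (sgl l)) m)"

lemma mc_nth [simp]: "mc T l m $ k = Poly_Mapping.lookup (endo_app (T $ k) (sgl l)) m"
  by (simp add: mc_def)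

lemma mc_eqI: "(\<And>l m. mc S l m = mc T l m) \<Longrightarrow> S = T"
  by (rule fps_ext, rule endo_eqI, rule poly_mapping_eqI) (metis mc_nth)

lemma mc_zero [simp]: "mc 0 l m = 0"
  by (rule fps_ext) (simp add: zero_endo.rep_eq)

lemma mc_add: "mc (S + T) l m = mc S l m + mc T l m"
  by (rule fps_ext) (simp add: plus_endo.rep_eq lookup_add)

lemma mc_diff: "mc (S - T) l m = mc S l m - mc T l m"
  by (rule fps_ext) (simp add: minus_endo.rep_eq lookup_minus)

lemma mc_uminus: "mc (- T) l m = - mc T l m"
  by (rule fps_ext) (simp add: uminus_endo.rep_eq)

lemma endo_app_sum_left: "endo_app (\<Sum>i\<in>I. f i) v = (\<Sum>i\<in>I. endo_app (f i) v)"
  by (induction I rule: infinite_finite_induct) (auto simp: zero_endo.rep_eq plus_endo.rep_eq)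

text \<open>Each coefficient of \<open>T\<close> maps a basis vector to a finite combination, but
  the support may grow with the power of p. One finite set \<open>F\<close> valid for all orders
  turns composition into a finite sum of products of series.\<close>

lemma mc_mult:
  assumes "finite F" "\<And>b. b \<notin> F \<Longrightarrow> mc T l b = 0"
  shows "mc (S * T) l m = (\<Sum>b\<in>F. mc T l b * mc S b m)"
proof (rule fps_ext)
  fix n
  have z: "Poly_Mapping.lookup (endo_app (T $ k) (sgl l)) b = 0" if "b \<notin> F" for b k
    using assms(2)[OF that] by (metis fps_zero_nth mc_nth)
  have "mc (S * T) l m $ n = (\<Sum>i=0..n. Poly_Mapping.lookup (endo_app (S $ i) (endo_app (T $ (n - i)) (sgl l))) m)"
    by (simp add: fps_mult_nth endo_app_sum_left lookup_sum times_endo.rep_eq)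
  also have "\<dots> = (\<Sum>i=0..n. \<Sum>b\<in>F. mc T l b $ (n - i) * mc S b m $ i)"
    by (subst endo_app_expand[OF assms(1) z]) (auto simp: lookup_sum)
  also have "\<dots> = (\<Sum>b\<in>F. \<Sum>i=0..n. mc S b m $ i * mc T l b $ (n - i))"
    by (subst sum.swap) (simp add: mult.commute)
  also have "\<dots> = (\<Sum>b\<in>F. mc S b m * mc T l b) $ n"
    by (simp only: fps_sum_nth fps_mult_nth)
  finally show "mc (S * T) l m $ n = (\<Sum>b\<in>F. mc T l b * mc S b m) $ n"
    by (simp add: mult.commute)
qed

lemma psum_eq_csum: "psum = csum"
  by (intro ext) (simp add: psum_def csum_def)

lemma mc_csum:
  assumes "pfin f" shows "mc (csum f) l m = csum (\<lambda>i. mc (f i) l m)"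
proof (rule fps_ext)
  fix n
  have "csum (\<lambda>i. mc (f i) l m) $ n = (\<Sum>i\<in>{i. f i $ n \<noteq> 0}. mc (f i) l m $ n)"
    by (rule csum_nth_superset) (use assms in \<open>auto simp: pfin_def zero_endo.rep_eq\<close>)
  moreover have "csum f $ n = (\<Sum>i\<in>{i. f i $ n \<noteq> 0}. f i $ n)"
    by (rule csum_nth_superset) (use assms in \<open>auto simp: pfin_def\<close>)
  ultimately show "mc (csum f) l m $ n = csum (\<lambda>i. mc (f i) l m) $ n"
    by (simp add: endo_app_sum_left lookup_sum)
qed

section \<open>Operators given by their values on the basis\<close>

definition lin_ext :: "('b \<Rightarrow> 'b \<Rightarrow>\<^sub>0 complex) \<Rightarrow> ('b \<Rightarrow>\<^sub>0 complex) \<Rightarrow> 'b \<Rightarrow>\<^sub>0 complex"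
  where "lin_ext R v = (\<Sum>b\<in>Poly_Mapping.keys v. cscale (Poly_Mapping.lookup v b) (R b))"

lemma lin_ext_superset:
  assumes "finite F" "Poly_Mapping.keys v \<subseteq> F"
  shows "lin_ext R v = (\<Sum>b\<in>F. cscale (Poly_Mapping.lookup v b) (R b))"
  unfolding lin_ext_def
  by (rule sum.mono_neutral_left) (use assms in \<open>auto simp: in_keys_iff intro!: poly_mapping_eqI\<close>)

lemma lookup_cscale_sum: "Poly_Mapping.lookup (\<Sum>b\<in>F. cscale (c b) (R b)) x = (\<Sum>b\<in>F. c b * Poly_Mapping.lookup (R b) x)"
  by (simp add: lookup_sum)

lift_definition endo_of :: "('b \<Rightarrow> 'b \<Rightarrow>\<^sub>0 complex) \<Rightarrow> 'b endo" is lin_ext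
proof -
  fix R :: "'b \<Rightarrow> 'b \<Rightarrow>\<^sub>0 complex"
  have "lin_ext R (v + w) = lin_ext R v + lin_ext R w" for v w
    by (simp add: lin_ext_superset[of "Poly_Mapping.keys v \<union> Poly_Mapping.keys w"] keys_add)
       (auto intro!: poly_mapping_eqI simp: lookup_add lookup_cscale_sum ring_distribs sum.distrib)
  moreover have "lin_ext R (cscale c v) = cscale c (lin_ext R v)" for c v
    by (subst (1 2) lin_ext_superset[of "Poly_Mapping.keys v"])
       (auto intro!: poly_mapping_eqI simp: lookup_cscale_sum in_keys_iff sum_distrib_left mult.assoc)
  ultimately show "Vector_Spaces.linear cscale cscale (lin_ext R)"
    by (simp add: linear_cscale_iff)
qed

lemma endo_of_sgl: "endo_app (endo_of R) (sgl l) = R l"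
  by (simp add: endo_of.rep_eq lin_ext_def) (auto intro!: poly_mapping_eqI)

definition opr :: "('b \<Rightarrow> ('b \<Rightarrow>\<^sub>0 complex) fps) \<Rightarrow> 'b opser"
  where "opr R = Abs_fps (\<lambda>k. endo_of (\<lambda>l. R l $ k))"

lemma act_opr: "act (opr R) (sgl l) = R l"
  by (rule fps_ext) (simp add: act_def opr_def endo_of_sgl)

lemma mc_opr: "mc (opr R) l m = Abs_fps (\<lambda>k. Poly_Mapping.lookup (R l $ k) m)"
  by (rule fps_ext) (simp add: opr_def endo_of_sgl)

definition dg :: "('b \<Rightarrow> complex fps) \<Rightarrow> 'b opser"
  where "dg f = opr (\<lambda>l. cmul (f l) (sgl l))"

lemma act_dg: "act (dg f) (sgl l) = cmul (f l) (sgl l)"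
  by (simp add: dg_def act_opr)

lemma mc_dg: "mc (dg f) l m = (if l = m then f l else 0)"
  by (rule fps_ext) (simp add: dg_def mc_opr cmul_def lookup_single when_def)

lemma mc_mult_dg: "mc (T * dg f) l m = f l * mc T l m"
  by (subst mc_mult[of "{l}"]) (auto simp: mc_dg)

text \<open>\<open>mc_mult\<close> does not apply, because no finite set need contain the supports
  of all coefficients of \<open>T\<close>. A diagonal factor on the left only rescales entries, so
  the identity holds order by order.\<close>

lemma mc_dg_mult: "mc (dg f * T) l m = f m * mc T l m"
proof (rule fps_ext)
  fix n
  have e: "endo_app (dg f $ i) v = (\<Sum>b\<in>Poly_Mapping.keys v. cscale (Poly_Mapping.lookup v b * f b $ i) (sgl b))" for i v
    by (subst endo_app_expand[of "Poly_Mapping.keys v"])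
       (auto simp: in_keys_iff dg_def opr_def endo_of_sgl cmul_def cscale_cscale)
  have "Poly_Mapping.lookup (endo_app (dg f $ i) v) m = f m $ i * Poly_Mapping.lookup v m" for i v
    unfolding e by (auto simp: lookup_sum lookup_single when_def in_keys_iff if_distrib
        sum.delta' cong: if_cong)
  then show "mc (dg f * T) l m $ n = (f m * mc T l m) $ n"
    by (simp add: fps_mult_nth endo_app_sum_left lookup_sum times_endo.rep_eq)
qed

lemma dg_zero: "dg (\<lambda>_. 0) = 0" by (rule mc_eqI) (simp add: mc_dg)

lemma dg_add: "dg f + dg g = dg (\<lambda>l. f l + g l)"
  by (rule mc_eqI) (auto simp: mc_dg mc_add)

lemma dg_diff: "dg f - dg g = dg (\<lambda>l. f l - g l)"
  by (rule mc_eqI) (auto simp: mc_dg mc_diff)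

lemma dg_uminus: "- dg f = dg (\<lambda>l. - f l)"
  by (rule mc_eqI) (auto simp: mc_dg mc_uminus)

lemma dg_mult: "dg f * dg g = dg (\<lambda>l. f l * g l)"
  by (rule mc_eqI) (auto simp: mc_dg mc_dg_mult)

lemma dg_sc: "sc c = dg (\<lambda>_. fps_const c)"
  by (rule mc_eqI, rule fps_ext)
     (auto simp: mc_dg sc_def endo_scalar.rep_eq zero_endo.rep_eq lookup_single when_def fps_const_def)

lemma dg_one: "1 = dg (\<lambda>_. 1)"
  by (rule mc_eqI, rule fps_ext)
     (auto simp: mc_dg one_endo.rep_eq zero_endo.rep_eq lookup_single when_def)

lemma dg_X: "fps_X = dg (\<lambda>_. fps_X)"
  by (rule mc_eqI, rule fps_ext)
     (auto simp: mc_dg one_endo.rep_eq zero_endo.rep_eq lookup_single when_def fps_X_def)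

lemma dg_power: "dg f ^ n = dg (\<lambda>l. f l ^ n)"
  by (induction n) (simp_all add: dg_one dg_mult)

lemma dg_sum: "(\<Sum>i\<in>I. dg (F i)) = dg (\<lambda>l. \<Sum>i\<in>I. F i l)"
  by (induction I rule: infinite_finite_induct) (simp_all add: dg_zero dg_add)

lemma dg_nth_eq_0: "dg f $ n = 0 \<longleftrightarrow> (\<forall>l. f l $ n = 0)"
proof
  assume "dg f $ n = 0"
  then have "mc (dg f) l l $ n = 0" for l by (simp add: zero_endo.rep_eq)
  then show "\<forall>l. f l $ n = 0" by (simp add: mc_dg)
next
  assume "\<forall>l. f l $ n = 0"
  then show "dg f $ n = 0"
    by (intro endo_eqI poly_mapping_eqI) (simp add: dg_def opr_def endo_of_sgl cmul_def zero_endo.rep_eq)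
qed

section \<open>Series with diagonal coefficients\<close>

text \<open>In \<open>complex fps fps\<close> the outer variable is z, 1/z or a ratio of such
  variables, and the inner one is p, as in \<open>'b opser fps\<close>.\<close>

definition dg2 :: "('b \<Rightarrow> complex fps fps) \<Rightarrow> 'b opser fps"
  where "dg2 F = Abs_fps (\<lambda>n. dg (\<lambda>l. F l $ n))"

lemma dg2_nth: "dg2 F $ n = dg (\<lambda>l. F l $ n)" by (simp add: dg2_def)

lemma dg2_mult: "dg2 F * dg2 G = dg2 (\<lambda>l. F l * G l)"
  by (rule fps_ext) (simp add: dg2_nth fps_mult_nth dg_mult dg_sum)

lemma dg2_diff: "dg2 F - dg2 G = dg2 (\<lambda>l. F l - G l)"
  by (rule fps_ext) (simp add: dg2_nth dg_diff)

lemma dg2_one: "1 = dg2 (\<lambda>_. 1)"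
  by (rule fps_ext) (simp add: dg2_nth fps_one_nth if_distrib dg_one dg_zero cong: if_cong)

lemma dg2_power: "dg2 F ^ n = dg2 (\<lambda>l. F l ^ n)"
  by (induction n) (simp_all add: dg2_one dg2_mult)

lemma dg2_const: "fps_const (dg f) = dg2 (\<lambda>l. fps_const (f l))"
  by (rule fps_ext) (simp add: dg2_nth fps_const_def if_distrib dg_zero cong: if_cong)

lemma dg2_X: "fps_X = dg2 (\<lambda>_. fps_X)"
  by (rule fps_ext) (simp add: dg2_nth fps_X_nth if_distrib dg_one dg_zero cong: if_cong)

lemma recip_left: "f $ 0 = 1 \<Longrightarrow> recip f * f = 1"
  unfolding recip_def by (rule fps_left_inverse) simp

lemma recip_unique:
  fixes f g :: "'a::ring_1 fps"
  assumes "f $ 0 = 1" "f * g = 1" shows "recip f = g"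
  by (metis assms mult.assoc mult_1 mult_1_right recip_left)

lemma recip_dg:
  assumes "\<And>l. f l $ 0 = 1" shows "recip (dg f) = dg (\<lambda>l. inverse (f l))"
proof (rule recip_unique)
  have "dg f $ 0 = (1 :: 'a opser) $ 0"
    by (intro endo_eqI poly_mapping_eqI)
       (simp add: dg_def opr_def endo_of_sgl cmul_def one_endo.rep_eq assms)
  then show "dg f $ 0 = 1" by simp
  show "dg f * dg (\<lambda>l. inverse (f l)) = 1"
    by (simp add: dg_mult dg_one inverse_mult_eq_1' assms)
qed

lemma recip_dg2:
  assumes "\<And>l. F l $ 0 = 1" shows "recip (dg2 F) = dg2 (\<lambda>l. recip (F l))"
proof (rule recip_unique)
  show "dg2 F $ 0 = 1" by (simp add: dg2_nth assms dg_one)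
  show "dg2 F * dg2 (\<lambda>l. recip (F l)) = 1"
    by (simp add: dg2_mult dg2_one) (metis assms mult.commute recip_left)
qed

definition gexp :: "complex fps fps \<Rightarrow> complex fps fps"
  where "gexp A = Abs_fps (\<lambda>n. \<Sum>k\<le>n. fps_const (1 / fact k) * (A ^ k) $ n)"

lemma fexp_dg2: "fexp (dg2 A) = dg2 (\<lambda>l. gexp (A l))"
  by (rule fps_ext) (simp add: fexp_def gexp_def dg2_power dg2_nth dg_sc dg_mult dg_sum)

section \<open>Exponentials and the Euler series\<close>

text \<open>\<open>A ^ k\<close> starts in degree \<open>k\<close>, so further terms do not change
  coefficient \<open>n\<close>. A fixed \<open>N\<close> replaces the varying truncation of the
  definition by one finite sum that can be differentiated.\<close>

lemma gexp_nth_ge: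
  assumes "A $ 0 = 0" "n \<le> N"
  shows "gexp A $ n = (\<Sum>k\<le>N. fps_const (fps_const (1 / fact k)) * A ^ k) $ n"
proof -
  have "(\<Sum>k\<le>N. fps_const (1 / fact k) * (A ^ k) $ n) = (\<Sum>k\<le>n. fps_const (1 / fact k) * (A ^ k) $ n)"
    by (rule sum.mono_neutral_right)
       (use assms startsby_zero_power_prefix[of A] in \<open>auto\<close>)
  then show ?thesis by (simp add: gexp_def fps_sum_nth)
qed

lemma gexp_0 [simp]: "gexp A $ 0 = 1"
  by (simp add: gexp_def)

lemma fps_deriv_gexp:
  assumes "A $ 0 = 0" shows "fps_deriv (gexp A) = fps_deriv A * gexp A"
proof (rule fps_ext)
  fix n
  define S where "S N = (\<Sum>k\<le>N. fps_const (fps_const (1 / fact k)) * A ^ k)" for N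
  have S: "gexp A $ m = S N $ m" if "m \<le> N" for m N
    unfolding S_def by (rule gexp_nth_ge[OF assms that])
  have c: "fps_const (fps_const (1 / fact (Suc k))) * of_nat (Suc k)
      = (fps_const (fps_const (1 / fact k)) :: complex fps fps)" for k
    by (simp only: fps_of_nat[symmetric] fps_const_mult)
       (simp add: field_simps del: of_nat_Suc)
  have "fps_deriv (S (Suc n)) = (\<Sum>k\<le>n. fps_const (fps_const (1 / fact (Suc k))) * fps_deriv (A ^ Suc k))"
    unfolding S_def by (subst sum.atMost_Suc_shift) (simp add: fps_deriv_sum del: power_Suc)
  also have "\<dots> = (\<Sum>k\<le>n. (fps_const (fps_const (1 / fact (Suc k))) * of_nat (Suc k)) * (fps_deriv A * A ^ k))"
    by (simp only: fps_deriv_power' diff_Suc_1) (simp add: mult_ac)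
  also have "\<dots> = fps_deriv A * S n"
    unfolding S_def c by (simp add: sum_distrib_left mult_ac)
  finally have d: "fps_deriv (S (Suc n)) = fps_deriv A * S n" .
  have "fps_deriv (gexp A) $ n = fps_deriv (S (Suc n)) $ n"
    by (simp add: S[of "Suc n" "Suc n"])
  also have "\<dots> = (fps_deriv A * gexp A) $ n"
    unfolding d fps_mult_nth by (intro sum.cong) (auto simp: S[of _ n])
  finally show "fps_deriv (gexp A) $ n = (fps_deriv A * gexp A) $ n" .
qed

text \<open>The equation determines coefficient n+1 from the lower ones, since the integer n+1 is
  not a zero divisor. The addition formula of \<open>gexp\<close> and the Euler expansion both rest
  on this uniqueness.\<close>

lemma linear_ode_unique:
  fixes F G B :: "complex fps fps"
  assumes "fps_deriv F = B * F" "fps_deriv G = B * G" "F $ 0 = G $ 0"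
  shows "F = G"
proof -
  have "F $ n = G $ n" for n
  proof (induction n rule: less_induct)
    case (less n)
    show ?case
    proof (cases n)
      case (Suc m)
      have "fps_deriv F $ m = fps_deriv G $ m"
        unfolding assms fps_mult_nth by (intro sum.cong) (auto simp: less Suc)
      moreover have "(of_nat (m + 1) :: complex fps) \<noteq> 0"
        by (simp only: fps_of_nat[symmetric] fps_const_eq_0_iff of_nat_eq_0_iff)
      ultimately show ?thesis
        unfolding fps_deriv_nth Suc by (simp only: mult_cancel_left) simp
    qed (use assms in simp)
  qed
  then show ?thesis by (rule fps_ext)
qed

lemma gexp_zero [simp]: "gexp 0 = 1"
  by (rule linear_ode_unique[of _ 0]) (simp_all add: fps_deriv_gexp)

lemma gexp_add: "A $ 0 = 0 \<Longrightarrow> B $ 0 = 0 \<Longrightarrow> gexp (A + B) = gexp A * gexp B"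
  by (rule linear_ode_unique[of _ "fps_deriv A + fps_deriv B"])
     (simp_all add: fps_deriv_gexp algebra_simps)

lemma gexp_uminus: "A $ 0 = 0 \<Longrightarrow> gexp A * gexp (- A) = 1"
  by (subst gexp_add[symmetric]) simp_all

lemma recip_gexp: "A $ 0 = 0 \<Longrightarrow> recip (gexp A) = gexp (- A)"
  by (rule recip_unique) (simp_all add: gexp_uminus)

text \<open>In closed form \<open>eul i\<close> is (-1)^i p^(i(i-1)/2) / ((1-p)...(1-p^i)), the
  coefficient of a^i in Euler's expansion of (a;p)_infinity. The recursion is the coefficient form
  of E(y) = (1 - y) E(p y).\<close>

fun eul :: "nat \<Rightarrow> complex fps"
  where "eul 0 = 1"
  | "eul (Suc i) = - (fps_X ^ i * inverse (1 - fps_X ^ Suc i) * eul i)"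

declare eul.simps(2) [simp del]

lemma eul_Suc: "eul (Suc i) * (1 - fps_X ^ Suc i) = - (fps_X ^ i * eul i)"
proof -
  have "inverse (1 - fps_X ^ Suc i) * (1 - fps_X ^ Suc i) = (1 :: complex fps)"
    by (rule inverse_mult_eq_1) simp
  then show ?thesis
    unfolding eul.simps(2) by (metis (no_types, lifting) mult.assoc mult.commute mult.right_neutral mult_minus_left)
qed

text \<open>The true order is i(i-1)/2; the factor p^(i-1) of the last recursion step gives the
  bound i-1, which suffices for p-adic convergence.\<close>

lemma eul_nth_eq_0: "n + 1 < i \<Longrightarrow> eul i $ n = 0"
proof (induction i arbitrary: n)
  case (Suc i)
  have "eul (Suc i) = fps_X ^ i * (- inverse (1 - fps_X ^ Suc i) * eul i)"
    by (simp add: eul.simps(2) mult.assoc)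
  then show ?case using Suc.prems by (simp add: fps_X_power_mult_nth)
qed simp

definition eulE :: "complex fps \<Rightarrow> complex fps fps"
  where "eulE c = Abs_fps (\<lambda>j. eul j * c ^ j)"

text \<open>\<open>- lg c\<close> is the logarithm of (c y; p)_infinity as a series in the outer
  variable y; \<open>c\<close> may itself involve p.\<close>

definition lg :: "complex fps \<Rightarrow> complex fps fps"
  where "lg c = Abs_fps (\<lambda>m. if m = 0 then 0 else
           fps_const (1 / of_nat m) * c ^ m * inverse (1 - fps_X ^ m))"

lemma lg_0 [simp]: "lg c $ 0 = 0"
  by (simp add: lg_def)

text \<open>The substitution y -> p y in the outer variable.\<close>

definition qscale :: "complex fps fps \<Rightarrow> complex fps fps"
  where "qscale F = Abs_fps (\<lambda>m. fps_X ^ m * F $ m)"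

lemma qscale_nth [simp]: "qscale F $ m = fps_X ^ m * F $ m"
  by (simp add: qscale_def)

lemma qscale_add: "qscale (F + G) = qscale F + qscale G"
  by (rule fps_ext) (simp add: algebra_simps)

lemma qscale_mult: "qscale (F * G) = qscale F * qscale G"
proof (rule fps_ext)
  fix m
  have "fps_X ^ m * (F $ i * G $ (m - i)) = fps_X ^ i * F $ i * (fps_X ^ (m - i) * G $ (m - i))"
    if "i \<in> {0..m}" for i
  proof -
    have "(fps_X :: complex fps) ^ m = fps_X ^ i * fps_X ^ (m - i)"
      using that by (simp flip: power_add)
    then show ?thesis by (simp only: mult_ac)
  qed
  then show "qscale (F * G) $ m = (qscale F * qscale G) $ m"
    unfolding qscale_nth fps_mult_nth sum_distrib_left by (rule sum.cong[OF refl])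
qed

lemma fps_deriv_qscale: "fps_deriv (qscale F) = fps_const fps_X * qscale (fps_deriv F)"
  by (rule fps_ext) (simp add: mult_ac)

lemma one_minus_const_X_mult_nth:
  "((1 - fps_const c * fps_X) * F) $ m = F $ m - (if m = 0 then 0 else c * F $ (m - 1))"
  for c :: "'a::comm_ring_1"
  by (simp add: left_diff_distrib mult.assoc fps_X_mult_nth)

text \<open>Writing \<open>E\<close> for the Euler series and \<open>B\<close> for its expected logarithmic derivative up to sign,
  the equation \<open>E(y) = (1 - c y) E(p y)\<close> shows that \<open>R = E' + B E\<close> satisfies
  \<open>R(y) = p (1 - c y) R(p y)\<close>, and the only such series is 0.\<close>

lemma gexp_lg: "gexp (- lg c) = eulE c"
proof (rule linear_ode_unique[of _ "- fps_deriv (lg c)"])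
  define E where "E = eulE c"
  define B where "B = fps_deriv (lg c)"
  define R where "R = fps_deriv E + B * E"
  define G where "G = Abs_fps (\<lambda>m. c ^ Suc m)"
  let ?L = "1 - fps_const c * fps_X"
  have inv: "inverse (1 - fps_X ^ Suc m) * (1 - fps_X ^ Suc m) = (1 :: complex fps)" for m
    by (rule inverse_mult_eq_1) simp
  have E: "E = ?L * qscale E"
  proof (rule fps_ext)
    fix n show "E $ n = (?L * qscale E) $ n"
    proof (cases n)
      case (Suc m)
      have "eul (Suc m) = fps_X ^ Suc m * eul (Suc m) - fps_X ^ m * eul m"
        using eul_Suc[of m] by (simp add: algebra_simps)
      then have "eul (Suc m) * c ^ Suc m = (fps_X ^ Suc m * eul (Suc m) - fps_X ^ m * eul m) * c ^ Suc m"
        by (rule arg_cong)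
      then show ?thesis
        unfolding one_minus_const_X_mult_nth qscale_nth Suc
        by (simp add: E_def eulE_def algebra_simps)
    qed (simp add: one_minus_const_X_mult_nth)
  qed
  have Bm: "B $ m = c ^ Suc m * inverse (1 - fps_X ^ Suc m)" for m
  proof -
    have "of_nat (Suc m) * fps_const (1 / of_nat (Suc m)) = (1 :: complex fps)"
      by (simp only: fps_of_nat[symmetric] fps_const_mult) (simp del: of_nat_Suc)
    then show ?thesis
      unfolding B_def lg_def fps_deriv_nth
      by (simp del: of_nat_Suc power_Suc)
  qed
  have B: "B = fps_const fps_X * qscale B + G"
  proof (rule fps_ext)
    fix m
    have "B $ m * (1 - fps_X ^ Suc m) = c ^ Suc m"
      unfolding Bm mult.assoc inv by simp
    then show "B $ m = (fps_const fps_X * qscale B + G) $ m"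
      by (simp add: G_def algebra_simps)
  qed
  have G: "?L * G = fps_const c"
    by (rule fps_ext, subst one_minus_const_X_mult_nth) (auto simp: G_def gr0_conv_Suc)
  have dE: "fps_deriv E = ?L * (fps_const fps_X * qscale (fps_deriv E)) - fps_const c * qscale E"
    by (subst E) (simp add: fps_deriv_qscale algebra_simps)
  have "B * E = (fps_const fps_X * qscale B + G) * (?L * qscale E)"
    using B E by metis
  also have "\<dots> = ?L * (fps_const fps_X * (qscale B * qscale E)) + (?L * G) * qscale E"
    by (simp only: algebra_simps)
  finally have "B * E = ?L * (fps_const fps_X * (qscale B * qscale E)) + fps_const c * qscale E"
    unfolding G .
  then have "R = ?L * (fps_const fps_X * (qscale (fps_deriv E) + qscale B * qscale E))"
    unfolding R_def by (subst dE) (simp add: algebra_simps)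
  moreover have "qscale R = qscale (fps_deriv E) + qscale B * qscale E"
    by (simp add: R_def qscale_add qscale_mult)
  ultimately have R: "R = ?L * (fps_const fps_X * qscale R)"
    by simp
  have "R $ m = 0" for m
  proof (induction m)
    case 0
    have "R $ 0 = (?L * (fps_const fps_X * qscale R)) $ 0" using R by simp
    then have "(1 - fps_X) * R $ 0 = 0"
      unfolding one_minus_const_X_mult_nth by (simp add: algebra_simps)
    moreover have "(1 - fps_X :: complex fps) $ 0 \<noteq> 0" by simp
    ultimately show ?case by (metis fps_zero_nth mult_eq_0_iff)
  next
    case (Suc m)
    have "R $ Suc m = (?L * (fps_const fps_X * qscale R)) $ Suc m" using R by simp
    then have "(1 - fps_X ^ Suc (Suc m)) * R $ Suc m = 0"
      unfolding one_minus_const_X_mult_nth by (simp add: algebra_simps Suc)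
    moreover have "(1 - fps_X ^ Suc (Suc m) :: complex fps) $ 0 \<noteq> 0" by simp
    ultimately show ?case by (metis fps_zero_nth mult_eq_0_iff)
  qed
  then have "R = 0" by (simp add: fps_ext)
  then show "fps_deriv (eulE c) = - fps_deriv (lg c) * eulE c"
    unfolding R_def B_def E_def by (simp add: eq_neg_iff_add_eq_0)
  show "fps_deriv (gexp (- lg c)) = - fps_deriv (lg c) * gexp (- lg c)"
    by (simp add: fps_deriv_gexp)
  show "gexp (- lg c) $ 0 = eulE c $ 0" by (simp add: eulE_def)
qed

section \<open>Change of coefficients\<close>

lemma pfin_mono:
  assumes "pfin f" "\<And>i n. f i $ n = 0 \<Longrightarrow> g i $ n = 0" shows "pfin g"
  unfolding pfin_def
proof
  fix n
  have "{i. g i $ n \<noteq> 0} \<subseteq> {i. f i $ n \<noteq> 0}" using assms(2) by auto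
  then show "finite {i. g i $ n \<noteq> 0}" by (rule finite_subset) (use assms in \<open>simp add: pfin_def\<close>)
qed

definition fmap :: "('a \<Rightarrow> 'b) \<Rightarrow> 'a fps \<Rightarrow> 'b fps"
  where "fmap \<phi> F = Abs_fps (\<lambda>n. \<phi> (F $ n))"

lemma fmap_nth [simp]: "fmap \<phi> F $ n = \<phi> (F $ n)"
  by (simp add: fmap_def)

lemma fmap_id [simp]: "fmap (\<lambda>x. x) F = F" by (rule fps_ext) simp

text \<open>Three kinds of homomorphism occur: the identity of the complex numbers, the embedding of
  constants into Laurent series, and the evaluation of Laurent polynomials at a point.\<close>

locale ring_hom_loc =
  fixes \<phi> :: "'a::comm_ring_1 \<Rightarrow> 'b::comm_ring_1"
  assumes add: "\<phi> (a + b) = \<phi> a + \<phi> b"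
    and mult: "\<phi> (a * b) = \<phi> a * \<phi> b"
    and one: "\<phi> 1 = 1"
begin

lemma zero: "\<phi> 0 = 0" using add[of 0 0] by simp

lemma uminus: "\<phi> (- a) = - \<phi> a"
  using add[of a "- a"] by (simp add: zero add_eq_0_iff)

lemma diff: "\<phi> (a - b) = \<phi> a - \<phi> b"
  using add[of a "- b"] by (simp add: uminus)

lemma sum: "\<phi> (\<Sum>i\<in>I. f i) = (\<Sum>i\<in>I. \<phi> (f i))"
  by (induction I rule: infinite_finite_induct) (simp_all add: zero add)

lemma power: "\<phi> (a ^ n) = \<phi> a ^ n"
  by (induction n) (simp_all add: one mult)

lemma fmap_hom: "ring_hom_loc (fmap \<phi>)"
  by unfold_locales
     (auto intro!: fps_ext simp: add one zero fps_mult_nth sum mult fps_one_nth)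

lemma fmap_X: "fmap \<phi> fps_X = fps_X"
  by (rule fps_ext) (simp add: fps_X_nth one zero)

lemma fmap_const: "fmap \<phi> (fps_const c) = fps_const (\<phi> c)"
  by (rule fps_ext) (simp add: zero)

lemma prod: "\<phi> (\<Prod>i\<in>I. f i) = (\<Prod>i\<in>I. \<phi> (f i))"
  by (induction I rule: infinite_finite_induct) (simp_all add: one mult)

end

lemma csum_add:
  assumes "pfin f" "pfin g" shows "csum (\<lambda>i. f i + g i) = csum f + csum g"
  using csum_sum[of "UNIV :: bool set" "\<lambda>b. if b then f else g"] assms by (simp add: UNIV_bool add.commute)

lemma csum_shift:
  fixes f :: "nat \<Rightarrow> 'a::comm_monoid_add fps"
  assumes "pfin f" shows "csum f = f 0 + csum (\<lambda>i. f (Suc i))" and "pfin (\<lambda>i. f (Suc i))"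
proof -
  have *: "finite {i. f (Suc i) $ n \<noteq> 0}" for n
    using finite_vimageI[of "{i. f i $ n \<noteq> 0}" Suc] assms by (simp add: pfin_def vimage_def)
  then show "pfin (\<lambda>i. f (Suc i))" by (simp add: pfin_def)
  show "csum f = f 0 + csum (\<lambda>i. f (Suc i))"
  proof (rule fps_ext)
    fix n
    have "csum f $ n = (\<Sum>i\<in>insert 0 (Suc ` {i. f (Suc i) $ n \<noteq> 0}). f i $ n)"
    proof (rule csum_nth_superset)
      fix i assume "i \<notin> insert 0 (Suc ` {i. f (Suc i) $ n \<noteq> 0})"
      then show "f i $ n = 0" by (cases i) auto
    qed (use * in auto)
    also have "\<dots> = f 0 $ n + (\<Sum>i\<in>{i. f (Suc i) $ n \<noteq> 0}. f (Suc i) $ n)"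
      by (subst sum.insert) (auto simp: * sum.reindex)
    also have "(\<Sum>i\<in>{i. f (Suc i) $ n \<noteq> 0}. f (Suc i) $ n) = csum (\<lambda>i. f (Suc i)) $ n"
      by (rule csum_nth_superset[symmetric]) (use * in auto)
    finally show "csum f $ n = (f 0 + csum (\<lambda>i. f (Suc i))) $ n" by simp
  qed
qed

lemma (in ring_hom_loc) fmap_qpoch: "fmap \<phi> (qpoch a) = qpoch (fmap \<phi> a)"
proof -
  interpret h: ring_hom_loc "fmap \<phi>" by (rule fmap_hom)
  show ?thesis
    by (rule fps_ext) (simp add: qpoch_def flip: fmap_nth[of \<phi>] fmap_X add: h.prod h.diff h.one h.mult h.power)
qed

section \<open>Euler's expansion over a complex algebra, and substitution into double series\<close>

locale complex_alg = ring_hom_loc \<phi> for \<phi> :: "complex \<Rightarrow> 'k::comm_ring_1"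
begin

sublocale fh: ring_hom_loc "fmap \<phi>" by (rule fmap_hom)

lemma pfin_eul: "pfin (\<lambda>i. fmap \<phi> (eul i) * b i)"
  unfolding pfin_def
proof
  fix n
  have "(fmap \<phi> (eul i) * b i) $ n = 0" if "n + 1 < i" for i
    unfolding fps_mult_nth by (rule sum.neutral) (use that in \<open>auto simp: eul_nth_eq_0 zero\<close>)
  then have "{i. (fmap \<phi> (eul i) * b i) $ n \<noteq> 0} \<subseteq> {..n + 1}"
    by (auto simp: not_less[symmetric])
  then show "finite {i. (fmap \<phi> (eul i) * b i) $ n \<noteq> 0}" by (rule finite_subset) simp
qed

text \<open>By \<open>eul_Suc\<close> the term of index i+1 splits into a term of the series at a p
  and one of index i. The argument \<open>a\<close> is itself a series in p, possibly with constant
  term, so convergence comes from \<open>eul\<close> alone.\<close>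

lemma eul_functional:
  "csum (\<lambda>i. fmap \<phi> (eul i) * a ^ i) = (1 - a) * csum (\<lambda>i. fmap \<phi> (eul i) * (a * fps_X) ^ i)"
proof -
  let ?e = "\<lambda>i. fmap \<phi> (eul i)"
  have s: "csum (\<lambda>i. ?e i * b i) = b 0 + csum (\<lambda>i. ?e (Suc i) * b (Suc i))" for b
    by (subst csum_shift(1)[OF pfin_eul]) (simp add: fh.one)
  have r: "?e (Suc i) = ?e (Suc i) * fps_X ^ Suc i - fps_X ^ i * ?e i" for i
    using arg_cong[OF eul_Suc[of i], of "fmap \<phi>"]
    by (simp add: fh.mult fh.diff fh.one fh.power fh.uminus fmap_X algebra_simps del: power_Suc)
  have p1: "pfin (\<lambda>i. ?e (Suc i) * (a * fps_X) ^ Suc i)"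
    by (rule csum_shift(2)[OF pfin_eul, of "\<lambda>i. (a * fps_X) ^ i"])
  have p2: "pfin (\<lambda>i. ?e i * (- a * (a * fps_X) ^ i))" by (rule pfin_eul)
  have "?e (Suc i) * a ^ Suc i = ?e (Suc i) * (a * fps_X) ^ Suc i + ?e i * (- a * (a * fps_X) ^ i)" for i
    by (subst r) (simp add: algebra_simps)
  then have "csum (\<lambda>i. ?e i * a ^ i)
     = 1 + csum (\<lambda>i. ?e (Suc i) * (a * fps_X) ^ Suc i + ?e i * (- a * (a * fps_X) ^ i))"
    by (subst s) simp
  also have "\<dots> = csum (\<lambda>i. ?e i * (a * fps_X) ^ i) + csum (\<lambda>i. - a * (?e i * (a * fps_X) ^ i))"
    by (subst csum_add[OF p1 p2], subst (2) s) (simp add: mult_ac)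
  also have "csum (\<lambda>i. - a * (?e i * (a * fps_X) ^ i)) = - a * csum (\<lambda>i. ?e i * (a * fps_X) ^ i)"
    by (rule csum_cmult) (rule pfin_eul)
  finally show ?thesis by (simp add: algebra_simps)
qed

text \<open>After k+1 steps of the functional equation the remaining factor is 1 + O(p^(k+1)), so
  coefficient k is that of the finite product by which \<open>qpoch\<close> is defined.\<close>

lemma qpoch_eq_csum: "qpoch a = csum (\<lambda>i. fmap \<phi> (eul i) * a ^ i)"
proof (rule fps_ext)
  fix k
  let ?P = "\<lambda>a. csum (\<lambda>i. fmap \<phi> (eul i) * a ^ i)"
  have it: "?P a = (\<Prod>n<m. 1 - a * fps_X ^ n) * ?P (a * fps_X ^ m)" for m
  proof (induction m)
    case (Suc m)
    show ?case unfolding Suc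
      by (subst eul_functional[of "a * fps_X ^ m"]) (simp add: mult_ac)
  qed simp
  have "?P (b * fps_X ^ Suc k) = 1 + fps_X ^ Suc k *
      csum (\<lambda>i. fmap \<phi> (eul (Suc i)) * (b ^ Suc i * (fps_X ^ Suc k) ^ i))" for b
  proof -
    have "pfin (\<lambda>i. fmap \<phi> (eul (Suc i)) * (b ^ Suc i * (fps_X ^ Suc k) ^ i))"
      using csum_shift(2)[OF pfin_eul, of "\<lambda>i. b ^ i * (fps_X ^ Suc k) ^ (i - 1)"] by simp
    from csum_cmult[OF this, of "fps_X ^ Suc k"]
    show ?thesis
      by (subst csum_shift(1)[OF pfin_eul]) (simp add: fh.one power_mult_distrib mult_ac)
  qed
  then have "?P a = (\<Prod>n<Suc k. 1 - a * fps_X ^ n) * (1 + fps_X ^ Suc k *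
      csum (\<lambda>i. fmap \<phi> (eul (Suc i)) * (a ^ Suc i * (fps_X ^ Suc k) ^ i)))"
    by (subst it[of "Suc k"]) metis
  also have "\<dots> = (\<Prod>n<Suc k. 1 - a * fps_X ^ n) + fps_X ^ Suc k * ((\<Prod>n<Suc k. 1 - a * fps_X ^ n) *
      csum (\<lambda>i. fmap \<phi> (eul (Suc i)) * (a ^ Suc i * (fps_X ^ Suc k) ^ i)))"
    by (simp only: algebra_simps mult_1)
  finally have "?P a $ k = (\<Prod>n<Suc k. 1 - a * fps_X ^ n) $ k"
    by (simp only: fps_add_nth fps_X_power_mult_nth) simp
  then show "qpoch a $ k = ?P a $ k" by (simp add: qpoch_def lessThan_Suc_atMost)
qed

text \<open>Substitution of \<open>y\<close> for the outer variable. The sum is infinite and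
  converges p-adically when \<open>pfin (fps_nth F)\<close>; no smallness of \<open>y\<close> is
  involved.\<close>

definition gev :: "'k \<Rightarrow> complex fps fps \<Rightarrow> 'k fps"
  where "gev y F = csum (\<lambda>j. fmap \<phi> (F $ j) * fps_const (y ^ j))"

lemma pfin_gev: "pfin (fps_nth F) \<Longrightarrow> pfin (\<lambda>j. fmap \<phi> (F $ j) * fps_const (y ^ j))"
  by (erule pfin_mono) (simp add: zero)

lemma gev_eulE: "gev y (eulE c) = qpoch (fmap \<phi> c * fps_const y)"
  by (simp add: gev_def qpoch_eq_csum eulE_def fh.mult fh.power power_mult_distrib fps_const_power mult.assoc)

end

lemma complex_alg_id: "complex_alg (\<lambda>x. x)"
  by unfold_locales auto

lemma pfin_eulE: "pfin (fps_nth (eulE c))"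
  using complex_alg.pfin_eul[OF complex_alg_id, of "\<lambda>j. c ^ j"]
  by (rule pfin_mono) (simp add: eulE_def)

lemma pfin_mult_series:
  fixes F G :: "complex fps fps"
  assumes "pfin (fps_nth F)" "pfin (fps_nth G)"
  shows "pfin (fps_nth (F * G))"
  unfolding pfin_def
proof
  fix n
  have "{k. (F * G) $ k $ n \<noteq> 0} \<subseteq> (\<lambda>(i, j). i + j) ` {(i, j). (F $ i * G $ j) $ n \<noteq> 0}"
  proof (rule subsetI)
    fix k assume "k \<in> {k. (F * G) $ k $ n \<noteq> 0}"
    then have "(\<Sum>i=0..k. (F $ i * G $ (k - i)) $ n) \<noteq> 0" by (simp add: fps_mult_nth[of F] fps_sum_nth)
    then obtain i where "i \<in> {0..k}" "(F $ i * G $ (k - i)) $ n \<noteq> 0" by (meson sum.neutral)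
    then show "k \<in> (\<lambda>(i, j). i + j) ` {(i, j). (F $ i * G $ j) $ n \<noteq> 0}"
      by (intro image_eqI[of _ _ "(i, k - i)"]) auto
  qed
  moreover have "finite {(i, j). (F $ i * G $ j) $ n \<noteq> 0}"
    using pfin_mult[OF assms] by (auto simp: pfin_def case_prod_unfold)
  ultimately show "finite {k. (F * G) $ k $ n \<noteq> 0}" by (blast intro: finite_subset)
qed

lemma (in complex_alg) gev_mult:
  assumes "pfin (fps_nth F)" "pfin (fps_nth G)"
  shows "gev y (F * G) = gev y F * gev y G"
proof -
  let ?f = "\<lambda>j. fmap \<phi> (F $ j) * fps_const (y ^ j)" and ?g = "\<lambda>j. fmap \<phi> (G $ j) * fps_const (y ^ j)"
  have p: "pfin (\<lambda>(i, j). ?f i * ?g j)"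
    by (rule pfin_mult) (rule pfin_gev assms)+
  have "csum (\<lambda>k. \<Sum>i=0..k. ?f i * ?g (k - i)) = csum (\<lambda>(i, j). ?f i * ?g j)"
  proof (rule fps_ext)
    fix n
    define S where "S = {(i, j). (?f i * ?g j) $ n \<noteq> 0}"
    have S: "finite S" using p by (auto simp: S_def pfin_def case_prod_unfold)
    define T where "T = (\<lambda>(i, j). i + j) ` S"
    have T: "finite T" using S by (simp add: T_def)
    have "csum (\<lambda>k. \<Sum>i=0..k. ?f i * ?g (k - i)) $ n = (\<Sum>k\<in>T. (\<Sum>i=0..k. ?f i * ?g (k - i)) $ n)"
    proof (rule csum_nth_superset[OF T])
      fix k assume k: "k \<notin> T"
      show "(\<Sum>i=0..k. ?f i * ?g (k - i)) $ n = 0"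
        unfolding fps_sum_nth
      proof (rule sum.neutral, rule ballI, rule ccontr)
        fix i assume "i \<in> {0..k}" "(?f i * ?g (k - i)) $ n \<noteq> 0"
        then have "(i, k - i) \<in> S" "i + (k - i) = k" by (auto simp: S_def)
        then show False using k by (force simp: T_def)
      qed
    qed
    also have "\<dots> = (\<Sum>(k, i)\<in>(SIGMA k:T. {0..k}). (?f i * ?g (k - i)) $ n)"
      by (simp add: fps_sum_nth sum.Sigma T)
    also have "\<dots> = (\<Sum>(k, i)\<in>(\<lambda>(i, j). (i + j, i)) ` S. (?f i * ?g (k - i)) $ n)"
    proof (rule sum.mono_neutral_right)
      show "finite (SIGMA k:T. {0..k})" using T by auto
      show "(\<lambda>(i,j). (i + j, i)) ` S \<subseteq> (SIGMA k:T. {0..k})" by (force simp: T_def)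
      show "\<forall>x\<in>(SIGMA k:T. {0..k}) - (\<lambda>(i,j). (i + j, i)) ` S. (case x of (k, i) \<Rightarrow> (?f i * ?g (k - i)) $ n) = 0"
      proof (clarify, rule ccontr)
        fix k i assume "k \<in> T" "i \<in> {0..k}" "(k, i) \<notin> (\<lambda>(i,j). (i + j, i)) ` S" "(?f i * ?g (k - i)) $ n \<noteq> 0"
        then show False by (auto simp: S_def image_iff dest!: spec[of _ "k - i"])
      qed
    qed
    also have "\<dots> = (\<Sum>(i, j)\<in>S. (?f i * ?g j) $ n)"
      by (subst sum.reindex) (auto simp: inj_on_def case_prod_unfold)
    also have "\<dots> = csum (\<lambda>(i, j). ?f i * ?g j) $ n"
      by (subst csum_nth_superset[OF S]) (auto simp: S_def case_prod_unfold)
    finally show "csum (\<lambda>k. \<Sum>i=0..k. ?f i * ?g (k - i)) $ n = csum (\<lambda>(i, j). ?f i * ?g j) $ n" .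
  qed
  moreover have "fmap \<phi> ((F * G) $ k) * fps_const (y ^ k) = (\<Sum>i=0..k. ?f i * ?g (k - i))" for k
    unfolding fps_mult_nth fh.sum sum_distrib_right
  proof (rule sum.cong[OF refl])
    fix i assume "i \<in> {0..k}"
    then have "fps_const (y ^ k) = fps_const (y ^ i) * fps_const (y ^ (k - i))"
      by (simp flip: power_add)
    then show "fmap \<phi> (F $ i * G $ (k - i)) * fps_const (y ^ k) = ?f i * ?g (k - i)"
      by (simp only: fh.mult mult_ac)
  qed
  ultimately show ?thesis
    using csum_prod[of ?f ?g] assms by (simp add: gev_def pfin_gev)
qed

lemma pfin_one_minus: "pfin (fps_nth (1 - fps_const c * fps_X :: complex fps fps))"
  by (rule pfin_finite, rule finite_subset[of _ "{0, 1}"]) (auto simp: fps_X_nth)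

lemma (in complex_alg) gev_one_minus:
  "gev y (1 - fps_const c * fps_X) = 1 - fmap \<phi> c * fps_const y"
  unfolding gev_def
  by (subst csum_finite[of "{0, 1}"]) (auto simp: fh.diff fh.one fh.zero fh.mult fps_X_nth fh.uminus)

lemma (in complex_alg) gev_1: "gev y 1 = 1"
  unfolding gev_def
  by (subst csum_finite[of "{0}"]) (auto simp: fh.diff fh.one fh.zero fh.mult fps_one_nth)

section \<open>Amplitudes\<close>

definition cubicP :: "complex \<Rightarrow> complex \<Rightarrow> complex \<Rightarrow> complex \<Rightarrow> complex"
  where "cubicP q t z w = (z - q * w) * (z - w / t) * (z - t / q * w)"

text \<open>Up to a common factor and a sign, the contribution of two boxes in different rows when
  the box with content \<open>z\<close> is added after the one with content
  \<open>w\<close>.\<close>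

definition pairR :: "complex \<Rightarrow> complex \<Rightarrow> complex \<Rightarrow> complex \<Rightarrow> complex"
  where "pairR q t z w = (z - t * w) * (z - q / t * w) / (z - q * w)"

definition serreC :: "complex \<Rightarrow> complex \<Rightarrow> complex \<Rightarrow> complex"
  where "serreC z w v = w / v + w / z - z / w - v / w"

text \<open>\<open>M\<close> is the numerator of \<open>pairR\<close> over a symmetric denominator.
  The identity holds for all \<open>c\<close> and \<open>d\<close>: the shape of \<open>M\<close>
  records that its coefficients of a^3 and b^3 are opposite.\<close>

lemma serre_identity_poly:
  fixes z w v q c d :: "'a::field"
  assumes M: "\<And>a b. M a b = q * (b^3 - a^3) + c * a^2 * b + d * a * b^2"
    and C: "\<And>z w v. C z w v = w^2 * z + w^2 * v - z^2 * v - v^2 * z"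
  shows "C z w v * M z w * M w v * M z v - C w z v * M w z * M z v * M w v
    - C z v w * M z v * M v w * M z w - C v w z * M v w * M w z * M v z
    + C w v z * M w v * M v z * M w z + C v z w * M v z * M z w * M v w = 0"
  unfolding M C by algebra

lemma serre_identity:
  assumes nz: "z \<noteq> 0" "w \<noteq> 0" "v \<noteq> 0" "t \<noteq> 0"
    and d: "z \<noteq> q * w" "w \<noteq> q * z" "z \<noteq> q * v" "v \<noteq> q * z" "w \<noteq> q * v" "v \<noteq> q * w"
  defines "R \<equiv> pairR q t"
  shows "serreC z w v * R z w * R w v * R z v - serreC w z v * R w z * R z v * R w v
    - serreC z v w * R z v * R v w * R z w - serreC v w z * R v w * R w z * R v z
    + serreC w v z * R w v * R v z * R w z + serreC v z w * R v z * R z w * R v w = 0"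
proof -
  \<comment> \<open>The parameter \<open>t\<close> enters only through s, because (x - t y)(x -
    (q/t) y) = x^2 - s x y + q y^2.\<close>
  define s where "s = t + q / t"
  define M where "M = (\<lambda>a b :: complex. q * (b^3 - a^3) + (1 + q * s) * a^2 * b + (- s - q^2) * a * b^2)"
  define C where "C = (\<lambda>z w v :: complex. w^2 * z + w^2 * v - z^2 * v - v^2 * z)"
  \<comment> \<open>Symmetric in its arguments, so that all six terms get the same
    denominator.\<close>
  define E where "E = (\<lambda>a b :: complex. (a - q * b) * (b - q * a))"
  have s: "(a - t * b) * (a - q / t * b) = a^2 - s * a * b + q * b^2" for a b
    using nz(4) by (simp add: s_def field_simps power2_eq_square)
  have M: "M a b = (a - t * b) * (a - q / t * b) * (b - q * a)" for a b
    unfolding s M_def by algebra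
  have R: "R a b = M a b / E a b" if "a \<noteq> q * b" "b \<noteq> q * a" for a b
    unfolding R_def pairR_def M E_def using that by simp
  have E: "E b a = E a b" for a b by (simp add: E_def)
  have C: "serreC a b c = C a b c / (a * b * c)" if "a \<noteq> 0" "b \<noteq> 0" "c \<noteq> 0" for a b c
    unfolding serreC_def C_def using that by (simp add: field_simps power2_eq_square)
  note p = serre_identity_poly[of M q "1 + q * s" "- s - q^2" C z w v, OF M_def[THEN fun_cong, THEN fun_cong] C_def[THEN fun_cong, THEN fun_cong, THEN fun_cong]]
  have C': "serreC a b c = C a b c / (z * w * v)" if "a \<noteq> 0" "b \<noteq> 0" "c \<noteq> 0" "a * b * c = z * w * v" for a b c
    using C[OF that(1-3)] that(4) by simp
  let ?D = "z * w * v * E z w * E w v * E z v"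
  have "serreC z w v * R z w * R w v * R z v - serreC w z v * R w z * R z v * R w v
    - serreC z v w * R z v * R v w * R z w - serreC v w z * R v w * R w z * R v z
    + serreC w v z * R w v * R v z * R w z + serreC v z w * R v z * R z w * R v w
    = (C z w v * M z w * M w v * M z v - C w z v * M w z * M z v * M w v
    - C z v w * M z v * M v w * M z w - C v w z * M v w * M w z * M v z
    + C w v z * M w v * M v z * M w z + C v z w * M v z * M z w * M v w) / ?D"
    using nz d by (simp add: C' R E[of w z] E[of v w] E[of v z] mult_ac add_divide_distrib diff_divide_distrib)
  then show ?thesis unfolding p by simp
qed

text \<open>\<open>V1\<close> and \<open>V2\<close> are the rational factors of the two orders of
  adding boxes in two rows with content ratio \<open>x\<close>: G(x) f(x) = V1(x) K(x) and G(1/x)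
  f(x/q) = V2(x) K(x), with one and the same K.\<close>

definition V1 :: "complex \<Rightarrow> complex \<Rightarrow> complex \<Rightarrow> complex"
  where "V1 q t x = (1 - t * x) * (1 - q / t * x) / (1 - q * x)"

definition V2 :: "complex \<Rightarrow> complex \<Rightarrow> complex \<Rightarrow> complex"
  where "V2 q t x = (1 - t / q * x) * (1 - x / t) / (1 - x / q)"

lemma V1_pairR: "a \<noteq> 0 \<Longrightarrow> a \<noteq> q * b \<Longrightarrow> t \<noteq> 0 \<Longrightarrow> V1 q t (b / a) = pairR q t a b / a"
  by (simp add: V1_def pairR_def divide_simps)

lemma V2_pairR: "a \<noteq> 0 \<Longrightarrow> b \<noteq> q * a \<Longrightarrow> t \<noteq> 0 \<Longrightarrow> q \<noteq> 0 \<Longrightarrow> V2 q t (b / a) = - pairR q t b a / a"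
  by (simp add: V2_def pairR_def divide_simps) (simp add: algebra_simps)

lemma pairR_cubicP:
  assumes "t \<noteq> 0" "q \<noteq> 0" "z \<noteq> q * w" "w \<noteq> q * z"
  shows "pairR q t z w * cubicP q t z w = pairR q t w z * cubicP q t w z"
  using assms by (simp add: pairR_def cubicP_def divide_simps) (simp add: algebra_simps)

text \<open>Two boxes in one row, with contents a and q a, and a box with content x a in another
  row. Three orders occur, since a has to come before q a. Here the row with two boxes enters the
  amplitude of the other row.\<close>

lemma serre_identity_double1:
  assumes nz: "q \<noteq> 0" "t \<noteq> 0" "a \<noteq> 0" "x \<noteq> 0"
    and d: "x \<noteq> 1" "q * x \<noteq> 1" "x \<noteq> q" "x \<noteq> q^2"
  shows "serreC (q * a) a (x * a) * V1 q t x / (1 - x) + serreC (q * a) (x * a) a * V2 q t x / (1 - x)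
    + serreC (x * a) (q * a) a * V2 q t (x / q) / (1 - x / q) = 0"
proof -
  define s where "s = t + q / t"
  have s: "t * s = t^2 + q" using nz by (simp add: s_def field_simps power2_eq_square)
  have C: "serreC (q * a) a (x * a) = 1 / x + 1 / q - q - x"
     "serreC (q * a) (x * a) a = x + x / q - q / x - 1 / x"
     "serreC (x * a) (q * a) a = q + q / x - x / q - 1 / q"
    using nz by (simp_all add: serreC_def)
  have v1: "V1 q t x = (1 - s * x + q * x^2) / (1 - q * x)"
    using nz by (simp add: V1_def s_def field_simps power2_eq_square)
  have v2: "V2 q t y = (q - s * y + y^2) / (q - y)" if "y \<noteq> q" for y
  proof -
    have "(1 - t / q * y) * (1 - y / t) = (q - s * y + y^2) / q"
      using nz by (simp add: s_def field_simps power2_eq_square)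
    moreover have "1 - y / q = (q - y) / q" using nz by (simp add: field_simps)
    ultimately show ?thesis unfolding V2_def using nz by simp
  qed
  have "x / q \<noteq> q" using d nz by (simp add: field_simps power2_eq_square)
  note v = v1 v2[OF d(3)] v2[OF this]
  have v3: "V2 q t (x / q) = (q^3 - s * q * x + x^2) / (q * (q^2 - x))"
    unfolding v using nz by (simp add: divide_simps) (simp add: algebra_simps power2_eq_square power3_eq_cube)
  have n: "1 - x \<noteq> 0" "1 - q * x \<noteq> 0" "q - x \<noteq> 0" "q^2 - x \<noteq> 0" using d by auto
  have x: "1 - x / q = (q - x) / q" using nz by (simp add: field_simps)
  have c: "1 / x + 1 / q - q - x = (q + x - q^2 * x - q * x^2) / (q * x)"
    "x + x / q - q / x - 1 / x = (q * x^2 + x^2 - q^2 - q) / (q * x)"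
    "q + q / x - x / q - 1 / q = (q^2 * x + q^2 - x^2 - x) / (q * x)"
    using nz by (simp_all add: field_simps power2_eq_square)
  show ?thesis
    unfolding C c v3 v1 v2[OF d(3)] x using n nz
    by (simp add: divide_simps) algebra
qed

text \<open>The opposite dependence: the single box has content b, and its row enters the amplitude
  of the row with contents y b and q y b.\<close>

lemma serre_identity_double2:
  assumes nz: "q \<noteq> 0" "t \<noteq> 0" "b \<noteq> 0" "y \<noteq> 0"
    and d: "y \<noteq> 1" "q * y \<noteq> 1" "y \<noteq> q" "q^2 * y \<noteq> 1"
  shows "serreC (q * (y * b)) (y * b) b * V2 q t y * V2 q t (q * y)
    + serreC (q * (y * b)) b (y * b) * V1 q t y * V2 q t (q * y)
    + serreC b (q * (y * b)) (y * b) * V1 q t y * V1 q t (q * y) = 0"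
proof -
  define s where "s = t + q / t"
  have C: "serreC (q * (y * b)) (y * b) b = y + 1 / q - q - 1 / y"
     "serreC (q * (y * b)) b (y * b) = 1 / y + 1 / (q * y) - q * y - y"
     "serreC b (q * (y * b)) (y * b) = q + q * y - 1 / (q * y) - 1 / q"
    using nz by (simp_all add: serreC_def)
  have v1: "V1 q t x = (1 - s * x + q * x^2) / (1 - q * x)" for x
    using nz by (simp add: V1_def s_def field_simps power2_eq_square)
  have v2: "V2 q t y = (q - s * y + y^2) / (q - y)" if "y \<noteq> q" for y
  proof -
    have "(1 - t / q * y) * (1 - y / t) = (q - s * y + y^2) / q"
      using nz by (simp add: s_def field_simps power2_eq_square)
    moreover have "1 - y / q = (q - y) / q" using nz by (simp add: field_simps)
    ultimately show ?thesis unfolding V2_def using nz by simp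
  qed
  have "q * y \<noteq> q" using d nz by simp
  note v = v1 v2[OF d(3)] v2[OF this]
  have v3: "V2 q t (q * y) = (1 - s * y + q * y^2) / (1 - y)"
    unfolding v using nz d by (simp add: divide_simps) (simp add: algebra_simps power2_eq_square power3_eq_cube)
  have v4: "V1 q t (q * y) = (1 - s * q * y + q^3 * y^2) / (1 - q^2 * y)"
    unfolding v by (simp add: power2_eq_square power3_eq_cube mult_ac)
  have n: "1 - y \<noteq> 0" "1 - q * y \<noteq> 0" "q - y \<noteq> 0" "1 - q^2 * y \<noteq> 0" using d by auto
  have c: "y + 1 / q - q - 1 / y = (q * y^2 + y - q^2 * y - q) / (q * y)"
     "1 / y + 1 / (q * y) - q * y - y = (q + 1 - q^2 * y^2 - q * y^2) / (q * y)"
     "q + q * y - 1 / (q * y) - 1 / q = (q^2 * y + q^2 * y^2 - 1 - y) / (q * y)"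
    using nz by (simp_all add: field_simps power2_eq_square)
  show ?thesis
    unfolding C c v3 v4 v1[of y] v2[OF d(3)] using n nz
    by (simp add: divide_simps) algebra
qed

text \<open>These are the content ratios of different rows, where \<open>b\<close> is the nonzero
  difference of the row numbers. Genericity keeps them away from all powers of q, hence from the
  zeros of the denominators at p = 0.\<close>

definition lattice_pt :: "complex \<Rightarrow> complex \<Rightarrow> complex \<Rightarrow> bool"
  where "lattice_pt q t x \<longleftrightarrow> (\<exists>a b. b \<noteq> 0 \<and> x = q powi a * t powi b)"

section \<open>Consequences of genericity\<close>

locale generic_params =
  fixes q t :: complex
  assumes q0: "q \<noteq> 0" and t0: "t \<noteq> 0" and gen: "generic q t"
begin

abbreviation "lp \<equiv> lattice_pt q t"

lemma lp_neq_powi: "lp x \<Longrightarrow> x \<noteq> q powi n"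
proof
  assume "lp x" "x = q powi n"
  then obtain a b where ab: "b \<noteq> 0" "q powi n = q powi a * t powi b" by (auto simp: lattice_pt_def)
  then have "q powi (a - n) * t powi b = 1" using q0 t0 by (simp add: power_int_diff)
  then show False using gen ab(1) by (auto simp: generic_def)
qed

lemma lp_nonzero: "lp x \<Longrightarrow> x \<noteq> 0"
  using q0 t0 by (auto simp: lattice_pt_def)

lemma lp_inverse: "lp x \<Longrightarrow> lp (1 / x)"
  unfolding lattice_pt_def
proof (elim exE conjE)
  fix a b assume "b \<noteq> 0" "x = q powi a * t powi b"
  then show "\<exists>a b. b \<noteq> 0 \<and> 1 / x = q powi a * t powi b"
    by (intro exI[of _ "- a"] exI[of _ "- b"]) (simp add: power_int_minus field_simps)
qed

lemma lp_mult: "lp x \<Longrightarrow> lp (q * x)"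
  unfolding lattice_pt_def
proof (elim exE conjE)
  fix a b assume "b \<noteq> 0" "x = q powi a * t powi b"
  then show "\<exists>a b. b \<noteq> 0 \<and> q * x = q powi a * t powi b"
    using q0 by (intro exI[of _ "a + 1"] exI[of _ b]) (simp add: power_int_add mult_ac)
qed

lemma lp_div: "lp x \<Longrightarrow> lp (x / q)"
  using lp_inverse[OF lp_mult[OF lp_inverse]] lp_nonzero q0 by (fastforce simp: field_simps)

lemma lp_neq: "lp x \<Longrightarrow> x \<noteq> 1 \<and> q * x \<noteq> 1 \<and> x \<noteq> q \<and> x \<noteq> q^2 \<and> q^2 * x \<noteq> 1"
  using lp_neq_powi[of x 0] lp_neq_powi[of "q * x" 0] lp_neq_powi[of x 1] lp_neq_powi[of x 2]
    lp_neq_powi[of "q * (q * x)" 0] lp_mult by (auto simp: power2_eq_square mult.assoc)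

end

text \<open>\<open>J i\<close> is the set of rows that enter the amplitude of row \<open>i\<close>; for two distinct rows exactly
  one enters the amplitude of the other.  The raising currents have \<open>J i = {1..<i}\<close>, the transposed
  lowering currents \<open>J i = {i<..N}\<close>.\<close>

locale amplitudes = generic_params +
  fixes f G K :: "complex \<Rightarrow> complex fps" and J :: "nat \<Rightarrow> nat set" and I :: "nat set"
    and e :: "complex \<Rightarrow> complex fps"
  assumes fG1: "lp x \<Longrightarrow> G x * f x = fps_const (V1 q t x) * K x"
    and fG2: "lp x \<Longrightarrow> G (1 / x) * f (x / q) = fps_const (V2 q t x) * K x"
    and KG: "lp x \<Longrightarrow> fps_const (1 - x) * K x * G (x / q) = fps_const (1 - x / q) * K (x / q) * G (1 / x)"
    and J_fin: "finite (J i)"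
    and J_irr: "i \<notin> J i"
    and J_tour: "i \<in> I \<Longrightarrow> j \<in> I \<Longrightarrow> i \<noteq> j \<Longrightarrow> i \<in> J j \<longleftrightarrow> j \<notin> J i"
begin

text \<open>The factor \<open>e\<close> depends on the content of row \<open>i\<close> alone; it is
  1 for the raising currents and the factor of the unchanging row N+1 for the lowering ones.\<close>

definition amp :: "(nat \<Rightarrow> complex) \<Rightarrow> nat \<Rightarrow> complex fps"
  where "amp V i = e (V i) * (\<Prod>j\<in>J i. f (V i / V j))"

text \<open>The content of a row is that of its next free box, so adding a box multiplies it by
  q.\<close>

definition up :: "(nat \<Rightarrow> complex) \<Rightarrow> nat \<Rightarrow> nat \<Rightarrow> complex"
  where "up V i = V(i := q * V i)"

lemma up_same [simp]: "up V i i = q * V i"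
  and up_other [simp]: "i \<noteq> j \<Longrightarrow> up V j i = V i"
  by (simp_all add: up_def)

definition admissible :: "(nat \<Rightarrow> complex) \<Rightarrow> bool"
  where "admissible V \<longleftrightarrow> (\<forall>i\<in>I. V i \<noteq> 0 \<and> (\<forall>j\<in>I. i \<noteq> j \<longrightarrow> lp (V i / V j)))"

text \<open>\<open>rest V X i c\<close> collects the factors of the amplitude of row \<open>i\<close>, at content \<open>c\<close>, that are not
  affected by changes in the rows \<open>X\<close>.\<close>

definition rest :: "(nat \<Rightarrow> complex) \<Rightarrow> nat set \<Rightarrow> nat \<Rightarrow> complex \<Rightarrow> complex fps"
  where "rest V X i c = e c * (\<Prod>j\<in>J i - X. f (c / V j))"

definition link :: "nat \<Rightarrow> nat \<Rightarrow> complex \<Rightarrow> complex fps"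
  where "link i j x = (if j \<in> J i then f x else 1)"

lemma amp_split:
  assumes "finite X" "\<And>k. k \<notin> X \<Longrightarrow> W k = V k"
  shows "amp W i = rest V X i (W i) * (\<Prod>j\<in>X. link i j (W i / W j))"
proof -
  have "(\<Prod>j\<in>J i. f (W i / W j)) = (\<Prod>j\<in>J i - X. f (W i / W j)) * (\<Prod>j\<in>J i \<inter> X. f (W i / W j))"
    using prod.Int_Diff[OF J_fin, of "\<lambda>j. f (W i / W j)" i X] by (simp add: mult.commute)
  also have "(\<Prod>j\<in>J i - X. f (W i / W j)) = (\<Prod>j\<in>J i - X. f (W i / V j))"
    using assms(2) by (intro prod.cong) auto
  also have "(\<Prod>j\<in>J i \<inter> X. f (W i / W j)) = (\<Prod>j\<in>X. link i j (W i / W j))"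
    unfolding link_def by (subst Int_commute, subst prod.inter_restrict) (use assms(1) in auto)
  finally show ?thesis by (simp add: amp_def rest_def mult.assoc)
qed

lemma link_self: "link i i x = 1"
  by (simp add: link_def J_irr)

lemma amp_split2:
  assumes "i \<noteq> j" "\<And>k. k \<notin> {i, j} \<Longrightarrow> W k = V k"
  shows "amp W i = rest V {i, j} i (W i) * link i j (W i / W j)"
  using amp_split[of "{i, j}" W V i] assms by (simp add: link_self)

lemma amp_split3:
  assumes "i \<noteq> j" "i \<noteq> k" "j \<noteq> k" "\<And>l. l \<notin> {i, j, k} \<Longrightarrow> W l = V l"
  shows "amp W i = rest V {i, j, k} i (W i) * link i j (W i / W j) * link i k (W i / W k)"
  using amp_split[of "{i, j, k}" W V i] assms by (simp add: link_self mult.assoc)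

text \<open>The contribution of a pair of boxes with contents \<open>a\<close>, \<open>b\<close> in the rows \<open>i\<close>, \<open>j\<close> when the box in
  row \<open>i\<close> is added first.\<close>

definition pairf :: "nat \<Rightarrow> nat \<Rightarrow> complex \<Rightarrow> complex \<Rightarrow> complex fps"
  where "pairf i j a b = G (a / b) * link i j (a / b) * link j i (b / (q * a))"

text \<open>Suppose row \<open>i\<close> enters the amplitude of row \<open>j\<close>, and put x =
  b/a. If the box in row \<open>i\<close> comes first, row \<open>j\<close> sees it at x/q and the
  pair gives G(1/x) f(x/q), the case \<open>fG2\<close>; the other order gives G(x) f(x), the case
  \<open>fG1\<close>. Both contain K(x), which goes into \<open>k\<close>.\<close>

lemma pairf_cases:
  assumes "i \<in> I" "j \<in> I" "i \<noteq> j" "a \<noteq> 0" "b \<noteq> 0" "lp (a / b)"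
  obtains k where "pairf i j a b = k * fps_const (pairR q t b a)"
    and "pairf j i b a = - k * fps_const (pairR q t a b)"
proof -
  have *: "\<exists>k. pairf i j a b = k * fps_const (pairR q t b a) \<and> pairf j i b a = - k * fps_const (pairR q t a b)"
    if h: "i \<in> I" "j \<in> I" "i \<noteq> j" "a \<noteq> 0" "b \<noteq> 0" "lp (a / b)" and J: "i \<in> J j" for i j a b
  proof -
    have J': "j \<notin> J i" using h J J_tour by blast
    have x: "lp (b / a)" using lp_inverse[OF h(6)] by simp
    have "a \<noteq> q * b" "b \<noteq> q * a"
      using lp_neq[OF x] lp_neq[OF h(6)] h by (auto simp: field_simps)
    then have R: "V1 q t (b / a) = pairR q t a b / a" "V2 q t (b / a) = - pairR q t b a / a"
      using V1_pairR[of a q b t] V2_pairR[of a b q t] h t0 q0 by auto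
    have 1: "pairf i j a b = fps_const (V2 q t (b / a)) * K (b / a)"
      using fG2[OF x] J J' by (simp add: pairf_def link_def mult.commute[of q])
    have 2: "pairf j i b a = fps_const (V1 q t (b / a)) * K (b / a)"
      using fG1[OF x] J J' by (simp add: pairf_def link_def)
    show ?thesis
      unfolding 1 2 R
      by (rule exI[of _ "- fps_const (1 / a) * K (b / a)"])
         (simp add: mult_ac fps_const_mult[symmetric] divide_inverse del: fps_const_mult flip: fps_const_neg)
  qed
  show ?thesis
  proof (cases "i \<in> J j")
    case True
    then show ?thesis using *[OF assms] that by blast
  next
    case False
    then have "j \<in> J i" using J_tour assms by blast
    moreover have "lp (b / a)" using lp_inverse[OF assms(6)] by simp
    ultimately obtain k where "pairf j i b a = k * fps_const (pairR q t a b)"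
      "pairf i j a b = - k * fps_const (pairR q t b a)" using *[of j i b a] assms by blast
    then show ?thesis using that[of "- k"] by simp
  qed
qed

lemma admissible_pair:
  assumes "admissible V" "i \<in> I" "j \<in> I" "i \<noteq> j"
  shows "V i \<noteq> 0" "V j \<noteq> 0" "lp (V i / V j)"
  using assms by (auto simp: admissible_def)

lemma lp_ratio_neq:
  assumes "lp (a / b)" "a \<noteq> 0" "b \<noteq> 0" shows "a \<noteq> q * b" "b \<noteq> q * a"
  using lp_neq[OF assms(1)] assms by (auto simp: field_simps)

section \<open>The quadratic relation\<close>

text \<open>The weight of the path that adds a box in row \<open>j\<close> and then one in row
  \<open>i\<close>, including the structure function.\<close>

definition quadT :: "(nat \<Rightarrow> complex) \<Rightarrow> nat \<Rightarrow> nat \<Rightarrow> complex fps"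
  where "quadT V i j = (let z = up V j i; w = V j in
    amp V j * amp (up V j) i * G (w / z) * fps_const (cubicP q t z w))"

lemma quadT_antisym:
  assumes "admissible V" "i \<in> I" "j \<in> I"
  shows "quadT V i j = - quadT V j i"
proof (cases "i = j")
  case True
  \<comment> \<open>In one row the second box has q times the content of the first, a zero of the
    structure polynomial.\<close>
  have "cubicP q t (q * V j) (V j) = 0" by (simp add: cubicP_def)
  then show ?thesis unfolding True by (simp add: quadT_def Let_def up_def)
next
  case False
  note p = admissible_pair[OF assms False]
  obtain k where k: "pairf i j (V i) (V j) = k * fps_const (pairR q t (V j) (V i))"
     "pairf j i (V j) (V i) = - k * fps_const (pairR q t (V i) (V j))"
    using pairf_cases[OF assms(2,3) False p] by blast
  have q: "quadT V i j = rest V {i, j} i (V i) * rest V {i, j} j (V j) * pairf j i (V j) (V i)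
        * fps_const (cubicP q t (V i) (V j))"
    if "i \<noteq> j" for i j
  proof -
    have ji: "j \<noteq> i" using that by simp
    have "amp (up V j) i = rest V {i, j} i (V i) * link i j (V i / (q * V j))"
      by (subst amp_split2[of i j _ V]) (use that in auto)
    moreover have "amp V j = rest V {i, j} j (V j) * link j i (V j / V i)"
      by (subst amp_split2[OF ji, of _ V]) (auto simp: insert_commute)
    ultimately show ?thesis
      by (simp only: quadT_def Let_def up_other[OF that] pairf_def mult_ac)
  qed
  show ?thesis
    unfolding q[OF False] q[OF False[symmetric]] k
    using pairR_cubicP[OF t0 q0 lp_ratio_neq[OF p(3,1,2)]]
    by (simp add: insert_commute mult_ac)
qed

section \<open>The cubic relation\<close>

text \<open>\<open>cubT V i j k\<close> is the weight of adding boxes in the rows \<open>k\<close>, \<open>j\<close>, \<open>i\<close>, in this order;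
  the third content belongs to the first box.\<close>

definition cubT :: "(nat \<Rightarrow> complex) \<Rightarrow> nat \<Rightarrow> nat \<Rightarrow> nat \<Rightarrow> (complex \<Rightarrow> complex \<Rightarrow> complex \<Rightarrow> complex) \<Rightarrow> complex fps"
  where "cubT V i j k F = (let v = V k; w = up V k j; z = up (up V k) j i in
    amp V k * amp (up V k) j * amp (up (up V k) j) i * G (w / z) * G (v / w) * G (v / z)
      * fps_const (serreC z w v * F z w v))"

text \<open>The order of the boxes enters through one \<open>pairf\<close> for each pair of rows and
  through the rational factor; the three \<open>rest\<close> factors are the same for all six
  orders.\<close>

lemma cubT_distinct:
  assumes "i \<noteq> j" "i \<noteq> k" "j \<noteq> k"
  shows "cubT V i j k F = rest V {i, j, k} i (V i) * rest V {i, j, k} j (V j) * rest V {i, j, k} k (V k)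
     * pairf j i (V j) (V i) * pairf k j (V k) (V j) * pairf k i (V k) (V i)
     * fps_const (serreC (V i) (V j) (V k) * F (V i) (V j) (V k))"
proof -
  have d: "i \<noteq> j" "j \<noteq> i" "i \<noteq> k" "k \<noteq> i" "j \<noteq> k" "k \<noteq> j" using assms by auto
  have X: "{k, i, j} = {i, j, k}" "{j, i, k} = {i, j, k}" by auto
  have "amp V k = rest V {i, j, k} k (V k) * link k i (V k / V i) * link k j (V k / V j)"
    by (subst amp_split3[OF d(4,6,1), of _ V, unfolded X]) auto
  moreover have "amp (up V k) j = rest V {i, j, k} j (V j) * link j i (V j / V i) * link j k (V j / (q * V k))"
    by (subst amp_split3[OF d(2,5,3), of _ V, unfolded X]) (use d in auto)
  moreover have "amp (up (up V k) j) i = rest V {i, j, k} i (V i) * link i j (V i / (q * V j)) * link i k (V i / (q * V k))"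
    by (subst amp_split3[OF d(1,3,5), of _ V]) (use d in auto)
  ultimately show ?thesis
    by (simp only: cubT_def Let_def up_other[OF d(1)] up_other[OF d(3)] up_other[OF d(5)] pairf_def mult_ac)
qed

text \<open>The three positions of the box in row \<open>k\<close> relative to the two in row
  \<open>i\<close>. The latter contribute the common factor G(1/q).\<close>

lemma cubT_double:
  assumes "i \<noteq> k" "a \<noteq> 0" "b \<noteq> 0" and a: "a = V i" and b: "b = V k"
    and r: "r = rest V {i, k} i (V i) * rest V {i, k} i (q * V i) * rest V {i, k} k (V k)"
  shows "cubT V i i k F = r * link k i (b / a) * link i k (a / (q * b)) * link i k (a / b)
      * G (1 / q) * G (b / a) * G (b / (q * a)) * fps_const (serreC (q * a) a b * F (q * a) a b)"
    and "cubT V i k i F = r * link i k (a / b) * link k i (b / (q * a)) * link i k (a / b)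
      * G (b / (q * a)) * G (a / b) * G (1 / q) * fps_const (serreC (q * a) b a * F (q * a) b a)"
    and "cubT V k i i F = r * link i k (a / b) * link i k (q * a / b) * link k i (b / (q * (q * a)))
      * G (q * a / b) * G (1 / q) * G (a / b) * fps_const (serreC b (q * a) a * F b (q * a) a)"
proof -
  have d: "i \<noteq> k" "k \<noteq> i" using assms by auto
  have X: "{k, i} = {i, k}" by auto
  have ab: "V i = a" "V k = b" using a b by auto
  have K: "amp W k = rest V {i, k} k b * link k i (b / W i)"
    if "W k = b" "\<And>l. l \<notin> {i, k} \<Longrightarrow> W l = V l" for W
    by (subst amp_split2[OF d(2), of _ V, unfolded X]) (use that in auto)
  have L: "amp W i = rest V {i, k} i c * link i k (c / W k)"
    if "W i = c" "\<And>l. l \<notin> {i, k} \<Longrightarrow> W l = V l" for W c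
    by (subst amp_split2[OF d(1), of _ V]) (use that in auto)
  have u: "up (up V k) i i = q * a" "up (up V i) i i = q * (q * a)" "up (up V i) k i = q * a"
    "up V i i = q * a" "up V k k = q * b" "up V i k = b" "up V k i = a" "up (up V k) i k = q * b"
    "up (up V i) k k = q * b" "up (up V i) i k = b" using d ab by auto
  have g: "a / (q * a) = 1 / q" "q * a / (q * b) = a / b" using assms(2) q0 by auto
  have 1: "amp V k = rest V {i, k} k b * link k i (b / a)"
    by (subst K) (auto simp: ab)
  have 2: "amp (up V k) i = rest V {i, k} i a * link i k (a / (q * b))"
    by (subst L[of _ a]) (auto simp: u ab)
  have 3: "amp (up (up V k) i) i = rest V {i, k} i (q * a) * link i k (a / b)"
    by (subst L[of _ "q * a"]) (auto simp: u g ab q0)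
  have 4: "amp V i = rest V {i, k} i a * link i k (a / b)"
    by (subst L[of _ a]) (auto simp: ab)
  have 5: "amp (up V i) k = rest V {i, k} k b * link k i (b / (q * a))"
    by (subst K) (auto simp: u ab)
  have 6: "amp (up (up V i) k) i = rest V {i, k} i (q * a) * link i k (a / b)"
    by (subst L[of _ "q * a"]) (auto simp: u g ab q0)
  have 7: "amp (up V i) i = rest V {i, k} i (q * a) * link i k (q * a / b)"
    by (subst L[of _ "q * a"]) (auto simp: u ab)
  have 8: "amp (up (up V i) i) k = rest V {i, k} k b * link k i (b / (q * (q * a)))"
    by (subst K) (auto simp: u ab)
  show "cubT V i i k F = r * link k i (b / a) * link i k (a / (q * b)) * link i k (a / b)
      * G (1 / q) * G (b / a) * G (b / (q * a)) * fps_const (serreC (q * a) a b * F (q * a) a b)"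
    unfolding cubT_def Let_def 1 2 3 u r ab g by (simp only: mult_ac)
  show "cubT V i k i F = r * link i k (a / b) * link k i (b / (q * a)) * link i k (a / b)
      * G (b / (q * a)) * G (a / b) * G (1 / q) * fps_const (serreC (q * a) b a * F (q * a) b a)"
    unfolding cubT_def Let_def 4 5 6 u r ab g by (simp only: mult_ac)
  show "cubT V k i i F = r * link i k (a / b) * link i k (q * a / b) * link k i (b / (q * (q * a)))
      * G (q * a / b) * G (1 / q) * G (a / b) * fps_const (serreC b (q * a) a * F b (q * a) a)"
    unfolding cubT_def Let_def 4 7 8 u r ab g by (simp only: mult_ac)
qed

lemma const_combine:
  fixes Q :: "complex fps"
  assumes "A = Q * fps_const a" "B = Q * fps_const b" "C = Q * fps_const c" "a + b + c = 0"
  shows "A + B + C = 0"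
proof -
  have "A + B + C = Q * fps_const (a + b + c)"
    unfolding assms(1-3) by (simp add: ring_distribs flip: fps_const_add)
  then show ?thesis by (simp add: assms(4))
qed

lemma const_combine6:
  fixes Q :: "complex fps"
  assumes "- a1 + a2 + a3 + (- a4) + (- a5) + a6 = 0"
  shows "- (Q * fps_const a1) + Q * fps_const a2 + Q * fps_const a3 + - (Q * fps_const a4)
    + - (Q * fps_const a5) + Q * fps_const a6 = 0"
proof -
  have "- (Q * fps_const a1) + Q * fps_const a2 + Q * fps_const a3 + - (Q * fps_const a4)
    + - (Q * fps_const a5) + Q * fps_const a6
    = Q * fps_const (- a1 + a2 + a3 + (- a4) + (- a5) + a6)"
    by (simp only: fps_const_add[symmetric] fps_const_neg[symmetric] ring_distribs mult_minus_right)
  also have "\<dots> = 0" by (simp only: assms) simp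
  finally show ?thesis .
qed

text \<open>\<open>F1\<close>, \<open>F2\<close>, \<open>F3\<close> stand for one monomial with
  permuted exponents, and \<open>c\<close> is its common value. When row \<open>i\<close> enters the
  amplitude of row \<open>k\<close>, the three orders carry different products of K and G, and
  \<open>KG\<close> reduces them to one factor; in the opposite case all three carry K(y) K(q
  y).\<close>

lemma cubT_sum_double:
  assumes V: "admissible V" "i \<in> I" "k \<in> I" "i \<noteq> k"
    and F: "F1 (q * V i) (V i) (V k) = c" "F2 (q * V i) (V k) (V i) = c" "F3 (V k) (q * V i) (V i) = c"
  shows "cubT V i i k F1 + cubT V i k i F2 + cubT V k i i F3 = 0"
proof -
  define a where "a = V i"
  define b where "b = V k"
  note p = admissible_pair[OF V, folded a_def b_def]
  define r where "r = rest V {i, k} i (V i) * rest V {i, k} i (q * V i) * rest V {i, k} k (V k)"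
  note c = cubT_double[OF V(4) p(1,2) a_def b_def r_def]
  show ?thesis
  proof (cases "i \<in> J k")
    case True
    then have J: "k \<notin> J i" using J_tour V by blast
    define x where "x = b / a"
    have lx: "lp x" using lp_inverse[OF p(3)] by (simp add: x_def)
    note n = lp_neq[OF lx] lp_nonzero[OF lx]
    \<comment> \<open>The common value of the two sides of \<open>KG\<close>; all three orders
      become complex multiples of it times the same factor.\<close>
    define M where "M = fps_const (1 - x) * K x * G (x / q)"
    have M1: "K x * G (x / q) = fps_const (1 / (1 - x)) * M"
      using n by (simp add: M_def mult.assoc[symmetric])
    have M2: "K (x / q) * G (1 / x) = fps_const (1 / (1 - x / q)) * M"
      using n q0 by (simp add: M_def KG[OF lx] mult.assoc[symmetric])
    have l: "link k i = f" "link i k = (\<lambda>_. 1)" using True J by (auto simp: link_def)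
    have x: "b / a = x" "b / (q * a) = x / q" "a / b = 1 / x" "b / (q * (q * a)) = x / q / q" "q * a / b = 1 / (x / q)"
      using p q0 by (simp_all add: x_def)
    have t1: "cubT V i i k F1 = r * G (1 / q) * M * fps_const (serreC (q * a) a b * V1 q t x / (1 - x) * c)"
    proof -
      have "cubT V i i k F1 = r * G (1 / q) * (G x * f x) * G (x / q) * fps_const (serreC (q * a) a b * c)"
        unfolding c(1) l x F[folded a_def b_def] by (simp only: mult_ac mult_1)
      also have "\<dots> = r * G (1 / q) * fps_const (V1 q t x) * (K x * G (x / q)) * fps_const (serreC (q * a) a b * c)"
        unfolding fG1[OF lx] by (simp only: mult_ac)
      also have "\<dots> = r * G (1 / q) * M * (fps_const (V1 q t x) * fps_const (1 / (1 - x)) * fps_const (serreC (q * a) a b * c))"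
        unfolding M1 by (simp only: mult_ac)
      finally show ?thesis by (simp add: mult_ac)
    qed
    have t2: "cubT V i k i F2 = r * G (1 / q) * M * fps_const (serreC (q * a) b a * V2 q t x / (1 - x) * c)"
    proof -
      have "cubT V i k i F2 = r * G (1 / q) * (G (1 / x) * f (x / q)) * G (x / q) * fps_const (serreC (q * a) b a * c)"
        unfolding c(2) l x F[folded a_def b_def] by (simp only: mult_ac mult_1)
      also have "\<dots> = r * G (1 / q) * fps_const (V2 q t x) * (K x * G (x / q)) * fps_const (serreC (q * a) b a * c)"
        unfolding fG2[OF lx] by (simp only: mult_ac)
      also have "\<dots> = r * G (1 / q) * M * (fps_const (V2 q t x) * fps_const (1 / (1 - x)) * fps_const (serreC (q * a) b a * c))"
        unfolding M1 by (simp only: mult_ac)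
      finally show ?thesis by (simp add: mult_ac)
    qed
    have t3: "cubT V k i i F3 = r * G (1 / q) * M * fps_const (serreC b (q * a) a * V2 q t (x / q) / (1 - x / q) * c)"
    proof -
      have "cubT V k i i F3 = r * G (1 / q) * (G (1 / (x / q)) * f (x / q / q)) * G (1 / x) * fps_const (serreC b (q * a) a * c)"
        unfolding c(3) l x F[folded a_def b_def] by (simp only: mult_ac mult_1)
      also have "\<dots> = r * G (1 / q) * fps_const (V2 q t (x / q)) * (K (x / q) * G (1 / x)) * fps_const (serreC b (q * a) a * c)"
        unfolding fG2[OF lp_div[OF lx]] by (simp only: mult_ac)
      also have "\<dots> = r * G (1 / q) * M * (fps_const (V2 q t (x / q)) * fps_const (1 / (1 - x / q)) * fps_const (serreC b (q * a) a * c))"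
        unfolding M2 by (simp only: mult_ac)
      finally show ?thesis by (simp add: mult_ac)
    qed
    have "b = x * a" using p by (simp add: x_def)
    then have "(serreC (q * a) a b * V1 q t x / (1 - x) + serreC (q * a) b a * V2 q t x / (1 - x)
       + serreC b (q * a) a * V2 q t (x / q) / (1 - x / q)) * c = 0"
      using serre_identity_double1[OF q0 t0 p(1), of x] n by simp
    then show ?thesis
      by (intro const_combine[OF t1 t2 t3]) (simp only: ring_distribs)
  next
    case False
    then have J: "k \<in> J i" using J_tour V by blast
    define y where "y = a / b"
    have ly: "lp y" "lp (q * y)" using p(3) lp_mult[OF p(3)] by (simp_all add: y_def)
    note n = lp_neq[OF ly(1)] lp_nonzero[OF ly(1)]
    have l: "link i k = f" "link k i = (\<lambda>_. 1)" using False J by (auto simp: link_def)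
    have y: "b / a = 1 / y" "b / (q * a) = 1 / (q * y)" "a / b = y" "a / (q * b) = y / q" "q * a / b = q * y"
      using p q0 by (simp_all add: y_def)
    have yq: "f y = f (q * y / q)" using q0 by simp
    let ?Q = "r * G (1 / q) * K y * K (q * y)"
    have t1: "cubT V i i k F1 = ?Q * fps_const (serreC (q * a) a b * V2 q t y * V2 q t (q * y) * c)"
    proof -
      have "cubT V i i k F1 = r * G (1 / q) * (G (1 / y) * f (y / q)) * (G (1 / (q * y)) * f (q * y / q)) * fps_const (serreC (q * a) a b * c)"
        unfolding c(1) l y F[folded a_def b_def] yq[symmetric] by (simp only: mult_ac mult_1)
      also have "\<dots> = ?Q * (fps_const (V2 q t y) * fps_const (V2 q t (q * y)) * fps_const (serreC (q * a) a b * c))"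
        unfolding fG2[OF ly(1)] fG2[OF ly(2)] by (simp only: mult_ac)
      finally show ?thesis by (simp add: mult_ac)
    qed
    have t2: "cubT V i k i F2 = ?Q * fps_const (serreC (q * a) b a * V1 q t y * V2 q t (q * y) * c)"
    proof -
      have "cubT V i k i F2 = r * G (1 / q) * (G y * f y) * (G (1 / (q * y)) * f (q * y / q)) * fps_const (serreC (q * a) b a * c)"
        unfolding c(2) l y F[folded a_def b_def] yq[symmetric] by (simp only: mult_ac mult_1)
      also have "\<dots> = ?Q * (fps_const (V1 q t y) * fps_const (V2 q t (q * y)) * fps_const (serreC (q * a) b a * c))"
        unfolding fG1[OF ly(1)] fG2[OF ly(2)] by (simp only: mult_ac)
      finally show ?thesis by (simp add: mult_ac)
    qed
    have t3: "cubT V k i i F3 = ?Q * fps_const (serreC b (q * a) a * V1 q t y * V1 q t (q * y) * c)"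
    proof -
      have "cubT V k i i F3 = r * G (1 / q) * (G y * f y) * (G (q * y) * f (q * y)) * fps_const (serreC b (q * a) a * c)"
        unfolding c(3) l y F[folded a_def b_def] by (simp only: mult_ac mult_1)
      also have "\<dots> = ?Q * (fps_const (V1 q t y) * fps_const (V1 q t (q * y)) * fps_const (serreC b (q * a) a * c))"
        unfolding fG1[OF ly(1)] fG1[OF ly(2)] by (simp only: mult_ac)
      finally show ?thesis by (simp add: mult_ac)
    qed
    have "a = y * b" using p by (simp add: y_def)
    then have "(serreC (q * a) a b * V2 q t y * V2 q t (q * y)
      + serreC (q * a) b a * V1 q t y * V2 q t (q * y)
      + serreC b (q * a) a * V1 q t y * V1 q t (q * y)) * c = 0"
      using serre_identity_double2[OF q0 t0 p(2), of y] n by simp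
    then show ?thesis
      by (intro const_combine[OF t1 t2 t3]) (simp only: ring_distribs)
  qed
qed

text \<open>The permuted arguments attach \<open>H\<close> to the rows: in all six terms its value
  is \<open>H (V i) (V j) (V k)\<close>. What is left is \<open>serre_identity\<close>, whose signs
  come from the sign change of \<open>pairf\<close>.\<close>

lemma cubT_sum_distinct:
  assumes V: "admissible V" "i \<in> I" "j \<in> I" "k \<in> I" "i \<noteq> j" "i \<noteq> k" "j \<noteq> k"
  shows "cubT V i j k H + cubT V i k j (\<lambda>z w v. H z v w) + cubT V j i k (\<lambda>z w v. H w z v)
    + cubT V j k i (\<lambda>z w v. H v z w) + cubT V k i j (\<lambda>z w v. H w v z)
    + cubT V k j i (\<lambda>z w v. H v w z) = 0"
proof -
  define x where "x = V i"
  define y where "y = V j"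
  define u where "u = V k"
  let ?R = "pairR q t"
  note p1 = admissible_pair[OF V(1,2,3,5), folded x_def y_def]
  note p2 = admissible_pair[OF V(1,2,4,6), folded x_def u_def]
  note p3 = admissible_pair[OF V(1,3,4,7), folded y_def u_def]
  obtain k1 where k1: "pairf i j x y = k1 * fps_const (?R y x)" "pairf j i y x = - k1 * fps_const (?R x y)"
    using pairf_cases[OF V(2,3,5) p1] by blast
  obtain k2 where k2: "pairf i k x u = k2 * fps_const (?R u x)" "pairf k i u x = - k2 * fps_const (?R x u)"
    using pairf_cases[OF V(2,4,6) p2] by blast
  obtain k3 where k3: "pairf j k y u = k3 * fps_const (?R u y)" "pairf k j u y = - k3 * fps_const (?R y u)"
    using pairf_cases[OF V(3,4,7) p3] by blast
  define X where "X = {i, j, k}"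
  define Q where "Q = rest V X i x * rest V X j y * rest V X k u * k1 * k2 * k3"
  have X: "{i, j, k} = X" "{i, k, j} = X" "{j, i, k} = X" "{j, k, i} = X" "{k, i, j} = X" "{k, j, i} = X"
    by (auto simp: X_def)
  let ?h = "H x y u"
  have c: "A * fps_const a * (B * fps_const b) * (C * fps_const c') * fps_const d
     = A * B * C * fps_const (a * b * c' * d)" for A B C and a b c' d :: complex
    by (simp flip: fps_const_mult add: mult_ac)
  have d: "i \<noteq> j" "j \<noteq> i" "i \<noteq> k" "k \<noteq> i" "j \<noteq> k" "k \<noteq> j" using V by auto
  note simps = cubT_distinct X x_def[symmetric] y_def[symmetric] u_def[symmetric] k1 k2 k3
  have t1: "cubT V i j k H = - (Q * fps_const (serreC x y u * ?R x y * ?R y u * ?R x u * ?h))"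
    unfolding cubT_distinct[OF d(1,3,5)] X x_def[symmetric] y_def[symmetric] u_def[symmetric] k1 k2 k3 Q_def
    by (simp flip: fps_const_mult add: mult_ac)
  have t2: "cubT V i k j (\<lambda>z w v. H z v w) = Q * fps_const (serreC x u y * ?R x u * ?R u y * ?R x y * ?h)"
    unfolding cubT_distinct[OF d(3,1,6)] X x_def[symmetric] y_def[symmetric] u_def[symmetric] k1 k2 k3 Q_def
    by (simp flip: fps_const_mult add: mult_ac)
  have t3: "cubT V j i k (\<lambda>z w v. H w z v) = Q * fps_const (serreC y x u * ?R y x * ?R x u * ?R y u * ?h)"
    unfolding cubT_distinct[OF d(2,5,3)] X x_def[symmetric] y_def[symmetric] u_def[symmetric] k1 k2 k3 Q_def
    by (simp flip: fps_const_mult add: mult_ac)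
  have t4: "cubT V j k i (\<lambda>z w v. H v z w) = - (Q * fps_const (serreC y u x * ?R y u * ?R u x * ?R y x * ?h))"
    unfolding cubT_distinct[OF d(5,2,4)] X x_def[symmetric] y_def[symmetric] u_def[symmetric] k1 k2 k3 Q_def
    by (simp flip: fps_const_mult add: mult_ac)
  have t5: "cubT V k i j (\<lambda>z w v. H w v z) = - (Q * fps_const (serreC u x y * ?R u x * ?R x y * ?R u y * ?h))"
    unfolding cubT_distinct[OF d(4,6,1)] X x_def[symmetric] y_def[symmetric] u_def[symmetric] k1 k2 k3 Q_def
    by (simp flip: fps_const_mult add: mult_ac)
  have t6: "cubT V k j i (\<lambda>z w v. H v w z) = Q * fps_const (serreC u y x * ?R u y * ?R y x * ?R u x * ?h)"
    unfolding cubT_distinct[OF d(6,4,2)] X x_def[symmetric] y_def[symmetric] u_def[symmetric] k1 k2 k3 Q_def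
    by (simp flip: fps_const_mult add: mult_ac)
  have "(serreC x y u * ?R x y * ?R y u * ?R x u - serreC y x u * ?R y x * ?R x u * ?R y u
    - serreC x u y * ?R x u * ?R u y * ?R x y - serreC u y x * ?R u y * ?R y x * ?R u x
    + serreC y u x * ?R y u * ?R u x * ?R y x + serreC u x y * ?R u x * ?R x y * ?R u y) = 0"
    using serre_identity[of x y u t q] p1 p2 p3 lp_ratio_neq[OF p1(3,1,2)] lp_ratio_neq[OF p2(3,1,2)]
      lp_ratio_neq[OF p3(3,1,2)] t0 by simp
  then show ?thesis
    unfolding t1 t2 t3 t4 t5 t6 by (intro const_combine6) algebra
qed

lemma cubT_sum:
  assumes V: "admissible V" "i \<in> I" "j \<in> I" "k \<in> I"
  shows "cubT V i j k H + cubT V i k j (\<lambda>z w v. H z v w) + cubT V j i k (\<lambda>z w v. H w z v)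
    + cubT V j k i (\<lambda>z w v. H v z w) + cubT V k i j (\<lambda>z w v. H w v z)
    + cubT V k j i (\<lambda>z w v. H v w z) = 0"
proof -
  \<comment> \<open>The six terms form two instances of the three-order identity: the arguments of
    \<open>H\<close> that belong to row \<open>i\<close> are q a, a in one and a, q a in the
    other.\<close>
  have dbl: "cubT V i i k H + cubT V i k i (\<lambda>z w v. H z v w) + cubT V i i k (\<lambda>z w v. H w z v)
    + cubT V i k i (\<lambda>z w v. H v z w) + cubT V k i i (\<lambda>z w v. H w v z)
    + cubT V k i i (\<lambda>z w v. H v w z) = 0" if "i \<in> I" "k \<in> I" "i \<noteq> k" for i k H
    using cubT_sum_double[OF V(1) that, of H "H (q * V i) (V i) (V k)" "\<lambda>z w v. H z v w" "\<lambda>z w v. H w v z"]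
      cubT_sum_double[OF V(1) that, of "\<lambda>z w v. H w z v" "H (V i) (q * V i) (V k)" "\<lambda>z w v. H v z w" "\<lambda>z w v. H v w z"]
    by (simp add: add_eq_0_iff algebra_simps)
  have tr: "cubT V i i i F = 0" for F
  proof -
    \<comment> \<open>Three boxes in one row come with contents c, q c, q^2 c, where w/v + w/z - z/w
      - v/w equals q + 1/q - q - 1/q.\<close>
    have "serreC (q * (q * c)) (q * c) c = 0" if "c \<noteq> 0" for c
      using that q0 by (simp add: serreC_def field_simps)
    moreover have "V i \<noteq> 0" using V by (auto simp: admissible_def)
    ultimately show ?thesis by (simp add: cubT_def up_def)
  qed
  consider "i = j" "j = k" | "i = j" "j \<noteq> k" | "i = k" "i \<noteq> j" | "j = k" "i \<noteq> j" | "i \<noteq> j" "i \<noteq> k" "j \<noteq> k"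
    by blast
  then show ?thesis
  proof cases
    case 1
    then have "j = i" "k = i" by simp_all
    then show ?thesis by (simp add: tr)
  next
    case 2 then show ?thesis using dbl[of i k H] V by simp
  next
    case 3 then show ?thesis using dbl[of i j "\<lambda>z w v. H z v w"] V by (simp add: algebra_simps)
  next
    case 4 then show ?thesis using dbl[of j i "\<lambda>z w v. H v z w"] V by (simp add: algebra_simps)
  next
    case 5 then show ?thesis using cubT_sum_distinct V by blast
  qed
qed

end

section \<open>Theta functions and structure functions\<close>

interpretation cid: complex_alg "\<lambda>x :: complex. x"
  by (rule complex_alg_id)

text \<open>This is (p y; p)_infinity, with constant term 1. Once its factors at p^0 are split off,
  \<open>theta\<close> leaves such units, and zeros and poles sit in ordinary complex
  factors.\<close>

definition qp :: "complex \<Rightarrow> complex fps"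
  where "qp y = qpoch (fps_const y * fps_X)"

lemma qpoch_nth_0: "qpoch a $ 0 = 1 - a $ 0"
  by (simp add: qpoch_def)

lemma qp_nth_0 [simp]: "qp y $ 0 = 1"
  by (simp add: qp_def qpoch_nth_0)

lemma (in complex_alg) qpoch_unfold: "qpoch a = (1 - a) * qpoch (a * fps_X)"
  for a :: "'k fps"
  unfolding qpoch_eq_csum by (rule eul_functional)

lemma theta_qp: "theta x = fps_const (1 - x) * (qp x * qp (1 / x))" for x :: complex
  unfolding theta_def
  by (subst cid.qpoch_unfold) (simp add: qp_def inverse_eq_divide mult.assoc flip: fps_const_sub)

lemma theta_nth_0: "theta x $ 0 = 1 - x" for x :: complex
  by (simp add: theta_qp)

lemma theta_one [simp]: "theta (1 :: complex) = 0"
  by (simp add: theta_qp)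

lemma theta_inverse: "x \<noteq> 0 \<Longrightarrow> theta (1 / x) = fps_const (- 1 / x) * theta x" for x :: complex
proof -
  assume "x \<noteq> 0"
  then have "1 - 1 / x = (- 1 / x) * (1 - x)" by (simp add: field_simps)
  then show ?thesis unfolding theta_qp by (simp add: mult_ac flip: fps_const_mult)
qed

abbreviation (input) to_fls where "to_fls \<equiv> fps_to_fls :: complex fps \<Rightarrow> complex fls"

text \<open>Laurent series in p form a field. Identities between products of units and inverses are
  proved there, where factors cancel freely, and pulled back by injectivity.\<close>

lemma to_fls_inverse: "f $ 0 \<noteq> 0 \<Longrightarrow> to_fls (inverse f) = inverse (to_fls f)"
proof -
  assume "f $ 0 \<noteq> 0"
  then have "f * inverse f = 1" by (rule inverse_mult_eq_1')
  then have "to_fls f * to_fls (inverse f) = 1" by (metis fls_times_fps_to_fls fps_one_to_fls)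
  then show ?thesis by (metis inverse_unique)
qed

lemma qp_nonzero [simp]: "qp y \<noteq> 0"
  by (metis fps_zero_nth qp_nth_0 zero_neq_one)

lemma fps_to_fls_injD: "to_fls f = to_fls g \<Longrightarrow> f = g" by simp

section \<open>The function f, the series g at a point, and the common factor K\<close>

definition fbody :: "complex \<Rightarrow> complex \<Rightarrow> complex \<Rightarrow> complex fps"
  where "fbody q t x = qp (t * x) * qp (1 / (t * x)) * qp (q / t * x) * qp (t / (q * x))
    * inverse (qp (q * x)) * inverse (qp (1 / (q * x))) * inverse (qp x) * inverse (qp (1 / x))"

text \<open>The rational factor at p^0 is separated so that zeros can be read off it: those at x =
  1/t and x = t/q encode the partition condition.\<close>

definition thf :: "complex \<Rightarrow> complex \<Rightarrow> complex \<Rightarrow> complex fps"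
  where "thf q t x = fps_const ((1 - t * x) * (1 - q / t * x) / ((1 - q * x) * (1 - x))) * fbody q t x"

definition GP :: "complex \<Rightarrow> complex \<Rightarrow> complex \<Rightarrow> complex fps"
  where "GP q t y = qp (q * y) * qp (y / t) * qp (t / q * y)
     * inverse (qp (q / t * y)) * inverse (qp (t * y)) * inverse (qp (y / q))"

text \<open>Invariant under x -> 1/x. It is what remains of G(x) f(x) after cancellation, apart from
  the rational factor.\<close>

definition Kbody :: "complex \<Rightarrow> complex \<Rightarrow> complex \<Rightarrow> complex fps"
  where "Kbody q t x = qp (1 / (t * x)) * qp (t / (q * x)) * qp (t / q * x) * qp (x / t)
    * inverse (qp (1 / (q * x))) * inverse (qp (x / q)) * inverse (qp x) * inverse (qp (1 / x))"

definition KP :: "complex \<Rightarrow> complex \<Rightarrow> complex \<Rightarrow> complex fps"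
  where "KP q t x = fps_const (1 / (1 - x)) * Kbody q t x"

text \<open>The lowering relations contain the inverse of g(w/z;p), and transposition reverses the
  order of the boxes; hence the inverse and the argument 1/y. \<open>KM\<close> divides
  \<open>KP\<close> by the product of \<open>GP\<close> at x and at 1/x, so the identities for
  \<open>GP\<close> carry over.\<close>

definition GM :: "complex \<Rightarrow> complex \<Rightarrow> complex \<Rightarrow> complex fps"
  where "GM q t y = inverse (GP q t (1 / y))"

definition KM :: "complex \<Rightarrow> complex \<Rightarrow> complex \<Rightarrow> complex fps"
  where "KM q t x = KP q t x * inverse (GP q t x) * inverse (GP q t (1 / x))"

lemma GP_nth_0 [simp]: "GP q t y $ 0 = 1"
  by (simp add: GP_def)

lemma GP_inverse: "GP q t y * inverse (GP q t y) = 1"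
  by (rule inverse_mult_eq_1') simp

lemma fps_inverse_unique: "a * b = 1 \<Longrightarrow> inverse b = (a :: complex fps)"
  by (metis fps_inverse_unique mult.commute)

lemmas to_fls_simps = fls_times_fps_to_fls to_fls_inverse

context generic_params
begin

lemma fG_body1: "x \<noteq> 0 \<Longrightarrow> GP q t x * fbody q t x = Kbody q t x"
  using q0 t0
  by (intro fps_to_fls_injD) (simp add: GP_def fbody_def Kbody_def to_fls_simps divide_simps mult_ac)

lemma fG_body2: "x \<noteq> 0 \<Longrightarrow> GP q t (1 / x) * fbody q t (x / q) = Kbody q t x"
  using q0 t0
  by (intro fps_to_fls_injD) (simp add: GP_def fbody_def Kbody_def to_fls_simps divide_simps mult_ac)

lemma KG_body: "x \<noteq> 0 \<Longrightarrow> Kbody q t x * GP q t (x / q) = Kbody q t (x / q) * GP q t (1 / x)"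
  using q0 t0
  by (intro fps_to_fls_injD) (simp add: GP_def fbody_def Kbody_def to_fls_simps divide_simps mult_ac)

lemma fbody_inverse: "x \<noteq> 0 \<Longrightarrow> fbody q t (1 / x) = fbody q t (x / q)"
  using q0 t0
  by (intro fps_to_fls_injD) (simp add: fbody_def to_fls_simps divide_simps mult_ac)

lemma thf_inverse:
  assumes "lp x" shows "thf q t (1 / x) = thf q t (x / q)"
proof -
  note n = lp_neq[OF assms] lp_nonzero[OF assms]
  have "(1 - t * (1 / x)) * (1 - q / t * (1 / x)) / ((1 - q * (1 / x)) * (1 - 1 / x))
     = (1 - t * (x / q)) * (1 - q / t * (x / q)) / ((1 - q * (x / q)) * (1 - x / q))"
    using n q0 t0 by (simp add: divide_simps) (simp add: algebra_simps)
  then show ?thesis using fbody_inverse[of x] n by (simp add: thf_def)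
qed

lemma fGP1:
  assumes "lp x" shows "GP q t x * thf q t x = fps_const (V1 q t x) * KP q t x"
proof -
  note n = lp_neq[OF assms] lp_nonzero[OF assms]
  have "GP q t x * thf q t x = fps_const ((1 - t * x) * (1 - q / t * x) / ((1 - q * x) * (1 - x))) * Kbody q t x"
    unfolding thf_def mult.left_commute[of "GP q t x"] fG_body1[OF lp_nonzero[OF assms]] ..
  also have "\<dots> = fps_const (V1 q t x) * KP q t x"
    by (simp add: V1_def KP_def flip: mult.assoc)
  finally show ?thesis .
qed

lemma fGP2:
  assumes "lp x" shows "GP q t (1 / x) * thf q t (x / q) = fps_const (V2 q t x) * KP q t x"
proof -
  note n = lp_neq[OF assms] lp_nonzero[OF assms]
  have "GP q t (1 / x) * thf q t (x / q) = fps_const ((1 - t * (x / q)) * (1 - q / t * (x / q)) / ((1 - q * (x / q)) * (1 - x / q))) * Kbody q t x"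
    unfolding thf_def mult.left_commute[of "GP q t (1 / x)"] fG_body2[OF lp_nonzero[OF assms]] ..
  also have "\<dots> = fps_const (V2 q t x) * KP q t x"
    using q0 by (simp add: V2_def KP_def mult_ac flip: mult.assoc)
  finally show ?thesis .
qed

lemma KGP:
  assumes "lp x"
  shows "fps_const (1 - x) * KP q t x * GP q t (x / q) = fps_const (1 - x / q) * KP q t (x / q) * GP q t (1 / x)"
proof -
  note n = lp_neq[OF assms] lp_nonzero[OF assms]
  have "fps_const (1 - x) * KP q t x = Kbody q t x" "fps_const (1 - x / q) * KP q t (x / q) = Kbody q t (x / q)"
    using n q0 unfolding KP_def by (simp_all flip: mult.assoc)
  then show ?thesis using KG_body[of x] n by simp
qed

lemma fGM1:
  assumes "lp x" shows "GM q t x * thf q t x = fps_const (V1 q t x) * KM q t x"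
proof -
  have "GM q t x * thf q t x = inverse (GP q t (1 / x)) * ((GP q t x * inverse (GP q t x)) * thf q t x)"
    by (simp add: GM_def GP_inverse)
  also have "\<dots> = inverse (GP q t (1 / x)) * inverse (GP q t x) * (GP q t x * thf q t x)"
    by (simp only: mult_ac)
  finally show ?thesis unfolding fGP1[OF assms] KM_def by (simp only: mult_ac)
qed

lemma fGM2:
  assumes "lp x" shows "GM q t (1 / x) * thf q t (x / q) = fps_const (V2 q t x) * KM q t x"
proof -
  have "GM q t (1 / x) * thf q t (x / q)
      = inverse (GP q t x) * ((GP q t (1 / x) * inverse (GP q t (1 / x))) * thf q t (x / q))"
    by (simp add: GM_def GP_inverse)
  also have "\<dots> = inverse (GP q t x) * inverse (GP q t (1 / x)) * (GP q t (1 / x) * thf q t (x / q))"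
    by (simp only: mult_ac)
  finally show ?thesis unfolding fGP2[OF assms] KM_def by (simp only: mult_ac)
qed

lemma KGM:
  assumes "lp x"
  shows "fps_const (1 - x) * KM q t x * GM q t (x / q) = fps_const (1 - x / q) * KM q t (x / q) * GM q t (1 / x)"
proof -
  have n: "x \<noteq> 0" by (rule lp_nonzero[OF assms])
  have "fps_const (1 - x) * KM q t x * GM q t (x / q)
     = (fps_const (1 - x) * KP q t x * GP q t (x / q)) * inverse (GP q t (x / q))
       * inverse (GP q t x) * inverse (GP q t (1 / x)) * inverse (GP q t (q / x))"
    using GP_inverse[of q t "x / q"] by (simp add: KM_def GM_def mult_ac)
  also have "\<dots> = fps_const (1 - x / q) * KM q t (x / q) * GM q t (1 / x)"
    unfolding KGP[OF assms]
    using GP_inverse[of q t "1 / x"] by (simp add: KM_def GM_def mult_ac)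
  finally show ?thesis .
qed

text \<open>For content ratios of different rows the denominator has nonzero constant term, so
  division of series is multiplication by the inverse.\<close>

lemma thf_theta:
  assumes "lp x"
  shows "thf q t x = theta (t * x) * theta (q / t * x) / (theta (q * x) * theta x)"
proof -
  note n = lp_neq[OF assms] lp_nonzero[OF assms]
  have u: "(theta (q * x) * theta x) $ 0 \<noteq> 0" using n by (simp add: theta_nth_0)
  have g: "1 / (q / t * x) = t / (q * x)" by simp
  have d: "inverse (fps_const (1 - q * x)) = fps_const (1 / (1 - q * x))"
    "inverse (fps_const (1 - x)) = fps_const (1 / (1 - x))"
    by (simp_all add: fps_const_inverse inverse_eq_divide)
  have "theta (t * x) * theta (q / t * x) / (theta (q * x) * theta x)
     = fps_const (1 - t * x) * fps_const (1 - q / t * x) * fps_const (1 / (1 - q * x)) * fps_const (1 / (1 - x))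
       * fbody q t x"
    by (subst fps_divide_unit[OF u])
       (simp only: theta_qp g fps_inverse_mult d fbody_def, simp only: mult_ac)
  then show ?thesis by (simp add: thf_def mult_ac)
qed

end

section \<open>The series \<open>g\<close>\<close>

lemma qscale_power: "qscale F ^ n = qscale (F ^ n)"
  by (induction n) (auto simp: qscale_mult intro!: fps_ext)

lemma qscale_gexp: "gexp (qscale A) = qscale (gexp A)"
  by (rule fps_ext) (simp add: gexp_def qscale_power sum_distrib_left mult_ac)

text \<open>Coefficient m has the factor p^m. This is why g and its inverse can be evaluated at any
  ratio of contents.\<close>

lemma pfin_qscale: "pfin (fps_nth (qscale F))"
  unfolding pfin_def
proof
  fix n
  have "{i. qscale F $ i $ n \<noteq> 0} \<subseteq> {..n}" by (auto simp: fps_X_power_mult_nth)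
  then show "finite {i. qscale F $ i $ n \<noteq> 0}" by (rule finite_subset) simp
qed

lemma lg_mult_X: "lg (c * fps_X) = qscale (lg c)"
  by (rule fps_ext) (simp add: lg_def power_mult_distrib mult_ac)

definition glog :: "complex \<Rightarrow> complex \<Rightarrow> complex fps fps"
  where "glog q t = Abs_fps (\<lambda>m. if m = 0 then 0
           else fps_const (kappa q t (int m) / of_nat m) * (fps_X ^ m * inverse (1 - fps_X ^ m)))"

definition gser :: "complex \<Rightarrow> complex \<Rightarrow> complex fps fps"
  where "gser q t = gexp (glog q t)"

text \<open>In the expanded product 1 and -1 cancel, because the product of q, 1/t and t/q is 1. The
  six remaining powers become the six Euler products of \<open>GP\<close>, three in the numerator
  and three in the denominator.\<close>

lemma kappa_expand:
  assumes "q \<noteq> 0" "t \<noteq> 0"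
  shows "kappa q t m = - (q powi m) - (1 / t) powi m - (t / q) powi m
    + (q / t) powi m + t powi m + (1 / q) powi m"
  using assms by (simp add: kappa_def power_int_minus power_int_divide_distrib field_simps)

lemma glog_eq:
  assumes "q \<noteq> 0" "t \<noteq> 0"
  shows "glog q t = qscale (- lg (fps_const q) + - lg (fps_const (1 / t)) + - lg (fps_const (t / q))
    + lg (fps_const (q / t)) + lg (fps_const t) + lg (fps_const (1 / q)))"
proof (rule fps_ext)
  fix m :: nat
  have c: "fps_const (kappa q t (int m) / of_nat m) =
    (- fps_const (q ^ m) - fps_const ((1 / t) ^ m) - fps_const ((t / q) ^ m)
     + fps_const ((q / t) ^ m) + fps_const (t ^ m) + fps_const ((1 / q) ^ m)) * fps_const (1 / of_nat m)"
    by (simp add: kappa_expand[OF assms])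
  show "glog q t $ m = qscale (- lg (fps_const q) + - lg (fps_const (1 / t)) + - lg (fps_const (t / q))
    + lg (fps_const (q / t)) + lg (fps_const t) + lg (fps_const (1 / q))) $ m"
  proof (cases "m = 0")
    case False
    then show ?thesis
      by (simp add: glog_def c lg_def fps_const_power del: fps_const_mult fps_const_add fps_const_sub fps_const_neg)
         (simp only: ring_distribs mult_ac mult_minus_left mult_minus_right)
  qed (simp add: glog_def)
qed

lemma glog_0 [simp]: "glog q t $ 0 = 0" by (simp add: glog_def)

lemma pfin_gser: "q \<noteq> 0 \<Longrightarrow> t \<noteq> 0 \<Longrightarrow> pfin (fps_nth (gser q t))"
  unfolding gser_def by (simp add: glog_eq qscale_gexp pfin_qscale)

lemma recip_gser: "recip (gser q t) = gexp (- glog q t)"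
  unfolding gser_def by (rule recip_gexp) simp

lemma qscale_uminus: "- qscale F = qscale (- F)"
  by (rule fps_ext) simp

lemma qscale_diff: "qscale (F - G) = qscale F - qscale G"
  by (rule fps_ext) (simp add: algebra_simps)

lemma pfin_recip_gser: "q \<noteq> 0 \<Longrightarrow> t \<noteq> 0 \<Longrightarrow> pfin (fps_nth (recip (gser q t)))"
  unfolding recip_gser by (simp add: glog_eq qscale_uminus qscale_gexp pfin_qscale)

lemma gev_eulE_X: "cid.gev y (eulE (fps_const c * fps_X)) = qp (c * y)"
  by (simp add: cid.gev_eulE qp_def mult_ac flip: fps_const_mult)

lemma gev_gser:
  assumes "q \<noteq> 0" "t \<noteq> 0"
  shows "cid.gev y (gser q t) = GP q t y"
proof -
  let ?e = "\<lambda>c. eulE (fps_const c * fps_X)"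
  have e: "?e c = gexp (- qscale (lg (fps_const c)))" for c
    by (simp add: gexp_lg[symmetric] lg_mult_X)
  have "gser q t * (?e (q / t) * ?e t * ?e (1 / q)) = ?e q * ?e (1 / t) * ?e (t / q)"
    unfolding gser_def glog_eq[OF assms] e
    by (subst gexp_add[symmetric], simp, simp)+
       (rule arg_cong[of _ _ gexp], simp add: qscale_add qscale_diff flip: qscale_uminus)
  then have "cid.gev y (gser q t * (?e (q / t) * ?e t * ?e (1 / q))) = cid.gev y (?e q * ?e (1 / t) * ?e (t / q))"
    by simp
  then have *: "cid.gev y (gser q t) * (qp (q / t * y) * qp (t * y) * qp (1 / q * y))
     = qp (q * y) * qp (1 / t * y) * qp (t / q * y)"
    by (simp only: cid.gev_mult pfin_gser[OF assms] pfin_eulE pfin_mult_series gev_eulE_X)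
  have i: "qp a * inverse (qp a) = 1" for a by (rule inverse_mult_eq_1') simp
  have "cid.gev y (gser q t) = cid.gev y (gser q t) * ((qp (q / t * y) * inverse (qp (q / t * y)))
     * (qp (t * y) * inverse (qp (t * y))) * (qp (1 / q * y) * inverse (qp (1 / q * y))))"
    unfolding i by simp
  also have "\<dots> = (cid.gev y (gser q t) * (qp (q / t * y) * qp (t * y) * qp (1 / q * y)))
     * inverse (qp (q / t * y)) * inverse (qp (t * y)) * inverse (qp (1 / q * y))"
    by (simp only: mult_ac)
  finally show ?thesis unfolding * by (simp add: GP_def)
qed

lemma gev_recip_gser:
  assumes "q \<noteq> 0" "t \<noteq> 0"
  shows "cid.gev y (recip (gser q t)) = inverse (GP q t y)"
proof -
  have "gser q t $ 0 = 1" by (simp add: gser_def)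
  then have "recip (gser q t) * gser q t = 1" by (rule recip_left)
  then have "cid.gev y (recip (gser q t)) * GP q t y = 1"
    using cid.gev_mult[OF pfin_recip_gser pfin_gser, of q t q t y] cid.gev_1[of y] gev_gser[of q t y] assms by simp
  then show ?thesis by (metis fps_inverse_unique)
qed

section \<open>Laurent polynomials\<close>

notation fls_nth (infixl "$$" 75)

text \<open>\<open>int \<Rightarrow>\<^sub>0 complex\<close> with the convolution product is the ring of Laurent polynomials.\<close>

type_synonym laurent = "int \<Rightarrow>\<^sub>0 complex"

abbreviation lmono :: "int \<Rightarrow> complex \<Rightarrow> laurent" where "lmono \<equiv> Poly_Mapping.single"

lemma laurent_expand: "F = (\<Sum>k\<in>Poly_Mapping.keys F. lmono k (Poly_Mapping.lookup F k))" for F :: laurent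
  by (rule poly_mapping_eqI)
     (auto simp: lookup_sum lookup_single when_def in_keys_iff if_distrib sum.delta cong: if_cong)

lemma laurent_additive_eq:
  fixes D E :: "laurent \<Rightarrow> 'a::comm_monoid_add"
  assumes "\<And>F G. D (F + G) = D F + D G" "D 0 = 0" "\<And>F G. E (F + G) = E F + E G" "E 0 = 0"
    and "\<And>m c. D (lmono m c) = E (lmono m c)"
  shows "D F = E F"
proof -
  have s: "H (\<Sum>i\<in>I. f i) = (\<Sum>i\<in>I. H (f i))"
    if "\<And>F G. H (F + G) = H F + H G" "H 0 = 0"
    for H :: "laurent \<Rightarrow> 'a" and I :: "int set" and f :: "int \<Rightarrow> laurent"
    by (induction I rule: infinite_finite_induct) (simp_all add: that)
  show ?thesis
    by (subst (1 2) laurent_expand)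
       (simp add: s[of D, OF assms(1,2)] s[of E, OF assms(3,4)] assms(5))
qed

locale complex_field_alg = complex_alg \<phi> for \<phi> :: "complex \<Rightarrow> 'k::field"
begin

lemma inverse: "\<phi> (inverse c) = inverse (\<phi> c)"
proof (cases "c = 0")
  case False
  then have "\<phi> c * \<phi> (inverse c) = 1" by (simp flip: mult add: one)
  then show ?thesis by (metis inverse_unique)
qed (simp add: zero)

lemma divide: "\<phi> (a / b) = \<phi> a / \<phi> b"
  by (simp add: divide_inverse mult inverse)

lemma eq_0_iff: "\<phi> c = 0 \<longleftrightarrow> c = 0"
proof
  assume "\<phi> c = 0"
  show "c = 0"
  proof (rule ccontr)
    assume "c \<noteq> 0"
    then have "\<phi> c * \<phi> (inverse c) = 1" by (simp flip: mult add: one)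
    then show False by (simp add: \<open>\<phi> c = 0\<close>)
  qed
qed (simp add: zero)

definition ev :: "'k \<Rightarrow> laurent \<Rightarrow> 'k"
  where "ev y F = (\<Sum>k\<in>Poly_Mapping.keys F. \<phi> (Poly_Mapping.lookup F k) * y powi k)"

lemma ev_superset:
  "finite S \<Longrightarrow> Poly_Mapping.keys F \<subseteq> S \<Longrightarrow> ev y F = (\<Sum>k\<in>S. \<phi> (Poly_Mapping.lookup F k) * y powi k)"
  unfolding ev_def by (rule sum.mono_neutral_left) (auto simp: in_keys_iff zero)

lemma ev_add: "ev y (F + G) = ev y F + ev y G"
  by (simp add: ev_superset[of "Poly_Mapping.keys F \<union> Poly_Mapping.keys G"] keys_add lookup_add add
      ring_distribs sum.distrib)

lemma ev_mono: "ev y (lmono k c) = \<phi> c * y powi k"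
  by (simp add: ev_superset[of "{k}"])

lemma ev_zero: "ev y 0 = 0" by (simp add: ev_def)

lemma ev_mult:
  assumes "y \<noteq> 0" shows "ev y (F * G) = ev y F * ev y G"
proof -
  have 1: "ev y (lmono m c * G) = ev y (lmono m c) * ev y G" for m c G
    by (rule laurent_additive_eq)
       (simp_all add: ev_add ev_zero ring_distribs ev_mono mult_single mult power_int_add assms)
  show ?thesis
    by (rule laurent_additive_eq[of "\<lambda>F. ev y (F * G)"])
       (simp_all add: ev_add ev_zero ring_distribs 1)
qed

lemma ev_one: "ev y 1 = 1"
  using ev_mono[of y 0 1] by (simp add: one)

lemma ev_hom: "y \<noteq> 0 \<Longrightarrow> ring_hom_loc (ev y)"
  by unfold_locales (simp_all add: ev_add ev_mult ev_one)

end

text \<open>This is theta (c y) without the factor 1 - c y. Each coefficient in p is a Laurent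
  polynomial in y, hence the same object for the expansions in y and in 1/y.\<close>

definition rho :: "complex \<Rightarrow> laurent fps"
  where "rho c = qpoch (fps_const (lmono 1 c) * fps_X) * qpoch (fps_const (lmono (- 1) (1 / c)) * fps_X)"

lemma rho_nth_0 [simp]: "rho c $ 0 = 1"
  by (simp add: rho_def qpoch_nth_0)

context complex_field_alg
begin

lemma theta_unfold:
  assumes "c \<noteq> 0" "y \<noteq> 0"
  shows "theta (\<phi> c * y) = fps_const (1 - \<phi> c * y) * fmap (ev y) (rho c)"
proof -
  interpret e: ring_hom_loc "ev y" by (rule ev_hom[OF assms(2)])
  interpret f: ring_hom_loc "fmap (ev y)" by (rule e.fmap_hom)
  have m: "ev y (lmono 1 c) = \<phi> c * y" "ev y (lmono (- 1) (1 / c)) = inverse (\<phi> c * y)"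
    by (simp_all add: ev_mono divide one power_int_minus field_simps)
  have "fmap (ev y) (rho c) = qpoch (fps_const (\<phi> c * y) * fps_X) * qpoch (fps_const (inverse (\<phi> c * y)) * fps_X)"
    by (simp add: rho_def f.mult e.fmap_qpoch e.fmap_const e.fmap_X m)
  then show ?thesis
    unfolding theta_def by (subst qpoch_unfold) (simp add: mult.assoc flip: fps_const_sub)
qed

lemma theta_inv:
  assumes "x \<noteq> (0 :: 'k)"
  shows "theta (inverse x) = fps_const (- inverse x) * theta x"
proof -
  have *: "qpoch (fps_const x) = fps_const (1 - x) * qpoch (fps_const x * fps_X)" for x :: 'k
    by (subst qpoch_unfold) (simp flip: fps_const_sub)
  have "1 - inverse x = - inverse x * (1 - x)" using assms by (simp add: field_simps)
  then show ?thesis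
    unfolding theta_def * using assms by (simp add: mult_ac flip: fps_const_mult)
qed

lemma theta_unit: "theta (x :: 'k) $ 0 = 1 - x"
  by (simp add: theta_def qpoch_nth_0)

end

section \<open>Partial fractions\<close>

text \<open>In the induction the coefficient of the new pole is the old sum at y = 1 / d j, so
  \<open>y\<close> has to be arbitrary.\<close>

lemma partial_fractions_complex:
  fixes d :: "'i \<Rightarrow> complex"
  assumes "finite S" "S \<noteq> {}" "inj_on d S" "\<And>i. i \<in> S \<Longrightarrow> d i \<noteq> 0" "\<And>i. i \<in> S \<Longrightarrow> d i * y \<noteq> 1"
  shows "(\<Prod>i\<in>S. inverse (1 - d i * y))
    = (\<Sum>k\<in>S. (\<Prod>i\<in>S - {k}. inverse (1 - d i / d k)) * inverse (1 - d k * y))"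
  using assms
proof (induction S arbitrary: y rule: finite_ne_induct)
  case (insert j S)
  define r where "r k = (\<Prod>i\<in>S - {k}. inverse (1 - d i / d k))" for k
  have ne: "d k \<noteq> d j" if "k \<in> S" for k using insert that by (auto simp: inj_on_def)
  have d0: "d j \<noteq> 0" using insert by simp
  have IH: "(\<Prod>i\<in>S. inverse (1 - d i * z)) = (\<Sum>k\<in>S. r k * inverse (1 - d k * z))"
    if "\<And>i. i \<in> S \<Longrightarrow> d i * z \<noteq> 1" for z
    unfolding r_def by (rule insert.IH) (use insert that in auto)
  have split: "inverse (1 - d j * y) * inverse (1 - d k * y)
     = inverse (1 - d j / d k) * inverse (1 - d k * y) + inverse (1 - d k / d j) * inverse (1 - d j * y)"
    if "k \<in> S" for k
  proof -
    have "d k \<noteq> 0" "d k * y \<noteq> 1" "d j * y \<noteq> 1" using insert that by auto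
    then have n: "1 - d k * y \<noteq> 0" "1 - d j * y \<noteq> 0" "d k - d j \<noteq> 0" "d j - d k \<noteq> 0" using ne[OF that] by auto
    have a: "inverse (1 - d j / d k) = d k / (d k - d j)" "inverse (1 - d k / d j) = - d j / (d k - d j)"
      using n d0 \<open>d k \<noteq> 0\<close> by (simp_all add: field_simps)
    show ?thesis unfolding a using n by (simp add: divide_simps) (simp add: algebra_simps)
  qed
  have "(\<Prod>i\<in>insert j S. inverse (1 - d i * y)) = inverse (1 - d j * y) * (\<Sum>k\<in>S. r k * inverse (1 - d k * y))"
    using insert by (simp add: IH)
  also have "\<dots> = (\<Sum>k\<in>S. r k * (inverse (1 - d j * y) * inverse (1 - d k * y)))"
    by (simp add: sum_distrib_left mult_ac)
  also have "\<dots> = (\<Sum>k\<in>S. r k * inverse (1 - d j / d k) * inverse (1 - d k * y))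
      + (\<Sum>k\<in>S. r k * inverse (1 - d k * (1 / d j))) * inverse (1 - d j * y)"
    unfolding sum_distrib_right sum.distrib[symmetric]
    by (rule sum.cong[OF refl], simp only: split) (simp add: algebra_simps)
  also have "(\<Sum>k\<in>S. r k * inverse (1 - d k * (1 / d j))) = (\<Prod>i\<in>S. inverse (1 - d i * (1 / d j)))"
    by (rule IH[symmetric]) (use ne d0 in \<open>auto simp: field_simps\<close>)
  also have "(\<Sum>k\<in>S. r k * inverse (1 - d j / d k) * inverse (1 - d k * y))
    = (\<Sum>k\<in>S. (\<Prod>i\<in>insert j S - {k}. inverse (1 - d i / d k)) * inverse (1 - d k * y))"
  proof (rule sum.cong[OF refl])
    fix k assume "k \<in> S"
    then have "insert j S - {k} = insert j (S - {k})" "j \<notin> S - {k}" using insert by auto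
    then show "r k * inverse (1 - d j / d k) * inverse (1 - d k * y)
       = (\<Prod>i\<in>insert j S - {k}. inverse (1 - d i / d k)) * inverse (1 - d k * y)"
      using insert by (simp add: r_def mult_ac)
  qed
  finally show ?case using insert by (simp add: add.commute)
qed simp

text \<open>Here \<open>y\<close> is a fixed element such as a Laurent variable, so the induction
  hypothesis says nothing about the point 1 / d j; the complex version supplies the coefficient
  there.\<close>

lemma (in complex_field_alg) partial_fractions:
  fixes d :: "'i \<Rightarrow> complex"
  assumes "finite S" "S \<noteq> {}" "inj_on d S" "\<And>i. i \<in> S \<Longrightarrow> d i \<noteq> 0" "\<And>i. i \<in> S \<Longrightarrow> \<phi> (d i) * y \<noteq> 1"
  shows "(\<Prod>i\<in>S. inverse (1 - \<phi> (d i) * y))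
    = (\<Sum>k\<in>S. \<phi> (\<Prod>i\<in>S - {k}. inverse (1 - d i / d k)) * inverse (1 - \<phi> (d k) * y))"
  using assms
proof (induction S rule: finite_ne_induct)
  case (insert j S)
  define r where "r k = (\<Prod>i\<in>S - {k}. inverse (1 - d i / d k))" for k
  have ne: "d k \<noteq> d j" if "k \<in> S" for k using insert that by (auto simp: inj_on_def)
  have d0: "d j \<noteq> 0" using insert by simp
  have IH: "(\<Prod>i\<in>S. inverse (1 - \<phi> (d i) * y)) = (\<Sum>k\<in>S. \<phi> (r k) * inverse (1 - \<phi> (d k) * y))"
    unfolding r_def by (rule insert.IH) (use insert in auto)
  have split: "inverse (1 - \<phi> (d j) * y) * inverse (1 - \<phi> (d k) * y)
     = \<phi> (inverse (1 - d j / d k)) * inverse (1 - \<phi> (d k) * y)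
      + \<phi> (inverse (1 - d k / d j)) * inverse (1 - \<phi> (d j) * y)"
    if "k \<in> S" for k
  proof -
    have "d k \<noteq> 0" "\<phi> (d k) * y \<noteq> 1" "\<phi> (d j) * y \<noteq> 1" using insert that by auto
    then have n: "1 - \<phi> (d k) * y \<noteq> 0" "1 - \<phi> (d j) * y \<noteq> 0" "d k - d j \<noteq> 0" "\<phi> (d k) - \<phi> (d j) \<noteq> 0"
      using ne[OF that] eq_0_iff[of "d k - d j"] by (auto simp: diff)
    have a: "inverse (1 - d j / d k) = d k / (d k - d j)" "inverse (1 - d k / d j) = - d j / (d k - d j)"
      using n(3) d0 \<open>d k \<noteq> 0\<close> by (simp_all add: field_simps)
    show ?thesis unfolding a divide diff uminus using n by (simp add: divide_simps) (simp add: algebra_simps)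
  qed
  have "(\<Prod>i\<in>insert j S. inverse (1 - \<phi> (d i) * y))
     = inverse (1 - \<phi> (d j) * y) * (\<Sum>k\<in>S. \<phi> (r k) * inverse (1 - \<phi> (d k) * y))"
    using insert by (simp add: IH)
  also have "\<dots> = (\<Sum>k\<in>S. \<phi> (r k) * (inverse (1 - \<phi> (d j) * y) * inverse (1 - \<phi> (d k) * y)))"
    by (simp add: sum_distrib_left mult_ac)
  also have "\<dots> = (\<Sum>k\<in>S. \<phi> (r k * inverse (1 - d j / d k)) * inverse (1 - \<phi> (d k) * y))
      + \<phi> (\<Sum>k\<in>S. r k * inverse (1 - d k * (1 / d j))) * inverse (1 - \<phi> (d j) * y)"
    unfolding sum sum_distrib_right sum.distrib[symmetric]
    by (rule sum.cong[OF refl], simp only: split) (simp add: mult algebra_simps)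
  also have "(\<Sum>k\<in>S. r k * inverse (1 - d k * (1 / d j))) = (\<Prod>i\<in>S. inverse (1 - d i * (1 / d j)))"
    unfolding r_def
    by (rule partial_fractions_complex[symmetric]) (use insert ne d0 in \<open>auto simp: field_simps\<close>)
  also have "(\<Sum>k\<in>S. \<phi> (r k * inverse (1 - d j / d k)) * inverse (1 - \<phi> (d k) * y))
    = (\<Sum>k\<in>S. \<phi> (\<Prod>i\<in>insert j S - {k}. inverse (1 - d i / d k)) * inverse (1 - \<phi> (d k) * y))"
  proof (rule sum.cong[OF refl])
    fix k assume "k \<in> S"
    then have "insert j S - {k} = insert j (S - {k})" "j \<notin> S - {k}" using insert by auto
    then show "\<phi> (r k * inverse (1 - d j / d k)) * inverse (1 - \<phi> (d k) * y)
       = \<phi> (\<Prod>i\<in>insert j S - {k}. inverse (1 - d i / d k)) * inverse (1 - \<phi> (d k) * y)"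
      using insert by (simp add: r_def mult_ac)
  qed
  finally show ?case using insert by (simp add: add.commute)
qed (simp add: one)

section \<open>The two expansions of a quotient of theta functions\<close>

lemma complex_field_alg_id: "complex_field_alg (\<lambda>x. x)"
  by unfold_locales auto

interpretation cfid: complex_field_alg "\<lambda>x :: complex. x"
  by (rule complex_field_alg_id)

lemma complex_field_alg_fls: "complex_field_alg fls_const"
  by unfold_locales (auto simp: fls_plus_const)

interpretation fl: complex_field_alg "fls_const :: complex \<Rightarrow> complex fls"
  by (rule complex_field_alg_fls)

lemma fps_const_prod_eq: "fps_const (\<Prod>i\<in>S. g i) = (\<Prod>i\<in>S. fps_const (g i))"
  for g :: "'i \<Rightarrow> 'a::comm_ring_1"
  by (induction S rule: infinite_finite_induct) (simp_all flip: fps_const_mult)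

lemma fps_inverse_eqI:
  fixes a b :: "'a::field fps"
  assumes "a * b = 1" shows "inverse b = a"
proof -
  have "b $ 0 \<noteq> 0"
  proof
    assume "b $ 0 = 0"
    then have "(a * b) $ 0 = 0" by simp
    then show False using assms by simp
  qed
  then have "inverse b * b = 1" by (rule inverse_mult_eq_1)
  moreover have "(a * b) * inverse b = a * (inverse b * b)" by (simp only: mult_ac)
  ultimately show ?thesis using assms by simp
qed

text \<open>The theta quotient with its simple poles removed. Laurent polynomials are not a field,
  hence \<open>recip\<close>, which inverts series with constant term 1.\<close>

definition laurent_num :: "('i \<Rightarrow> complex) \<Rightarrow> ('i \<Rightarrow> complex) \<Rightarrow> 'i set \<Rightarrow> laurent fps"
  where "laurent_num c d S = (\<Prod>i\<in>S. fps_const (1 - lmono 1 (c i)) * rho (c i) * recip (rho (d i)))"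

lemma (in complex_field_alg) theta_quotient:
  assumes "finite S" "y \<noteq> 0" "\<And>i. i \<in> S \<Longrightarrow> c i \<noteq> 0" "\<And>i. i \<in> S \<Longrightarrow> d i \<noteq> 0"
    and "\<And>i. i \<in> S \<Longrightarrow> \<phi> (d i) * y \<noteq> 1"
  shows "(\<Prod>i\<in>S. theta (\<phi> (c i) * y) / theta (\<phi> (d i) * y))
    = fmap (ev y) (laurent_num c d S) * fps_const (\<Prod>i\<in>S. inverse (1 - \<phi> (d i) * y))"
proof -
  interpret e: ring_hom_loc "ev y" by (rule ev_hom[OF assms(2)])
  interpret f: ring_hom_loc "fmap (ev y)" by (rule e.fmap_hom)
  have "theta (\<phi> (c i) * y) / theta (\<phi> (d i) * y)
     = fmap (ev y) (fps_const (1 - lmono 1 (c i)) * rho (c i) * recip (rho (d i))) * fps_const (inverse (1 - \<phi> (d i) * y))"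
    if i: "i \<in> S" for i
  proof -
    have u: "theta (\<phi> (d i) * y) $ 0 \<noteq> 0" using assms(5)[OF i] by (simp add: theta_unit)
    have "recip (rho (d i)) * rho (d i) = 1" by (rule recip_left) simp
    then have "fmap (ev y) (recip (rho (d i))) * fmap (ev y) (rho (d i)) = 1"
      by (simp flip: f.mult add: f.one)
    then have r: "inverse (fmap (ev y) (rho (d i))) = fmap (ev y) (recip (rho (d i)))"
      by (rule fps_inverse_eqI)
    show ?thesis
      unfolding fps_divide_unit[OF u]
      unfolding theta_unfold[OF assms(3)[OF i] assms(2)] theta_unfold[OF assms(4)[OF i] assms(2)]
        fps_inverse_mult r f.mult e.fmap_const e.diff e.one ev_mono fps_const_inverse power_int_1_right
      by (simp only: mult_ac)
  qed
  then show ?thesis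
    unfolding laurent_num_def f.prod fps_const_prod_eq prod.distrib[symmetric]
    by (intro prod.cong refl)
qed

lemma fls_geometric: "inverse (1 - fls_const a * fls_X) = fps_to_fls (Abs_fps (\<lambda>k. a ^ k))" for a :: complex
proof -
  have "(1 - fps_const a * fps_X) * Abs_fps (\<lambda>k. a ^ k) = 1"
    by (rule fps_ext, subst one_minus_const_X_mult_nth) (auto simp: gr0_conv_Suc)
  then have "fps_to_fls (1 - fps_const a * fps_X) * fps_to_fls (Abs_fps (\<lambda>k. a ^ k)) = 1"
    by (metis fls_times_fps_to_fls fps_one_to_fls)
  moreover have "fps_to_fls (1 - fps_const a * fps_X) = 1 - fls_const a * fls_X"
    by (simp only: fps_to_fls_minus fps_one_to_fls fls_times_fps_to_fls fps_const_to_fls fps_X_to_fls)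
  ultimately show ?thesis by (metis inverse_unique)
qed

lemma fls_monomial_mult_nth:
  "(fls_const c * fls_X powi m * F) $$ n = c * F $$ (n - m)" for c :: complex
  by (simp only: mult.assoc fls_X_power_int fls_X_intpow_times_conv_shift(1) fls_mult_const_nth fls_shift_nth)
     simp

text \<open>G(x) / (1 - a x) is expanded at 0 and at infinity; in the second expansion
  \<open>fls_X\<close> is 1/x, hence the coefficient -n. The difference of the two expansions of 1 /
  (1 - a x) is the delta function of a x, which evaluates \<open>G\<close> at 1/a. By additivity it
  is enough to take monomials.\<close>

lemma expansion_difference:
  assumes "a \<noteq> 0"
  shows "(fl.ev fls_X G * inverse (1 - fls_const a * fls_X)) $$ n
    - (fl.ev (inverse fls_X) G * inverse (1 - fls_const a * inverse fls_X)) $$ (- n)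
    = a powi n * cfid.ev (1 / a) G"
proof (rule laurent_additive_eq[of "\<lambda>G. (fl.ev fls_X G * inverse (1 - fls_const a * fls_X)) $$ n
    - (fl.ev (inverse fls_X) G * inverse (1 - fls_const a * inverse fls_X)) $$ (- n)"])
  fix m :: int and c :: complex
  \<comment> \<open>1 / (1 - a/X) = - (X/a) / (1 - X/a), a geometric series in positive powers of
    X.\<close>
  have i: "inverse (1 - fls_const a * inverse fls_X)
     = fls_const (- (1 / a)) * fls_X powi 1 * inverse (1 - fls_const (1 / a) * fls_X)"
  proof -
    have "fls_const (1 / a) * fls_const a = (1 :: complex fls)"
      using assms by (simp only: fls_const_mult_const) simp
    then have "(fls_const (1 / a) * fls_X) * (1 - fls_const a * inverse fls_X)
        = fls_const (1 / a) * fls_X - (fls_const (1 / a) * fls_const a) * (fls_X * inverse fls_X)"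
      unfolding right_diff_distrib mult_1_right by (simp only: mult_ac)
    also have "\<dots> = - (1 - fls_const (1 / a) * fls_X)"
      using \<open>fls_const (1 / a) * fls_const a = 1\<close> by (simp only: right_inverse[OF fls_X_nonzero]) simp
    finally have *: "(1 - fls_const a * inverse fls_X) * (fls_const (1 / a) * fls_X) = - (1 - fls_const (1 / a) * fls_X)"
      by (simp only: mult.commute)
    have nz: "1 - fls_const (1 / a) * fls_X \<noteq> (0 :: complex fls)"
    proof
      assume "1 - fls_const (1 / a) * fls_X = (0 :: complex fls)"
      then have "inverse (1 - fls_const (1 / a) * fls_X) $$ 0 = (0 :: complex)" by simp
      then show False unfolding fls_geometric by simp
    qed
    have "(1 - fls_const a * inverse fls_X) * (fls_const (- (1 / a)) * fls_X powi 1 * inverse (1 - fls_const (1 / a) * fls_X))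
      = - ((1 - fls_const a * inverse fls_X) * (fls_const (1 / a) * fls_X)) * inverse (1 - fls_const (1 / a) * fls_X)"
      by (simp only: fls_const_uminus power_int_1_right mult_minus_left mult_minus_right mult.assoc)
    also have "\<dots> = 1" unfolding * using nz by (simp only: minus_minus right_inverse not_False_eq_True)
    finally show ?thesis by (rule inverse_unique)
  qed
  have 2: "fl.ev (inverse fls_X) (lmono m c) = fls_const c * fls_X powi (- m)"
    by (simp only: fl.ev_mono power_int_inverse power_int_minus)
  have t2: "(fl.ev (inverse fls_X) (lmono m c) * inverse (1 - fls_const a * inverse fls_X)) $$ (- n)
    = - c / a * (if m - n - 1 < 0 then 0 else (1 / a) ^ nat (m - n - 1))"
    unfolding 2 i mult.assoc[of _ _ "_ * _"] fls_geometric
    by (simp only: fls_monomial_mult_nth mult.assoc[symmetric]) 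
       (simp only: mult.assoc fls_monomial_mult_nth[unfolded mult.assoc], simp add: algebra_simps)
  have t1: "(fl.ev fls_X (lmono m c) * inverse (1 - fls_const a * fls_X)) $$ n
    = c * (if n - m < 0 then 0 else a ^ nat (n - m))"
    unfolding fl.ev_mono fls_geometric fls_monomial_mult_nth by simp
  have t0: "a powi n * cfid.ev (1 / a) (lmono m c) = c * a powi (n - m)"
    using assms by (simp add: cfid.ev_mono power_int_diff power_int_divide_distrib)
  have t3: "c / a * (1 / a) ^ nat (m - n - 1) = c * a powi (n - m)" if "m > n"
  proof -
    have "a powi (n - m) = inverse (a ^ Suc (nat (m - n - 1)))"
      using that by (simp add: power_int_def Suc_nat_eq_nat_zadd1 power_inverse)
    then show ?thesis by (simp add: divide_inverse power_inverse)
  qed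
  show "(fl.ev fls_X (lmono m c) * inverse (1 - fls_const a * fls_X)) $$ n
    - (fl.ev (inverse fls_X) (lmono m c) * inverse (1 - fls_const a * inverse fls_X)) $$ (- n)
    = a powi n * cfid.ev (1 / a) (lmono m c)"
    unfolding t0 t1 t2
  proof (cases "m > n")
    case True
    then show "c * (if n - m < 0 then 0 else a ^ nat (n - m))
      - - c / a * (if m - n - 1 < 0 then 0 else (1 / a) ^ nat (m - n - 1)) = c * a powi (n - m)"
      using t3 by simp
  qed (auto simp: power_int_def)
qed (simp_all add: fl.ev_add fl.ev_zero cfid.ev_add cfid.ev_zero ring_distribs)

text \<open>The quotient without its pole factor, evaluated at the pole 1 / d k. There theta (d k x)
  / (1 - d k x) becomes \<open>qp 1 * qp 1\<close>.\<close>

definition theta_residue :: "('i \<Rightarrow> complex) \<Rightarrow> ('i \<Rightarrow> complex) \<Rightarrow> 'i set \<Rightarrow> 'i \<Rightarrow> complex fps"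
  where "theta_residue c d S k = (\<Prod>i\<in>S. theta (c i / d k)) * inverse (\<Prod>i\<in>S - {k}. theta (d i / d k))
     * inverse (qp 1 * qp 1)"

lemma fps_inverse_prod: "inverse (\<Prod>i\<in>S. g i) = (\<Prod>i\<in>S. inverse (g i :: complex fps))"
  by (induction S rule: infinite_finite_induct) (simp_all add: fps_inverse_mult)

lemma laurent_num_residue:
  assumes "finite S" "k \<in> S" "inj_on d S" "\<And>i. i \<in> S \<Longrightarrow> c i \<noteq> 0" "\<And>i. i \<in> S \<Longrightarrow> d i \<noteq> 0"
  shows "fps_const (\<Prod>i\<in>S - {k}. inverse (1 - d i / d k)) * fmap (cfid.ev (1 / d k)) (laurent_num c d S)
    = theta_residue c d S k"
proof -
  define y where "y = 1 / d k"
  have y: "y \<noteq> 0" using assms by (simp add: y_def)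
  interpret e: ring_hom_loc "cfid.ev y" by (rule cfid.ev_hom[OF y])
  interpret f: ring_hom_loc "fmap (cfid.ev y)" by (rule e.fmap_hom)
  have r: "fmap (cfid.ev y) (recip (rho a)) = inverse (fmap (cfid.ev y) (rho a))" for a
  proof -
    have "recip (rho a) * rho a = 1" by (rule recip_left) simp
    then have "fmap (cfid.ev y) (recip (rho a)) * fmap (cfid.ev y) (rho a) = 1"
      by (simp flip: f.mult add: f.one)
    then show ?thesis by (rule fps_inverse_eqI[symmetric])
  qed
  have k: "fmap (cfid.ev y) (rho (d k)) = qp 1 * qp 1"
  proof -
    have "cfid.ev y (lmono 1 (d k)) = 1" "cfid.ev y (lmono (- 1) (1 / d k)) = 1"
      using assms by (simp_all add: cfid.ev_mono y_def power_int_minus)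
    then show ?thesis
      by (simp add: rho_def f.mult e.fmap_qpoch e.fmap_const e.fmap_X qp_def)
  qed
  have "fmap (cfid.ev y) (laurent_num c d S)
    = (\<Prod>i\<in>S. theta (c i * y)) * (\<Prod>i\<in>S. inverse (fmap (cfid.ev y) (rho (d i))))"
    unfolding laurent_num_def f.prod prod.distrib[symmetric]
  proof (rule prod.cong[OF refl])
    fix i assume "i \<in> S"
    then show "fmap (cfid.ev y) (fps_const (1 - lmono 1 (c i)) * rho (c i) * recip (rho (d i)))
      = theta (c i * y) * inverse (fmap (cfid.ev y) (rho (d i)))"
      using cfid.theta_unfold[of "c i" y] assms y
      by (simp add: f.mult r e.fmap_const e.diff e.one cfid.ev_mono)
  qed
  also have "(\<Prod>i\<in>S. inverse (fmap (cfid.ev y) (rho (d i))))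
    = inverse (qp 1 * qp 1) * (\<Prod>i\<in>S - {k}. inverse (fmap (cfid.ev y) (rho (d i))))"
    using assms by (subst prod.remove[of _ k]) (auto simp: k)
  finally have "fps_const (\<Prod>i\<in>S - {k}. inverse (1 - d i / d k)) * fmap (cfid.ev y) (laurent_num c d S)
    = (\<Prod>i\<in>S. theta (c i * y)) * inverse (qp 1 * qp 1) *
      ((\<Prod>i\<in>S - {k}. fps_const (inverse (1 - d i / d k))) * (\<Prod>i\<in>S - {k}. inverse (fmap (cfid.ev y) (rho (d i)))))"
    by (simp only: fps_const_prod_eq mult_ac)
  also have "(\<Prod>i\<in>S - {k}. fps_const (inverse (1 - d i / d k))) * (\<Prod>i\<in>S - {k}. inverse (fmap (cfid.ev y) (rho (d i))))
    = inverse (\<Prod>i\<in>S - {k}. theta (d i * y))"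
    unfolding prod.distrib[symmetric] fps_inverse_prod
  proof (rule prod.cong[OF refl])
    fix i assume "i \<in> S - {k}"
    then have "theta (d i * y) = fps_const (1 - d i * y) * fmap (cfid.ev y) (rho (d i))"
      using cfid.theta_unfold[of "d i" y] assms y by simp
    then show "fps_const (inverse (1 - d i / d k)) * inverse (fmap (cfid.ev y) (rho (d i))) = inverse (theta (d i * y))"
      by (simp add: fps_inverse_mult fps_const_inverse y_def)
  qed
  finally show ?thesis by (simp add: theta_residue_def y_def mult_ac)
qed

lemma mode_const_mult: "mode (fps_const (fls_const a) * B) n = fps_const a * mode B n"
  by (rule fps_ext) (simp add: mode_def)

text \<open>The second quotient is the first one in the variable 1/x: by theta (1/x) = (-1/x) theta
  x, inverting the arguments costs a factor d i / c i for each i, which the product in front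
  compensates.\<close>

theorem theta_quotient_delta:
  fixes c d :: "'i \<Rightarrow> complex"
  assumes S: "finite S" "S \<noteq> {}" "inj_on d S" and c0: "\<And>i. i \<in> S \<Longrightarrow> c i \<noteq> 0" and d0: "\<And>i. i \<in> S \<Longrightarrow> d i \<noteq> 0"
  shows "mode (\<Prod>i\<in>S. theta (fls_const (c i) * fls_X) / theta (fls_const (d i) * fls_X)) n
    - fps_const (\<Prod>i\<in>S. c i / d i)
      * mode (\<Prod>i\<in>S. theta (fls_const (1 / c i) * fls_X) / theta (fls_const (1 / d i) * fls_X)) (- n)
    = (\<Sum>k\<in>S. fps_const (d k powi n) * theta_residue c d S k)"
proof -
  define y where "y = (inverse fls_X :: complex fls)"
  have y: "y \<noteq> 0" by (simp add: y_def)
  have n1: "fls_const a * fls_X \<noteq> 1" for a :: complex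
  proof
    assume "fls_const a * fls_X = 1"
    then have "(fls_const a * fls_X) $$ 0 = (1 :: complex fls) $$ 0" by simp
    then show False by simp
  qed
  have n2: "fls_const a * y \<noteq> 1" if "a \<noteq> 0" for a :: complex
  proof
    assume "fls_const a * y = 1"
    then have "fls_const a * y * (fls_const (1 / a) * fls_X) = fls_const (1 / a) * fls_X" by simp
    moreover have "fls_const a * y * (fls_const (1 / a) * fls_X) = (fls_const a * fls_const (1 / a)) * (y * fls_X)"
      by (simp only: mult_ac)
    moreover have "\<dots> = 1" using that by (simp only: fls_const_mult_const y_def left_inverse[OF fls_X_nonzero]) simp
    ultimately show False using n1 by metis
  qed
  have inv: "fls_const (1 / a) * fls_X = inverse (fls_const a * y)" for a :: complex
    unfolding fl.divide y_def fl.one by (simp only: inverse_mult_distrib inverse_inverse_eq divide_inverse mult_1)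
  have m: "theta (fls_const (1 / c i) * fls_X) / theta (fls_const (1 / d i) * fls_X)
    = fps_const (fls_const (d i / c i)) * (theta (fls_const (c i) * y) / theta (fls_const (d i) * y))" if "i \<in> S" for i
  proof -
    have nz: "fls_const (c i) * y \<noteq> 0" "fls_const (d i) * y \<noteq> 0"
      using c0[OF that] d0[OF that] y by (simp_all add: fl.eq_0_iff)
    have u: "theta (fls_const (d i) * y) $ 0 \<noteq> 0"
      using n2[OF d0[OF that]] by (simp add: fl.theta_unit)
    have u': "(fps_const (- inverse (fls_const (d i) * y)) * theta (fls_const (d i) * y)) $ 0 \<noteq> 0"
      using u nz by simp
    have "- inverse (fls_const (c i) * y) * inverse (- inverse (fls_const (d i) * y)) = fls_const (d i / c i)"
      using nz by (simp add: fl.divide field_simps)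
    then show ?thesis
      unfolding inv fl.theta_inv[OF nz(1)] fl.theta_inv[OF nz(2)] fps_divide_unit[OF u] fps_divide_unit[OF u']
        fps_inverse_mult fps_const_inverse
      by (simp add: mult_ac flip: fps_const_mult)
  qed
  have "(\<Prod>i\<in>S. c i / d i) * (\<Prod>i\<in>S. d i / c i) = 1"
    unfolding prod.distrib[symmetric] using c0 d0 by (intro prod.neutral) auto
  then have one: "fps_const (fls_const (\<Prod>i\<in>S. c i / d i)) * (\<Prod>i\<in>S. fps_const (fls_const (d i / c i))) = 1"
    unfolding fps_const_prod_eq[symmetric] fl.prod[symmetric] fps_const_mult fl.mult[symmetric]
    by (simp add: fl.one)
  have "fps_const (\<Prod>i\<in>S. c i / d i)
      * mode (\<Prod>i\<in>S. theta (fls_const (1 / c i) * fls_X) / theta (fls_const (1 / d i) * fls_X)) (- n)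
    = mode (fps_const (fls_const (\<Prod>i\<in>S. c i / d i)) *
        ((\<Prod>i\<in>S. fps_const (fls_const (d i / c i))) * (\<Prod>i\<in>S. theta (fls_const (c i) * y) / theta (fls_const (d i) * y)))) (- n)"
    unfolding mode_const_mult[symmetric] prod.distrib[symmetric] using m by (simp cong: prod.cong)
  also have "\<dots> = mode (\<Prod>i\<in>S. theta (fls_const (c i) * y) / theta (fls_const (d i) * y)) (- n)"
    unfolding mult.assoc[symmetric] one by simp
  finally have B: "fps_const (\<Prod>i\<in>S. c i / d i)
      * mode (\<Prod>i\<in>S. theta (fls_const (1 / c i) * fls_X) / theta (fls_const (1 / d i) * fls_X)) (- n)
    = mode (\<Prod>i\<in>S. theta (fls_const (c i) * y) / theta (fls_const (d i) * y)) (- n)" .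
  define r where "r k = (\<Prod>i\<in>S - {k}. inverse (1 - d i / d k))" for k
  define F where "F = laurent_num c d S"
  have Q: "(\<Prod>i\<in>S. theta (fls_const (c i) * x) / theta (fls_const (d i) * x)) $ j
     = (\<Sum>k\<in>S. fls_const (r k) * (fl.ev x (F $ j) * inverse (1 - fls_const (d k) * x)))"
    if "x \<noteq> 0" "\<And>i. i \<in> S \<Longrightarrow> fls_const (d i) * x \<noteq> 1" for x j
  proof -
    have "(\<Prod>i\<in>S. theta (fls_const (c i) * x) / theta (fls_const (d i) * x))
      = fmap (fl.ev x) F * fps_const (\<Prod>i\<in>S. inverse (1 - fls_const (d i) * x))"
      unfolding F_def by (rule fl.theta_quotient) (use S c0 d0 that in auto)
    also have "(\<Prod>i\<in>S. inverse (1 - fls_const (d i) * x)) = (\<Sum>k\<in>S. fls_const (r k) * inverse (1 - fls_const (d k) * x))"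
      unfolding r_def by (rule fl.partial_fractions) (use S c0 d0 that in auto)
    finally show ?thesis by (simp add: sum_distrib_left mult_ac)
  qed
  have Qy: "(\<Prod>i\<in>S. theta (fls_const (c i) * y) / theta (fls_const (d i) * y)) $ j
     = (\<Sum>k\<in>S. fls_const (r k) * (fl.ev y (F $ j) * inverse (1 - fls_const (d k) * y)))" for j
    by (rule Q) (use y n2 d0 in auto)
  show ?thesis
    unfolding B
  proof (rule fps_ext)
    fix j
    have "(mode (\<Prod>i\<in>S. theta (fls_const (c i) * fls_X) / theta (fls_const (d i) * fls_X)) n
        - mode (\<Prod>i\<in>S. theta (fls_const (c i) * y) / theta (fls_const (d i) * y)) (- n)) $ j
      = (\<Sum>k\<in>S. r k * ((fl.ev fls_X (F $ j) * inverse (1 - fls_const (d k) * fls_X)) $$ n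
        - (fl.ev y (F $ j) * inverse (1 - fls_const (d k) * y)) $$ (- n)))"
      unfolding mode_def fps_sub_nth fps_nth_Abs_fps Q[OF fls_X_nonzero n1] Qy
        fls_nth_sum fls_mult_const_nth right_diff_distrib sum_subtractf
      by simp
    also have "\<dots> = (\<Sum>k\<in>S. r k * (d k powi n * cfid.ev (1 / d k) (F $ j)))"
      unfolding y_def by (intro sum.cong refl arg_cong2[of _ _ _ _ "(*)"] expansion_difference d0)
    also have "\<dots> = (\<Sum>k\<in>S. fps_const (d k powi n) * (fps_const (r k) * fmap (cfid.ev (1 / d k)) F)) $ j"
      by (simp add: fps_sum_nth mult_ac)
    also have "\<dots> = (\<Sum>k\<in>S. fps_const (d k powi n) * theta_residue c d S k) $ j"
      unfolding r_def F_def using laurent_num_residue[OF S(1) _ S(3) c0 d0] by (simp cong: sum.cong)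
    finally show "(mode (\<Prod>i\<in>S. theta (fls_const (c i) * fls_X) / theta (fls_const (d i) * fls_X)) n
        - mode (\<Prod>i\<in>S. theta (fls_const (c i) * y) / theta (fls_const (d i) * y)) (- n)) $ j
      = (\<Sum>k\<in>S. fps_const (d k powi n) * theta_residue c d S k) $ j" .
  qed
qed

section \<open>Modes of theta quotients\<close>

text \<open>Nonnegative powers of \<open>fls_X\<close> always form a Laurent series, whatever their
  dependence on p. The negative powers of \<open>dnY\<close> need p-adic convergence, which factors
  p^m provide.\<close>

definition upY :: "complex fps fps \<Rightarrow> complex fls fps"
  where "upY F = Abs_fps (\<lambda>k. fps_to_fls (Abs_fps (\<lambda>j. F $ j $ k)))"

abbreviation dnY :: "complex fps fps \<Rightarrow> complex fls fps"
  where "dnY \<equiv> fl.gev (inverse fls_X)"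

lemma upY_mult: "upY (F * G) = upY F * upY G"
proof (rule fps_ext)
  fix k
  have "Abs_fps (\<lambda>j. (F * G) $ j $ k) = (\<Sum>i=0..k. Abs_fps (\<lambda>j. F $ j $ i) * Abs_fps (\<lambda>j. G $ j $ (k - i)))"
    by (rule fps_ext) (simp add: fps_mult_nth fps_sum_nth, subst sum.swap, rule refl)
  moreover have "fps_to_fls (\<Sum>i\<in>I. H i) = (\<Sum>i\<in>I. fps_to_fls (H i))" for H :: "nat \<Rightarrow> complex fps" and I
    by (induction I rule: infinite_finite_induct) simp_all
  ultimately show "upY (F * G) $ k = (upY F * upY G) $ k"
    by (simp add: upY_def fps_mult_nth fls_times_fps_to_fls)
qed

lemma fls_X_power_nth: "(fls_const c * fls_X ^ j) $$ n = (if n = int j then c else 0)" for c :: complex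
  by (simp add: fls_X_power_conv_shift_1)

lemma upY_eq_gev:
  assumes "pfin (fps_nth F)" shows "upY F = fl.gev fls_X F"
proof (rule fps_ext, rule fls_eqI)
  fix k n
  have p: "pfin (\<lambda>j. fmap fls_const (F $ j) * fps_const (fls_X ^ j))" by (rule fl.pfin_gev[OF assms])
  have "fl.gev fls_X F $ k $$ n = (\<Sum>j\<in>psupp (fps_nth F) k. if n = int j then F $ j $ k else 0)"
    unfolding fl.gev_def
    by (subst csum_nth_superset[OF finite_psupp[OF assms, of k]])
       (auto simp: psupp_def fls_nth_sum fls_X_power_nth simp del: fls_mult_const_nth)
  also have "\<dots> = upY F $ k $$ n"
  proof (cases "n < 0")
    case True
    then show ?thesis by (simp add: upY_def)
  next
    case False
    then have "(\<Sum>j\<in>psupp (fps_nth F) k. if n = int j then F $ j $ k else 0)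
      = (\<Sum>j\<in>psupp (fps_nth F) k. if nat n = j then F $ j $ k else 0)"
      by (intro sum.cong) auto
    also have "\<dots> = F $ nat n $ k"
      by (simp add: finite_psupp[OF assms]) (auto simp: psupp_def)
    finally show ?thesis using False by (simp add: upY_def)
  qed
  finally show "upY F $ k $$ n = fl.gev fls_X F $ k $$ n" ..
qed

lemma mode_upY_dnY:
  assumes "pfin (fps_nth G)"
  shows "mode (upY F * dnY G) n = csum (\<lambda>(i, j). if int i - int j = n then F $ i * G $ j else 0)"
proof (rule fps_ext)
  fix k
  define S where "S = psupp (fps_nth G) k"
  have S: "finite S" by (simp add: S_def finite_psupp assms)
  have G0: "G $ j $ m = 0" if "j \<notin> S" "m \<le> k" for j m using that by (auto simp: S_def psupp_def)
  have d: "dnY G $ m = (\<Sum>j\<in>S. fls_const (G $ j $ m) * fls_X powi (- int j))" if "m \<le> k" for m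
    unfolding fl.gev_def
    by (subst csum_nth_superset[OF S])
       (use that in \<open>auto simp: G0 power_int_minus power_inverse intro!: sum.cong\<close>)
  have "mode (upY F * dnY G) n $ k = (\<Sum>i=0..k. (upY F $ i * dnY G $ (k - i)) $$ n)"
    by (simp add: mode_def fps_mult_nth fls_nth_sum)
  also have "\<dots> = (\<Sum>i=0..k. \<Sum>j\<in>S. G $ j $ (k - i) * upY F $ i $$ (n + int j))"
  proof (rule sum.cong[OF refl])
    fix i assume "i \<in> {0..k}"
    have "upY F $ i * dnY G $ (k - i) = (\<Sum>j\<in>S. fls_const (G $ j $ (k - i)) * fls_X powi (- int j) * upY F $ i)"
      by (simp only: d[OF diff_le_self] sum_distrib_left mult_ac)
    then show "(upY F $ i * dnY G $ (k - i)) $$ n = (\<Sum>j\<in>S. G $ j $ (k - i) * upY F $ i $$ (n + int j))"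
      by (simp only: fls_nth_sum fls_monomial_mult_nth) simp
  qed
  also have "\<dots> = (\<Sum>j\<in>S. \<Sum>i=0..k. if n + int j < 0 then 0 else F $ nat (n + int j) $ i * G $ j $ (k - i))"
    by (subst sum.swap) (auto simp: upY_def intro!: sum.cong)
  also have "\<dots> = (\<Sum>j\<in>S. if n + int j < 0 then 0 else (F $ nat (n + int j) * G $ j) $ k)"
    by (intro sum.cong refl) (simp add: fps_mult_nth)
  also have "\<dots> = (\<Sum>j\<in>{j\<in>S. 0 \<le> n + int j}. (F $ nat (n + int j) * G $ j) $ k)"
    by (subst sum.inter_filter[OF S]) (auto intro!: sum.cong)
  also have "\<dots> = (\<Sum>(i, j)\<in>(\<lambda>j. (nat (n + int j), j)) ` {j\<in>S. 0 \<le> n + int j}. (F $ i * G $ j) $ k)"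
    by (subst sum.reindex) (auto simp: inj_on_def)
  also have "\<dots> = csum (\<lambda>(i, j). if int i - int j = n then F $ i * G $ j else 0) $ k"
  proof (subst csum_nth_superset[of "(\<lambda>j. (nat (n + int j), j)) ` {j\<in>S. 0 \<le> n + int j}"])
    fix x assume x: "x \<notin> (\<lambda>j. (nat (n + int j), j)) ` {j\<in>S. 0 \<le> n + int j}"
    show "(case x of (i, j) \<Rightarrow> if int i - int j = n then F $ i * G $ j else 0) $ k = 0"
    proof (cases x)
      case (Pair i j)
      show ?thesis
      proof (cases "int i - int j = n")
        case True
        then have "j \<notin> S" using x Pair by (force simp: image_iff)
        then show ?thesis using Pair by (auto simp: fps_mult_nth G0 intro!: sum.neutral)
      qed (simp add: Pair)
    qed
  qed (use S in \<open>auto intro!: sum.cong\<close>)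
  finally show "mode (upY F * dnY G) n $ k = csum (\<lambda>(i, j). if int i - int j = n then F $ i * G $ j else 0) $ k" .
qed

lemma theta_mon:
  assumes "c \<noteq> 0"
  shows "theta (fls_const c * fls_X) = upY (eulE (fps_const c)) * dnY (eulE (fps_const (1 / c) * fps_X))"
proof -
  have "inverse (fls_const c * fls_X) = fls_const (1 / c) * inverse fls_X"
    by (simp only: fl.divide inverse_mult_distrib fl.one) (simp only: divide_inverse mult_1)
  then have i: "fps_const (inverse (fls_const c * fls_X)) * fps_X
     = fmap fls_const (fps_const (1 / c) * fps_X) * fps_const (inverse fls_X)"
    by (simp only: fl.fh.mult fl.fmap_const fl.fmap_X fps_const_mult[symmetric] mult_ac)
  have "fps_const (fls_const c * fls_X) = fmap fls_const (fps_const c) * fps_const fls_X"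
    by (simp only: fl.fmap_const fps_const_mult)
  then show ?thesis
    unfolding theta_def i upY_eq_gev[OF pfin_eulE] fl.gev_eulE by (simp only:)
qed

lemma pfin_gexp_lg_X: "pfin (fps_nth (gexp (lg (c * fps_X) - lg (d * fps_X))))"
  by (simp add: lg_mult_X flip: qscale_diff) (simp add: qscale_gexp pfin_qscale)

lemma gexp_lg_diff: "gexp (lg d - lg c) * eulE d = eulE c"
  by (simp add: gexp_lg[symmetric] gexp_add[symmetric])

lemma fl_const_X_neq_1: "fls_const a * fls_X \<noteq> (1 :: complex fls)"
proof
  assume "fls_const a * fls_X = (1 :: complex fls)"
  then have "(fls_const a * fls_X) $$ 0 = (1 :: complex fls) $$ 0" by simp
  then show False by simp
qed

text \<open>The logarithm of a theta quotient splits into positive powers of \<open>fls_X\<close>,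
  from the factors (c x; p), and negative ones, from (p / (c x); p). These become the two
  exponentials of a psi current.\<close>

lemma theta_ratio:
  assumes "c \<noteq> 0" "d \<noteq> 0"
  shows "theta (fls_const c * fls_X) / theta (fls_const d * fls_X)
    = upY (gexp (lg (fps_const d) - lg (fps_const c)))
      * dnY (gexp (lg (fps_const (1 / d) * fps_X) - lg (fps_const (1 / c) * fps_X)))"
proof -
  let ?u = "gexp (lg (fps_const d) - lg (fps_const c))"
  let ?v = "gexp (lg (fps_const (1 / d) * fps_X) - lg (fps_const (1 / c) * fps_X))"
  have "upY ?u * dnY ?v * theta (fls_const d * fls_X) = (upY ?u * upY (eulE (fps_const d))) * (dnY ?v * dnY (eulE (fps_const (1 / d) * fps_X)))"
    unfolding theta_mon[OF assms(2)] by (simp only: mult_ac)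
  also have "\<dots> = theta (fls_const c * fls_X)"
    unfolding upY_mult[symmetric] fl.gev_mult[OF pfin_gexp_lg_X pfin_eulE, symmetric] gexp_lg_diff
    by (simp only: theta_mon[OF assms(1)])
  finally have *: "upY ?u * dnY ?v * theta (fls_const d * fls_X) = theta (fls_const c * fls_X)" .
  have u: "theta (fls_const d * fls_X) $ 0 \<noteq> (0 :: complex fls)"
    using fl_const_X_neq_1[of d] by (simp add: fl.theta_unit)
  have "theta (fls_const d * fls_X) * inverse (theta (fls_const d * fls_X)) = (1 :: complex fls fps)"
    by (rule inverse_mult_eq_1') (rule u)
  then show ?thesis
    unfolding fps_divide_unit[OF u] *[symmetric] by (simp only: mult.assoc mult_1_right)
qed

lemma upY_one: "upY 1 = 1"
proof (rule fps_ext)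
  fix k
  have "Abs_fps (\<lambda>j. (1 :: complex fps fps) $ j $ k) = (if k = 0 then 1 else 0)"
    by (rule fps_ext) simp
  then show "upY 1 $ k = 1 $ k" by (simp add: upY_def)
qed

lemma theta_ratio_prod:
  assumes "finite S" "\<And>i. i \<in> S \<Longrightarrow> c i \<noteq> 0" "\<And>i. i \<in> S \<Longrightarrow> d i \<noteq> 0"
  defines "P \<equiv> \<lambda>S. \<Sum>i\<in>S. lg (fps_const (d i)) - lg (fps_const (c i))"
    and "M \<equiv> \<lambda>S. \<Sum>i\<in>S. lg (fps_const (1 / d i) * fps_X) - lg (fps_const (1 / c i) * fps_X)"
  shows "(\<Prod>i\<in>S. theta (fls_const (c i) * fls_X) / theta (fls_const (d i) * fls_X))
    = upY (gexp (P S)) * dnY (gexp (M S))" and "pfin (fps_nth (gexp (M S)))"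
proof -
  have "(\<Prod>i\<in>S. theta (fls_const (c i) * fls_X) / theta (fls_const (d i) * fls_X))
    = upY (gexp (P S)) * dnY (gexp (M S)) \<and> pfin (fps_nth (gexp (M S)))"
    using assms(1-3)
  proof (induction S rule: finite_induct)
    case empty
    have "pfin (fps_nth (1 :: complex fps fps))"
      by (rule pfin_finite, rule finite_subset[of _ "{0}"]) auto
    then show ?case
      unfolding P_def M_def sum.empty prod.empty gexp_zero upY_one fl.gev_1 by (simp only: mult_1 simp_thms)
  next
    case (insert i S)
    have a: "gexp (P (insert i S)) = gexp (lg (fps_const (d i)) - lg (fps_const (c i))) * gexp (P S)"
      unfolding P_def sum.insert[OF insert(1,2)] by (rule gexp_add) (simp_all add: fps_sum_nth)
    have b: "gexp (M (insert i S)) = gexp (lg (fps_const (1 / d i) * fps_X) - lg (fps_const (1 / c i) * fps_X)) * gexp (M S)"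
      unfolding M_def sum.insert[OF insert(1,2)] by (rule gexp_add) (simp_all add: fps_sum_nth)
    have IH: "(\<Prod>i\<in>S. theta (fls_const (c i) * fls_X) / theta (fls_const (d i) * fls_X))
        = upY (gexp (P S)) * dnY (gexp (M S))" "pfin (fps_nth (gexp (M S)))"
      using insert by auto
    have "c i \<noteq> 0" "d i \<noteq> 0" using insert by auto
    then show ?case
      unfolding a b prod.insert[OF insert(1,2)] IH theta_ratio[OF \<open>c i \<noteq> 0\<close> \<open>d i \<noteq> 0\<close>]
        upY_mult fl.gev_mult[OF pfin_gexp_lg_X IH(2)]
      by (intro conjI pfin_mult_series[OF pfin_gexp_lg_X IH(2)]) (simp only: mult_ac)
  qed
  then show "(\<Prod>i\<in>S. theta (fls_const (c i) * fls_X) / theta (fls_const (d i) * fls_X))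
    = upY (gexp (P S)) * dnY (gexp (M S))" "pfin (fps_nth (gexp (M S)))" by auto
qed

text \<open>The exponents of the four half currents in terms of the eigenvalues \<open>e\<close> of the \<open>\<alpha>\<^sub>m\<close>.\<close>

definition half_exp :: "(int \<Rightarrow> complex) \<Rightarrow> complex fps fps"
  where "half_exp e = Abs_fps (\<lambda>m. if m = 0 then 0 else inverse (1 - fps_X ^ m) * fps_const (e (int m)))"

definition half_exp_p :: "(int \<Rightarrow> complex) \<Rightarrow> complex fps fps"
  where "half_exp_p e = qscale (half_exp e)"

definition spec :: "('i \<Rightarrow> complex) \<Rightarrow> ('i \<Rightarrow> complex) \<Rightarrow> 'i set \<Rightarrow> int \<Rightarrow> complex"
  where "spec c d S m = (\<Sum>i\<in>S. d i powi m - c i powi m) / of_int m"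

lemma fps_const_sum: "fps_const (\<Sum>i\<in>S. g i) = (\<Sum>i\<in>S. fps_const (g i))"
  by (induction S rule: infinite_finite_induct) (simp_all flip: fps_const_add)

lemma half_exp_spec:
  "(\<Sum>i\<in>S. lg (fps_const (d i)) - lg (fps_const (c i))) = half_exp (spec c d S)"
proof (rule fps_ext)
  fix m
  show "(\<Sum>i\<in>S. lg (fps_const (d i)) - lg (fps_const (c i))) $ m = half_exp (spec c d S) $ m"
  proof (cases "m = 0")
    case False
    have "lg (fps_const a) $ m = fps_const (a powi int m / of_nat m) * inverse (1 - fps_X ^ m)" for a
      using False by (simp add: lg_def fps_const_power flip: fps_const_mult)
    then have "(\<Sum>i\<in>S. lg (fps_const (d i)) - lg (fps_const (c i))) $ m
      = (\<Sum>i\<in>S. fps_const ((d i powi int m - c i powi int m) / of_nat m) * inverse (1 - fps_X ^ m))"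
      by (simp add: fps_sum_nth diff_divide_distrib left_diff_distrib flip: fps_const_sub)
    also have "\<dots> = fps_const (\<Sum>i\<in>S. (d i powi int m - c i powi int m) / of_nat m) * inverse (1 - fps_X ^ m)"
      by (simp only: fps_const_sum sum_distrib_right)
    finally show ?thesis using False
      by (simp add: half_exp_def spec_def sum_divide_distrib mult.commute)
  qed (simp add: half_exp_def fps_sum_nth)
qed

text \<open>Inverting zeros and poles replaces m by -m. This is why one family of eigenvalues serves
  both psi currents.\<close>

lemma spec_inverse:
  "spec (\<lambda>i. 1 / c i) (\<lambda>i. 1 / d i) S m = - spec c d S (- m)"
  by (simp add: spec_def power_int_divide_distrib power_int_minus inverse_eq_divide)

lemma half_exp_0 [simp]: "half_exp e $ 0 = 0" "half_exp_p e $ 0 = 0"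
  by (simp_all add: half_exp_def half_exp_p_def)

lemma mode_theta_product:
  assumes "finite S" "\<And>i. i \<in> S \<Longrightarrow> c i \<noteq> 0" "\<And>i. i \<in> S \<Longrightarrow> d i \<noteq> 0"
  shows "mode (\<Prod>i\<in>S. theta (fls_const (c i) * fls_X) / theta (fls_const (d i) * fls_X)) n
    = csum (\<lambda>(i, j). if int i - int j = n
        then gexp (half_exp (spec c d S)) $ i * gexp (half_exp_p (\<lambda>m. - spec c d S (- m))) $ j else 0)"
proof -
  have M: "(\<Sum>i\<in>S. lg (fps_const (1 / d i) * fps_X) - lg (fps_const (1 / c i) * fps_X))
     = half_exp_p (\<lambda>m. - spec c d S (- m))"
  proof -
    have q: "(\<Sum>i\<in>I. qscale (h i)) = qscale (\<Sum>i\<in>I. h i)" for I and h :: "'a \<Rightarrow> _"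
      by (induction I rule: infinite_finite_induct) (auto simp: qscale_add intro!: fps_ext)
    show ?thesis
      unfolding half_exp_p_def lg_mult_X qscale_diff[symmetric] q spec_inverse[symmetric] half_exp_spec ..
  qed
  have "(\<Prod>i\<in>S. theta (fls_const (c i) * fls_X) / theta (fls_const (d i) * fls_X))
    = upY (gexp (half_exp (spec c d S))) * dnY (gexp (half_exp_p (\<lambda>m. - spec c d S (- m))))"
    unfolding M[symmetric] half_exp_spec[symmetric] by (rule theta_ratio_prod(1)) (use assms in auto)
  moreover have "pfin (fps_nth (gexp (half_exp_p (\<lambda>m. - spec c d S (- m)))))"
    unfolding M[symmetric] by (rule theta_ratio_prod(2)) (use assms in auto)
  ultimately show ?thesis by (simp only: mode_upY_dnY)
qed

section \<open>Raising and lowering amplitudes\<close>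

definition ampP :: "complex \<Rightarrow> complex \<Rightarrow> (nat \<Rightarrow> complex) \<Rightarrow> nat \<Rightarrow> complex fps"
  where "ampP q t V i = (\<Prod>j\<in>{1..<i}. thf q t (V i / V j))"

text \<open>Half of a theta quotient: the last row, with content \<open>w\<close>, occurs in only
  one of the two products of A^-.\<close>

definition ampE :: "complex \<Rightarrow> complex \<Rightarrow> complex \<Rightarrow> complex \<Rightarrow> complex fps"
  where "ampE q t w x = theta (t * w / (q * x)) * inverse (theta (w / x))"

text \<open>The amplitude of removing the box in row \<open>i\<close> that \<open>V\<close> does not yet contain.\<close>

definition ampM :: "complex \<Rightarrow> complex \<Rightarrow> nat \<Rightarrow> (nat \<Rightarrow> complex) \<Rightarrow> nat \<Rightarrow> complex fps"
  where "ampM q t N V i = ampE q t (V (N + 1)) (V i) * (\<Prod>j\<in>{i<..N}. thf q t (V i / V j))"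

text \<open>The constant common to all residues of the psi eigenvalue; \<open>a_plus_minus\<close>
  matches it with the normalisations of the two currents.\<close>

definition kap0 :: "complex \<Rightarrow> complex \<Rightarrow> complex fps"
  where "kap0 q t = theta t * theta (q / t) * inverse (theta q) * inverse (qp 1 * qp 1)"

text \<open>The psi eigenvalue is a product over rows 1..N times one over rows 1..N+1; the disjoint
  sum merges them into one product with equally many zeros and poles.\<close>

definition idx :: "nat \<Rightarrow> (nat + nat) set"
  where "idx N = {1..N} <+> {1..N + 1}"

definition numc :: "complex \<Rightarrow> complex \<Rightarrow> (nat \<Rightarrow> complex) \<Rightarrow> nat + nat \<Rightarrow> complex"
  where "numc q t V = case_sum (\<lambda>i. V i / t) (\<lambda>i. t * V i / q)"

definition denc :: "complex \<Rightarrow> (nat \<Rightarrow> complex) \<Rightarrow> nat + nat \<Rightarrow> complex"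
  where "denc q V = case_sum (\<lambda>i. V i / q) V"

lemma prod_Plus: "finite A \<Longrightarrow> finite B \<Longrightarrow> prod g (A <+> B) = prod (g \<circ> Inl) A * prod (g \<circ> Inr) B"
  by (rule prod.Plus)

lemma finite_idx [simp]: "finite (idx N)"
  by (simp add: idx_def)

context generic_params
begin

definition genV :: "nat \<Rightarrow> (nat \<Rightarrow> complex) \<Rightarrow> bool"
  where "genV N V \<longleftrightarrow> (\<forall>i\<in>{1..N+1}. V i \<noteq> 0) \<and> (\<forall>i\<in>{1..N+1}. \<forall>j\<in>{1..N+1}. i \<noteq> j \<longrightarrow> lp (V i / V j))"

lemma genVD:
  assumes "genV N V" "i \<in> {1..N+1}"
  shows "V i \<noteq> 0" "j \<in> {1..N+1} \<Longrightarrow> i \<noteq> j \<Longrightarrow> lp (V i / V j)"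
  using assms by (auto simp: genV_def)

lemma q_neq_1: "q \<noteq> 1" and t_neq_1: "t \<noteq> 1" and q_neq_t: "q \<noteq> t"
proof -
  have "\<not> (q powi a * t powi b = 1)" if "a \<noteq> 0 \<or> b \<noteq> 0" for a b using gen that by (auto simp: generic_def)
  from this[of 1 0] this[of 0 1] this[of 1 "- 1"] show "q \<noteq> 1" "t \<noteq> 1" "q \<noteq> t"
    using t0 by (auto simp: power_int_minus)
qed

lemma thf_expand:
  assumes "lp x"
  shows "thf q t x = theta (t * x) * theta (q / t * x) * inverse (theta (q * x)) * inverse (theta x)"
proof -
  have "(theta (q * x) * theta x) $ 0 \<noteq> 0" using lp_neq[OF assms] by (simp add: theta_nth_0)
  then show ?thesis
    unfolding thf_theta[OF assms] by (subst fps_divide_unit) (simp_all add: fps_inverse_mult mult_ac)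
qed

lemma thf_flip:
  assumes "lp x"
  shows "thf q t (1 / x) = theta (x / t) * theta (t * x / q) * inverse (theta (x / q)) * inverse (theta x)"
proof -
  have a: "t * (x / q) = t * x / q" "q / t * (x / q) = x / t" "q * (x / q) = x" using q0 by auto
  show ?thesis
    unfolding thf_inverse[OF assms] thf_expand[OF lp_div[OF assms]] a by (simp only: mult_ac)
qed

lemma thf_flip_div:
  assumes "lp x"
  shows "thf q t (1 / (q * x)) = thf q t x"
  using thf_inverse[OF lp_mult[OF assms]] q0 by simp

lemma split_range: "k \<in> {1..N} \<Longrightarrow> (\<Prod>j\<in>{1..<k}. g j) * (\<Prod>j\<in>{k<..N}. g j) = (\<Prod>j\<in>{1..N} - {k}. g j)"
  for g :: "nat \<Rightarrow> complex fps"
  by (subst prod.union_disjoint[symmetric]) (auto intro: prod.cong)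

lemma prod4:
  fixes a b c d :: "nat \<Rightarrow> complex fps"
  shows "(\<Prod>j\<in>R. a j * b j * inverse (c j) * inverse (d j))
    = prod a R * prod b R * inverse (prod c R) * inverse (prod d R)"
  by (simp add: prod.distrib fps_inverse_prod)

text \<open>The pole at V k belongs to adding a box in row k and removing it again, whence both
  amplitudes at \<open>V\<close>.\<close>

lemma residue_Inr:
  assumes V: "genV N V" and k: "k \<in> {1..N}"
  shows "theta_residue (numc q t V) (denc q V) (idx N) (Inr k) = - (kap0 q t * (ampP q t V k * ampM q t N V k))"
proof -
  let ?R = "{1..N} - {k}"
  define A where "A j = theta (V j / V k / t)" for j
  define B where "B j = theta (t * (V j / V k) / q)" for j
  define C where "C j = theta (V j / V k / q)" for j
  define D where "D j = theta (V j / V k)" for j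
  have k0: "V k \<noteq> 0" using V k by (auto simp: genV_def)
  have f: "thf q t (V k / V j) = A j * B j * inverse (C j) * inverse (D j)" if "j \<in> ?R" for j
  proof -
    have l: "lp (V j / V k)" using V k that by (auto simp: genV_def)
    have "V k / V j = 1 / (V j / V k)" by simp
    then show ?thesis unfolding A_def B_def C_def D_def by (simp only: thf_flip[OF l])
  qed
  have S: "idx N - {Inr k} = {1..N} <+> ({1..N+1} - {k})" by (auto simp: idx_def)
  have I: "{1..N+1} - {k} = insert (N+1) ?R" using k by auto
  have R1: "prod g {1..N} = g k * prod g ?R" for g :: "nat \<Rightarrow> complex fps"
    by (subst prod.remove[of _ k]) (use k in auto)
  have R2: "prod g {1..N+1} = g (N+1) * (g k * prod g ?R)" for g :: "nat \<Rightarrow> complex fps"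
    using R1[of g] by simp
  have R3: "prod g ({1..N+1} - {k}) = g (N+1) * prod g ?R" for g :: "nat \<Rightarrow> complex fps"
    unfolding I by (subst prod.insert) auto
  have num: "(\<Prod>i\<in>idx N. theta (numc q t V i / denc q V (Inr k)))
     = (theta (1 / t) * prod A ?R) * (B (N+1) * (theta (t / q) * prod B ?R))"
    unfolding idx_def prod_Plus[OF finite_atLeastAtMost finite_atLeastAtMost] R1 R2
    using k0 by (simp add: numc_def denc_def o_def A_def B_def mult_ac)
  have den: "(\<Prod>i\<in>idx N - {Inr k}. theta (denc q V i / denc q V (Inr k)))
     = (theta (1 / q) * prod C ?R) * (D (N+1) * prod D ?R)"
    unfolding S prod_Plus[OF finite_atLeastAtMost finite_Diff[OF finite_atLeastAtMost]] R1 R3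
    using k0 by (simp add: denc_def o_def C_def D_def mult_ac)
  have "ampP q t V k * ampM q t N V k = ampE q t (V (N+1)) (V k) * ((\<Prod>j\<in>{1..<k}. thf q t (V k / V j)) * (\<Prod>j\<in>{k<..N}. thf q t (V k / V j)))"
    by (simp add: ampP_def ampM_def mult_ac)
  also have "\<dots> = ampE q t (V (N+1)) (V k) * (\<Prod>j\<in>?R. A j * B j * inverse (C j) * inverse (D j))"
    unfolding split_range[OF k] by (intro arg_cong2[of _ _ _ _ "(*)"] refl prod.cong) (rule f)
  also have "\<dots> = B (N+1) * inverse (D (N+1)) * (prod A ?R * prod B ?R * inverse (prod C ?R) * inverse (prod D ?R))"
    unfolding prod4 by (simp add: ampE_def B_def D_def mult_ac)
  finally have amp: "ampP q t V k * ampM q t N V k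
    = B (N+1) * inverse (D (N+1)) * (prod A ?R * prod B ?R * inverse (prod C ?R) * inverse (prod D ?R))" .
  \<comment> \<open>The source of the minus sign: inverting the arguments t, q/t and q gives
    (-1/t)(-t/q)/(-1/q) = -1.\<close>
  have th: "theta (1 / t) * theta (t / q) * inverse (theta (1 / q)) = - (theta t * theta (q / t) * inverse (theta q))"
  proof -
    have "theta (1 / (q / t)) = fps_const (- 1 / (q / t)) * theta (q / t)"
      by (rule theta_inverse) (use q0 t0 in auto)
    then have a: "theta (t / q) = fps_const (- t / q) * theta (q / t)" by simp
    have b: "theta (1 / t) = fps_const (- 1 / t) * theta t" "theta (1 / q) = fps_const (- 1 / q) * theta q"
      by (rule theta_inverse, rule t0, rule theta_inverse, rule q0)
    have c: "fps_const (- 1 / t) * fps_const (- t / q) * inverse (fps_const (- 1 / q)) = - 1"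
      using q0 t0 by (simp add: fps_const_inverse)
    have "theta (1 / t) * theta (t / q) * inverse (theta (1 / q))
      = (fps_const (- 1 / t) * fps_const (- t / q) * inverse (fps_const (- 1 / q))) * (theta t * theta (q / t) * inverse (theta q))"
      unfolding a b fps_inverse_mult by (simp only: mult_ac)
    then show ?thesis unfolding c by simp
  qed
  have "theta_residue (numc q t V) (denc q V) (idx N) (Inr k)
    = (theta (1 / t) * theta (t / q) * inverse (theta (1 / q))) * inverse (qp 1 * qp 1) * (ampP q t V k * ampM q t N V k)"
    unfolding theta_residue_def num den amp fps_inverse_mult by (simp only: mult_ac)
  then show ?thesis unfolding th by (simp add: kap0_def mult_ac)
qed

text \<open>The pole at V k / q belongs to removing a box from row k and adding it again;
  \<open>W\<close> is the configuration without that box.\<close>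

lemma residue_Inl:
  assumes V: "genV N V" and k: "k \<in> {1..N}"
  defines "W \<equiv> V(k := V k / q)"
  shows "theta_residue (numc q t V) (denc q V) (idx N) (Inl k) = kap0 q t * (ampP q t W k * ampM q t N W k)"
proof -
  let ?R = "{1..N} - {k}"
  define A where "A j = theta (q / t * (V j / V k))" for j
  define B where "B j = theta (t * (V j / V k))" for j
  define C where "C j = theta (V j / V k)" for j
  define D where "D j = theta (q * (V j / V k))" for j
  have k0: "V k \<noteq> 0" using V k by (auto simp: genV_def)
  have f: "thf q t (W k / W j) = A j * B j * inverse (C j) * inverse (D j)" if "j \<in> ?R" for j
  proof -
    have l: "lp (V j / V k)" using V k that by (auto simp: genV_def)
    have "W k / W j = 1 / (q * (V j / V k))" using that by (simp add: W_def)
    then show ?thesis unfolding A_def B_def C_def D_def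
      by (simp only: thf_flip_div[OF l] thf_expand[OF l] mult_ac)
  qed
  have S: "idx N - {Inl k} = ?R <+> {1..N+1}" by (auto simp: idx_def)
  have nk: "N + 1 \<noteq> k" using k by auto
  have R1: "prod g {1..N} = g k * prod g ?R" for g :: "nat \<Rightarrow> complex fps"
    by (subst prod.remove[of _ k]) (use k in auto)
  have R2: "prod g {1..N+1} = g (N+1) * (g k * prod g ?R)" for g :: "nat \<Rightarrow> complex fps"
    using R1[of g] by simp
  have num: "(\<Prod>i\<in>idx N. theta (numc q t V i / denc q V (Inl k)))
     = (theta (q / t) * prod A ?R) * (B (N+1) * (theta t * prod B ?R))"
    unfolding idx_def prod_Plus[OF finite_atLeastAtMost finite_atLeastAtMost] R1 R2
    using k0 q0 by (simp add: numc_def denc_def o_def A_def B_def mult_ac)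
  have den: "(\<Prod>i\<in>idx N - {Inl k}. theta (denc q V i / denc q V (Inl k)))
     = prod C ?R * (D (N+1) * (theta q * prod D ?R))"
    unfolding S prod_Plus[OF finite_Diff[OF finite_atLeastAtMost] finite_atLeastAtMost] R2
    using k0 q0 by (simp add: denc_def o_def C_def D_def mult_ac)
  have "ampP q t W k * ampM q t N W k = ampE q t (W (N+1)) (W k) * ((\<Prod>j\<in>{1..<k}. thf q t (W k / W j)) * (\<Prod>j\<in>{k<..N}. thf q t (W k / W j)))"
    by (simp add: ampP_def ampM_def mult_ac)
  also have "\<dots> = ampE q t (W (N+1)) (W k) * (\<Prod>j\<in>?R. A j * B j * inverse (C j) * inverse (D j))"
    unfolding split_range[OF k] by (intro arg_cong2[of _ _ _ _ "(*)"] refl prod.cong) (rule f)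
  also have "\<dots> = B (N+1) * inverse (D (N+1)) * (prod A ?R * prod B ?R * inverse (prod C ?R) * inverse (prod D ?R))"
    unfolding prod4 using nk q0 by (simp add: ampE_def B_def D_def W_def mult_ac)
  finally have amp: "ampP q t W k * ampM q t N W k
    = B (N+1) * inverse (D (N+1)) * (prod A ?R * prod B ?R * inverse (prod C ?R) * inverse (prod D ?R))" .
  show ?thesis
    unfolding theta_residue_def num den amp fps_inverse_mult kap0_def by (simp only: mult_ac)
qed

text \<open>When rows N and N+1 are equally long no box can be added in row N+1: its pole meets the
  zero V N / t of the numerator.\<close>

lemma residue_last:
  assumes "1 \<le> N" "V (N + 1) = V N / t" "V N \<noteq> 0"
  shows "theta_residue (numc q t V) (denc q V) (idx N) (Inr (N + 1)) = 0"
proof -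
  have "theta (numc q t V (Inl N) / denc q V (Inr (N + 1))) = 0"
    using assms t0 by (simp add: numc_def denc_def)
  moreover have "Inl N \<in> idx N" using assms by (auto simp: idx_def)
  ultimately have "(\<Prod>i\<in>idx N. theta (numc q t V i / denc q V (Inr (N + 1)))) = 0"
    by (intro prod_zero) (auto simp: finite_idx)
  then show ?thesis by (simp add: theta_residue_def)
qed

lemma a_plus_minus:
  "a_plus q t * a_minus q t = fps_const ((1 - q) * (1 - 1 / t) / (1 - q / t)) * kap0 q t"
proof -
  have X: "qpoch fps_X = qp 1" by (simp add: qp_def)
  have u1: "(qp 1 * qp (1 / q)) $ 0 \<noteq> 0" "(qp 1 * qp q) $ 0 \<noteq> 0" by simp_all
  have n: "1 - q \<noteq> 0" "1 - q / t \<noteq> 0" using q_neq_1 q_neq_t t0 by auto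
  have p: "a_plus q t = fps_const (1 - t) * (qp (t / q) * qp (1 / t)) * inverse (qp 1 * qp (1 / q))"
    unfolding a_plus_def X qp_def[symmetric] by (rule fps_divide_unit[OF u1(1)])
  have m: "a_minus q t = fps_const (1 - 1 / t) * (qp (q / t) * qp t) * inverse (qp 1 * qp q)"
    unfolding a_minus_def X qp_def[symmetric] by (rule fps_divide_unit[OF u1(2)])
  have i: "inverse (theta q) = fps_const (1 / (1 - q)) * inverse (qp q) * inverse (qp (1 / q))"
    unfolding theta_qp fps_inverse_mult by (simp add: fps_const_inverse inverse_eq_divide)
  have *: "a * c / b * d * b * (1 / a) = d * c" if "a \<noteq> 0" "b \<noteq> 0" for a b c d :: complex
    using that by simp
  have c: "fps_const ((1 - q) * (1 - 1 / t) / (1 - q / t)) * fps_const (1 - t) * fps_const (1 - q / t) * fps_const (1 / (1 - q))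
     = fps_const (1 - t) * fps_const (1 - 1 / t)"
    unfolding fps_const_mult by (rule arg_cong[of _ _ fps_const], rule *[OF n])
  have "fps_const ((1 - q) * (1 - 1 / t) / (1 - q / t)) * kap0 q t
    = (fps_const ((1 - q) * (1 - 1 / t) / (1 - q / t)) * fps_const (1 - t) * fps_const (1 - q / t) * fps_const (1 / (1 - q)))
      * (qp t * qp (1 / t) * qp (q / t) * qp (1 / (q / t)) * inverse (qp q) * inverse (qp (1 / q)) * inverse (qp 1 * qp 1))"
    unfolding kap0_def i unfolding theta_qp by (simp only: mult_ac)
  also have "\<dots> = a_plus q t * a_minus q t"
    unfolding c p m fps_inverse_mult by (simp add: mult_ac)
  finally show ?thesis ..
qed

section \<open>Difference of the two psi eigenvalues\<close>

definition Bp :: "nat \<Rightarrow> (nat \<Rightarrow> complex) \<Rightarrow> complex fls fps"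
  where "Bp N V = (\<Prod>i\<in>idx N. theta (fls_const (numc q t V i) * fls_X) / theta (fls_const (denc q V i) * fls_X))"

definition Bm :: "nat \<Rightarrow> (nat \<Rightarrow> complex) \<Rightarrow> complex fls fps"
  where "Bm N V = (\<Prod>i\<in>idx N. theta (fls_const (1 / numc q t V i) * fls_X) / theta (fls_const (1 / denc q V i) * fls_X))"

lemma numc_denc_nonzero:
  assumes "genV N V" "i \<in> idx N" shows "numc q t V i \<noteq> 0" "denc q V i \<noteq> 0"
  using assms q0 t0 by (auto simp: genV_def idx_def numc_def denc_def)

lemma inj_denc:
  assumes "genV N V" shows "inj_on (denc q V) (idx N)"
proof (rule inj_onI)
  fix x y assume xy: "x \<in> idx N" "y \<in> idx N" "denc q V x = denc q V y"
  have 1: "i = j" if "V i = V j" "i \<in> {1..N+1}" "j \<in> {1..N+1}" for i j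
    using genVD[OF assms that(2)] lp_neq[of "V i / V j"] that by fastforce
  have 2: False if "V i / q = V j" "i \<in> {1..N+1}" "j \<in> {1..N+1}" for i j
  proof (cases "i = j")
    case True
    then show ?thesis using that genVD(1)[OF assms that(2)] q_neq_1 q0 by (simp add: field_simps)
  next
    case False
    have "V i = q * V j" using that(1) q0 by (simp add: field_simps)
    then show ?thesis using genVD(2)[OF assms that(2,3) False] genVD(1)[OF assms that(3)] lp_neq[of "V i / V j"] by simp
  qed
  have 3: False if "V j = V i / q" "i \<in> {1..N+1}" "j \<in> {1..N+1}" for i j
    using 2[of i j] that by simp
  show "x = y" using xy q0 by (auto simp: idx_def denc_def split: sum.splits intro: 1 dest: 2 3)
qed

text \<open>This is s^(-2), the ratio of the prefactors of psi^- and psi^+, so the two weighted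
  eigenvalues are expansions of the same function.\<close>

lemma prod_ratio: "genV N V \<Longrightarrow> (\<Prod>i\<in>idx N. numc q t V i / denc q V i) = t / q"
proof -
  assume V: "genV N V"
  have "(\<Prod>i\<in>idx N. numc q t V i / denc q V i) = (\<Prod>i\<in>{1..N}. q / t) * (\<Prod>i\<in>{1..N+1}. t / q)"
    unfolding idx_def prod_Plus[OF finite_atLeastAtMost finite_atLeastAtMost] o_def
    using V q0 t0 by (intro arg_cong2[of _ _ _ _ "(*)"] prod.cong) (auto simp: genV_def numc_def denc_def)
  also have "\<dots> = t / q" using q0 t0 by (simp add: power_divide)
  finally show ?thesis .
qed

lemma psi_difference:
  assumes V: "genV N V" and N: "1 \<le> N" "V (N + 1) = V N / t" and s: "s^2 = q / t"
  shows "fps_const ((1 - q) * (1 - 1 / t) / (1 - q / t)) *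
      (fps_const s * mode (Bp N V) (- n) - fps_const (inverse s) * mode (Bm N V) n)
    = a_plus q t * a_minus q t * fps_const s *
      ((\<Sum>k\<in>{1..N}. fps_const ((V k / q) powi (- n)) * (ampP q t (V(k := V k / q)) k * ampM q t N (V(k := V k / q)) k))
       - (\<Sum>k\<in>{1..N}. fps_const (V k powi (- n)) * (ampP q t V k * ampM q t N V k)))"
proof -
  have ne: "idx N \<noteq> {}" by (auto simp: idx_def)
  have s0: "s \<noteq> 0" using s q0 t0 by auto
  have "s * (t / q) = inverse s" using s s0 q0 t0 by (simp add: field_simps power2_eq_square)
  then have s': "fps_const (inverse s) = fps_const s * fps_const (t / q)" by simp
  have d: "mode (Bp N V) (- n) - fps_const (t / q) * mode (Bm N V) n
     = (\<Sum>k\<in>idx N. fps_const (denc q V k powi (- n)) * theta_residue (numc q t V) (denc q V) (idx N) k)"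
    using theta_quotient_delta[OF finite_idx ne inj_denc[OF V], of "numc q t V" "- n"] numc_denc_nonzero[OF V]
    by (simp add: prod_ratio[OF V] Bp_def Bm_def)
  have "(\<Sum>k\<in>idx N. fps_const (denc q V k powi (- n)) * theta_residue (numc q t V) (denc q V) (idx N) k)
    = (\<Sum>k\<in>{1..N}. fps_const ((V k / q) powi (- n)) * theta_residue (numc q t V) (denc q V) (idx N) (Inl k))
    + (\<Sum>k\<in>{1..N+1}. fps_const (V k powi (- n)) * theta_residue (numc q t V) (denc q V) (idx N) (Inr k))"
    by (subst (1) idx_def, subst sum.Plus) (simp_all add: o_def denc_def)
  also have "(\<Sum>k\<in>{1..N+1}. fps_const (V k powi (- n)) * theta_residue (numc q t V) (denc q V) (idx N) (Inr k))
    = (\<Sum>k\<in>{1..N}. fps_const (V k powi (- n)) * theta_residue (numc q t V) (denc q V) (idx N) (Inr k))"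
    using residue_last[of N V] N V by (simp add: genV_def)
  also have "\<dots> = - kap0 q t * (\<Sum>k\<in>{1..N}. fps_const (V k powi (- n)) * (ampP q t V k * ampM q t N V k))"
    unfolding sum_distrib_left by (rule sum.cong[OF refl]) (simp add: residue_Inr[OF V] mult_ac)
  also have "(\<Sum>k\<in>{1..N}. fps_const ((V k / q) powi (- n)) * theta_residue (numc q t V) (denc q V) (idx N) (Inl k))
    = kap0 q t * (\<Sum>k\<in>{1..N}. fps_const ((V k / q) powi (- n)) * (ampP q t (V(k := V k / q)) k * ampM q t N (V(k := V k / q)) k))"
    unfolding sum_distrib_left by (rule sum.cong[OF refl]) (simp only: residue_Inl[OF V] mult_ac)
  finally have "mode (Bp N V) (- n) - fps_const (t / q) * mode (Bm N V) n = kap0 q t *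
      ((\<Sum>k\<in>{1..N}. fps_const ((V k / q) powi (- n)) * (ampP q t (V(k := V k / q)) k * ampM q t N (V(k := V k / q)) k))
       - (\<Sum>k\<in>{1..N}. fps_const (V k powi (- n)) * (ampP q t V k * ampM q t N V k)))"
    unfolding d by (simp only: distrib_left mult_minus_left mult_minus_right diff_conv_add_uminus)
  moreover have "fps_const s * mode (Bp N V) (- n) - fps_const (inverse s) * mode (Bm N V) n
     = fps_const s * (mode (Bp N V) (- n) - fps_const (t / q) * mode (Bm N V) n)"
    unfolding s' by (simp only: right_diff_distrib mult.assoc)
  ultimately show ?thesis unfolding a_plus_minus by (simp only: mult_ac)
qed

text \<open>Only factors between rows \<open>i\<close> and \<open>j\<close> can differ. If j < i
  there are none. If i < j, with x = V j / V i, the claim is f(1/x) f(x) = f(x/q) f(1/(q x)), which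
  is f(1/x) = f(x/q) used at x and at q x.\<close>

lemma amp_commute:
  assumes V: "genV N V" and i: "i \<in> {1..N}" and j: "j \<in> {1..N}" and ij: "i \<noteq> j"
  shows "ampM q t N V i * ampP q t V j
    = ampP q t (V(i := q * V i)) j * ampM q t N (V(j := q * V j)) i"
proof (cases "i < j")
  case False
  then have "ampP q t (V(i := q * V i)) j = ampP q t V j"
    using ij by (auto simp: ampP_def intro!: prod.cong)
  moreover have "ampM q t N (V(j := q * V j)) i = ampM q t N V i"
    using ij False j by (auto simp: ampM_def intro!: prod.cong)
  ultimately show ?thesis by (simp add: mult.commute)
next
  case True
  define x where "x = V j / V i"
  have v: "V i \<noteq> 0" "V j \<noteq> 0" and lx: "lp x" using V i j ij by (auto simp: genV_def x_def)
  have P: "ampP q t W j = thf q t (W j / W i) * (\<Prod>k\<in>{1..<j} - {i}. thf q t (W j / W k))" for W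
    unfolding ampP_def using True i by (subst prod.remove[of _ i]) auto
  have M: "ampM q t N W i = ampE q t (W (N + 1)) (W i) * (thf q t (W i / W j) * (\<Prod>k\<in>{i<..N} - {j}. thf q t (W i / W k)))" for W
    unfolding ampM_def using True j by (subst prod.remove[of _ j]) auto
  have P1: "(\<Prod>k\<in>{1..<j} - {i}. thf q t ((V(i := q * V i)) j / (V(i := q * V i)) k)) = (\<Prod>k\<in>{1..<j} - {i}. thf q t (V j / V k))"
    using ij by (intro prod.cong) auto
  have M1: "(\<Prod>k\<in>{i<..N} - {j}. thf q t ((V(j := q * V j)) i / (V(j := q * V j)) k)) = (\<Prod>k\<in>{i<..N} - {j}. thf q t (V i / V k))"
    using ij by (intro prod.cong) auto
  have "(V(i := q * V i)) j / (V(i := q * V i)) i = x / q" "(V(j := q * V j)) i / (V(j := q * V j)) j = 1 / (q * x)"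
    "V j / V i = x" "V i / V j = 1 / x" "(V(j := q * V j)) (N + 1) = V (N + 1)" "(V(j := q * V j)) i = V i"
    using ij j v by (auto simp: x_def)
  then show ?thesis
    unfolding P M P1 M1 by (simp only: thf_flip_div[OF lx] thf_inverse[OF lx] mult_ac)
qed

section \<open>The amplitudes as instances\<close>

lemma amplitudes_plus: "amplitudes q t (thf q t) (GP q t) (KP q t) (\<lambda>i. {1..<i}) {1..N}"
  by unfold_locales (auto simp: fGP1 fGP2 KGP)

lemma amplitudes_minus: "amplitudes q t (thf q t) (GM q t) (KM q t) (\<lambda>i. {i<..N}) {1..N}"
  by unfold_locales (auto simp: fGM1 fGM2 KGM)

end

section \<open>Partitions\<close>

lemma is_ptn_fun [simp]: "is_ptn (ptn_fun l)"
  using ptn_fun[of l] by simp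

lemma ptn_fun_Abs: "is_ptn F \<Longrightarrow> ptn_fun (Abs_ptn F) = F"
  by (rule Abs_ptn_inverse) simp

lemma ptn_eq_iff: "l = m \<longleftrightarrow> ptn_fun l = ptn_fun m"
  by (simp add: ptn_fun_inject)

lemma ptn_fun_antimono: "i \<le> j \<Longrightarrow> ptn_fun l j \<le> ptn_fun l i"
  using is_ptn_fun[of l] by (simp add: is_ptn_def antimonoD)

lemma ptn_fun_nonzero_iff: "ptn_fun l i \<noteq> 0 \<longleftrightarrow> i < plen l"
proof -
  let ?S = "{i. ptn_fun l i \<noteq> 0}"
  have fin: "finite ?S" using is_ptn_fun[of l] by (simp add: is_ptn_def)
  show ?thesis
  proof
    assume "ptn_fun l i \<noteq> 0"
    then have "{..i} \<subseteq> ?S" using ptn_fun_antimono[of _ i l] by fastforce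
    then have "card {..i} \<le> card ?S" by (rule card_mono[OF fin])
    then show "i < plen l" by (simp add: plen_def)
  next
    assume i: "i < plen l"
    show "ptn_fun l i \<noteq> 0"
    proof
      assume "ptn_fun l i = 0"
      then have "?S \<subseteq> {..<i}" using ptn_fun_antimono[of i _ l] by (force simp: not_less[symmetric])
      then have "card ?S \<le> card {..<i}" by (intro card_mono) auto
      then show False using i by (simp add: plen_def)
    qed
  qed
qed

lemma ptn_fun_eq_0: "plen l \<le> i \<Longrightarrow> ptn_fun l i = 0"
  using ptn_fun_nonzero_iff[of l i] by auto

text \<open>Rows are counted from 1.\<close>

definition inc :: "(nat \<Rightarrow> nat) \<Rightarrow> nat \<Rightarrow> nat \<Rightarrow> nat"
  where "inc F i = F(i - 1 := F (i - 1) + 1)"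

text \<open>Subtraction of naturals leaves an empty row unchanged, so \<open>dec F i\<close> may be
  a partition although no box was removed; hence the condition \<open>F (i - 1) \<noteq> 0\<close>
  in later statements.\<close>

definition dec :: "(nat \<Rightarrow> nat) \<Rightarrow> nat \<Rightarrow> nat \<Rightarrow> nat"
  where "dec F i = F(i - 1 := F (i - 1) - 1)"

lemma inc_commute: "inc (inc F i) j = inc (inc F j) i"
  by (auto simp: inc_def fun_eq_iff)

lemma inc_dec: "F (i - 1) \<noteq> 0 \<Longrightarrow> inc (dec F i) i = F"
  by (auto simp: inc_def dec_def fun_eq_iff)

lemma dec_inc: "dec (inc F i) i = F"
  by (auto simp: inc_def dec_def fun_eq_iff)

lemma inc_eq_iff: "i \<ge> 1 \<Longrightarrow> j \<ge> 1 \<Longrightarrow> inc F i = inc F j \<longleftrightarrow> i = j"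
proof
  assume a: "i \<ge> 1" "j \<ge> 1" "inc F i = inc F j"
  have "inc F i (i - 1) = inc F j (i - 1)" unfolding a(3) ..
  then have "i - 1 = j - 1" by (simp add: inc_def split: if_splits)
  then show "i = j" using a by simp
qed simp

lemma antimono_nat_step: "antimono F \<longleftrightarrow> (\<forall>i. F (Suc i) \<le> F i)" for F :: "nat \<Rightarrow> nat"
  by (auto simp: antimono_iff_le_Suc)

lemma finite_support_upd: "finite {i. (F(k := c)) i \<noteq> 0} \<longleftrightarrow> finite {i. F i \<noteq> (0::nat)}"
proof -
  have "{i. (F(k := c)) i \<noteq> 0} \<subseteq> insert k {i. F i \<noteq> 0}" "{i. F i \<noteq> 0} \<subseteq> insert k {i. (F(k := c)) i \<noteq> 0}"
    by auto
  then show ?thesis by (metis finite_insert finite_subset)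
qed

lemma not_ptn_inc:
  assumes "is_ptn F" "\<not> is_ptn (inc F i)" "1 \<le> i"
  shows "2 \<le> i" "F (i - 1) = F (i - 2)"
proof -
  have f: "finite {k. inc F i k \<noteq> 0}" using assms(1) finite_support_upd[of F "i - 1" "F (i - 1) + 1"] by (simp add: inc_def is_ptn_def)
  obtain k where k: "\<not> inc F i (Suc k) \<le> inc F i k" using assms(2) f by (auto simp: is_ptn_def antimono_nat_step)
  have "F (Suc k) \<le> F k" using assms(1) by (simp add: is_ptn_def antimono_nat_step)
  then have "i - 1 = Suc k" "F (Suc k) = F k" using k by (auto simp: inc_def split: if_splits)
  then have "i = Suc (Suc k)" "F (Suc k) = F k" by linarith+
  then show "2 \<le> i" "F (i - 1) = F (i - 2)" by simp_all
qed

text \<open>The violation must lie between rows i and i+1, and it disappears when row i grows by one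
  box, so the difference of the two rows is exactly one.\<close>

lemma not_ptn_dec:
  assumes "is_ptn (inc G i)" "\<not> is_ptn G" "1 \<le> i"
  shows "G i = G (i - 1) + 1"
proof -
  have f: "finite {k. G k \<noteq> 0}" using assms(1) finite_support_upd[of G "i - 1" "G (i - 1) + 1"] by (simp add: inc_def is_ptn_def)
  obtain k where k: "\<not> G (Suc k) \<le> G k" using assms(2) f by (auto simp: is_ptn_def antimono_nat_step)
  have "inc G i (Suc k) \<le> inc G i k" using assms(1) by (simp add: is_ptn_def antimono_nat_step)
  then have "k = i - 1" "G (Suc k) = G k + 1" using k by (auto simp: inc_def split: if_splits)
  then show ?thesis using assms(3) by simp
qed

lemma ptn_inc_row: "is_ptn (inc (ptn_fun l) i) \<Longrightarrow> i \<le> plen l + 1"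
proof (rule ccontr)
  assume a: "is_ptn (inc (ptn_fun l) i)" and "\<not> i \<le> plen l + 1"
  then obtain k where k: "i - 1 = Suc k" "plen l \<le> k" by (cases "i - 1") auto
  have "inc (ptn_fun l) i (Suc k) \<le> inc (ptn_fun l) i k" using a by (simp add: is_ptn_def antimono_nat_step)
  then show False using k by (simp add: inc_def ptn_fun_eq_0)
qed

lemma plen_inc:
  assumes "is_ptn (inc (ptn_fun l) i)" shows "plen (Abs_ptn (inc (ptn_fun l) i)) \<le> plen l + 1"
proof (rule ccontr)
  assume "\<not> ?thesis"
  then have "ptn_fun (Abs_ptn (inc (ptn_fun l) i)) (plen l + 1) \<noteq> 0" unfolding ptn_fun_nonzero_iff by simp
  then have "inc (ptn_fun l) i (plen l + 1) \<noteq> 0" by (simp add: ptn_fun_Abs[OF assms])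
  then show False using ptn_inc_row[OF assms] ptn_fun_eq_0[of l "plen l + 1"] by (auto simp: inc_def split: if_splits)
qed

lemma plen_dec:
  assumes "is_ptn (dec (ptn_fun l) i)" shows "plen (Abs_ptn (dec (ptn_fun l) i)) \<le> plen l"
proof (rule ccontr)
  assume "\<not> ?thesis"
  then have "ptn_fun (Abs_ptn (dec (ptn_fun l) i)) (plen l) \<noteq> 0" unfolding ptn_fun_nonzero_iff by simp
  then have "dec (ptn_fun l) i (plen l) \<noteq> 0" by (simp add: ptn_fun_Abs[OF assms])
  then show False by (auto simp: dec_def ptn_fun_eq_0 split: if_splits)
qed

section \<open>Products of sparse operators\<close>

definition rowfin :: "ptn opser \<Rightarrow> bool"
  where "rowfin T \<longleftrightarrow> (\<forall>l. finite {m. mc T l m \<noteq> 0})"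

lemma sum_over_ptn:
  fixes t :: "'i \<Rightarrow> complex fps"
  assumes "finite M" "finite I" "\<And>i. i \<in> I \<Longrightarrow> is_ptn (\<phi> i) \<Longrightarrow> Abs_ptn (\<phi> i) \<in> M"
  shows "(\<Sum>m\<in>M. (\<Sum>i\<in>I. if ptn_fun m = \<phi> i then t i else 0) * y m)
    = (\<Sum>i\<in>I. if is_ptn (\<phi> i) then t i * y (Abs_ptn (\<phi> i)) else 0)"
proof -
  have "(\<Sum>m\<in>M. (\<Sum>i\<in>I. if ptn_fun m = \<phi> i then t i else 0) * y m)
    = (\<Sum>i\<in>I. \<Sum>m\<in>M. if ptn_fun m = \<phi> i then t i * y m else 0)"
    by (subst sum.swap) (simp add: sum_distrib_right if_distrib[of "\<lambda>x. x * _"] cong: if_cong)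
  also have "\<dots> = (\<Sum>i\<in>I. if is_ptn (\<phi> i) then t i * y (Abs_ptn (\<phi> i)) else 0)"
  proof (rule sum.cong[OF refl])
    fix i assume i: "i \<in> I"
    show "(\<Sum>m\<in>M. if ptn_fun m = \<phi> i then t i * y m else 0) = (if is_ptn (\<phi> i) then t i * y (Abs_ptn (\<phi> i)) else 0)"
    proof (cases "is_ptn (\<phi> i)")
      case True
      then have e: "ptn_fun m = \<phi> i \<longleftrightarrow> m = Abs_ptn (\<phi> i)" for m by (auto simp: ptn_eq_iff ptn_fun_Abs)
      show ?thesis using True assms(1,3) i by (simp add: e)
    next
      case False
      then have "ptn_fun m \<noteq> \<phi> i" for m by (metis is_ptn_fun)
      then show ?thesis using False by simp
    qed
  qed
  finally show ?thesis .
qed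

lemma mc_mult_row:
  assumes "finite I" "\<And>m. mc X l m = (\<Sum>i\<in>I. if ptn_fun m = \<phi> i then t i else 0)"
  shows "mc (Y * X) l m = (\<Sum>i\<in>I. if is_ptn (\<phi> i) then t i * mc Y (Abs_ptn (\<phi> i)) m else 0)"
proof -
  let ?M = "(\<lambda>i. Abs_ptn (\<phi> i)) ` I"
  have "mc X l b = 0" if "b \<notin> ?M" for b
  proof -
    have "ptn_fun b \<noteq> \<phi> i" if "i \<in> I" for i
    proof
      assume "ptn_fun b = \<phi> i"
      then have "b = Abs_ptn (\<phi> i)" by (metis ptn_fun_inverse)
      then show False using that \<open>b \<notin> ?M\<close> by blast
    qed
    then show ?thesis unfolding assms(2) by (intro sum.neutral) auto
  qed
  then have "mc (Y * X) l m = (\<Sum>b\<in>?M. mc X l b * mc Y b m)"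
    by (intro mc_mult) (use assms in auto)
  also have "\<dots> = (\<Sum>i\<in>I. if is_ptn (\<phi> i) then t i * mc Y (Abs_ptn (\<phi> i)) m else 0)"
    unfolding assms(2) by (rule sum_over_ptn) (use assms in auto)
  finally show ?thesis .
qed

text \<open>Expansion along the column of the left factor at \<open>m\<close>, for the lowering
  currents, whose entries are read from the target upwards; \<open>rowfin\<close> makes the
  intermediate sum finite.\<close>

lemma mc_mult_column:
  assumes "finite I" "rowfin X" "\<And>l. mc Y l m = (\<Sum>i\<in>I. if ptn_fun l = \<phi> i then t i else 0)"
  shows "mc (Y * X) l m = (\<Sum>i\<in>I. if is_ptn (\<phi> i) then t i * mc X l (Abs_ptn (\<phi> i)) else 0)"
proof -
  let ?M = "(\<lambda>i. Abs_ptn (\<phi> i)) ` I \<union> {b. mc X l b \<noteq> 0}"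
  have M: "finite ?M" using assms by (auto simp: rowfin_def)
  have "mc (Y * X) l m = (\<Sum>b\<in>?M. mc X l b * mc Y b m)"
    by (intro mc_mult M) auto
  also have "\<dots> = (\<Sum>b\<in>?M. mc Y b m * mc X l b)" by (simp add: mult.commute)
  also have "\<dots> = (\<Sum>i\<in>I. if is_ptn (\<phi> i) then t i * mc X l (Abs_ptn (\<phi> i)) else 0)"
    unfolding assms(3) by (rule sum_over_ptn[OF M assms(1)]) auto
  finally show ?thesis .
qed

lemma rowfin_mult:
  assumes "rowfin X" "rowfin Y" shows "rowfin (Y * X)"
  unfolding rowfin_def
proof
  fix l
  have "mc (Y * X) l m = (\<Sum>b\<in>{b. mc X l b \<noteq> 0}. mc X l b * mc Y b m)" for m
    by (rule mc_mult) (use assms in \<open>auto simp: rowfin_def\<close>)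
  note e = this
  have "{m. mc (Y * X) l m \<noteq> 0} \<subseteq> (\<Union>b\<in>{b. mc X l b \<noteq> 0}. {m. mc Y b m \<noteq> 0})"
  proof
    fix m assume "m \<in> {m. mc (Y * X) l m \<noteq> 0}"
    then have "(\<Sum>b\<in>{b. mc X l b \<noteq> 0}. mc X l b * mc Y b m) \<noteq> 0" by (simp add: e)
    then obtain b where "mc X l b \<noteq> 0" "mc X l b * mc Y b m \<noteq> 0"
      by (rule sum.not_neutral_contains_not_neutral) auto
    then show "m \<in> (\<Union>b\<in>{b. mc X l b \<noteq> 0}. {m. mc Y b m \<noteq> 0})" by auto
  qed
  then show "finite {m. mc (Y * X) l m \<noteq> 0}"
    by (rule finite_subset) (use assms in \<open>auto simp: rowfin_def\<close>)
qed

section \<open>Contents\<close>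

text \<open>Defined for arbitrary functions, because intermediate shapes need not be partitions.
  Since 0 - 1 = 0, without the guard row 0 would change together with row 1, and
  \<open>vf_inc\<close> would fail for i = 1.\<close>

definition vf :: "complex \<Rightarrow> complex \<Rightarrow> complex \<Rightarrow> (nat \<Rightarrow> nat) \<Rightarrow> nat \<Rightarrow> complex"
  where "vf q t u F i = (if i = 0 then 0 else q ^ F (i - 1) * t powi (- int i + 1) * u)"

lemma uu_eq_vf: "1 \<le> i \<Longrightarrow> uu q t u l i = vf q t u (ptn_fun l) i"
  by (simp add: uu_def vf_def part_def)

lemma vf_inc: "1 \<le> i \<Longrightarrow> vf q t u (inc F i) = (vf q t u F)(i := q * vf q t u F i)"
  by (rule ext) (auto simp: vf_def inc_def)

lemma vf_dec: "1 \<le> i \<Longrightarrow> F (i - 1) \<noteq> 0 \<Longrightarrow> q \<noteq> 0 \<Longrightarrow> vf q t u (dec F i) = (vf q t u F)(i := vf q t u F i / q)"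
  by (rule ext) (auto simp: vf_def dec_def power_diff)

lemma vf_next: "1 \<le> i \<Longrightarrow> t \<noteq> 0 \<Longrightarrow> F i = F (i - 1) \<Longrightarrow> vf q t u F (i + 1) = vf q t u F i / t"
proof -
  assume "1 \<le> i" "t \<noteq> 0" "F i = F (i - 1)"
  moreover have "t powi (- int (i + 1) + 1) = t powi (- int i + 1) / t"
    using power_int_diff[of t "- int i + 1" 1] \<open>t \<noteq> 0\<close> by simp
  ultimately show ?thesis unfolding vf_def by (simp del: of_nat_add of_nat_Suc)
qed

lemma vf_next_q: "1 \<le> i \<Longrightarrow> t \<noteq> 0 \<Longrightarrow> F i = F (i - 1) + 1 \<Longrightarrow> vf q t u F (i + 1) = q / t * vf q t u F i"
proof -
  assume "1 \<le> i" "t \<noteq> 0" "F i = F (i - 1) + 1"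
  moreover have "t powi (- int (i + 1) + 1) = t powi (- int i + 1) / t"
    using power_int_diff[of t "- int i + 1" 1] \<open>t \<noteq> 0\<close> by simp
  ultimately show ?thesis unfolding vf_def by (simp del: of_nat_add of_nat_Suc)
qed

locale fock_params = generic_params +
  fixes u :: complex
  assumes u0: "u \<noteq> 0"
begin

abbreviation "V \<equiv> vf q t u"

lemma genV_vf: "genV N (V F)"
proof -
  have "lp (V F i / V F j)" if "1 \<le> i" "1 \<le> j" "i \<noteq> j" for i j
    unfolding lattice_pt_def
  proof (intro exI conjI)
    show "int j - int i \<noteq> 0" using that by simp
    have a: "int j - int i = (- int i + 1) - (- int j + 1)" by simp
    show "V F i / V F j = q powi (int (F (i - 1)) - int (F (j - 1))) * t powi (int j - int i)"
      using that q0 t0 u0 unfolding a by (simp add: vf_def power_int_diff)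
  qed
  then show ?thesis using q0 t0 u0 by (auto simp: genV_def vf_def)
qed

lemma vf_nonzero: "1 \<le> i \<Longrightarrow> V F i \<noteq> 0"
  using q0 t0 u0 by (simp add: vf_def)

text \<open>The row above has the same length, so the content ratio is 1/t, a zero of f. Sums over
  rows may therefore ignore the partition condition.\<close>

lemma ampP_vanish:
  assumes "is_ptn F" "\<not> is_ptn (inc F i)" "1 \<le> i" shows "ampP q t (V F) i = 0"
proof -
  note n = not_ptn_inc[OF assms]
  have v: "V F i = V F (i - 1) / t"
    using vf_next[of "i - 1" t F q u] n t0 by (simp add: numeral_2_eq_2)
  have "thf q t (V F i / V F (i - 1)) = 0"
    unfolding thf_def v using t0 n vf_nonzero[of "i - 1" F] by simp
  then show ?thesis unfolding ampP_def by (intro prod_zero) (use n in auto)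
qed

text \<open>The hypothesis means that row k+1 is one box longer than row k. The resulting ratio t/q
  is a zero of f; for k = N the zero lies in \<open>ampE\<close>.\<close>

lemma ampM_vanish:
  assumes "k \<in> {1..N}" "W (k + 1) = q / t * W k" "W k \<noteq> 0"
  shows "ampM q t N W k = 0"
proof (cases "k = N")
  case True
  have "t * W (N + 1) / (q * W N) = 1" using assms True q0 t0 by simp
  then show ?thesis unfolding ampM_def ampE_def True by simp
next
  case False
  have "q / t * (W k / W (k + 1)) = 1" using assms q0 t0 by simp
  then have "thf q t (W k / W (k + 1)) = 0" by (simp add: thf_def)
  then show ?thesis unfolding ampM_def using False assms(1)
    by (intro mult_eq_0_iff[THEN iffD2] disjI2 prod_zero) (auto intro!: bexI[of _ "k + 1"])
qed

lemma ampM_vanish_ptn: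
  assumes "is_ptn (inc G i)" "\<not> is_ptn G" "i \<in> {1..N}" shows "ampM q t N (V G) i = 0"
  by (rule ampM_vanish[OF assms(3)])
     (use assms vf_next_q[of i t G q u] t0 vf_nonzero[of i G] not_ptn_dec[OF assms(1,2)] in auto)

lemma ampM_vanish_dec:
  assumes "F k = F (k - 1)" "k \<in> {1..N}"
  shows "ampM q t N ((V F)(k := V F k / q)) k = 0"
  by (rule ampM_vanish[OF assms(2)])
     (use assms vf_next[of k t F q u] t0 q0 vf_nonzero[of k F] in auto)

lemma not_ptn_dec':
  assumes "is_ptn F" "\<not> is_ptn (dec F k) \<or> F (k - 1) = 0" "1 \<le> k"
  shows "F k = F (k - 1)"
proof (cases "F (k - 1) = 0")
  case True
  then show ?thesis using assms(1) antimonoD[of F "k - 1" k] by (simp add: is_ptn_def)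
next
  case False
  then have "is_ptn (inc (dec F k) k)" using assms(1) by (simp add: inc_dec)
  then have "dec F k k = dec F k (k - 1) + 1" using not_ptn_dec[of "dec F k" k] assms False by blast
  then show ?thesis using assms(3) False by (auto simp: dec_def split: if_splits)
qed

lemma A_plus_eq: "1 \<le> i \<Longrightarrow> A_plus q t u l i = ampP q t (V (ptn_fun l)) i"
proof -
  assume i: "1 \<le> i"
  show ?thesis
    unfolding A_plus_def ampP_def Let_def
  proof (rule prod.cong[OF refl])
    fix j assume j: "j \<in> {1..<i}"
    have "lp (V (ptn_fun l) i / V (ptn_fun l) j)" using genV_vf[of i "ptn_fun l"] i j by (auto simp: genV_def)
    from thf_theta[OF this]
    show "theta (t * uu q t u l i / uu q t u l j) * theta (q / t * uu q t u l i / uu q t u l j) /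
       (theta (q * uu q t u l i / uu q t u l j) * theta (uu q t u l i / uu q t u l j)) = thf q t (V (ptn_fun l) i / V (ptn_fun l) j)"
      using i j by (simp add: uu_eq_vf)
  qed
qed

definition lowA :: "nat \<Rightarrow> (nat \<Rightarrow> complex) \<Rightarrow> nat \<Rightarrow> complex fps"
  where "lowA N W i = (\<Prod>j = i+1..N. theta (q / t * W j / W i) / theta (W j / W i)) *
     (\<Prod>j = i+1..N+1. theta (t * W j / W i) / theta (q * W j / W i))"

text \<open>Beyond the last nonempty row consecutive contents have ratio 1/t, and then the new
  factors of the two products are reciprocal. The amplitude is thus independent of the
  cutoff.\<close>

lemma lowA_Suc:
  assumes "i \<in> {1..N}" "genV (N + 1) W" "W (N + 2) = W (N + 1) / t"
  shows "lowA (N + 1) W i = lowA N W i"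
proof -
  have l: "lp (W (N + 1) / W i)" "lp (W (N + 2) / W i)" and i0: "W i \<noteq> 0"
    using assms(1,2) by (auto simp: genV_def)
  have u: "theta (W (N + 1) / W i) $ 0 \<noteq> 0" "theta (q / t * W (N + 1) / W i) $ 0 \<noteq> 0"
    using lp_neq[OF l(1)] lp_neq[OF l(2)] assms(3) by (auto simp: theta_nth_0)
  have e: "t * W (N + 2) / W i = W (N + 1) / W i" "q * W (N + 2) / W i = q / t * W (N + 1) / W i"
    using assms(3) t0 by auto
  have inv: "f * inverse f = 1" if "f $ 0 \<noteq> 0" for f :: "complex fps" by (rule inverse_mult_eq_1'[OF that])
  have r: "{i + 1..N + 1} = insert (N + 1) {i + 1..N}" "{i + 1..(N + 1) + 1} = insert (N + 2) {i + 1..N + 1}"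
    using assms(1) by auto
  have "lowA (N + 1) W i = lowA N W i * ((theta (q / t * W (N + 1) / W i) / theta (W (N + 1) / W i)) *
    (theta (t * W (N + 2) / W i) / theta (q * W (N + 2) / W i)))"
    unfolding lowA_def r(2) by (subst (1) r(1)) (simp add: mult_ac)
  also have "(theta (q / t * W (N + 1) / W i) / theta (W (N + 1) / W i)) * (theta (t * W (N + 2) / W i) / theta (q * W (N + 2) / W i))
    = (theta (q / t * W (N + 1) / W i) * inverse (theta (q / t * W (N + 1) / W i)))
      * (theta (W (N + 1) / W i) * inverse (theta (W (N + 1) / W i)))"
    unfolding e fps_divide_unit[OF u(1)] fps_divide_unit[OF u(2)] by (simp only: mult_ac)
  finally show ?thesis unfolding inv[OF u(1)] inv[OF u(2)] by simp
qed

lemma lowA_ampM: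
  assumes "i \<in> {1..N}" "genV N W"
  shows "lowA N W i = ampM q t N (W(i := W i / q)) i"
proof -
  let ?W = "W(i := W i / q)"
  have i0: "W i \<noteq> 0" using assms by (auto simp: genV_def)
  have l: "lp (W j / W i)" if "j \<in> {i<..N+1}" for j using assms that by (auto simp: genV_def)
  have d: "theta (q / t * W j / W i) / theta (W j / W i) * (theta (t * W j / W i) / theta (q * W j / W i))
      = thf q t (?W i / ?W j)" if j: "j \<in> {i<..N}" for j
  proof -
    have lj: "lp (W j / W i)" using l j by auto
    have u: "theta (W j / W i) $ 0 \<noteq> 0" "theta (q * W j / W i) $ 0 \<noteq> 0"
      using lp_neq[OF lj] by (auto simp: theta_nth_0)
    have e: "?W i / ?W j = 1 / (q * (W j / W i))" using j by simp
    show ?thesis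
      unfolding fps_divide_unit[OF u(1)] fps_divide_unit[OF u(2)]
      unfolding e thf_flip_div[OF lj] thf_expand[OF lj]
      unfolding times_divide_eq_right
      by (simp only: mult_ac)
  qed
  have e: "theta (t * W (N + 1) / W i) / theta (q * W (N + 1) / W i) = ampE q t (?W (N + 1)) (?W i)"
  proof -
    have lN: "lp (W (N + 1) / W i)" using l[of "N + 1"] assms(1) by auto
    have u: "theta (q * W (N + 1) / W i) $ 0 \<noteq> 0"
      using lp_neq[OF lN] by (auto simp: theta_nth_0)
    show ?thesis unfolding fps_divide_unit[OF u] ampE_def using assms(1) q0 i0 by (simp add: mult.commute)
  qed
  have r: "{i + 1..N + 1} = insert (N + 1) {i<..N}" "{i + 1..N} = {i<..N}" using assms(1) by auto
  have "lowA N W i = (theta (t * W (N + 1) / W i) / theta (q * W (N + 1) / W i)) *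
     (\<Prod>j\<in>{i<..N}. theta (q / t * W j / W i) / theta (W j / W i) * (theta (t * W j / W i) / theta (q * W j / W i)))"
    unfolding lowA_def r(1) unfolding r(2) prod.distrib by (simp add: mult_ac)
  also have "\<dots> = ampE q t (?W (N + 1)) (?W i) * (\<Prod>j\<in>{i<..N}. thf q t (?W i / ?W j))"
    unfolding e by (intro arg_cong2[of _ _ _ _ "(*)"] refl prod.cong) (rule d)
  finally show ?thesis by (simp add: ampM_def)
qed

lemma A_minus_eq:
  assumes "i \<in> {1..plen l}" "plen l \<le> N"
  shows "A_minus q t u l i = ampM q t N ((V (ptn_fun l))(i := V (ptn_fun l) i / q)) i"
proof -
  have "lowA N (V (ptn_fun l)) i = lowA (plen l) (V (ptn_fun l)) i"
    using assms(2)
  proof (induction N rule: dec_induct)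
    case (step n)
    have "V (ptn_fun l) (n + 2) = V (ptn_fun l) (n + 1) / t"
      using vf_next[of "n + 1" t "ptn_fun l" q u] t0 step by (simp add: ptn_fun_eq_0)
    then have "lowA (n + 1) (V (ptn_fun l)) i = lowA n (V (ptn_fun l)) i"
      by (intro lowA_Suc genV_vf) (use assms step in auto)
    then show ?case using step by simp
  qed simp
  also have "\<dots> = A_minus q t u l i"
    unfolding A_minus_def lowA_def Let_def
    by (intro arg_cong2[of _ _ _ _ "(*)"] prod.cong refl) (use assms in \<open>auto simp: uu_eq_vf\<close>)
  finally show ?thesis using lowA_ampM[OF _ genV_vf, of i N] assms by auto
qed

section \<open>The spectrum of \<open>\<alpha>\<^sub>m\<close>\<close>

definition sp :: "nat \<Rightarrow> (nat \<Rightarrow> complex) \<Rightarrow> int \<Rightarrow> complex"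
  where "sp N W = spec (numc q t W) (denc q W) (idx N)"

lemma sp_expand:
  "sp N W m = ((\<Sum>i\<in>{1..N}. (W i / q) powi m - (W i / t) powi m) + (\<Sum>i\<in>{1..N+1}. W i powi m - (t * W i / q) powi m)) / of_int m"
  unfolding sp_def spec_def idx_def by (subst sum.Plus) (simp_all add: o_def numc_def denc_def)

lemma sp_mono:
  assumes "plen l \<le> N" shows "sp N (V (ptn_fun l)) m = sp (plen l) (V (ptn_fun l)) m"
  using assms
proof (induction N rule: dec_induct)
  case (step n)
  have "V (ptn_fun l) (n + 2) = V (ptn_fun l) (n + 1) / t"
    using vf_next[of "n + 1" t "ptn_fun l" q u] t0 step by (simp add: ptn_fun_eq_0)
  then have "sp (Suc n) (V (ptn_fun l)) m = sp n (V (ptn_fun l)) m"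
    unfolding sp_expand using t0 by simp
  then show ?case using step by simp
qed simp

text \<open>Of the eight powers that change, the two equal to \<open>W i powi m\<close> cancel, and
  the other six are those of \<open>kappa_expand\<close>.\<close>

lemma sp_up:
  assumes "i \<in> {1..N}" "m \<noteq> 0"
  shows "sp N (W(i := q * W i)) m - sp N W m = - (kappa q t m / of_int m) * W i powi m"
proof -
  let ?W = "W(i := q * W i)"
  have s: "(\<Sum>j\<in>A. f (?W j)) = (\<Sum>j\<in>A. f (W j)) + (f (q * W i) - f (W i))" if "i \<in> A" "finite A"
    for A and f :: "complex \<Rightarrow> complex"
  proof -
    have "(\<Sum>j\<in>A - {i}. f (?W j)) = (\<Sum>j\<in>A - {i}. f (W j))" by (rule sum.cong) auto
    then show ?thesis using sum.remove[OF that(2,1), of "\<lambda>j. f (?W j)"] sum.remove[OF that(2,1), of "\<lambda>j. f (W j)"] by simp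
  qed
  have i: "i \<in> {1..N}" "i \<in> {1..N+1}" using assms by auto
  have "sp N ?W m - sp N W m
    = (((q * W i / q) powi m - (q * W i / t) powi m - ((W i / q) powi m - (W i / t) powi m))
      + ((q * W i) powi m - (t * (q * W i) / q) powi m - (W i powi m - (t * W i / q) powi m))) / of_int m"
    unfolding sp_expand s[OF i(1) finite_atLeastAtMost, of "\<lambda>x. (x / q) powi m - (x / t) powi m"]
      s[OF i(2) finite_atLeastAtMost, of "\<lambda>x. x powi m - (t * x / q) powi m"]
    by (simp add: diff_divide_distrib add_divide_distrib)
  also have "\<dots> = - (kappa q t m / of_int m) * W i powi m"
    unfolding kappa_expand[OF q0 t0] using q0 t0
    assms(2) by (simp add: power_int_mult_distrib power_int_divide_distrib divide_simps) (simp add: algebra_simps)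
  finally show ?thesis .
qed

end

context fock_params
begin

section \<open>The currents on the Fock space\<close>

definition XP :: "int \<Rightarrow> ptn opser"
  where "XP n = opr (\<lambda>l. \<Sum>i = 1..plen l + 1.
           cmul (a_plus q t * A_plus q t u l i * fps_const (uu q t u l i powi n)) (ket_add l i))"

definition XM :: "complex \<Rightarrow> int \<Rightarrow> ptn opser"
  where "XM s n = opr (\<lambda>l. \<Sum>i = 1..plen l.
           cmul (fps_const s * a_minus q t * A_minus q t u l i
                 * fps_const ((uu q t u l i / q) powi n)) (ket_remove l i))"

definition AL :: "int \<Rightarrow> ptn opser"
  where "AL m = dg (\<lambda>l. fps_const (sp (plen l) (V (ptn_fun l)) m))"

lemma mc_opr_sum:
  shows "mc (opr (\<lambda>l. \<Sum>i\<in>I l. cmul (c l i) (v l i))) l m = (\<Sum>i\<in>I l. c l i * fps_const (Poly_Mapping.lookup (v l i) m))"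
  by (rule fps_ext) (simp add: mc_opr fps_sum_nth lookup_sum cmul_def)

lemma lookup_ket_fun: "Poly_Mapping.lookup (ket_fun F) m = (if ptn_fun m = F then 1 else 0)"
proof (cases "is_ptn F")
  case True
  then have "Abs_ptn F = m \<longleftrightarrow> ptn_fun m = F" by (auto simp: ptn_eq_iff ptn_fun_Abs)
  then show ?thesis using True by (simp add: ket_fun_def ket_def lookup_single when_def)
next
  case False
  then have "ptn_fun m \<noteq> F" by (metis is_ptn_fun)
  then show ?thesis using False by (simp add: ket_fun_def)
qed

lemma lookup_ket_add: "Poly_Mapping.lookup (ket_add l i) m = (if ptn_fun m = inc (ptn_fun l) i then 1 else 0)"
  unfolding ket_add_def by (subst lookup_ket_fun) (simp add: inc_def part_def)

lemma lookup_ket_remove: "Poly_Mapping.lookup (ket_remove l i) m = (if ptn_fun m = dec (ptn_fun l) i then 1 else 0)"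
  unfolding ket_remove_def by (subst lookup_ket_fun) (simp add: dec_def part_def)

lemma mult_const_if: "c * fps_const (if P then 1 else 0) = (if P then c else (0 :: complex fps))"
  by simp

lemma mc_XP:
  assumes "plen l + 1 \<le> N"
  shows "mc (XP n) l m = (\<Sum>i\<in>{1..N}. if ptn_fun m = inc (ptn_fun l) i
     then a_plus q t * ampP q t (V (ptn_fun l)) i * fps_const (V (ptn_fun l) i powi n) else 0)"
proof -
  have "mc (XP n) l m = (\<Sum>i\<in>{1..plen l + 1}. if ptn_fun m = inc (ptn_fun l) i
     then a_plus q t * A_plus q t u l i * fps_const (uu q t u l i powi n) else 0)"
    unfolding XP_def by (subst mc_opr_sum) (simp only: lookup_ket_add mult_const_if)
  also have "\<dots> = (\<Sum>i\<in>{1..N}. if ptn_fun m = inc (ptn_fun l) i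
     then a_plus q t * ampP q t (V (ptn_fun l)) i * fps_const (V (ptn_fun l) i powi n) else 0)"
  proof (rule sum.mono_neutral_cong)
    fix i assume i: "i \<in> {1..N} - {1..plen l + 1}"
    have "ptn_fun m \<noteq> inc (ptn_fun l) i"
    proof
      assume "ptn_fun m = inc (ptn_fun l) i"
      then have "is_ptn (inc (ptn_fun l) i)" by (metis is_ptn_fun)
      then show False using ptn_inc_row[of l i] i by auto
    qed
    then show "(if ptn_fun m = inc (ptn_fun l) i
     then a_plus q t * ampP q t (V (ptn_fun l)) i * fps_const (V (ptn_fun l) i powi n) else 0) = 0" by simp
  qed (use assms in \<open>auto simp: A_plus_eq uu_eq_vf\<close>)
  finally show ?thesis .
qed

lemma mc_XM_dec:
  "mc (XM s n) l m = (\<Sum>i\<in>{1..plen l}. if ptn_fun m = dec (ptn_fun l) i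
     then fps_const s * a_minus q t * A_minus q t u l i * fps_const ((uu q t u l i / q) powi n) else 0)"
  unfolding XM_def by (subst mc_opr_sum) (simp only: lookup_ket_remove mult_const_if)

text \<open>Read from the target, lowering becomes adding a box to \<open>m\<close>, with the
  contents of \<open>m\<close>. In this transposed form the results on amplitudes apply to both
  currents.\<close>

lemma mc_XM:
  assumes "plen m + 1 \<le> N"
  shows "mc (XM s n) l m = (\<Sum>i\<in>{1..N}. if ptn_fun l = inc (ptn_fun m) i
     then fps_const s * a_minus q t * ampM q t N (V (ptn_fun m)) i * fps_const (V (ptn_fun m) i powi n) else 0)"
  unfolding mc_XM_dec
proof (rule sum.mono_neutral_cong)
  have row: "i \<le> plen m + 1 \<and> plen l \<le> plen m + 1" if "ptn_fun l = inc (ptn_fun m) i" for i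
  proof -
    have p: "is_ptn (inc (ptn_fun m) i)" using that by (metis is_ptn_fun)
    have "Abs_ptn (inc (ptn_fun m) i) = l" using that by (metis ptn_fun_inverse)
    then show ?thesis using ptn_inc_row[OF p] plen_inc[OF p] by simp
  qed
  have nz: "ptn_fun l (i - 1) \<noteq> 0" if "i \<in> {1..plen l}" for i using that by (subst ptn_fun_nonzero_iff) auto
  have iff: "ptn_fun m = dec (ptn_fun l) i \<longleftrightarrow> ptn_fun l = inc (ptn_fun m) i" if "i \<in> {1..plen l}" for i
    using inc_dec[of "ptn_fun l" i] nz[OF that] dec_inc[of "ptn_fun m" i] by auto
  {
    fix i assume i: "i \<in> {1..N} - {1..plen l}"
    have "ptn_fun l \<noteq> inc (ptn_fun m) i"
    proof
      assume "ptn_fun l = inc (ptn_fun m) i"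
      then have "ptn_fun l (i - 1) \<noteq> 0" by (simp add: inc_def)
      then show False using i by (subst (asm) ptn_fun_nonzero_iff) auto
    qed
    then show "(if ptn_fun l = inc (ptn_fun m) i
     then fps_const s * a_minus q t * ampM q t N (V (ptn_fun m)) i * fps_const (V (ptn_fun m) i powi n) else 0) = 0" by simp
  next
    fix i assume i: "i \<in> {1..plen l} - {1..N}"
    then have "\<not> ptn_fun m = dec (ptn_fun l) i" unfolding iff[OF DiffD1[OF i]] using row[of i] assms by auto
    then show "(if ptn_fun m = dec (ptn_fun l) i
     then fps_const s * a_minus q t * A_minus q t u l i * fps_const ((uu q t u l i / q) powi n) else 0) = 0" by simp
  next
    fix i assume i: "i \<in> {1..plen l} \<inter> {1..N}"
    then have i': "i \<in> {1..plen l}" by blast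
    show "(if ptn_fun m = dec (ptn_fun l) i
     then fps_const s * a_minus q t * A_minus q t u l i * fps_const ((uu q t u l i / q) powi n) else 0)
     = (if ptn_fun l = inc (ptn_fun m) i
     then fps_const s * a_minus q t * ampM q t N (V (ptn_fun m)) i * fps_const (V (ptn_fun m) i powi n) else 0)"
    proof (cases "ptn_fun l = inc (ptn_fun m) i")
      case True
      have m: "ptn_fun m = dec (ptn_fun l) i" using True dec_inc by metis
      have "plen l \<le> N" using row[OF True] assms by simp
      then have "A_minus q t u l i = ampM q t N (V (ptn_fun m)) i"
        unfolding A_minus_eq[OF i' \<open>plen l \<le> N\<close>] m using i' nz[OF i'] q0 by (subst vf_dec) auto
      moreover have "uu q t u l i / q = V (ptn_fun m) i"
        unfolding m using i' nz[OF i'] q0 by (subst vf_dec) (auto simp: uu_eq_vf)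
      ultimately show ?thesis using True iff[OF i'] by simp
    qed (use iff[OF i'] in simp)
  }
qed auto

lemma rowfin_XM: "rowfin (XM s n)"
  unfolding rowfin_def
proof
  fix l
  have "{m. mc (XM s n) l m \<noteq> 0} \<subseteq> (\<lambda>i. Abs_ptn (dec (ptn_fun l) i)) ` {1..plen l}"
  proof
    fix m assume "m \<in> {m. mc (XM s n) l m \<noteq> 0}"
    then have "\<exists>i\<in>{1..plen l}. ptn_fun m = dec (ptn_fun l) i"
      unfolding mc_XM_dec by (rule contrapos_pp) (simp add: sum.neutral)
    then obtain i where "i \<in> {1..plen l}" "ptn_fun m = dec (ptn_fun l) i" by blast
    then show "m \<in> (\<lambda>i. Abs_ptn (dec (ptn_fun l) i)) ` {1..plen l}" by (metis image_eqI ptn_fun_inverse)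
  qed
  then show "finite {m. mc (XM s n) l m \<noteq> 0}" by (rule finite_subset) simp
qed

section \<open>Commutators with \<open>\<alpha>\<^sub>m\<close>\<close>

lemma mc_sc_mult: "mc (sc c * T) l m = fps_const c * mc T l m"
  by (simp add: dg_sc mc_dg_mult)

lemma sp_step:
  assumes "ptn_fun m = inc (ptn_fun l) i" "1 \<le> i" "k \<noteq> 0"
  shows "sp (plen m) (V (ptn_fun m)) k - sp (plen l) (V (ptn_fun l)) k
    = - (kappa q t k / of_int k) * V (ptn_fun l) i powi k"
proof -
  have p: "is_ptn (inc (ptn_fun l) i)" using assms(1) by (metis is_ptn_fun)
  have "Abs_ptn (inc (ptn_fun l) i) = m" using assms(1) by (metis ptn_fun_inverse)
  then have b: "i \<le> plen l + 1" "plen m \<le> plen l + 1" using ptn_inc_row[OF p] plen_inc[OF p] by simp_all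
  have i: "i \<in> {1..plen l + 1}" using b assms by simp
  have "sp (plen m) (V (ptn_fun m)) k = sp (plen l + 1) (V (ptn_fun m)) k"
    by (rule sp_mono[symmetric]) (rule b)
  moreover have "sp (plen l) (V (ptn_fun l)) k = sp (plen l + 1) (V (ptn_fun l)) k"
    by (rule sp_mono[symmetric]) simp
  moreover have "V (ptn_fun m) = (V (ptn_fun l))(i := q * V (ptn_fun l) i)"
    unfolding assms(1) by (rule vf_inc[OF assms(2)])
  ultimately show ?thesis using sp_up[OF i assms(3), of "V (ptn_fun l)"] by simp
qed

lemma commutator_AL_XP:
  assumes "k \<noteq> 0"
  shows "commutator (AL k) (XP n) = sc (- (kappa q t k / of_int k)) * XP (n + k)"
proof (rule mc_eqI)
  fix l m
  let ?e = "\<lambda>l. sp (plen l) (V (ptn_fun l)) k"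
  have "mc (commutator (AL k) (XP n)) l m = fps_const (?e m - ?e l) * mc (XP n) l m"
    unfolding commutator_def mc_diff AL_def mc_mult_dg mc_dg_mult
    by (simp add: left_diff_distrib flip: fps_const_sub)
  also have "\<dots> = fps_const (- (kappa q t k / of_int k)) * mc (XP (n + k)) l m"
    unfolding mc_XP[OF order_refl] sum_distrib_left
  proof (rule sum.cong[OF refl])
    fix i assume i: "i \<in> {1..plen l + 1}"
    have "V (ptn_fun l) i powi (n + k) = V (ptn_fun l) i powi n * V (ptn_fun l) i powi k"
      using vf_nonzero i by (intro power_int_add) auto
    then show "fps_const (?e m - ?e l) * (if ptn_fun m = inc (ptn_fun l) i
        then a_plus q t * ampP q t (V (ptn_fun l)) i * fps_const (V (ptn_fun l) i powi n) else 0)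
      = fps_const (- (kappa q t k / of_int k)) * (if ptn_fun m = inc (ptn_fun l) i
        then a_plus q t * ampP q t (V (ptn_fun l)) i * fps_const (V (ptn_fun l) i powi (n + k)) else 0)"
      using sp_step[of m l i k] i assms by (auto simp: mult_ac simp flip: fps_const_mult)
  qed
  finally show "mc (commutator (AL k) (XP n)) l m = mc (sc (- (kappa q t k / of_int k)) * XP (n + k)) l m"
    by (simp only: mc_sc_mult)
qed

lemma commutator_AL_XM:
  assumes "k \<noteq> 0"
  shows "commutator (AL k) (XM s n) = sc (kappa q t k / of_int k) * XM s (n + k)"
proof (rule mc_eqI)
  fix l m
  let ?e = "\<lambda>l. sp (plen l) (V (ptn_fun l)) k"
  have "mc (commutator (AL k) (XM s n)) l m = fps_const (?e m - ?e l) * mc (XM s n) l m"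
    unfolding commutator_def mc_diff AL_def mc_mult_dg mc_dg_mult
    by (simp add: left_diff_distrib flip: fps_const_sub)
  also have "\<dots> = fps_const (kappa q t k / of_int k) * mc (XM s (n + k)) l m"
    unfolding mc_XM[OF order_refl] sum_distrib_left
  proof (rule sum.cong[OF refl])
    fix i assume i: "i \<in> {1..plen m + 1}"
    have "V (ptn_fun m) i powi (n + k) = V (ptn_fun m) i powi n * V (ptn_fun m) i powi k"
      using vf_nonzero i by (intro power_int_add) auto
    moreover have "?e m - ?e l = kappa q t k / of_int k * V (ptn_fun m) i powi k" if "ptn_fun l = inc (ptn_fun m) i"
      using sp_step[OF that _ assms] i by (simp add: algebra_simps)
    ultimately show "fps_const (?e m - ?e l) * (if ptn_fun l = inc (ptn_fun m) i
        then fps_const s * a_minus q t * ampM q t (plen m + 1) (V (ptn_fun m)) i * fps_const (V (ptn_fun m) i powi n) else 0)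
      = fps_const (kappa q t k / of_int k) * (if ptn_fun l = inc (ptn_fun m) i
        then fps_const s * a_minus q t * ampM q t (plen m + 1) (V (ptn_fun m)) i * fps_const (V (ptn_fun m) i powi (n + k)) else 0)"
      by (auto simp: mult_ac simp flip: fps_const_mult)
  qed
  finally show "mc (commutator (AL k) (XM s n)) l m = mc (sc (kappa q t k / of_int k) * XM s (n + k)) l m"
    by (simp only: mc_sc_mult)
qed

section \<open>The commutator of raising and lowering currents\<close>

definition PSIp :: "complex \<Rightarrow> int \<Rightarrow> ptn opser"
  where "PSIp s n = dg (\<lambda>l. fps_const s * mode (Bp (plen l) (V (ptn_fun l))) (- n))"

definition PSIm :: "complex \<Rightarrow> int \<Rightarrow> ptn opser"
  where "PSIm s n = dg (\<lambda>l. fps_const (inverse s) * mode (Bm (plen l) (V (ptn_fun l))) n)"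

lemma mode_Bp: "mode (Bp N (V F)) n = csum (\<lambda>(i, j). if int i - int j = n
        then gexp (half_exp (sp N (V F))) $ i * gexp (half_exp_p (\<lambda>m. - sp N (V F) (- m))) $ j else 0)"
  unfolding Bp_def sp_def by (rule mode_theta_product) (auto simp: numc_denc_nonzero[OF genV_vf])

lemma mode_Bm: "mode (Bm N (V F)) n = csum (\<lambda>(i, j). if int i - int j = n
        then gexp (half_exp (\<lambda>m. - sp N (V F) (- m))) $ i * gexp (half_exp_p (sp N (V F))) $ j else 0)"
proof -
  have s: "spec (\<lambda>i. 1 / numc q t (V F) i) (\<lambda>i. 1 / denc q (V F) i) (idx N) = (\<lambda>m. - sp N (V F) (- m))"
    by (rule ext) (simp add: spec_inverse sp_def)
  have "mode (Bm N (V F)) n = csum (\<lambda>(i, j). if int i - int j = n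
        then gexp (half_exp (\<lambda>m. - sp N (V F) (- m))) $ i * gexp (half_exp_p (\<lambda>m. - (- sp N (V F) (- (- m))))) $ j else 0)"
    unfolding Bm_def
    by (rule mode_theta_product[of "idx N" "\<lambda>i. 1 / numc q t (V F) i" "\<lambda>i. 1 / denc q (V F) i", unfolded s])
       (auto simp: numc_denc_nonzero[OF genV_vf])
  then show ?thesis by (simp only: minus_minus)
qed

text \<open>The modes depend on N only through the power sums \<open>sp\<close>, which are
  independent of it by \<open>sp_mono\<close>.\<close>

lemma mode_B_mono:
  assumes "plen l \<le> N"
  shows "mode (Bp N (V (ptn_fun l))) n = mode (Bp (plen l) (V (ptn_fun l))) n"
    and "mode (Bm N (V (ptn_fun l))) n = mode (Bm (plen l) (V (ptn_fun l))) n"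
proof -
  have "sp N (V (ptn_fun l)) = sp (plen l) (V (ptn_fun l))" by (rule ext) (rule sp_mono[OF assms])
  then show "mode (Bp N (V (ptn_fun l))) n = mode (Bp (plen l) (V (ptn_fun l))) n"
    "mode (Bm N (V (ptn_fun l))) n = mode (Bm (plen l) (V (ptn_fun l))) n"
    by (simp_all only: mode_Bp mode_Bm)
qed

lemma mc_XP_XM:
  assumes N: "plen l + 1 \<le> N"
  defines "F \<equiv> ptn_fun l"
  defines "W \<equiv> \<lambda>i. (V F)(i := V F i / q)"
  shows "mc (XP a * XM s b) l m = (\<Sum>i\<in>{1..N}. \<Sum>j\<in>{1..N}. if F (i - 1) \<noteq> 0 \<and> ptn_fun m = inc (dec F i) j
     then fps_const s * a_minus q t * ampM q t N (W i) i * fps_const ((V F i / q) powi b)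
       * (a_plus q t * ampP q t (W i) j * fps_const (W i j powi a)) else 0)" (is "_ = (\<Sum>i\<in>_. \<Sum>j\<in>_. ?T i j)")
proof -
  have nz: "F (i - 1) \<noteq> 0" if "i \<in> {1..plen l}" for i using that unfolding F_def by (subst ptn_fun_nonzero_iff) auto
  have "mc (XP a * XM s b) l m = (\<Sum>i\<in>{1..plen l}. if is_ptn (dec F i)
    then fps_const s * a_minus q t * A_minus q t u l i * fps_const ((uu q t u l i / q) powi b) * mc (XP a) (Abs_ptn (dec F i)) m else 0)"
    by (rule mc_mult_row) (auto simp: mc_XM_dec F_def)
  also have "\<dots> = (\<Sum>i\<in>{1..plen l}. \<Sum>j\<in>{1..N}. ?T i j)"
  proof (rule sum.cong[OF refl])
    fix i assume i: "i \<in> {1..plen l}"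
    then have i1: "1 \<le> i" "i \<in> {1..N}" using N by auto
    have A: "A_minus q t u l i = ampM q t N (W i) i"
      unfolding W_def F_def by (rule A_minus_eq[OF i]) (use N in simp)
    have U: "uu q t u l i / q = V F i / q" using i1 by (simp add: uu_eq_vf F_def)
    show "(if is_ptn (dec F i) then fps_const s * a_minus q t * A_minus q t u l i * fps_const ((uu q t u l i / q) powi b)
        * mc (XP a) (Abs_ptn (dec F i)) m else 0) = (\<Sum>j\<in>{1..N}. ?T i j)"
    proof (cases "is_ptn (dec F i)")
      case True
      have "plen (Abs_ptn (dec F i)) + 1 \<le> N" using plen_dec[of l i] True N by (simp add: F_def)
      moreover have "V (ptn_fun (Abs_ptn (dec F i))) = W i"
        unfolding ptn_fun_Abs[OF True] W_def using i1 nz[OF i] q0 by (intro vf_dec)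
      ultimately show ?thesis
        using True nz[OF i] by (simp add: mc_XP A U ptn_fun_Abs sum_distrib_left if_distrib cong: if_cong sum.cong)
    next
      case False
      have "ampM q t N (W i) i = 0"
        unfolding W_def using ampM_vanish_dec[OF not_ptn_dec'[OF _ _ i1(1)] i1(2), of F] False by (simp add: F_def)
      then show ?thesis using False by (simp add: sum.neutral)
    qed
  qed
  also have "\<dots> = (\<Sum>i\<in>{1..N}. \<Sum>j\<in>{1..N}. ?T i j)"
  proof (rule sum.mono_neutral_left)
    show "\<forall>i\<in>{1..N} - {1..plen l}. (\<Sum>j\<in>{1..N}. ?T i j) = 0"
    proof
      fix i assume "i \<in> {1..N} - {1..plen l}"
      then have "F (i - 1) = 0" unfolding F_def by (intro ptn_fun_eq_0) auto
      then show "(\<Sum>j\<in>{1..N}. ?T i j) = 0" by simp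
    qed
  qed (use N in auto)
  finally show ?thesis .
qed

lemma mc_XM_XP:
  assumes N: "plen l + 1 \<le> N" "plen m + 1 \<le> N"
  defines "F \<equiv> ptn_fun l" and "M \<equiv> ptn_fun m"
  shows "mc (XM s b * XP a) l m = (\<Sum>i\<in>{1..N}. \<Sum>j\<in>{1..N}. if inc F j = inc M i
     then a_plus q t * ampP q t (V F) j * fps_const (V F j powi a)
       * (fps_const s * a_minus q t * ampM q t N (V M) i * fps_const (V M i powi b)) else 0)" (is "_ = (\<Sum>i\<in>_. \<Sum>j\<in>_. ?T i j)")
proof -
  have X: "mc (XP a) l m' = (\<Sum>i\<in>{1..N}. if ptn_fun m' = inc F i
     then a_plus q t * ampP q t (V F) i * fps_const (V F i powi a) else 0)" for m'
    unfolding F_def by (rule mc_XP[OF N(1)])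
  have "mc (XM s b * XP a) l m = (\<Sum>j\<in>{1..N}. if is_ptn (inc F j)
    then a_plus q t * ampP q t (V F) j * fps_const (V F j powi a) * mc (XM s b) (Abs_ptn (inc F j)) m else 0)"
    by (rule mc_mult_row[OF finite_atLeastAtMost X])
  also have "\<dots> = (\<Sum>j\<in>{1..N}. \<Sum>i\<in>{1..N}. ?T i j)"
  proof (rule sum.cong[OF refl])
    fix j assume j: "j \<in> {1..N}"
    show "(if is_ptn (inc F j) then a_plus q t * ampP q t (V F) j * fps_const (V F j powi a)
        * mc (XM s b) (Abs_ptn (inc F j)) m else 0) = (\<Sum>i\<in>{1..N}. ?T i j)"
    proof (cases "is_ptn (inc F j)")
      case True
      then show ?thesis
        by (simp add: mc_XM[OF N(2)] ptn_fun_Abs sum_distrib_left M_def if_distrib cong: if_cong sum.cong)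
    next
      case False
      have "ampP q t (V F) j = 0" by (rule ampP_vanish[OF _ False]) (use j in \<open>auto simp: F_def\<close>)
      then show ?thesis using False by (simp add: sum.neutral)
    qed
  qed
  also have "\<dots> = (\<Sum>i\<in>{1..N}. \<Sum>j\<in>{1..N}. ?T i j)" by (rule sum.swap)
  finally show ?thesis .
qed

lemma commutator_XP_XM:
  assumes s: "s^2 = q / t"
  shows "commutator (XP a) (XM s b) = sc ((1 - q) * (1 - 1 / t) / (1 - q / t)) *
    (PSIp s (- a - b) - PSIm s (- a - b))"
proof (rule mc_eqI)
  fix l m
  \<comment> \<open>Large enough for both partitions, with rows N and N+1 of \<open>l\<close> empty,
    as \<open>residue_last\<close> requires.\<close>
  define N where "N = plen l + plen m + 2"
  have N: "plen l + 1 \<le> N" "plen m + 1 \<le> N" "1 \<le> N" by (simp_all add: N_def)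
  define F where "F = ptn_fun l"
  define M where "M = ptn_fun m"
  define W where "W i = (V F)(i := V F i / q)" for i
  note c1 = mc_XP_XM[OF N(1), of a s b m, folded F_def, folded W_def M_def]
  note c2 = mc_XM_XP[OF N(1,2), of s b a, folded F_def M_def]
  let ?C = "(1 - q) * (1 - 1 / t) / (1 - q / t)"
  show "mc (commutator (XP a) (XM s b)) l m = mc (sc ?C * (PSIp s (- a - b) - PSIm s (- a - b))) l m"
  proof (cases "l = m")
    case False
    then have FM: "F \<noteq> M" by (simp add: F_def M_def ptn_eq_iff)
    have "mc (XP a * XM s b) l m = mc (XM s b * XP a) l m"
      unfolding c1 c2
    proof (intro sum.cong refl)
      fix i j assume ij: "i \<in> {1..N}" "j \<in> {1..N}"
      \<comment> \<open>For F \<noteq> M the two orders of the moves use the same pairs of rows; i =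
        j would lead back to \<open>F\<close>.\<close>
      have iff: "(F (i - 1) \<noteq> 0 \<and> M = inc (dec F i) j) \<longleftrightarrow> inc F j = inc M i"
      proof
        assume a: "F (i - 1) \<noteq> 0 \<and> M = inc (dec F i) j"
        then show "inc F j = inc M i" using inc_dec[of F i] inc_commute[of "dec F i" j i] by simp
      next
        assume a: "inc F j = inc M i"
        have "i \<noteq> j"
        proof
          assume "i = j"
          then have "dec (inc F i) i = dec (inc M i) i" using a by simp
          then show False using FM by (simp add: dec_inc)
        qed
        then have ne: "i - 1 \<noteq> j - 1" using ij by auto
        have "inc F j (i - 1) = inc M i (i - 1)" by (simp only: a)
        then have "F (i - 1) = M (i - 1) + 1" using ne by (simp add: inc_def)
        moreover have "M = dec (inc F j) i" by (simp add: a dec_inc)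
        moreover have "dec (inc F j) i = inc (dec F i) j" using ne by (auto simp: dec_def inc_def fun_eq_iff)
        ultimately show "F (i - 1) \<noteq> 0 \<and> M = inc (dec F i) j" by simp
      qed
      show "(if F (i - 1) \<noteq> 0 \<and> M = inc (dec F i) j
         then fps_const s * a_minus q t * ampM q t N (W i) i * fps_const ((V F i / q) powi b)
           * (a_plus q t * ampP q t (W i) j * fps_const (W i j powi a)) else 0)
        = (if inc F j = inc M i
         then a_plus q t * ampP q t (V F) j * fps_const (V F j powi a)
           * (fps_const s * a_minus q t * ampM q t N (V M) i * fps_const (V M i powi b)) else 0)"
      proof (cases "inc F j = inc M i")
        case True
        with iff have h: "F (i - 1) \<noteq> 0" "M = inc (dec F i) j" by auto
        have ne: "i \<noteq> j"
        proof
          assume "i = j"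
          then show False using h FM inc_dec[of F i] by simp
        qed
        have W: "V (dec F i) = W i" unfolding W_def using ij h q0 by (intro vf_dec) auto
        have VM: "V M = (W i)(j := q * W i j)" unfolding h(2) W[symmetric] using ij by (intro vf_inc) auto
        have VF: "V F = (W i)(i := q * W i i)" using q0 by (simp add: W_def)
        have "genV N (W i)" unfolding W[symmetric] by (rule genV_vf)
        from amp_commute[OF this ij ne]
        have e1: "ampM q t N (W i) i * ampP q t (W i) j = ampP q t (V F) j * ampM q t N (V M) i"
          by (simp only: VM VF[symmetric])
        have e2: "W i j = V F j" "V M i = V F i / q" using ne VM by (auto simp: W_def)
        have re: "A * M1 * B * (C * P1 * D) = C * P2 * D * (A * M2 * B)" if "M1 * P1 = P2 * M2"
          for A B C D M1 M2 P1 P2 :: "complex fps"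
        proof -
          have "A * M1 * B * (C * P1 * D) = A * B * C * D * (M1 * P1)" by (simp only: mult_ac)
          then show ?thesis unfolding that by (simp only: mult_ac)
        qed
        show ?thesis
          unfolding iff if_P[OF True] e2 by (rule re[OF e1])
      next
        case False
        show ?thesis unfolding iff if_not_P[OF False] by (rule refl)
      qed
    qed
    then show ?thesis
      using False by (simp add: commutator_def mc_diff mc_sc_mult PSIp_def PSIm_def mc_dg)
  next
    case True
    then have MF: "M = F" by (simp add: F_def M_def)
    have "mc (XP a * XM s b) l m = (\<Sum>i\<in>{1..N}. fps_const s * a_minus q t * a_plus q t *
        (fps_const ((V F i / q) powi (a + b)) * (ampP q t (W i) i * ampM q t N (W i) i)))"
      unfolding c1
    proof (rule sum.cong[OF refl])
      fix i assume i: "i \<in> {1..N}"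
      have iff: "(F (i - 1) \<noteq> 0 \<and> M = inc (dec F i) j) \<longleftrightarrow> (j = i \<and> F (i - 1) \<noteq> 0)" if "j \<in> {1..N}" for j
        using inc_dec[of F i] inc_eq_iff[of i j "dec F i"] i that MF by auto
      let ?Q = "fps_const s * a_minus q t * a_plus q t *
        (fps_const ((V F i / q) powi (a + b)) * (ampP q t (W i) i * ampM q t N (W i) i))"
      \<comment> \<open>A row without boxes has nothing to remove. The next row is empty too, so the
        amplitude vanishes and the sum may run over all rows.\<close>
      have z: "ampM q t N (W i) i = 0" if "F (i - 1) = 0"
      proof -
        have "F i = F (i - 1)" by (rule not_ptn_dec') (use that i in \<open>auto simp: F_def\<close>)
        then show ?thesis unfolding W_def by (rule ampM_vanish_dec[OF _ i])
      qed
      have v: "V F i / q \<noteq> 0" using i vf_nonzero q0 by simp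
      have "(\<Sum>j\<in>{1..N}. if F (i - 1) \<noteq> 0 \<and> M = inc (dec F i) j
         then fps_const s * a_minus q t * ampM q t N (W i) i * fps_const ((V F i / q) powi b)
           * (a_plus q t * ampP q t (W i) j * fps_const (W i j powi a)) else 0)
        = (\<Sum>j\<in>{1..N}. if j = i then ?Q else 0)"
      proof (rule sum.cong[OF refl])
        fix j assume j: "j \<in> {1..N}"
        show "(if F (i - 1) \<noteq> 0 \<and> M = inc (dec F i) j
         then fps_const s * a_minus q t * ampM q t N (W i) i * fps_const ((V F i / q) powi b)
           * (a_plus q t * ampP q t (W i) j * fps_const (W i j powi a)) else 0) = (if j = i then ?Q else 0)"
          unfolding iff[OF j] using z power_int_add[of "V F i / q" a b] v
          by (auto simp: W_def mult_ac simp flip: fps_const_mult)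
      qed
      also have "\<dots> = ?Q" using i by simp
      finally show "(\<Sum>j\<in>{1..N}. if F (i - 1) \<noteq> 0 \<and> M = inc (dec F i) j
         then fps_const s * a_minus q t * ampM q t N (W i) i * fps_const ((V F i / q) powi b)
           * (a_plus q t * ampP q t (W i) j * fps_const (W i j powi a)) else 0) = ?Q" .
    qed
    moreover have "mc (XM s b * XP a) l m = (\<Sum>i\<in>{1..N}. fps_const s * a_minus q t * a_plus q t *
        (fps_const (V F i powi (a + b)) * (ampP q t (V F) i * ampM q t N (V F) i)))"
      unfolding c2 MF
    proof (rule sum.cong[OF refl])
      fix i assume i: "i \<in> {1..N}"
      let ?Q = "fps_const s * a_minus q t * a_plus q t *
        (fps_const (V F i powi (a + b)) * (ampP q t (V F) i * ampM q t N (V F) i))"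
      have v: "V F i \<noteq> 0" using i vf_nonzero by simp
      have "(\<Sum>j\<in>{1..N}. if inc F j = inc F i
         then a_plus q t * ampP q t (V F) j * fps_const (V F j powi a)
           * (fps_const s * a_minus q t * ampM q t N (V F) i * fps_const (V F i powi b)) else 0)
        = (\<Sum>j\<in>{1..N}. if j = i then ?Q else 0)"
        using i inc_eq_iff[of _ i F] power_int_add[of "V F i" a b] v
        by (intro sum.cong refl) (auto simp: mult_ac simp flip: fps_const_mult)
      also have "\<dots> = ?Q" using i by simp
      finally show "(\<Sum>j\<in>{1..N}. if inc F j = inc F i
         then a_plus q t * ampP q t (V F) j * fps_const (V F j powi a)
           * (fps_const s * a_minus q t * ampM q t N (V F) i * fps_const (V F i powi b)) else 0) = ?Q" .
    qed
    ultimately have L: "mc (commutator (XP a) (XM s b)) l m = a_plus q t * a_minus q t * fps_const s *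
      ((\<Sum>k\<in>{1..N}. fps_const ((V F k / q) powi (a + b)) * (ampP q t (W k) k * ampM q t N (W k) k))
       - (\<Sum>k\<in>{1..N}. fps_const (V F k powi (a + b)) * (ampP q t (V F) k * ampM q t N (V F) k)))"
      unfolding commutator_def mc_diff by (simp only: sum_distrib_left[symmetric] right_diff_distrib mult_ac)
    have "V F (N + 1) = V F N / t"
      using vf_next[of N t F q u] N t0 by (simp add: F_def N_def ptn_fun_eq_0)
    note d = psi_difference[OF genV_vf N(3) this s, of "- a - b"]
    have ab: "- (- a - b) = a + b" by simp
    have PQ: "mode (Bp N (V F)) n = mode (Bp (plen l) (V (ptn_fun l))) n"
       "mode (Bm N (V F)) n = mode (Bm (plen l) (V (ptn_fun l))) n" for n
      unfolding F_def using mode_B_mono[of l N] N by simp_all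
    have e: "mc (sc ?C * (PSIp s (- a - b) - PSIm s (- a - b))) l m
      = fps_const ?C * (fps_const s * mode (Bp N (V F)) (- (- a - b)) - fps_const (inverse s) * mode (Bm N (V F)) (- a - b))"
      using True unfolding PQ by (simp only: mc_sc_mult mc_diff PSIp_def PSIm_def mc_dg if_True simp_thms)
    show ?thesis unfolding L e unfolding d unfolding ab W_def by (rule refl)
  qed
qed

end

section \<open>Sums over paths\<close>

definition path2 :: "nat \<Rightarrow> (nat \<Rightarrow> nat) \<Rightarrow> (nat \<Rightarrow> nat) \<Rightarrow> (nat \<times> nat) set"
  where "path2 N F M = {(i, j). i \<in> {1..N} \<and> j \<in> {1..N} \<and> M = inc (inc F i) j}"

definition path3 :: "nat \<Rightarrow> (nat \<Rightarrow> nat) \<Rightarrow> (nat \<Rightarrow> nat) \<Rightarrow> (nat \<times> nat \<times> nat) set"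
  where "path3 N F M = {(i, j, k). i \<in> {1..N} \<and> j \<in> {1..N} \<and> k \<in> {1..N} \<and> M = inc (inc (inc F i) j) k}"

lemma finite_path2 [simp]: "finite (path2 N F M)"
  by (rule finite_subset[of _ "{1..N} \<times> {1..N}"]) (auto simp: path2_def)

lemma finite_path3 [simp]: "finite (path3 N F M)"
  by (rule finite_subset[of _ "{1..N} \<times> {1..N} \<times> {1..N}"]) (auto simp: path3_def)

lemma sum_path2:
  "(\<Sum>i\<in>{1..N}. \<Sum>j\<in>{1..N}. if M = inc (inc F i) j then f i j else 0) = (\<Sum>(i, j)\<in>path2 N F M. f i j)"
proof -
  have "(\<Sum>(i, j)\<in>path2 N F M. f i j) = (\<Sum>(i, j)\<in>{x \<in> {1..N} \<times> {1..N}. case x of (i, j) \<Rightarrow> M = inc (inc F i) j}. f i j)"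
    by (rule sum.cong) (auto simp: path2_def)
  then show ?thesis
    by (simp add: sum.inter_filter sum.cartesian_product case_prod_unfold)
qed

lemma sum_path3:
  "(\<Sum>i\<in>{1..N}. \<Sum>j\<in>{1..N}. \<Sum>k\<in>{1..N}. if M = inc (inc (inc F i) j) k then f i j k else 0)
    = (\<Sum>(i, j, k)\<in>path3 N F M. f i j k)"
proof -
  have "(\<Sum>(i, j, k)\<in>path3 N F M. f i j k)
    = (\<Sum>(i, j, k)\<in>{x \<in> {1..N} \<times> {1..N} \<times> {1..N}. case x of (i, j, k) \<Rightarrow> M = inc (inc (inc F i) j) k}. f i j k)"
    by (rule sum.cong) (auto simp: path3_def)
  then show ?thesis
    by (simp add: sum.inter_filter sum.cartesian_product case_prod_unfold)
qed

text \<open>Path reversal matches the two sides. For i \<noteq> j the contents do not depend on the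
  order; for i = j both weights vanish.\<close>

lemma (in amplitudes) quad_sum:
  assumes "admissible W" "P \<subseteq> I \<times> I" "\<And>i j. (i, j) \<in> P \<Longrightarrow> (j, i) \<in> P"
  shows "(\<Sum>(i, j)\<in>P. quadT W j i * fps_const (W i powi (- b) * up W i j powi (- a)))
    = - (\<Sum>(i, j)\<in>P. quadT W j i * fps_const (W i powi (- a) * up W i j powi (- b)))"
proof -
  have "(\<Sum>(i, j)\<in>P. quadT W j i * fps_const (W i powi (- a) * up W i j powi (- b)))
    = (\<Sum>(i, j)\<in>P. quadT W i j * fps_const (W j powi (- a) * up W j i powi (- b)))"
    by (rule sum.reindex_bij_witness[of _ "\<lambda>(i, j). (j, i)" "\<lambda>(i, j). (j, i)"]) (use assms(3) in auto)
  also have "\<dots> = (\<Sum>(i, j)\<in>P. - (quadT W j i * fps_const (W i powi (- b) * up W i j powi (- a))))"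
  proof (rule sum.cong[OF refl], clarify)
    fix i j assume "(i, j) \<in> P"
    then have I: "i \<in> I" "j \<in> I" using assms(2) by auto
    show "quadT W i j * fps_const (W j powi (- a) * up W j i powi (- b))
       = - (quadT W j i * fps_const (W i powi (- b) * up W i j powi (- a)))"
    proof (cases "i = j")
      case True
      have "quadT W j j = 0" by (simp add: quadT_def Let_def cubicP_def)
      then show ?thesis using True by simp
    next
      case False
      then show ?thesis using quadT_antisym[OF assms(1) I] by (simp add: mult_ac)
    qed
  qed
  finally show ?thesis by (simp add: sum_negf case_prod_unfold)
qed

definition expH :: "int \<Rightarrow> int \<Rightarrow> int \<Rightarrow> complex \<Rightarrow> complex \<Rightarrow> complex \<Rightarrow> complex"
  where "expH a b c z w v = z powi (- a) * w powi (- b) * v powi (- c)"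

text \<open>Each of the six sums is reindexed by its own permutation of \<open>P\<close>, which
  moves the permutation from the exponents to the rows; \<open>cubT_sum\<close> then applies path by
  path.\<close>

lemma (in amplitudes) cub_sum:
  assumes "admissible W" "P \<subseteq> I \<times> I \<times> I" "\<And>i j k. (i, j, k) \<in> P \<Longrightarrow> (j, i, k) \<in> P \<and> (i, k, j) \<in> P"
  defines "S \<equiv> \<lambda>a b c. \<Sum>(i, j, k)\<in>P. cubT W k j i (expH a b c)"
  shows "S a b c + S a c b + S b a c + S b c a + S c a b + S c b a = 0"
proof -
  have p: "(j, i, k) \<in> P" "(i, k, j) \<in> P" "(k, j, i) \<in> P" "(j, k, i) \<in> P" "(k, i, j) \<in> P"
    if "(i, j, k) \<in> P" for i j k
  proof -
    show a: "(j, i, k) \<in> P" and b: "(i, k, j) \<in> P" using assms(3)[OF that] by simp_all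
    show "(k, i, j) \<in> P" using assms(3)[OF b] by simp
    show c: "(j, k, i) \<in> P" using assms(3)[OF a] by simp
    show "(k, j, i) \<in> P" using assms(3)[OF c] by simp
  qed
  have 1: "S a b c = (\<Sum>(i, j, k)\<in>P. cubT W i j k (expH a b c))"
    unfolding S_def by (rule sum.reindex_bij_witness[of _ "\<lambda>(i, j, k). (k, j, i)" "\<lambda>(i, j, k). (k, j, i)"]) (auto intro: p(3))
  have 2: "S a c b = (\<Sum>(i, j, k)\<in>P. cubT W i k j (expH a c b))"
    unfolding S_def by (rule sum.reindex_bij_witness[of _ "\<lambda>(i, j, k). (j, k, i)" "\<lambda>(j, k, i). (i, j, k)"]) (auto intro: p(4,5))
  have 3: "S b a c = (\<Sum>(i, j, k)\<in>P. cubT W j i k (expH b a c))"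
    unfolding S_def by (rule sum.reindex_bij_witness[of _ "\<lambda>(i, j, k). (k, i, j)" "\<lambda>(k, i, j). (i, j, k)"]) (auto intro: p(4,5))
  have 4: "S b c a = (\<Sum>(i, j, k)\<in>P. cubT W j k i (expH b c a))"
    unfolding S_def by (rule sum.reindex_bij_witness[of _ "\<lambda>(i, j, k). (i, k, j)" "\<lambda>(i, k, j). (i, j, k)"]) (auto intro: p(2))
  have 5: "S c a b = (\<Sum>(i, j, k)\<in>P. cubT W k i j (expH c a b))"
    unfolding S_def by (rule sum.reindex_bij_witness[of _ "\<lambda>(i, j, k). (j, i, k)" "\<lambda>(j, i, k). (i, j, k)"]) (auto intro: p(1))
  have 6: "S c b a = (\<Sum>(i, j, k)\<in>P. cubT W k j i (expH c b a))"
    unfolding S_def ..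
  have H: "expH a c b = (\<lambda>z w v. expH a b c z v w)" "expH b a c = (\<lambda>z w v. expH a b c w z v)"
    "expH b c a = (\<lambda>z w v. expH a b c v z w)" "expH c a b = (\<lambda>z w v. expH a b c w v z)"
    "expH c b a = (\<lambda>z w v. expH a b c v w z)"
    by (auto simp: expH_def fun_eq_iff mult_ac)
  have "S a b c + S a c b + S b a c + S b c a + S c a b + S c b a
    = (\<Sum>(i, j, k)\<in>P. cubT W i j k (expH a b c) + cubT W i k j (expH a c b) + cubT W j i k (expH b a c)
       + cubT W j k i (expH b c a) + cubT W k i j (expH c a b) + cubT W k j i (expH c b a))"
    unfolding 1 2 3 4 5 6 by (simp add: sum.distrib case_prod_unfold)
  also have "\<dots> = 0"
  proof (rule sum.neutral, clarify)
    fix i j k assume "(i, j, k) \<in> P"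
    then have "i \<in> I" "j \<in> I" "k \<in> I" using assms(2) by auto
    from cubT_sum[OF assms(1) this, of "expH a b c"]
    show "cubT W i j k (expH a b c) + cubT W i k j (expH a c b) + cubT W j i k (expH b a c)
       + cubT W j k i (expH b c a) + cubT W k i j (expH c a b) + cubT W k j i (expH c b a) = 0"
      unfolding H .
  qed
  finally show ?thesis .
qed

lemma pfin_dg_mult:
  fixes T :: "'i \<Rightarrow> 'b opser"
  assumes "pfin h" shows "pfin (\<lambda>k. dg (\<lambda>_. h k) * T k)"
  unfolding pfin_def
proof
  fix n
  have "{k. (dg (\<lambda>_. h k) * T k) $ n \<noteq> 0} \<subseteq> psupp h n"
  proof
    fix k assume "k \<in> {k. (dg (\<lambda>_. h k) * T k) $ n \<noteq> 0}"
    then have "(\<Sum>i=0..n. dg (\<lambda>_. h k) $ i * T k $ (n - i)) \<noteq> 0" by (simp add: fps_mult_nth)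
    then obtain i where "i \<in> {0..n}" "dg (\<lambda>_. h k) $ i * T k $ (n - i) \<noteq> 0"
      by (rule sum.not_neutral_contains_not_neutral)
    then have "i \<le> n" "dg (\<lambda>_. h k) $ i \<noteq> (0 :: 'b endo)" by auto
    then have "i \<le> n" "h k $ i \<noteq> 0" by (simp_all add: dg_nth_eq_0)
    then show "k \<in> psupp h n" by (auto simp: psupp_def)
  qed
  then show "finite {k. (dg (\<lambda>_. h k) * T k) $ n \<noteq> 0}" by (rule finite_subset) (rule finite_psupp[OF assms])
qed

text \<open>The finite sum over paths is taken out of the p-adic sum. In the applications
  \<open>y p k\<close> is a power of content ratios, so the inner sum is the structure series at
  these ratios.\<close>

lemma csum_over_paths:
  fixes h :: "'k \<Rightarrow> complex fps"
  assumes "finite P" "pfin h" "\<And>k. X k = (\<Sum>p\<in>P. w p * fps_const (c p * y p k))"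
  shows "csum (\<lambda>k. h k * X k) = (\<Sum>p\<in>P. w p * fps_const (c p) * csum (\<lambda>k. h k * fps_const (y p k)))"
proof -
  have p: "pfin (\<lambda>k. h k * fps_const (y p k))" for p
    by (rule pfin_mono[OF assms(2)]) simp
  have "csum (\<lambda>k. h k * X k) = csum (\<lambda>k. \<Sum>p\<in>P. (w p * fps_const (c p)) * (h k * fps_const (y p k)))"
    unfolding assms(3) sum_distrib_left fps_const_mult[symmetric] by (simp only: mult_ac)
  also have "\<dots> = (\<Sum>p\<in>P. csum (\<lambda>k. (w p * fps_const (c p)) * (h k * fps_const (y p k))))"
    by (rule csum_sum) (use assms(1) pfin_cmult[OF p] in auto)
  also have "\<dots> = (\<Sum>p\<in>P. w p * fps_const (c p) * csum (\<lambda>k. h k * fps_const (y p k)))"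
    by (intro sum.cong refl csum_cmult p)
  finally show ?thesis .
qed

lemma csum_gev: "csum (\<lambda>k. F $ k * fps_const (y ^ k)) = cid.gev y F"
  by (simp add: cid.gev_def)

lemma csum_gev3:
  assumes "pfin (fps_nth F)"
  shows "csum (\<lambda>(i, j, k). (F $ i * F $ j * F $ k) * fps_const (x ^ i * y ^ j * z ^ k))
    = cid.gev x F * cid.gev y F * cid.gev z F"
proof -
  have p: "pfin (\<lambda>k. F $ k * fps_const (y ^ k))" for y
    by (rule pfin_mono[OF assms]) simp
  have "cid.gev x F * (cid.gev y F * cid.gev z F) = csum (\<lambda>i. F $ i * fps_const (x ^ i)) *
    csum (\<lambda>(j, k). F $ j * fps_const (y ^ j) * (F $ k * fps_const (z ^ k)))"
    unfolding csum_gev[symmetric] by (subst csum_prod[OF p p]) simp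
  also have "\<dots> = csum (\<lambda>(i, p). F $ i * fps_const (x ^ i) * (case p of (j, k) \<Rightarrow> F $ j * fps_const (y ^ j) * (F $ k * fps_const (z ^ k))))"
    by (rule csum_prod[OF p pfin_mult[OF p p]])
  also have "(\<lambda>(i, p). F $ i * fps_const (x ^ i) * (case p of (j, k) \<Rightarrow> F $ j * fps_const (y ^ j) * (F $ k * fps_const (z ^ k))))
     = (\<lambda>(i, j, k). (F $ i * F $ j * F $ k) * fps_const (x ^ i * y ^ j * z ^ k))"
    by (auto simp: fun_eq_iff mult_ac simp flip: fps_const_mult)
  finally show ?thesis by (simp add: mult.assoc)
qed

lemma pfin3:
  assumes "pfin (fps_nth F)"
  shows "pfin (\<lambda>(i, j, k). F $ i * F $ j * (F $ k :: complex fps))"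
proof -
  have "pfin (\<lambda>(i, p). F $ i * (case p of (j, k) \<Rightarrow> F $ j * F $ k))"
    by (intro pfin_mult assms)
  then show ?thesis by (rule pfin_mono) (auto simp: mult.assoc)
qed

context fock_params
begin

section \<open>Products of currents\<close>

definition pw2 :: "((nat \<Rightarrow> complex) \<Rightarrow> nat \<Rightarrow> complex fps) \<Rightarrow> (nat \<Rightarrow> nat) \<Rightarrow> int \<Rightarrow> int \<Rightarrow> nat \<Rightarrow> nat \<Rightarrow> complex fps"
  where "pw2 A F a b i j = A (V F) i * A (V (inc F i)) j * fps_const (V F i powi a * V (inc F i) j powi b)"

definition pw3 :: "((nat \<Rightarrow> complex) \<Rightarrow> nat \<Rightarrow> complex fps) \<Rightarrow> (nat \<Rightarrow> nat) \<Rightarrow> int \<Rightarrow> int \<Rightarrow> int \<Rightarrow> nat \<Rightarrow> nat \<Rightarrow> nat \<Rightarrow> complex fps"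
  where "pw3 A F a b c i j k = A (V F) i * A (V (inc F i)) j * A (V (inc (inc F i) j)) k
     * fps_const (V F i powi a * V (inc F i) j powi b * V (inc (inc F i) j) k powi c)"

text \<open>The right factor acts first, hence the exchanged exponents. Terms with an illegal
  intermediate shape can be included because their first amplitude vanishes.\<close>

lemma mc_XP2:
  assumes "plen l + 2 \<le> N"
  shows "mc (XP a * XP b) l m = (\<Sum>(i, j)\<in>path2 N (ptn_fun l) (ptn_fun m). (a_plus q t)^2 * pw2 (ampP q t) (ptn_fun l) b a i j)"
proof -
  let ?F = "ptn_fun l" and ?A = "a_plus q t"
  have N: "plen l + 1 \<le> N" using assms by simp
  have "mc (XP a * XP b) l m = (\<Sum>i\<in>{1..N}. if is_ptn (inc ?F i)
    then ?A * ampP q t (V ?F) i * fps_const (V ?F i powi b) * mc (XP a) (Abs_ptn (inc ?F i)) m else 0)"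
    by (rule mc_mult_row[OF finite_atLeastAtMost mc_XP[OF N]])
  also have "\<dots> = (\<Sum>i\<in>{1..N}. \<Sum>j\<in>{1..N}. if ptn_fun m = inc (inc ?F i) j then ?A^2 * pw2 (ampP q t) ?F b a i j else 0)"
  proof (rule sum.cong[OF refl])
    fix i assume i: "i \<in> {1..N}"
    show "(if is_ptn (inc ?F i) then ?A * ampP q t (V ?F) i * fps_const (V ?F i powi b) * mc (XP a) (Abs_ptn (inc ?F i)) m else 0)
      = (\<Sum>j\<in>{1..N}. if ptn_fun m = inc (inc ?F i) j then ?A^2 * pw2 (ampP q t) ?F b a i j else 0)"
    proof (cases "is_ptn (inc ?F i)")
      case True
      have "plen (Abs_ptn (inc ?F i)) + 1 \<le> N" using plen_inc[OF True] assms by simp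
      then have E: "mc (XP a) (Abs_ptn (inc ?F i)) m = (\<Sum>j\<in>{1..N}. if ptn_fun m = inc (inc ?F i) j
         then ?A * ampP q t (V (inc ?F i)) j * fps_const (V (inc ?F i) j powi a) else 0)"
        by (rule mc_XP[where l = "Abs_ptn (inc ?F i)", unfolded ptn_fun_Abs[OF True]])
      show ?thesis
        unfolding if_P[OF True] E sum_distrib_left
        by (intro sum.cong refl) (simp add: pw2_def power2_eq_square mult_ac flip: fps_const_mult)
    next
      case False
      have "ampP q t (V ?F) i = 0" by (rule ampP_vanish[OF _ False]) (use i in auto)
      then show ?thesis using False by (simp add: pw2_def sum.neutral)
    qed
  qed
  finally show ?thesis by (simp only: sum_path2)
qed

lemma mc_XP3:
  assumes "plen l + 3 \<le> N"
  shows "mc (XP a * XP b * XP c) l m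
    = (\<Sum>(i, j, k)\<in>path3 N (ptn_fun l) (ptn_fun m). (a_plus q t)^3 * pw3 (ampP q t) (ptn_fun l) c b a i j k)"
proof -
  let ?F = "ptn_fun l" and ?A = "a_plus q t"
  have N: "plen l + 1 \<le> N" using assms by simp
  have "mc (XP a * XP b * XP c) l m = (\<Sum>i\<in>{1..N}. if is_ptn (inc ?F i)
    then ?A * ampP q t (V ?F) i * fps_const (V ?F i powi c) * mc (XP a * XP b) (Abs_ptn (inc ?F i)) m else 0)"
    by (rule mc_mult_row[OF finite_atLeastAtMost mc_XP[OF N]])
  also have "\<dots> = (\<Sum>i\<in>{1..N}. \<Sum>j\<in>{1..N}. \<Sum>k\<in>{1..N}. if ptn_fun m = inc (inc (inc ?F i) j) k
      then ?A^3 * pw3 (ampP q t) ?F c b a i j k else 0)"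
  proof (rule sum.cong[OF refl])
    fix i assume i: "i \<in> {1..N}"
    show "(if is_ptn (inc ?F i) then ?A * ampP q t (V ?F) i * fps_const (V ?F i powi c) * mc (XP a * XP b) (Abs_ptn (inc ?F i)) m else 0)
      = (\<Sum>j\<in>{1..N}. \<Sum>k\<in>{1..N}. if ptn_fun m = inc (inc (inc ?F i) j) k then ?A^3 * pw3 (ampP q t) ?F c b a i j k else 0)"
    proof (cases "is_ptn (inc ?F i)")
      case True
      have "plen (Abs_ptn (inc ?F i)) + 2 \<le> N" using plen_inc[OF True] assms by simp
      then have E: "mc (XP a * XP b) (Abs_ptn (inc ?F i)) m = (\<Sum>j\<in>{1..N}. \<Sum>k\<in>{1..N}. if ptn_fun m = inc (inc (inc ?F i) j) k
         then ?A^2 * pw2 (ampP q t) (inc ?F i) b a j k else 0)"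
        unfolding sum_path2 by (rule mc_XP2[where l = "Abs_ptn (inc ?F i)", unfolded ptn_fun_Abs[OF True]])
      show ?thesis
        unfolding if_P[OF True] E sum_distrib_left
        by (intro sum.cong refl)
           (simp add: pw2_def pw3_def power2_eq_square power3_eq_cube mult_ac flip: fps_const_mult)
    next
      case False
      have "ampP q t (V ?F) i = 0" by (rule ampP_vanish[OF _ False]) (use i in auto)
      then show ?thesis using False by (simp add: pw3_def sum.neutral)
    qed
  qed
  finally show ?thesis by (simp only: sum_path3)
qed

text \<open>In the transposed picture boxes are added to the target \<open>m\<close>, so the left
  factor comes first and the exponents keep their order.\<close>

lemma mc_XM2:
  assumes "plen m + 2 \<le> N"
  shows "mc (XM s a * XM s b) l m
    = (\<Sum>(i, j)\<in>path2 N (ptn_fun m) (ptn_fun l). (fps_const s * a_minus q t)^2 * pw2 (ampM q t N) (ptn_fun m) a b i j)"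
proof -
  let ?F = "ptn_fun m" and ?A = "fps_const s * a_minus q t"
  have N: "plen m + 1 \<le> N" using assms by simp
  have "mc (XM s a * XM s b) l m = (\<Sum>i\<in>{1..N}. if is_ptn (inc ?F i)
    then ?A * ampM q t N (V ?F) i * fps_const (V ?F i powi a) * mc (XM s b) l (Abs_ptn (inc ?F i)) else 0)"
    by (rule mc_mult_column[OF finite_atLeastAtMost rowfin_XM mc_XM[OF N]])
  also have "\<dots> = (\<Sum>i\<in>{1..N}. \<Sum>j\<in>{1..N}. if ptn_fun l = inc (inc ?F i) j then ?A^2 * pw2 (ampM q t N) ?F a b i j else 0)"
  proof (rule sum.cong[OF refl])
    fix i assume i: "i \<in> {1..N}"
    show "(if is_ptn (inc ?F i) then ?A * ampM q t N (V ?F) i * fps_const (V ?F i powi a) * mc (XM s b) l (Abs_ptn (inc ?F i)) else 0)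
      = (\<Sum>j\<in>{1..N}. if ptn_fun l = inc (inc ?F i) j then ?A^2 * pw2 (ampM q t N) ?F a b i j else 0)"
    proof (cases "is_ptn (inc ?F i)")
      case True
      have "plen (Abs_ptn (inc ?F i)) + 1 \<le> N" using plen_inc[OF True] assms by simp
      then have E: "mc (XM s b) l (Abs_ptn (inc ?F i)) = (\<Sum>j\<in>{1..N}. if ptn_fun l = inc (inc ?F i) j
         then ?A * ampM q t N (V (inc ?F i)) j * fps_const (V (inc ?F i) j powi b) else 0)"
        by (rule mc_XM[where m = "Abs_ptn (inc ?F i)", unfolded ptn_fun_Abs[OF True]])
      show ?thesis
        unfolding if_P[OF True] E sum_distrib_left
        by (intro sum.cong refl) (simp add: pw2_def power2_eq_square mult_ac flip: fps_const_mult)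
    next
      case False
      \<comment> \<open>The first box may be illegal although the final shape is the partition
        \<open>l\<close>; it is then the amplitude of the second box that vanishes.\<close>
      have "ampM q t N (V (inc ?F i)) j = 0" if "ptn_fun l = inc (inc ?F i) j" "j \<in> {1..N}" for j
        by (rule ampM_vanish_ptn[OF _ False that(2)]) (metis that(1) is_ptn_fun)
      then show ?thesis using False by (auto simp: pw2_def intro!: sum.neutral)
    qed
  qed
  finally show ?thesis by (simp only: sum_path2)
qed

lemma mc_XM3:
  assumes "plen m + 3 \<le> N"
  shows "mc (XM s a * XM s b * XM s c) l m
    = (\<Sum>(i, j, k)\<in>path3 N (ptn_fun m) (ptn_fun l). (fps_const s * a_minus q t)^3 * pw3 (ampM q t N) (ptn_fun m) a b c i j k)"
proof -
  let ?F = "ptn_fun m" and ?A = "fps_const s * a_minus q t"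
  have N: "plen m + 1 \<le> N" using assms by simp
  have "mc (XM s a * (XM s b * XM s c)) l m = (\<Sum>i\<in>{1..N}. if is_ptn (inc ?F i)
    then ?A * ampM q t N (V ?F) i * fps_const (V ?F i powi a) * mc (XM s b * XM s c) l (Abs_ptn (inc ?F i)) else 0)"
    by (rule mc_mult_column[OF finite_atLeastAtMost rowfin_mult[OF rowfin_XM rowfin_XM] mc_XM[OF N]])
  also have "\<dots> = (\<Sum>i\<in>{1..N}. \<Sum>j\<in>{1..N}. \<Sum>k\<in>{1..N}. if ptn_fun l = inc (inc (inc ?F i) j) k
     then ?A^3 * pw3 (ampM q t N) ?F a b c i j k else 0)"
  proof (rule sum.cong[OF refl])
    fix i assume i: "i \<in> {1..N}"
    show "(if is_ptn (inc ?F i) then ?A * ampM q t N (V ?F) i * fps_const (V ?F i powi a) * mc (XM s b * XM s c) l (Abs_ptn (inc ?F i)) else 0)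
      = (\<Sum>j\<in>{1..N}. \<Sum>k\<in>{1..N}. if ptn_fun l = inc (inc (inc ?F i) j) k then ?A^3 * pw3 (ampM q t N) ?F a b c i j k else 0)"
    proof (cases "is_ptn (inc ?F i)")
      case True
      have "plen (Abs_ptn (inc ?F i)) + 2 \<le> N" using plen_inc[OF True] assms by simp
      then have E: "mc (XM s b * XM s c) l (Abs_ptn (inc ?F i)) = (\<Sum>j\<in>{1..N}. \<Sum>k\<in>{1..N}. if ptn_fun l = inc (inc (inc ?F i) j) k
         then ?A^2 * pw2 (ampM q t N) (inc ?F i) b c j k else 0)"
        unfolding sum_path2 by (rule mc_XM2[where m = "Abs_ptn (inc ?F i)", unfolded ptn_fun_Abs[OF True]])
      show ?thesis
        unfolding if_P[OF True] E sum_distrib_left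
        by (intro sum.cong refl)
           (simp add: pw2_def pw3_def power2_eq_square power3_eq_cube mult_ac flip: fps_const_mult)
    next
      case False
      \<comment> \<open>With an illegal first box, the zero is in the second amplitude if the next
        shape is a partition, and in the third otherwise.\<close>
      have "pw3 (ampM q t N) ?F a b c i j k = 0"
        if h: "ptn_fun l = inc (inc (inc ?F i) j) k" "j \<in> {1..N}" "k \<in> {1..N}" for j k
      proof (cases "is_ptn (inc (inc ?F i) j)")
        case True
        then have "ampM q t N (V (inc ?F i)) j = 0" by (rule ampM_vanish_ptn[OF _ False h(2)])
        then show ?thesis by (simp add: pw3_def)
      next
        case G: False
        have "ampM q t N (V (inc (inc ?F i) j)) k = 0"
          by (rule ampM_vanish_ptn[OF _ G h(3)]) (metis h(1) is_ptn_fun)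
        then show ?thesis by (simp add: pw3_def)
      qed
      then show ?thesis using False by (auto intro!: sum.neutral[symmetric] sum.neutral)
    qed
  qed
  finally show ?thesis by (simp only: sum_path3 mult.assoc)
qed

end

section \<open>Scalar structure series\<close>

definition Gc :: "complex \<Rightarrow> complex \<Rightarrow> int \<Rightarrow> complex fps fps"
  where "Gc q t e = (1 - fps_const (fps_const (q powi e)) * fps_X) *
     (1 - fps_const (fps_const (t powi (- e))) * fps_X) *
     (1 - fps_const (fps_const ((q / t) powi (- e))) * fps_X)"

lemma G_ser_dg2: "G_ser q t e = dg2 (\<lambda>_. Gc q t e)"
  unfolding G_ser_def Gc_def dg2_one dg_sc dg2_const dg2_X dg2_mult dg2_diff ..

lemma recip_one_minus_X: "0 < m \<Longrightarrow> recip (1 - fps_X ^ m) = (dg (\<lambda>_. inverse (1 - fps_X ^ m)) :: 'b opser)"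
  unfolding dg_one dg_X dg_power dg_diff by (rule recip_dg) simp

lemma g_ser_dg2: "(g_ser q t fps_X :: 'b opser fps) = dg2 (\<lambda>_. gser q t)"
proof -
  have E: "Abs_fps (\<lambda>m. if m = 0 then 0 else sc (kappa q t (int m) / of_nat m) * (fps_X ^ m * recip (1 - fps_X ^ m)))
    = (dg2 (\<lambda>_. glog q t) :: 'b opser fps)"
  proof (rule fps_ext)
    fix m
    show "Abs_fps (\<lambda>m. if m = 0 then 0 else sc (kappa q t (int m) / of_nat m) * (fps_X ^ m * recip (1 - fps_X ^ m))) $ m
      = (dg2 (\<lambda>_. glog q t) :: 'b opser fps) $ m"
    proof (cases "m = 0")
      case False
      then show ?thesis
        by (simp add: dg2_nth glog_def recip_one_minus_X) (simp add: dg_sc dg_X dg_power dg_mult)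
    qed (simp add: dg2_nth dg_zero)
  qed
  show ?thesis unfolding g_ser_def E fexp_dg2 gser_def ..
qed

lemma recip_g_ser_dg2: "recip (g_ser q t fps_X) = dg2 (\<lambda>_. recip (gser q t))"
  unfolding g_ser_dg2 by (rule recip_dg2) (simp add: gser_def)

lemma pfin_Gc: "pfin (fps_nth (Gc q t e))"
  unfolding Gc_def by (intro pfin_mult_series pfin_one_minus)

lemma gev_Gc: "cid.gev y (Gc q t e) = fps_const ((1 - q powi e * y) * (1 - t powi (- e) * y) * (1 - (q / t) powi (- e) * y))"
  unfolding Gc_def
  by (simp only: cid.gev_mult pfin_mult_series pfin_one_minus cid.gev_one_minus fmap_id)
     (simp flip: fps_const_sub fps_const_mult)

section \<open>The quadratic and cubic relations\<close>

text \<open>Moving k between the exponents multiplies by the k-th power of the content ratio;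
  summing over k evaluates the structure series at this ratio.\<close>

lemma power_shift2:
  fixes x y :: complex
  assumes "x \<noteq> 0" "y \<noteq> 0"
  shows "x powi (- (b - int k)) * y powi (- (a + int k)) = x powi (- b) * y powi (- a) * (x / y) ^ k"
proof -
  have "- (b - int k) = - b + int k" "- (a + int k) = - a - int k" by simp_all
  then show ?thesis using assms
    by (simp add: power_int_add power_int_diff power_divide power_int_minus field_simps del: minus_add_distrib minus_diff_eq)
qed

lemma power_shift3:
  fixes x y z :: complex
  assumes "x \<noteq> 0" "y \<noteq> 0" "z \<noteq> 0"
  shows "x powi (- (a + int i + int k)) * y powi (- (b - int i + int j)) * z powi (- (c - int j - int k))
    = x powi (- a) * y powi (- b) * z powi (- c) * ((y / x) ^ i * (z / y) ^ j * (z / x) ^ k)"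
proof -
  have e: "- (a + int i + int k) = - a - int i - int k" "- (b - int i + int j) = - b + int i - int j"
    "- (c - int j - int k) = - c + int j + int k" by simp_all
  show ?thesis unfolding e using assms by (simp add: power_int_add power_int_diff power_divide power_int_minus field_simps)
qed

lemma const_regroup:
  fixes g :: "complex fps"
  assumes "u * v = c * d" shows "fps_const u * (fps_const v * g) = g * fps_const c * fps_const d"
proof -
  have "fps_const u * (fps_const v * g) = fps_const (u * v) * g" by (simp flip: mult.assoc)
  then show ?thesis unfolding assms by (simp flip: fps_const_mult add: mult_ac)
qed

lemma cube_regroup:
  fixes u v w x y :: complex
  assumes "w = v * y" "y * x = z" shows "u * w * x = z * (u * v)"
  using assms by (simp add: mult_ac)

context fock_params
begin

lemma mc_quad_XP:
  assumes "plen l + 2 \<le> N" and h: "pfin (fps_nth h)"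
  defines "F \<equiv> ptn_fun l"
  shows "mc (quad_coeff (dg2 (\<lambda>_. h)) XP a b) l m = (\<Sum>(i, j)\<in>path2 N F (ptn_fun m).
    (a_plus q t)^2 * (ampP q t (V F) i * ampP q t (V (inc F i)) j)
      * fps_const (V F i powi (- b) * V (inc F i) j powi (- (a - 3))) * cid.gev (V F i / V (inc F i) j) h)"
proof -
  have "mc (quad_coeff (dg2 (\<lambda>_. h)) XP a b) l m = csum (\<lambda>k. h $ k * mc (XP (- (a - 3 + int k)) * XP (- (b - int k))) l m)"
    unfolding quad_coeff_def psum_eq_csum dg2_nth cur_def mult.assoc
    by (subst mc_csum[OF pfin_dg_mult[OF h]]) (simp only: mc_dg_mult)
  also have "\<dots> = (\<Sum>p\<in>path2 N F (ptn_fun m). (case p of (i, j) \<Rightarrow> (a_plus q t)^2 * (ampP q t (V F) i * ampP q t (V (inc F i)) j))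
      * fps_const (case p of (i, j) \<Rightarrow> V F i powi (- b) * V (inc F i) j powi (- (a - 3)))
      * csum (\<lambda>k. h $ k * fps_const (case p of (i, j) \<Rightarrow> (V F i / V (inc F i) j) ^ k)))"
  proof (rule csum_over_paths[OF finite_path2 h])
    fix k
    show "mc (XP (- (a - 3 + int k)) * XP (- (b - int k))) l m = (\<Sum>p\<in>path2 N F (ptn_fun m).
      (case p of (i, j) \<Rightarrow> (a_plus q t)^2 * (ampP q t (V F) i * ampP q t (V (inc F i)) j))
      * fps_const ((case p of (i, j) \<Rightarrow> V F i powi (- b) * V (inc F i) j powi (- (a - 3))) * (case p of (i, j) \<Rightarrow> (V F i / V (inc F i) j) ^ k)))"
      unfolding mc_XP2[OF assms(1)] F_def[symmetric]
    proof (rule sum.cong[OF refl], clarify)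
      fix i j assume "(i, j) \<in> path2 N F (ptn_fun m)"
      then have "V F i \<noteq> 0" "V (inc F i) j \<noteq> 0" by (auto simp: path2_def vf_nonzero)
      from power_shift2[OF this, of b k "a - 3"]
      show "(a_plus q t)^2 * pw2 (ampP q t) F (- (b - int k)) (- (a - 3 + int k)) i j
        = (a_plus q t)^2 * (ampP q t (V F) i * ampP q t (V (inc F i)) j)
          * fps_const (V F i powi (- b) * V (inc F i) j powi (- (a - 3)) * (V F i / V (inc F i) j) ^ k)"
        unfolding pw2_def by (simp only: mult.assoc)
    qed
  qed
  finally show ?thesis by (simp add: case_prod_unfold csum_gev)
qed

lemma mc_quad_XM:
  assumes "plen m + 2 \<le> N" and h: "pfin (fps_nth h)"
  defines "F \<equiv> ptn_fun m"
  shows "mc (quad_coeff (dg2 (\<lambda>_. h)) (XM s) a b) l m = (\<Sum>(i, j)\<in>path2 N F (ptn_fun l).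
    (fps_const s * a_minus q t)^2 * (ampM q t N (V F) i * ampM q t N (V (inc F i)) j)
      * fps_const (V (inc F i) j powi (- b) * V F i powi (- (a - 3))) * cid.gev (V (inc F i) j / V F i) h)"
proof -
  have "mc (quad_coeff (dg2 (\<lambda>_. h)) (XM s) a b) l m = csum (\<lambda>k. h $ k * mc (XM s (- (a - 3 + int k)) * XM s (- (b - int k))) l m)"
    unfolding quad_coeff_def psum_eq_csum dg2_nth cur_def mult.assoc
    by (subst mc_csum[OF pfin_dg_mult[OF h]]) (simp only: mc_dg_mult)
  also have "\<dots> = (\<Sum>p\<in>path2 N F (ptn_fun l). (case p of (i, j) \<Rightarrow> (fps_const s * a_minus q t)^2 * (ampM q t N (V F) i * ampM q t N (V (inc F i)) j))
      * fps_const (case p of (i, j) \<Rightarrow> V (inc F i) j powi (- b) * V F i powi (- (a - 3)))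
      * csum (\<lambda>k. h $ k * fps_const (case p of (i, j) \<Rightarrow> (V (inc F i) j / V F i) ^ k)))"
  proof (rule csum_over_paths[OF finite_path2 h])
    fix k
    show "mc (XM s (- (a - 3 + int k)) * XM s (- (b - int k))) l m = (\<Sum>p\<in>path2 N F (ptn_fun l).
      (case p of (i, j) \<Rightarrow> (fps_const s * a_minus q t)^2 * (ampM q t N (V F) i * ampM q t N (V (inc F i)) j))
      * fps_const ((case p of (i, j) \<Rightarrow> V (inc F i) j powi (- b) * V F i powi (- (a - 3))) * (case p of (i, j) \<Rightarrow> (V (inc F i) j / V F i) ^ k)))"
      unfolding mc_XM2[OF assms(1)] F_def[symmetric]
    proof (rule sum.cong[OF refl], clarify)
      fix i j assume "(i, j) \<in> path2 N F (ptn_fun l)"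
      then have "V (inc F i) j \<noteq> 0" "V F i \<noteq> 0" by (auto simp: path2_def vf_nonzero)
      from power_shift2[OF this, of b k "a - 3"]
      have e: "V F i powi (- (a - 3 + int k)) * V (inc F i) j powi (- (b - int k))
        = V (inc F i) j powi (- b) * V F i powi (- (a - 3)) * (V (inc F i) j / V F i) ^ k"
        by (simp only: mult.commute[of "V F i powi (- (a - 3 + int k))"])
      show "(fps_const s * a_minus q t)^2 * pw2 (ampM q t N) F (- (a - 3 + int k)) (- (b - int k)) i j
        = (fps_const s * a_minus q t)^2 * (ampM q t N (V F) i * ampM q t N (V (inc F i)) j)
          * fps_const (V (inc F i) j powi (- b) * V F i powi (- (a - 3)) * (V (inc F i) j / V F i) ^ k)"
        unfolding pw2_def e by (simp only: mult.assoc)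
    qed
  qed
  finally show ?thesis by (simp add: case_prod_unfold csum_gev)
qed

lemma admissible_V:
  assumes "amplitudes q t f G K J {1..N}"
  shows "amplitudes.admissible q t {1..N} (V F)"
  unfolding amplitudes.admissible_def[OF assms] using genV_vf[of N F] by (auto simp: genV_def)

lemma quad_XP:
  defines "h \<equiv> G_ser q t 1 * g_ser q t fps_X"
  shows "quad_coeff h XP a b = - quad_coeff h XP b a"
proof (rule mc_eqI)
  fix l m
  define N where "N = plen l + 2"
  define F where "F = ptn_fun l"
  interpret P: amplitudes q t "thf q t" "GP q t" "KP q t" "\<lambda>i. {1..<i}" "{1..N}" "\<lambda>_. 1"
    by (rule amplitudes_plus)
  have amp: "ampP q t W i = P.amp W i" for W i unfolding P.amp_def ampP_def by (simp only: mult_1)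
  have h: "h = dg2 (\<lambda>_. Gc q t 1 * gser q t)" unfolding h_def G_ser_dg2 g_ser_dg2 dg2_mult ..
  have p: "pfin (fps_nth (Gc q t 1 * gser q t))" by (intro pfin_mult_series pfin_Gc pfin_gser q0 t0)
  have e: "mc (quad_coeff h XP a b) l m = (a_plus q t)^2 *
    (\<Sum>(i, j)\<in>path2 N F (ptn_fun m). P.quadT (V F) j i * fps_const (V F i powi (- b) * P.up (V F) i j powi (- a)))" for a b
    unfolding h mc_quad_XP[OF order_refl[of "plen l + 2"] p] N_def[symmetric] F_def[symmetric] sum_distrib_left
  proof (rule sum.cong[OF refl], clarify)
    fix i j assume "(i, j) \<in> path2 N F (ptn_fun m)"
    then have ij: "1 \<le> i" "1 \<le> j" by (auto simp: path2_def)
    have up: "V (inc F i) = P.up (V F) i" using vf_inc[OF ij(1)] by (simp add: P.up_def)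
    define x where "x = V F i"
    define y where "y = P.up (V F) i j"
    have nz: "x \<noteq> 0" "y \<noteq> 0" using ij vf_nonzero[of i F] vf_nonzero[of j "inc F i"] by (simp_all add: x_def y_def up)
    \<comment> \<open>The factor z^3 of the relation, present as the shift a - 3, makes G^+(w/z) a
      homogeneous polynomial.\<close>
    have e1: "y powi (- (a - 3)) = y powi (- a) * y^3"
      using power_int_add[of y "- a" 3] nz by simp
    have e2: "y^3 * ((1 - q powi 1 * (x / y)) * (1 - t powi (- 1) * (x / y)) * (1 - (q / t) powi (- 1) * (x / y))) = cubicP q t y x"
    proof -
      have "1 - q powi 1 * (x / y) = (y - q * x) / y" "1 - t powi (- 1) * (x / y) = (y - x / t) / y"
        "1 - (q / t) powi (- 1) * (x / y) = (y - t / q * x) / y"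
        using nz q0 t0 by (simp_all add: power_int_minus field_simps)
      then show ?thesis using nz by (simp add: cubicP_def power3_eq_cube)
    qed
    note c = cube_regroup[OF e1 e2, of "x powi (- b)"]
    have g: "cid.gev (x / y) (Gc q t 1 * gser q t) = fps_const ((1 - q powi 1 * (x / y)) * (1 - t powi (- 1) * (x / y)) * (1 - (q / t) powi (- 1) * (x / y))) * GP q t (x / y)"
      by (simp only: cid.gev_mult[OF pfin_Gc pfin_gser[OF q0 t0]] gev_Gc gev_gser[OF q0 t0])
    have "fps_const (x powi (- b) * y powi (- (a - 3))) * cid.gev (x / y) (Gc q t 1 * gser q t)
      = GP q t (x / y) * fps_const (cubicP q t y x) * fps_const (x powi (- b) * y powi (- a))"
      unfolding g by (rule const_regroup[OF c])
    then show "(a_plus q t)^2 * (ampP q t (V F) i * ampP q t (V (inc F i)) j)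
      * fps_const (V F i powi (- b) * V (inc F i) j powi (- (a - 3))) * cid.gev (V F i / V (inc F i) j) (Gc q t 1 * gser q t)
      = (a_plus q t)^2 * (P.quadT (V F) j i * fps_const (V F i powi (- b) * P.up (V F) i j powi (- a)))"
      unfolding P.quadT_def Let_def amp up x_def[symmetric] y_def[symmetric] by (simp only: mult.assoc)
  qed
  have "(\<Sum>(i, j)\<in>path2 N F (ptn_fun m). P.quadT (V F) j i * fps_const (V F i powi (- b) * P.up (V F) i j powi (- a)))
    = - (\<Sum>(i, j)\<in>path2 N F (ptn_fun m). P.quadT (V F) j i * fps_const (V F i powi (- a) * P.up (V F) i j powi (- b)))"
    by (rule P.quad_sum[OF admissible_V[OF amplitudes_plus]]) (auto simp: path2_def inc_commute)
  then show "mc (quad_coeff h XP a b) l m = mc (- quad_coeff h XP b a) l m"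
    unfolding mc_uminus e by simp
qed

lemma quad_XM:
  defines "h \<equiv> G_ser q t (- 1) * recip (g_ser q t fps_X)"
  shows "quad_coeff h (XM s) a b = - quad_coeff h (XM s) b a"
proof (rule mc_eqI)
  fix l m
  define N where "N = plen m + 2"
  define F where "F = ptn_fun m"
  \<comment> \<open>Boxes are added in rows 1..N only, so the content of row N+1 stays fixed and its
    factor can be part of \<open>e\<close>.\<close>
  interpret P: amplitudes q t "thf q t" "GM q t" "KM q t" "\<lambda>i. {i<..N}" "{1..N}" "ampE q t (V F (N + 1))"
    by (rule amplitudes_minus)
  have amp: "ampM q t N W i = P.amp W i" if "W (N + 1) = V F (N + 1)" for W i unfolding P.amp_def ampM_def that ..
  have h: "h = dg2 (\<lambda>_. Gc q t (- 1) * recip (gser q t))" unfolding h_def G_ser_dg2 recip_g_ser_dg2 dg2_mult ..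
  have p: "pfin (fps_nth (Gc q t (- 1) * recip (gser q t)))" by (intro pfin_mult_series pfin_Gc pfin_recip_gser q0 t0)
  have e: "mc (quad_coeff h (XM s) a b) l m = (fps_const s * a_minus q t)^2 *
    - (\<Sum>(i, j)\<in>path2 N F (ptn_fun l). P.quadT (V F) j i * fps_const (V F i powi (- a) * P.up (V F) i j powi (- b)))" for a b
    unfolding h mc_quad_XM[OF order_refl[of "plen m + 2"] p] N_def[symmetric] F_def[symmetric] sum_distrib_left sum_negf[symmetric]
  proof (rule sum.cong[OF refl], clarify)
    fix i j assume ijp: "(i, j) \<in> path2 N F (ptn_fun l)"
    then have ij: "1 \<le> i" "1 \<le> j" "i \<le> N" by (auto simp: path2_def)
    have up: "V (inc F i) = P.up (V F) i" using vf_inc[OF ij(1)] by (simp add: P.up_def)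
    have w: "P.up (V F) i (N + 1) = V F (N + 1)" using ij by simp
    define x where "x = V F i"
    define y where "y = P.up (V F) i j"
    have nz: "x \<noteq> 0" "y \<noteq> 0" using ij vf_nonzero[of i F] vf_nonzero[of j "inc F i"] by (simp_all add: x_def y_def up)
    have e1: "x powi (- (a - 3)) = x powi (- a) * x^3"
      using power_int_add[of x "- a" 3] nz by simp
    \<comment> \<open>G^- has the reciprocal zeros and transposition exchanges the variables. The
      result is the polynomial of G^+ times (-1/q)(-t)(-q/t) = -1, a sign shared by both sides of
      the relation.\<close>
    have e2: "x^3 * ((1 - q powi (- 1) * (y / x)) * (1 - t powi (- (- 1)) * (y / x)) * (1 - (q / t) powi (- (- 1)) * (y / x))) = - cubicP q t y x"
    proof -
      have "1 - q powi (- 1) * (y / x) = (- 1 / q) * (y - q * x) / x" "1 - t powi (- (- 1)) * (y / x) = (- t) * (y - x / t) / x"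
        "1 - (q / t) powi (- (- 1)) * (y / x) = (- q / t) * (y - t / q * x) / x"
        using nz q0 t0 by (simp_all add: power_int_minus field_simps)
      then show ?thesis using nz q0 t0 by (simp add: cubicP_def power3_eq_cube)
    qed
    note c = cube_regroup[OF e1 e2, of "y powi (- b)"]
    have "GM q t (x / y) = inverse (GP q t (y / x))" by (simp add: GM_def)
    then have g: "cid.gev (y / x) (Gc q t (- 1) * recip (gser q t)) = fps_const ((1 - q powi (- 1) * (y / x)) * (1 - t powi (- (- 1)) * (y / x)) * (1 - (q / t) powi (- (- 1)) * (y / x))) * GM q t (x / y)"
      by (simp only: cid.gev_mult[OF pfin_Gc pfin_recip_gser[OF q0 t0]] gev_Gc gev_recip_gser[OF q0 t0])
    have "fps_const (y powi (- b) * x powi (- (a - 3))) * cid.gev (y / x) (Gc q t (- 1) * recip (gser q t))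
      = GM q t (x / y) * fps_const (- cubicP q t y x) * fps_const (y powi (- b) * x powi (- a))"
      unfolding g by (rule const_regroup[OF c])
    then have "fps_const (y powi (- b) * x powi (- (a - 3))) * cid.gev (y / x) (Gc q t (- 1) * recip (gser q t))
      = - (GM q t (x / y) * fps_const (cubicP q t y x) * fps_const (x powi (- a) * y powi (- b)))"
      by (simp only: fps_const_neg[symmetric] mult_minus_left mult_minus_right mult.commute[of "x powi (- a)"])
    then show "(fps_const s * a_minus q t)^2 * (ampM q t N (V F) i * ampM q t N (V (inc F i)) j)
      * fps_const (V (inc F i) j powi (- b) * V F i powi (- (a - 3))) * cid.gev (V (inc F i) j / V F i) (Gc q t (- 1) * recip (gser q t))
      = (fps_const s * a_minus q t)^2 * - (P.quadT (V F) j i * fps_const (V F i powi (- a) * P.up (V F) i j powi (- b)))"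
      unfolding P.quadT_def Let_def up amp[of "V F", OF refl] amp[of "P.up (V F) i", OF w] x_def[symmetric] y_def[symmetric]
      by (simp only: mult.assoc mult_minus_right)
  qed
  have "(\<Sum>(i, j)\<in>path2 N F (ptn_fun l). P.quadT (V F) j i * fps_const (V F i powi (- b) * P.up (V F) i j powi (- a)))
    = - (\<Sum>(i, j)\<in>path2 N F (ptn_fun l). P.quadT (V F) j i * fps_const (V F i powi (- a) * P.up (V F) i j powi (- b)))"
    by (rule P.quad_sum[OF admissible_V[OF amplitudes_minus]]) (auto simp: path2_def inc_commute)
  then show "mc (quad_coeff h (XM s) a b) l m = mc (- quad_coeff h (XM s) b a) l m"
    unfolding mc_uminus e by simp
qed

end

section \<open>Mode sums of the cubic relation\<close>

lemma serre_exponents: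
  fixes z w v :: complex
  assumes "z \<noteq> 0" "w \<noteq> 0" "v \<noteq> 0"
  shows "z powi (- a) * w powi (- (b - 1)) * v powi (- (c + 1)) + z powi (- (a + 1)) * w powi (- (b - 1)) * v powi (- c)
    - z powi (- (a - 1)) * w powi (- (b + 1)) * v powi (- c) - z powi (- a) * w powi (- (b + 1)) * v powi (- (c - 1))
    = serreC z w v * expH a b c z w v"
proof -
  have e: "x powi (- (n - 1)) = x powi (- n) * x" "x powi (- (n + 1)) = x powi (- n) / x" if "x \<noteq> 0" for x :: complex and n
    using power_int_add[of x "- n" 1] power_int_diff[of x "- n" 1] that by simp_all
  have z: "z powi (- (a + 1)) = z powi (- a) / z" "z powi (- (a - 1)) = z powi (- a) * z"
    and w: "w powi (- (b + 1)) = w powi (- b) / w" "w powi (- (b - 1)) = w powi (- b) * w"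
    and v: "v powi (- (c + 1)) = v powi (- c) / v" "v powi (- (c - 1)) = v powi (- c) * v"
    using e assms by auto
  show ?thesis unfolding z w v serreC_def expH_def using assms by (simp add: algebra_simps)
qed

lemma mc_serre_coeff:
  assumes "\<And>a b c. mc (cubic_coeff h x a b c) l m
      = (\<Sum>p\<in>P. k p * fps_const (z p powi (- a) * w p powi (- b) * v p powi (- c)) * \<gamma> p)"
    and "\<And>p. p \<in> P \<Longrightarrow> z p \<noteq> 0 \<and> w p \<noteq> 0 \<and> v p \<noteq> 0"
  shows "mc (serre_coeff h x a b c) l m
    = (\<Sum>p\<in>P. k p * \<gamma> p * fps_const (serreC (z p) (w p) (v p) * expH a b c (z p) (w p) (v p)))"
  unfolding serre_coeff_def mc_diff mc_add assms(1) sum.distrib[symmetric] sum_subtractf[symmetric]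
proof (rule sum.cong[OF refl])
  fix p assume "p \<in> P"
  note nz = assms(2)[OF this]
  have d: "k p * fps_const A * \<gamma> p + k p * fps_const B * \<gamma> p - k p * fps_const C * \<gamma> p - k p * fps_const D * \<gamma> p
    = k p * \<gamma> p * fps_const (A + B - C - D)" for A B C D
    by (simp add: algebra_simps flip: fps_const_add fps_const_sub)
  show "k p * fps_const (z p powi (- a) * w p powi (- (b - 1)) * v p powi (- (c + 1))) * \<gamma> p
      + k p * fps_const (z p powi (- (a + 1)) * w p powi (- (b - 1)) * v p powi (- c)) * \<gamma> p
      - k p * fps_const (z p powi (- (a - 1)) * w p powi (- (b + 1)) * v p powi (- c)) * \<gamma> p
      - k p * fps_const (z p powi (- a) * w p powi (- (b + 1)) * v p powi (- (c - 1))) * \<gamma> p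
    = k p * \<gamma> p * fps_const (serreC (z p) (w p) (v p) * expH a b c (z p) (w p) (v p))"
    unfolding d using serre_exponents[of "z p" "w p" "v p" a b c] nz by simp
qed

lemma mc_cubic_coeff:
  assumes g: "pfin (fps_nth g)" and P: "finite P"
    and x: "\<And>a b c. mc (x (- a) * x (- b) * x (- c)) l m
      = (\<Sum>p\<in>P. k p * fps_const (z p powi (- a) * w p powi (- b) * v p powi (- c)))"
    and nz: "\<And>p. p \<in> P \<Longrightarrow> z p \<noteq> 0 \<and> w p \<noteq> 0 \<and> v p \<noteq> 0"
  shows "mc (cubic_coeff (dg2 (\<lambda>_. g)) x a b c) l m
    = (\<Sum>p\<in>P. k p * fps_const (z p powi (- a) * w p powi (- b) * v p powi (- c))
       * (cid.gev (w p / z p) g * cid.gev (v p / w p) g * cid.gev (v p / z p) g))"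
proof -
  let ?h = "\<lambda>(i, j, k). g $ i * g $ j * g $ k"
  let ?T = "\<lambda>(i, j, k). x (- (a + int i + int k)) * x (- (b - int i + int j)) * x (- (c - int j - int k))"
  have f: "(\<lambda>(i, j, k). dg2 (\<lambda>_. g) $ i * dg2 (\<lambda>_. g) $ j * dg2 (\<lambda>_. g) $ k *
     cur x (a + int i + int k) * cur x (b - int i + int j) * cur x (c - int j - int k))
    = (\<lambda>n. dg (\<lambda>_. ?h n) * ?T n)"
    by (auto simp: fun_eq_iff dg2_nth dg_mult cur_def mult.assoc simp flip: dg_mult)
  have "mc (cubic_coeff (dg2 (\<lambda>_. g)) x a b c) l m = csum (\<lambda>n. ?h n * mc (?T n) l m)"
    unfolding cubic_coeff_def psum_eq_csum f
    by (subst mc_csum[OF pfin_dg_mult[OF pfin3[OF g]]]) (simp only: mc_dg_mult)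
  also have "\<dots> = (\<Sum>p\<in>P. k p * fps_const (z p powi (- a) * w p powi (- b) * v p powi (- c))
      * csum (\<lambda>n. ?h n * fps_const (case n of (i, j, k) \<Rightarrow> (w p / z p) ^ i * (v p / w p) ^ j * (v p / z p) ^ k)))"
  proof (rule csum_over_paths[OF P pfin3[OF g]])
    fix n :: "nat \<times> nat \<times> nat"
    obtain i j k' where n: "n = (i, j, k')" by (cases n) auto
    show "mc (?T n) l m = (\<Sum>p\<in>P. k p * fps_const (z p powi (- a) * w p powi (- b) * v p powi (- c)
       * (case n of (i, j, k) \<Rightarrow> (w p / z p) ^ i * (v p / w p) ^ j * (v p / z p) ^ k)))"
      unfolding n prod.case x using power_shift3 nz by (intro sum.cong refl) simp
  qed
  also have "\<dots> = (\<Sum>p\<in>P. k p * fps_const (z p powi (- a) * w p powi (- b) * v p powi (- c))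
       * (cid.gev (w p / z p) g * cid.gev (v p / w p) g * cid.gev (v p / z p) g))"
  proof (rule sum.cong[OF refl])
    fix p
    have e: "(\<lambda>n. ?h n * fps_const (case n of (i, j, k) \<Rightarrow> (w p / z p) ^ i * (v p / w p) ^ j * (v p / z p) ^ k))
      = (\<lambda>(i, j, k). (g $ i * g $ j * g $ k) * fps_const ((w p / z p) ^ i * (v p / w p) ^ j * (v p / z p) ^ k))"
      by (auto simp: fun_eq_iff)
    show "k p * fps_const (z p powi (- a) * w p powi (- b) * v p powi (- c))
      * csum (\<lambda>n. ?h n * fps_const (case n of (i, j, k) \<Rightarrow> (w p / z p) ^ i * (v p / w p) ^ j * (v p / z p) ^ k))
      = k p * fps_const (z p powi (- a) * w p powi (- b) * v p powi (- c))
       * (cid.gev (w p / z p) g * cid.gev (v p / w p) g * cid.gev (v p / z p) g)"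
      unfolding e csum_gev3[OF g] ..
  qed
  finally show ?thesis .
qed

context fock_params
begin

lemma serre_XP:
  fixes a b c :: int
  defines "S \<equiv> serre_coeff (g_ser q t fps_X) XP"
  shows "S a b c + S a c b + S b a c + S b c a + S c a b + S c b a = 0"
proof (rule mc_eqI)
  fix l m
  define N where "N = plen l + 3"
  define F where "F = ptn_fun l"
  define P where "P = path3 N F (ptn_fun m)"
  interpret P: amplitudes q t "thf q t" "GP q t" "KP q t" "\<lambda>i. {1..<i}" "{1..N}" "\<lambda>_. 1"
    by (rule amplitudes_plus)
  have amp: "ampP q t W i = P.amp W i" for W i unfolding P.amp_def ampP_def by (simp only: mult_1)
  define v where "v = (\<lambda>(i, j :: nat, k :: nat). V F i)"
  define w where "w = (\<lambda>(i, j, k :: nat). V (inc F i) j)"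
  define z where "z = (\<lambda>(i, j, k). V (inc (inc F i) j) k)"
  define A where "A = (\<lambda>(i, j, k). (a_plus q t)^3 * (ampP q t (V F) i * ampP q t (V (inc F i)) j * ampP q t (V (inc (inc F i) j)) k))"
  have nz: "z p \<noteq> 0 \<and> w p \<noteq> 0 \<and> v p \<noteq> 0" if "p \<in> P" for p
    using that vf_nonzero by (auto simp: P_def path3_def z_def w_def v_def)
  have x: "mc (XP (- a) * XP (- b) * XP (- c)) l m = (\<Sum>p\<in>P. A p * fps_const (z p powi (- a) * w p powi (- b) * v p powi (- c)))" for a b c
    unfolding mc_XP3[OF order_refl[of "plen l + 3"]] N_def[symmetric] F_def[symmetric] P_def[symmetric]
    by (rule sum.cong[OF refl]) (auto simp: A_def z_def w_def v_def pw3_def mult_ac)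
  have S: "mc (S a b c) l m = (a_plus q t)^3 * (\<Sum>(i, j, k)\<in>P. P.cubT (V F) k j i (expH a b c))" for a b c
  proof -
    have "mc (S a b c) l m = (\<Sum>p\<in>P. A p * (cid.gev (w p / z p) (gser q t) * cid.gev (v p / w p) (gser q t) * cid.gev (v p / z p) (gser q t))
      * fps_const (serreC (z p) (w p) (v p) * expH a b c (z p) (w p) (v p)))"
      unfolding S_def g_ser_dg2
      by (rule mc_serre_coeff, rule mc_cubic_coeff[OF pfin_gser[OF q0 t0]]) (use x nz in \<open>auto simp: P_def\<close>)
    also have "\<dots> = (\<Sum>(i, j, k)\<in>P. (a_plus q t)^3 * P.cubT (V F) k j i (expH a b c))"
    proof (rule sum.cong[OF refl], clarify)
      fix i j k assume "(i, j, k) \<in> P"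
      then have "1 \<le> i" "1 \<le> j" by (auto simp: P_def path3_def)
      then have up: "V (inc F i) = P.up (V F) i" "V (inc (inc F i) j) = P.up (P.up (V F) i) j"
        by (simp_all add: vf_inc P.up_def)
      show "A (i, j, k) * (cid.gev (w (i, j, k) / z (i, j, k)) (gser q t) * cid.gev (v (i, j, k) / w (i, j, k)) (gser q t) * cid.gev (v (i, j, k) / z (i, j, k)) (gser q t))
        * fps_const (serreC (z (i, j, k)) (w (i, j, k)) (v (i, j, k)) * expH a b c (z (i, j, k)) (w (i, j, k)) (v (i, j, k)))
        = (a_plus q t)^3 * P.cubT (V F) k j i (expH a b c)"
        unfolding P.cubT_def Let_def A_def z_def w_def v_def prod.case gev_gser[OF q0 t0] up amp by (simp only: mult.assoc)
    qed
    finally show ?thesis by (simp add: sum_distrib_left case_prod_unfold)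
  qed
  have z: "(\<Sum>(i, j, k)\<in>P. P.cubT (V F) k j i (expH a b c)) + (\<Sum>(i, j, k)\<in>P. P.cubT (V F) k j i (expH a c b))
    + (\<Sum>(i, j, k)\<in>P. P.cubT (V F) k j i (expH b a c)) + (\<Sum>(i, j, k)\<in>P. P.cubT (V F) k j i (expH b c a))
    + (\<Sum>(i, j, k)\<in>P. P.cubT (V F) k j i (expH c a b)) + (\<Sum>(i, j, k)\<in>P. P.cubT (V F) k j i (expH c b a)) = 0"
    by (rule P.cub_sum[OF admissible_V[OF amplitudes_plus]]) (auto simp: P_def path3_def intro: inc_commute inc_commute[THEN arg_cong])
  show "mc (S a b c + S a c b + S b a c + S b c a + S c a b + S c b a) l m = mc 0 l m"
    unfolding mc_add S distrib_left[symmetric] z by simp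
qed

lemma serre_XM:
  fixes a b c :: int and s :: complex
  defines "S \<equiv> serre_coeff (recip (g_ser q t fps_X)) (XM s)"
  shows "S a b c + S a c b + S b a c + S b c a + S c a b + S c b a = 0"
proof (rule mc_eqI)
  fix l m
  define N where "N = plen m + 3"
  define F where "F = ptn_fun m"
  define P where "P = path3 N F (ptn_fun l)"
  interpret P: amplitudes q t "thf q t" "GM q t" "KM q t" "\<lambda>i. {i<..N}" "{1..N}" "ampE q t (V F (N + 1))"
    by (rule amplitudes_minus)
  have amp: "ampM q t N W i = P.amp W i" if "W (N + 1) = V F (N + 1)" for W i
    unfolding P.amp_def ampM_def that ..
  define z where "z = (\<lambda>(i, j :: nat, k :: nat). V F i)"
  define w where "w = (\<lambda>(i, j, k :: nat). V (inc F i) j)"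
  define v where "v = (\<lambda>(i, j, k). V (inc (inc F i) j) k)"
  let ?K = "(fps_const s * a_minus q t)^3"
  define A where "A = (\<lambda>(i, j, k). ?K * (ampM q t N (V F) i * ampM q t N (V (inc F i)) j * ampM q t N (V (inc (inc F i) j)) k))"
  have nz: "z p \<noteq> 0 \<and> w p \<noteq> 0 \<and> v p \<noteq> 0" if "p \<in> P" for p
    using that vf_nonzero by (auto simp: P_def path3_def z_def w_def v_def)
  have x: "mc (XM s (- a) * XM s (- b) * XM s (- c)) l m = (\<Sum>p\<in>P. A p * fps_const (z p powi (- a) * w p powi (- b) * v p powi (- c)))" for a b c
    unfolding mc_XM3[OF order_refl[of "plen m + 3"]] N_def[symmetric] F_def[symmetric] P_def[symmetric]
    by (rule sum.cong[OF refl]) (auto simp: A_def z_def w_def v_def pw3_def mult_ac)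
  have S: "mc (S a b c) l m = ?K * (\<Sum>(i, j, k)\<in>P. P.cubT (V F) k j i (expH c b a))" for a b c
  proof -
    have "mc (S a b c) l m = (\<Sum>p\<in>P. A p * (cid.gev (w p / z p) (recip (gser q t)) * cid.gev (v p / w p) (recip (gser q t)) * cid.gev (v p / z p) (recip (gser q t)))
      * fps_const (serreC (z p) (w p) (v p) * expH a b c (z p) (w p) (v p)))"
      unfolding S_def recip_g_ser_dg2
      by (rule mc_serre_coeff, rule mc_cubic_coeff[OF pfin_recip_gser[OF q0 t0]]) (use x nz in \<open>auto simp: P_def\<close>)
    also have "\<dots> = (\<Sum>(i, j, k)\<in>P. ?K * P.cubT (V F) k j i (expH c b a))"
    proof (rule sum.cong[OF refl], clarify)
      fix i j k assume "(i, j, k) \<in> P"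
      then have ij: "1 \<le> i" "1 \<le> j" "i \<le> N" "j \<le> N" by (auto simp: P_def path3_def)
      then have up: "V (inc F i) = P.up (V F) i" "V (inc (inc F i) j) = P.up (P.up (V F) i) j"
        by (simp_all add: vf_inc P.up_def)
      have am: "ampM q t N (V F) i = P.amp (V F) i" "ampM q t N (P.up (V F) i) j = P.amp (P.up (V F) i) j"
        "ampM q t N (P.up (P.up (V F) i) j) k = P.amp (P.up (P.up (V F) i) j) k"
        by (rule amp; use ij in simp)+
      have g: "cid.gev (y / x) (recip (gser q t)) = GM q t (x / y)" for x y
        by (simp add: gev_recip_gser[OF q0 t0] GM_def)
      \<comment> \<open>The cubic factor is symmetric in its first and last arguments, so reversing
        the order of the boxes only permutes the exponents, over which the relation is
        summed.\<close>
      have sH: "serreC x y u * expH a b c x y u = serreC u y x * expH c b a u y x" for x y u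
        by (simp add: serreC_def expH_def algebra_simps)
      show "A (i, j, k) * (cid.gev (w (i, j, k) / z (i, j, k)) (recip (gser q t)) * cid.gev (v (i, j, k) / w (i, j, k)) (recip (gser q t)) * cid.gev (v (i, j, k) / z (i, j, k)) (recip (gser q t)))
        * fps_const (serreC (z (i, j, k)) (w (i, j, k)) (v (i, j, k)) * expH a b c (z (i, j, k)) (w (i, j, k)) (v (i, j, k)))
        = ?K * P.cubT (V F) k j i (expH c b a)"
        unfolding P.cubT_def Let_def A_def z_def w_def v_def prod.case g up am sH[of "V F i"] by (simp only: mult_ac)
    qed
    finally show ?thesis by (simp add: sum_distrib_left case_prod_unfold)
  qed
  have z: "(\<Sum>(i, j, k)\<in>P. P.cubT (V F) k j i (expH a b c)) + (\<Sum>(i, j, k)\<in>P. P.cubT (V F) k j i (expH a c b))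
    + (\<Sum>(i, j, k)\<in>P. P.cubT (V F) k j i (expH b a c)) + (\<Sum>(i, j, k)\<in>P. P.cubT (V F) k j i (expH b c a))
    + (\<Sum>(i, j, k)\<in>P. P.cubT (V F) k j i (expH c a b)) + (\<Sum>(i, j, k)\<in>P. P.cubT (V F) k j i (expH c b a)) = 0"
    by (rule P.cub_sum[OF admissible_V[OF amplitudes_minus]]) (auto simp: P_def path3_def intro: inc_commute inc_commute[THEN arg_cong])
  show "mc (S a b c + S a c b + S b a c + S b c a + S c a b + S c b a) l m = mc 0 l m"
    unfolding mc_add S distrib_left[symmetric] using z by (simp add: add_ac)
qed

end

section \<open>The representation\<close>

text \<open>A coefficient of a diagonal operator is nonzero as soon as one eigenvalue is, so
  finiteness has to be uniform in \<open>l\<close>.\<close>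

lemma csum_dg:
  assumes "\<And>n. finite {i. \<exists>l. f i l $ n \<noteq> 0}"
  shows "csum (\<lambda>i. dg (f i)) = dg (\<lambda>l. csum (\<lambda>i. f i l))"
proof (rule mc_eqI)
  fix l m
  have p: "pfin (\<lambda>i. dg (f i))" using assms by (simp add: pfin_def dg_nth_eq_0)
  show "mc (csum (\<lambda>i. dg (f i))) l m = mc (dg (\<lambda>l. csum (\<lambda>i. f i l))) l m"
    unfolding mc_csum[OF p] mc_dg by (cases "l = m") (simp_all add: csum_finite[of "{}"])
qed

lemma csum_swap: "csum (\<lambda>(i, j). f i j) = csum (\<lambda>(i, j). f j i)"
proof -
  have "Sum_any (\<lambda>x. (case x of (i, j) \<Rightarrow> f i j) $ n) = Sum_any (\<lambda>x. (case x of (i, j) \<Rightarrow> f j i) $ n)" for n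
    by (rule Sum_any.reindex_cong[of prod.swap]) (auto simp: fun_eq_iff)
  then show ?thesis by (simp add: csum_def)
qed

text \<open>The constraint i - j = n leaves one free index, and the factor p^i or p^j carried by one
  of the two series bounds it, uniformly in \<open>l\<close>.\<close>

lemma two_sided_dg2:
  assumes "(\<exists>A. C = (\<lambda>l. qscale (A l))) \<or> (\<exists>B. D = (\<lambda>l. qscale (B l)))"
  shows "two_sided (dg2 C) (dg2 D) n = dg (\<lambda>l. csum (\<lambda>(i, j). if int i - int j = n then C l $ i * D l $ j else 0))"
proof -
  have "two_sided (dg2 C) (dg2 D) n = csum (\<lambda>x. dg (\<lambda>l. case x of (i, j) \<Rightarrow> if int i - int j = n then C l $ i * D l $ j else 0))"
    unfolding two_sided_def psum_eq_csum
    by (rule arg_cong[of _ _ csum]) (auto simp: fun_eq_iff dg2_nth dg_mult dg_zero)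
  also have "\<dots> = dg (\<lambda>l. csum (\<lambda>x. case x of (i, j) \<Rightarrow> if int i - int j = n then C l $ i * D l $ j else 0))"
  proof (rule csum_dg)
    fix k
    have z: "(fps_X ^ i * a * b) $ k = 0" "(b * (fps_X ^ i * a)) $ k = 0" if "k < i" for i and a b :: "complex fps"
    proof -
      have "(fps_X ^ i * (a * b)) $ k = 0" using that by (simp only: fps_X_power_mult_nth) simp
      then show "(fps_X ^ i * a * b) $ k = 0" "(b * (fps_X ^ i * a)) $ k = 0" by (simp_all only: mult_ac)
    qed
    have "{x. \<exists>l. (case x of (i, j) \<Rightarrow> if int i - int j = n then C l $ i * D l $ j else 0) $ k \<noteq> 0}
      \<subseteq> (\<lambda>i. (i, nat (int i - n))) ` {..k} \<union> (\<lambda>j. (nat (int j + n), j)) ` {..k}"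
    proof (rule subsetI)
      fix x assume "x \<in> {x. \<exists>l. (case x of (i, j) \<Rightarrow> if int i - int j = n then C l $ i * D l $ j else 0) $ k \<noteq> 0}"
      then obtain l where l: "(case x of (i, j) \<Rightarrow> if int i - int j = n then C l $ i * D l $ j else 0) $ k \<noteq> 0"
        by blast
      obtain i j where ij: "x = (i, j)" by (cases x)
      have x: "x = (i, j)" "int i - int j = n" "(C l $ i * D l $ j) $ k \<noteq> 0"
        using l unfolding ij by (simp_all split: if_splits)
      from assms have "i \<le> k \<or> j \<le> k"
      proof
        assume "\<exists>A. C = (\<lambda>l. qscale (A l))"
        then obtain A where A: "C = (\<lambda>l. qscale (A l))" by blast
        have "\<not> k < i" using x(3) z(1)[of i] unfolding A qscale_nth by blast
        then show ?thesis by simp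
      next
        assume "\<exists>B. D = (\<lambda>l. qscale (B l))"
        then obtain B where B: "D = (\<lambda>l. qscale (B l))" by blast
        have "\<not> k < j" using x(3) z(2)[of j] unfolding B qscale_nth by blast
        then show ?thesis by simp
      qed
      moreover have "nat (int i - n) = j" "nat (int j + n) = i" using x(2) by auto
      ultimately show "x \<in> (\<lambda>i. (i, nat (int i - n))) ` {..k} \<union> (\<lambda>j. (nat (int j + n), j)) ` {..k}"
        using x(1) by (auto simp: image_iff)
    qed
    then show "finite {x. \<exists>l. (case x of (i, j) \<Rightarrow> if int i - int j = n then C l $ i * D l $ j else 0) $ k \<noteq> 0}"
      by (rule finite_subset) simp
  qed
  finally show ?thesis .
qed

lemma sc_commute: "sc c * T = T * sc c"
  by (rule mc_eqI) (simp add: dg_sc mc_dg_mult mc_mult_dg)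

lemma commutator_sc: "commutator (sc c) T = 0"
  by (simp add: commutator_def sc_commute)

lemma sc_one: "sc 1 = 1"
  by (simp add: dg_sc dg_one)

lemma unit_inv_one: "unit_inv (1 :: 'a::ring_1) = 1"
  unfolding unit_inv_def by (rule the_equality) auto

lemma is_invertible_sc: "c \<noteq> 0 \<Longrightarrow> is_invertible (sc c)"
  unfolding is_invertible_def by (rule exI[of _ "sc (inverse c)"]) (simp add: dg_sc dg_mult dg_one)

context fock_params
begin

definition fock_ops :: "complex \<Rightarrow> ptn etor_ops"
  where "fock_ops s = \<lparr>gam_half = 1, psi0_p = sc s, psi0_m = sc (inverse s), alpha = AL, x_p = XP, x_m = XM s\<rparr>"

lemma fock_ops_sel [simp]:
  "gam_half (fock_ops s) = 1" "psi0_p (fock_ops s) = sc s" "psi0_m (fock_ops s) = sc (inverse s)"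
  "alpha (fock_ops s) = AL" "x_p (fock_ops s) = XP" "x_m (fock_ops s) = XM s"
  by (simp_all add: fock_ops_def)

lemma gpow_fock [simp]: "gpow (fock_ops s) n = 1"
  by (simp add: gpow_def upow_def unit_inv_one)

lemma pstar_fock [simp]: "pstar (fock_ops s) = fps_X"
  by (simp add: pstar_def)

lemma p_ratio_fock:
  assumes "m \<noteq> 0" shows "p_ratio (fock_ops s) m = 1"
proof -
  have k: "0 < nat \<bar>m\<bar>" using assms by simp
  have "(1 - fps_X ^ nat \<bar>m\<bar>) * recip (1 - fps_X ^ nat \<bar>m\<bar>) = (1 :: ptn opser)"
  proof -
    have "(1 - fps_X ^ nat \<bar>m\<bar>) * inverse (1 - fps_X ^ nat \<bar>m\<bar>) = (1 :: complex fps)"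
      by (rule inverse_mult_eq_1') (use k in simp)
    then show ?thesis
      unfolding recip_one_minus_X[OF k] unfolding dg_one dg_X dg_power dg_diff dg_mult by simp
  qed
  then show ?thesis unfolding p_ratio_def Let_def pstar_fock gpow_fock mult_1_left if_cancel .
qed

lemma half_exp_ops:
  "Abs_fps (\<lambda>m. if m = 0 then 0 else - (fps_X ^ m * recip (1 - fps_X ^ m) * AL (- int m) * 1))
    = dg2 (\<lambda>l. half_exp_p (\<lambda>k. - sp (plen l) (V (ptn_fun l)) (- k)))"
  "Abs_fps (\<lambda>m. if m = 0 then 0 else recip (1 - fps_X ^ m) * AL (int m) * 1)
    = dg2 (\<lambda>l. half_exp (sp (plen l) (V (ptn_fun l))))"
  "Abs_fps (\<lambda>m. if m = 0 then 0 else - (recip (1 - fps_X ^ m) * AL (- int m) * 1))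
    = dg2 (\<lambda>l. half_exp (\<lambda>k. - sp (plen l) (V (ptn_fun l)) (- k)))"
  "Abs_fps (\<lambda>m. if m = 0 then 0 else fps_X ^ m * recip (1 - fps_X ^ m) * AL (int m) * 1)
    = dg2 (\<lambda>l. half_exp_p (sp (plen l) (V (ptn_fun l))))"
proof -
  have r: "m \<noteq> 0 \<Longrightarrow> recip (1 - fps_X ^ m) = (dg (\<lambda>_. inverse (1 - fps_X ^ m)) :: ptn opser)" for m
    by (rule recip_one_minus_X) simp
  have X: "(fps_X :: ptn opser) ^ m = dg (\<lambda>_. fps_X ^ m)" for m by (simp add: dg_X dg_power)
  show "Abs_fps (\<lambda>m. if m = 0 then 0 else - (fps_X ^ m * recip (1 - fps_X ^ m) * AL (- int m) * 1))
    = dg2 (\<lambda>l. half_exp_p (\<lambda>k. - sp (plen l) (V (ptn_fun l)) (- k)))"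
  proof (rule fps_ext)
    fix m show "Abs_fps (\<lambda>m. if m = 0 then 0 else - (fps_X ^ m * recip (1 - fps_X ^ m) * AL (- int m) * 1)) $ m
      = dg2 (\<lambda>l. half_exp_p (\<lambda>k. - sp (plen l) (V (ptn_fun l)) (- k))) $ m"
      by (cases "m = 0") (simp_all add: dg2_nth dg_zero r, simp add: X AL_def dg_mult dg_uminus half_exp_p_def half_exp_def mult.assoc flip: fps_const_neg)
  qed
  show "Abs_fps (\<lambda>m. if m = 0 then 0 else recip (1 - fps_X ^ m) * AL (int m) * 1)
    = dg2 (\<lambda>l. half_exp (sp (plen l) (V (ptn_fun l))))"
  proof (rule fps_ext)
    fix m show "Abs_fps (\<lambda>m. if m = 0 then 0 else recip (1 - fps_X ^ m) * AL (int m) * 1) $ m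
      = dg2 (\<lambda>l. half_exp (sp (plen l) (V (ptn_fun l)))) $ m"
      by (cases "m = 0") (simp_all add: dg2_nth dg_zero r AL_def dg_mult dg_uminus half_exp_p_def half_exp_def mult.assoc flip: fps_const_neg)
  qed
  show "Abs_fps (\<lambda>m. if m = 0 then 0 else - (recip (1 - fps_X ^ m) * AL (- int m) * 1))
    = dg2 (\<lambda>l. half_exp (\<lambda>k. - sp (plen l) (V (ptn_fun l)) (- k)))"
  proof (rule fps_ext)
    fix m show "Abs_fps (\<lambda>m. if m = 0 then 0 else - (recip (1 - fps_X ^ m) * AL (- int m) * 1)) $ m
      = dg2 (\<lambda>l. half_exp (\<lambda>k. - sp (plen l) (V (ptn_fun l)) (- k))) $ m"
      by (cases "m = 0") (simp_all add: dg2_nth dg_zero r AL_def dg_mult dg_uminus half_exp_p_def half_exp_def mult.assoc flip: fps_const_neg)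
  qed
  show "Abs_fps (\<lambda>m. if m = 0 then 0 else fps_X ^ m * recip (1 - fps_X ^ m) * AL (int m) * 1)
    = dg2 (\<lambda>l. half_exp_p (sp (plen l) (V (ptn_fun l))))"
  proof (rule fps_ext)
    fix m show "Abs_fps (\<lambda>m. if m = 0 then 0 else fps_X ^ m * recip (1 - fps_X ^ m) * AL (int m) * 1) $ m
      = dg2 (\<lambda>l. half_exp_p (sp (plen l) (V (ptn_fun l)))) $ m"
      by (cases "m = 0") (simp_all add: dg2_nth dg_zero r, simp add: X AL_def dg_mult dg_uminus half_exp_p_def half_exp_def mult.assoc flip: fps_const_neg)
  qed
qed

lemma gexp_half_exp_p: "gexp (half_exp_p e) = qscale (gexp (half_exp e))"
  by (simp add: half_exp_p_def qscale_gexp)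

lemma psi_plus_fock: "psi_plus (fock_ops s) n = PSIp s n"
proof -
  let ?E = "\<lambda>l. gexp (half_exp_p (\<lambda>k. - sp (plen l) (V (ptn_fun l)) (- k)))"
  let ?F = "\<lambda>l. gexp (half_exp (sp (plen l) (V (ptn_fun l))))"
  have "psi_plus (fock_ops s) n = sc s * two_sided (dg2 ?E) (dg2 ?F) n"
    unfolding psi_plus_def fock_ops_sel gpow_fock half_exp_ops fexp_dg2 ..
  also have "two_sided (dg2 ?E) (dg2 ?F) n = dg (\<lambda>l. csum (\<lambda>(i, j). if int i - int j = n then ?E l $ i * ?F l $ j else 0))"
    unfolding gexp_half_exp_p by (rule two_sided_dg2[OF disjI1[OF exI]]) (rule refl)
  also have "\<dots> = dg (\<lambda>l. mode (Bp (plen l) (V (ptn_fun l))) (- n))"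
  proof (intro arg_cong[of _ _ dg] ext)
    fix l
    \<comment> \<open>\<open>psi_plus\<close> counts powers of z, whereas the variable of
      \<open>Bp\<close> is 1/z: the two exponentials change places and n changes sign.\<close>
    have "csum (\<lambda>(i, j). if int i - int j = n then ?E l $ i * ?F l $ j else 0)
      = csum (\<lambda>(i, j). if int j - int i = n then ?E l $ j * ?F l $ i else 0)" by (rule csum_swap)
    also have "(\<lambda>(i, j). if int j - int i = n then ?E l $ j * ?F l $ i else 0)
      = (\<lambda>(i, j). if int i - int j = - n then ?F l $ i * ?E l $ j else 0)"
      by (auto simp: fun_eq_iff mult.commute)
    finally show "csum (\<lambda>(i, j). if int i - int j = n then ?E l $ i * ?F l $ j else 0) = mode (Bp (plen l) (V (ptn_fun l))) (- n)"
      unfolding mode_Bp .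
  qed
  finally show ?thesis by (simp add: dg_sc dg_mult PSIp_def)
qed

lemma psi_minus_fock: "psi_minus (fock_ops s) n = PSIm s n"
proof -
  let ?E = "\<lambda>l. gexp (half_exp (\<lambda>k. - sp (plen l) (V (ptn_fun l)) (- k)))"
  let ?F = "\<lambda>l. gexp (half_exp_p (sp (plen l) (V (ptn_fun l))))"
  have "psi_minus (fock_ops s) n = sc (inverse s) * two_sided (dg2 ?E) (dg2 ?F) n"
    unfolding psi_minus_def fock_ops_sel gpow_fock half_exp_ops fexp_dg2 ..
  also have "two_sided (dg2 ?E) (dg2 ?F) n = dg (\<lambda>l. csum (\<lambda>(i, j). if int i - int j = n then ?E l $ i * ?F l $ j else 0))"
    unfolding gexp_half_exp_p by (rule two_sided_dg2[OF disjI2[OF exI]]) (rule refl)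
  also have "\<dots> = dg (\<lambda>l. mode (Bm (plen l) (V (ptn_fun l))) n)"
    unfolding mode_Bm ..
  finally show ?thesis by (simp add: dg_sc dg_mult PSIm_def)
qed

lemma etor_rep_fock:
  assumes s: "s^2 = q / t"
  shows "etor_rep q t (fock_ops s)"
proof -
  have s0: "s \<noteq> 0" using s q0 t0 by auto
  have inv1: "is_invertible (1 :: ptn opser)" unfolding is_invertible_def by (rule exI[of _ 1]) simp
  have c1: "commutator 1 T = 0" for T :: "ptn opser" by (simp add: commutator_def)
  have AA: "commutator (AL m) (AL n) = 0" for m n
    by (simp add: commutator_def AL_def dg_mult mult.commute)
  have e: "- a + m = - (a - m)" for a m :: int by simp
  show ?thesis
    unfolding etor_rep_def central_op_def Let_def fock_ops_sel gpow_fock pstar_fock psi_plus_fock psi_minus_fock cur_def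
  proof (intro conjI allI impI)
    fix m n :: int assume "m \<noteq> 0" "n \<noteq> 0"
    show "commutator (AL m) (AL n) = (if m + n = 0 then sc (- (kappa q t m / of_int m)) * (1 - 1) * 1 * p_ratio (fock_ops s) m else 0)"
      by (simp add: AA)
  next
    fix m a :: int assume m: "m \<noteq> 0"
    show "commutator (AL m) (XP (- a)) = sc (- (kappa q t m / of_int m)) * p_ratio (fock_ops s) m * 1 * XP (- (a - m))"
      unfolding commutator_AL_XP[OF m] p_ratio_fock[OF m] e by simp
    show "commutator (AL m) (XM s (- a)) = sc (kappa q t m / of_int m) * 1 * XM s (- (a - m))"
      unfolding commutator_AL_XM[OF m] e by simp
  next
    fix a b :: int
    have "- (- a) - (- b) = a + b" by simp
    then show "commutator (XP (- a)) (XM s (- b)) = sc ((1 - q) * (1 - 1 / t) / (1 - q / t)) * (1 * PSIp s (a + b) - 1 * PSIm s (a + b))"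
      unfolding commutator_XP_XM[OF s] by simp
  qed (rule quad_XP quad_XM serre_XP serre_XM | simp add: inv1 c1 commutator_sc is_invertible_sc s0)+
qed

lemma B_plus_eq: "B_plus q t u l = Bp (plen l) (V (ptn_fun l))"
  unfolding B_plus_def Bp_def idx_def Let_def prod_Plus[OF finite_atLeastAtMost finite_atLeastAtMost]
  by (intro arg_cong2[of _ _ _ _ "(*)"] prod.cong refl) (simp_all add: numc_def denc_def uu_eq_vf)

lemma B_minus_eq: "B_minus q t u l = Bm (plen l) (V (ptn_fun l))"
  unfolding B_minus_def Bm_def idx_def Let_def prod_Plus[OF finite_atLeastAtMost finite_atLeastAtMost]
  by (intro arg_cong2[of _ _ _ _ "(*)"] prod.cong refl) (simp_all add: numc_def denc_def uu_eq_vf)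

lemma fock_action_fock: "fock_action q t s u (fock_ops s)"
proof -
  have one: "act 1 (ket l) = cmul 1 (ket l)" for l
    unfolding ket_def dg_one by (rule act_dg)
  show ?thesis
    unfolding fock_action_def fock_ops_sel psi_plus_fock psi_minus_fock
    by (simp add: one) (simp add: ket_def XP_def XM_def act_opr PSIp_def PSIm_def act_dg B_plus_eq B_minus_eq)
qed

end

theorem theorem3p4:
  fixes q t r u :: complex
  assumes "q \<noteq> 0" and "t \<noteq> 0" and "generic q t"
    and "r ^ 4 = t / q"
    and "u \<noteq> 0"
  shows "\<exists>A :: ptn etor_ops.
           etor_rep q t A \<and> has_level r 0 1 A \<and> fock_action q t (r powi (- 2)) u A"
proof -
  interpret fock_params q t u by unfold_locales (use assms in auto)
  \<comment> \<open>The square root of q/t picked by the chosen fourth root; level (0,1) prescribes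
    the same value for \<open>psi0_p\<close>.\<close>
  let ?s = "r powi (- 2)"
  have "?s ^ 2 = inverse (r ^ 4)"
    by (simp add: power_int_minus power_inverse flip: power_mult)
  then have s: "?s ^ 2 = q / t" using assms by simp
  have "has_level r 0 1 (fock_ops ?s)"
    by (simp add: has_level_def sc_one)
  then show ?thesis using etor_rep_fock[OF s] fock_action_fock by blast
qed

end
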